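(* Let $A$ be an existentially closed $\mathcal{R}^\omega$-embeddable von Neumann algebra. Then $A$ is a strong amalgamation base for the class of $\mathcal{R}^\omega$-embeddable von Neumann algebras; that is, whenever $A$ is a subalgebra of $\mathcal{R}^\omega$-embeddable von Neumann algebras $B$ and $C$, there are an $\mathcal{R}^\omega$-embeddable von Neumann algebra $D$ and embeddings $f:B\to D$ and $g:C\to D$ such that $f|_A=g|_A$ and $f(B)\cap g(C)=f(A)$.
   Context: $\mathcal{R}$ denotes the hyperfinite II$_1$ factor. All von Neumann algebras are tracial, i.e. equipped with a fixed faithful normal tracial state $\operatorname{tr}$; subalgebras are unital von Neumann subalgebras with the restricted trace, and embeddings are unital trace-preserving $*$-homomorphisms. For an ultrafilter $\mathcal{U}$ on $\mathbb{N}$, $\mathcal{R}^{\mathcal{U}}$ is the tracial ultrapower: operator-norm bounded sequences from $\mathcal{R}$ modulo those with $\lim_{\mathcal U}\|x_n\|_2=0$, where $\|x\|_2=\operatorname{tr}(x^*x)^{1/2}$. A separable (i.e. $\|\cdot\|_2$-separable) von Neumann algebra $A$ is $\mathcal{R}^\omega$-embeddable if it embeds into some (equivalently, every) nonprincipal ultrapower $\mathcal{R}^{\mathcal{U}}$ with $\mathcal{U}$ on $\mathbb{N}$. The $\mathcal{R}^\omega$-embeddable von Neumann algebras are exactly the separable models of the universal theory $\operatorname{Th}_\forall(\mathcal{R})$ of $\mathcal{R}$ in the continuous-logic language of tracial von Neumann algebras. Existentially closed: an $\mathcal{R}^\omega$-embeddable von Neumann algebra $A$ is existentially closed (e.c.)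 if for every quantifier-free formula $\varphi(x,y)$ ($x,y$ finite tuples of variables), every tuple $a$ from $A$, and every $\mathcal{R}^\omega$-embeddable von Neumann algebra $B\supseteq A$, $$\inf_{c\in A}\varphi^A(c,a)=\inf_{b\in B}\varphi^B(b,a).$$ Here the variables range over operator-norm balls of fixed radii (the sorts of the language), the metric is the one induced by $\|\cdot\|_2$, and quantifier-free formulas are built by applying continuous real-valued connectives to the real and imaginary parts of $\operatorname{tr}(p(x,y))$ for $*$-polynomials $p$. *)

theory Defs
  imports "HOL-Analysis.Analysis" "HOL-Algebra.Module"
begin

section \<open>The Hilbert spaces \<open>\<ell>\<^sup>2(I)\<close>\<close>

text \<open>
  Every nonzero complex Hilbert space is unitarily equivalent to some \<open>\<ell>\<^sup>2(I)\<close> with \<open>I\<close> nonempty,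
  so letting the index type vary covers von Neumann algebras on arbitrary Hilbert spaces.
\<close>

typedef 'i ell2 = "{f :: 'i \<Rightarrow> complex. (\<lambda>i. (cmod (f i))\<^sup>2) summable_on UNIV}"
  morphisms coord Abs_ell2
  by (rule exI[of _ "\<lambda>_. 0"]) simp

setup_lifting type_definition_ell2

lemma ell2_mult_abs_summable:
  fixes f g :: "'i \<Rightarrow> complex"
  assumes "(\<lambda>i. (cmod (f i))\<^sup>2) summable_on UNIV" "(\<lambda>i. (cmod (g i))\<^sup>2) summable_on UNIV"
  shows "(\<lambda>i. norm (cnj (f i) * g i)) summable_on UNIV"
proof (rule summable_on_comparison_test)
  show "(\<lambda>i. (cmod (f i))\<^sup>2 + (cmod (g i))\<^sup>2) summable_on UNIV"
    using assms by (rule summable_on_add)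
  fix i
  have "2 * (cmod (f i) * cmod (g i)) \<le> (cmod (f i))\<^sup>2 + (cmod (g i))\<^sup>2"
    using sum_squares_bound[of "cmod (f i)" "cmod (g i)"] by simp
  moreover have "0 \<le> cmod (f i) * cmod (g i)" by simp
  ultimately show "norm (cnj (f i) * g i) \<le> (cmod (f i))\<^sup>2 + (cmod (g i))\<^sup>2"
    unfolding norm_mult complex_mod_cnj by linarith
qed simp

lemma ell2_add_summable:
  fixes f g :: "'i \<Rightarrow> complex"
  assumes "(\<lambda>i. (cmod (f i))\<^sup>2) summable_on UNIV" "(\<lambda>i. (cmod (g i))\<^sup>2) summable_on UNIV"
  shows "(\<lambda>i. (cmod (f i + g i))\<^sup>2) summable_on UNIV"
proof (rule summable_on_comparison_test)
  show "(\<lambda>i. 2 * ((cmod (f i))\<^sup>2 + (cmod (g i))\<^sup>2)) summable_on UNIV"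
    using assms by (intro summable_on_cmult_right summable_on_add)
  fix i
  have "(cmod (f i + g i))\<^sup>2 \<le> (cmod (f i) + cmod (g i))\<^sup>2"
    by (intro power_mono norm_triangle_ineq) simp
  also have "\<dots> \<le> 2 * ((cmod (f i))\<^sup>2 + (cmod (g i))\<^sup>2)"
    using sum_squares_bound[of "cmod (f i)" "cmod (g i)"] by (simp add: power2_sum)
  finally show "(cmod (f i + g i))\<^sup>2 \<le> 2 * ((cmod (f i))\<^sup>2 + (cmod (g i))\<^sup>2)" .
qed simp

lemma ell2_scale_summable:
  fixes f :: "'i \<Rightarrow> complex"
  assumes "(\<lambda>i. (cmod (f i))\<^sup>2) summable_on UNIV"
  shows "(\<lambda>i. (cmod (c * f i))\<^sup>2) summable_on UNIV"
  using summable_on_cmult_right[OF assms, of "(cmod c)\<^sup>2"] by (simp add: norm_mult power_mult_distrib)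

lift_definition ell2_scale :: "complex \<Rightarrow> 'i ell2 \<Rightarrow> 'i ell2" is "\<lambda>c f i. c * f i"
  by (rule ell2_scale_summable)

text \<open>The inner product is conjugate-linear in its first argument.\<close>

lift_definition cinner :: "'i ell2 \<Rightarrow> 'i ell2 \<Rightarrow> complex"
  is "\<lambda>f g. \<Sum>\<^sub>\<infinity>i. cnj (f i) * g i" .

lemma infsum_of_real_ell2:
  "(\<Sum>\<^sub>\<infinity>i. complex_of_real (h i)) = complex_of_real (\<Sum>\<^sub>\<infinity>i. h i)"
  by (rule infsum_bounded_linear_strong[OF _ bounded_linear_of_real])
    (rule summable_on_bounded_linear_iff[OF bounded_linear_of_real bounded_linear_Re Re_complex_of_real])

instantiation ell2 :: (type) real_inner
begin

lift_definition zero_ell2 :: "'a ell2" is "\<lambda>_. 0" by simp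

lift_definition plus_ell2 :: "'a ell2 \<Rightarrow> 'a ell2 \<Rightarrow> 'a ell2" is "\<lambda>f g i. f i + g i"
  by (rule ell2_add_summable)

lift_definition uminus_ell2 :: "'a ell2 \<Rightarrow> 'a ell2" is "\<lambda>f i. - f i" by simp

lift_definition minus_ell2 :: "'a ell2 \<Rightarrow> 'a ell2 \<Rightarrow> 'a ell2" is "\<lambda>f g i. f i - g i"
  subgoal for f g using ell2_add_summable[of f "\<lambda>i. - g i"] by simp
  done

definition scaleR_ell2 :: "real \<Rightarrow> 'a ell2 \<Rightarrow> 'a ell2"
  where "scaleR r (x :: 'a ell2) = ell2_scale (complex_of_real r) x"

definition inner_ell2 :: "'a ell2 \<Rightarrow> 'a ell2 \<Rightarrow> real"
  where "inner (x :: 'a ell2) y = Re (cinner x y)"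

definition norm_ell2 :: "'a ell2 \<Rightarrow> real"
  where "norm (x :: 'a ell2) = sqrt (inner x x)"

definition sgn_ell2 :: "'a ell2 \<Rightarrow> 'a ell2"
  where "sgn (x :: 'a ell2) = scaleR (inverse (norm x)) x"

definition dist_ell2 :: "'a ell2 \<Rightarrow> 'a ell2 \<Rightarrow> real"
  where "dist (x :: 'a ell2) y = norm (x - y)"

definition uniformity_ell2 :: "('a ell2 \<times> 'a ell2) filter"
  where "(uniformity :: ('a ell2 \<times> 'a ell2) filter) = (INF e\<in>{0 <..}. principal {(x, y). dist x y < e})"

definition open_ell2 :: "'a ell2 set \<Rightarrow> bool"
  where "open (U :: 'a ell2 set) \<longleftrightarrow> (\<forall>x\<in>U. eventually (\<lambda>(x', y). x' = x \<longrightarrow> y \<in> U) uniformity)"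

instance
proof
  fix x y z :: "'a ell2" and r s :: real
  show "x + y + z = x + (y + z)" by transfer (simp add: add.assoc)
  show "x + y = y + x" by transfer (simp add: add.commute)
  show "0 + x = x" by transfer simp
  show "- x + x = 0" by transfer simp
  show "x - y = x + - y" by transfer simp
  show "r *\<^sub>R (x + y) = r *\<^sub>R x + r *\<^sub>R y"
    unfolding scaleR_ell2_def by transfer (simp add: algebra_simps)
  show "(r + s) *\<^sub>R x = r *\<^sub>R x + s *\<^sub>R x"
    unfolding scaleR_ell2_def by transfer (simp add: algebra_simps)
  show "r *\<^sub>R s *\<^sub>R x = (r * s) *\<^sub>R x"
    unfolding scaleR_ell2_def by transfer (simp add: algebra_simps)
  show "1 *\<^sub>R x = x"
    unfolding scaleR_ell2_def by transfer simp
  show "inner x y = inner y x"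
    unfolding inner_ell2_def
  proof transfer
    fix f g :: "'a \<Rightarrow> complex"
    have "(\<Sum>\<^sub>\<infinity>i. cnj (f i) * g i) = (\<Sum>\<^sub>\<infinity>i. cnj (cnj (g i) * f i))"
      by (simp add: mult.commute)
    also have "\<dots> = cnj (\<Sum>\<^sub>\<infinity>i. cnj (g i) * f i)"
      by (rule infsum_cnj)
    finally show "Re (\<Sum>\<^sub>\<infinity>i. cnj (f i) * g i) = Re (\<Sum>\<^sub>\<infinity>i. cnj (g i) * f i)"
      by simp
  qed
  have "cinner (x + y) z = cinner x z + cinner y z"
    by transfer (simp add: distrib_right infsum_add abs_summable_summable ell2_mult_abs_summable)
  then show "inner (x + y) z = inner x z + inner y z"
    unfolding inner_ell2_def by simp
  have "cinner (r *\<^sub>R x) y = complex_of_real r * cinner x y"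
    unfolding scaleR_ell2_def by transfer (simp add: mult.assoc infsum_cmult_right')
  then show "inner (r *\<^sub>R x) y = r * inner x y"
    unfolding inner_ell2_def by simp
  have sq: "inner x x = (\<Sum>\<^sub>\<infinity>i. (cmod (coord x i))\<^sup>2)"
  proof -
    have "(\<Sum>\<^sub>\<infinity>i. cnj (coord x i) * coord x i) = (\<Sum>\<^sub>\<infinity>i. complex_of_real ((cmod (coord x i))\<^sup>2))"
      by (simp only: complex_norm_square mult.commute)
    also have "\<dots> = complex_of_real (\<Sum>\<^sub>\<infinity>i. (cmod (coord x i))\<^sup>2)"
      by (rule infsum_of_real_ell2)
    finally show ?thesis
      unfolding inner_ell2_def cinner.rep_eq by simp
  qed
  show "0 \<le> inner x x"
    unfolding sq by (rule infsum_nonneg) simp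
  have "(\<lambda>i. (cmod (coord x i))\<^sup>2) summable_on UNIV"
    using coord[of x] by simp
  then have "(cmod (coord x i))\<^sup>2 = 0" if "inner x x = 0" for i
    using that unfolding sq by (intro nonneg_infsum_le_0D[where A = UNIV]) simp_all
  then have "x = 0" if "inner x x = 0"
    using that by (simp add: coord_inject[symmetric] zero_ell2.rep_eq fun_eq_iff)
  moreover have "inner x x = 0" if "x = 0"
    unfolding sq by (simp add: that zero_ell2.rep_eq)
  ultimately show "inner x x = 0 \<longleftrightarrow> x = 0" by blast
qed (rule norm_ell2_def sgn_ell2_def dist_ell2_def uniformity_ell2_def open_ell2_def)+

end

lemma norm_ell2_eq: "(norm x)\<^sup>2 = (\<Sum>\<^sub>\<infinity>i. (cmod (coord x i))\<^sup>2)"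
proof -
  have "(\<Sum>\<^sub>\<infinity>i. cnj (coord x i) * coord x i) = (\<Sum>\<^sub>\<infinity>i. complex_of_real ((cmod (coord x i))\<^sup>2))"
    by (simp only: complex_norm_square mult.commute)
  also have "\<dots> = complex_of_real (\<Sum>\<^sub>\<infinity>i. (cmod (coord x i))\<^sup>2)"
    by (rule infsum_of_real_ell2)
  finally show ?thesis
    unfolding power2_norm_eq_inner inner_ell2_def cinner.rep_eq by simp
qed

lemma norm_ell2_scale: "norm (ell2_scale c x) = cmod c * norm x"
proof -
  have "(norm (ell2_scale c x))\<^sup>2 = (cmod c * norm x)\<^sup>2"
    unfolding norm_ell2_eq power_mult_distrib ell2_scale.rep_eq
    by (simp add: norm_mult power_mult_distrib infsum_cmult_right')
  then show ?thesis by (simp add: power2_eq_iff_nonneg)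
qed

lemma ell2_sum_le_norm:
  assumes "finite F"
  shows "(\<Sum>i\<in>F. (cmod (coord x i))\<^sup>2) \<le> (norm x)\<^sup>2"
  unfolding norm_ell2_eq using coord[of x] assms by (intro finite_sum_le_infsum) auto

instance ell2 :: (type) complete_space
proof
  fix X :: "nat \<Rightarrow> 'a ell2"
  assume X: "Cauchy X"
  have "cmod (coord x i) \<le> norm x" for x :: "'a ell2" and i
    using ell2_sum_le_norm[of "{i}" x] by (simp add: abs_le_square_iff[symmetric])
  then have le: "cmod (coord (X m) i - coord (X n) i) \<le> norm (X m - X n)" for m n i
    using minus_ell2.rep_eq[of "X m" "X n"] by metis
  have "\<exists>l. (\<lambda>n. coord (X n) i) \<longlonglongrightarrow> l" for i
  proof -
    have "Cauchy (\<lambda>n. coord (X n) i)"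
      using X unfolding Cauchy_iff by (meson le le_less_trans)
    then show ?thesis by (simp add: Cauchy_convergent_iff convergent_def)
  qed
  then obtain f where f: "\<And>i. (\<lambda>n. coord (X n) i) \<longlonglongrightarrow> f i" by metis
  have key: "(\<Sum>i\<in>F. (cmod (coord (X m) i - f i))\<^sup>2) \<le> e\<^sup>2"
    if "finite F" and e: "\<And>n. n \<ge> m \<Longrightarrow> norm (X m - X n) \<le> e" for F m e
  proof (rule LIMSEQ_le_const2)
    show "(\<lambda>n. \<Sum>i\<in>F. (cmod (coord (X m) i - coord (X n) i))\<^sup>2)
        \<longlonglongrightarrow> (\<Sum>i\<in>F. (cmod (coord (X m) i - f i))\<^sup>2)"
      by (intro tendsto_intros f)
    have "(\<Sum>i\<in>F. (cmod (coord (X m) i - coord (X n) i))\<^sup>2) \<le> e\<^sup>2" if "n \<ge> m" for n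
    proof -
      have "(\<Sum>i\<in>F. (cmod (coord (X m) i - coord (X n) i))\<^sup>2) \<le> (norm (X m - X n))\<^sup>2"
        using ell2_sum_le_norm[OF \<open>finite F\<close>, of "X m - X n"] by (simp add: minus_ell2.rep_eq)
      also have "\<dots> \<le> e\<^sup>2" using e[OF that] by (intro power_mono) auto
      finally show ?thesis .
    qed
    then show "\<exists>N. \<forall>n\<ge>N. (\<Sum>i\<in>F. (cmod (coord (X m) i - coord (X n) i))\<^sup>2) \<le> e\<^sup>2" by blast
  qed
  have summ: "(\<lambda>i. (cmod (coord (X m) i - f i))\<^sup>2) summable_on UNIV"
    if e: "\<And>n. n \<ge> m \<Longrightarrow> norm (X m - X n) \<le> e" for m e
    by (rule nonneg_bdd_above_summable_on) (auto intro!: bdd_aboveI2[where M = "e\<^sup>2"] key e)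
  have ev: "\<exists>M. \<forall>m\<ge>M. \<forall>n\<ge>m. norm (X m - X n) \<le> e" if "e > 0" for e
    using X that unfolding Cauchy_iff by (meson less_imp_le order_trans)
  obtain M where M: "\<And>n. n \<ge> M \<Longrightarrow> norm (X M - X n) \<le> 1" using ev[of 1] by auto
  have "(\<lambda>i. (cmod (coord (X M) i + - (coord (X M) i - f i)))\<^sup>2) summable_on UNIV"
    using coord[of "X M"] summ[OF M] by (intro ell2_add_summable) (auto simp: norm_minus_commute)
  then have fin: "f \<in> {f. (\<lambda>i. (cmod (f i))\<^sup>2) summable_on UNIV}"
    by (simp add: norm_minus_commute)
  have "X \<longlonglongrightarrow> Abs_ell2 f"
  proof (rule LIMSEQ_I)
    fix r :: real assume "r > 0"
    then obtain N where N: "\<And>m n. m \<ge> N \<Longrightarrow> n \<ge> m \<Longrightarrow> norm (X m - X n) \<le> r / 2"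
      using ev[of "r / 2"] by auto
    have "norm (X m - Abs_ell2 f) < r" if "m \<ge> N" for m
    proof -
      have "(norm (X m - Abs_ell2 f))\<^sup>2 = (\<Sum>\<^sub>\<infinity>i. (cmod (coord (X m) i - f i))\<^sup>2)"
        unfolding norm_ell2_eq minus_ell2.rep_eq by (simp add: Abs_ell2_inverse[OF fin])
      also have "\<dots> \<le> (r / 2)\<^sup>2"
        by (rule infsum_le_finite_sums[OF summ[OF N[OF that]] key[OF _ N[OF that]]])
      finally have "norm (X m - Abs_ell2 f) \<le> r / 2"
        using \<open>r > 0\<close> by (simp add: power2_le_iff_abs_le)
      then show ?thesis using \<open>r > 0\<close> by simp
    qed
    then show "\<exists>no. \<forall>n\<ge>no. norm (X n - Abs_ell2 f) < r" by blast
  qed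
  then show "convergent X" by (auto simp: convergent_def)
qed

section \<open>Operators and von Neumann algebras\<close>

text \<open>Elements of type \<open>'i op\<close> are only real-linear; \<open>B(\<ell>\<^sup>2)\<close> is cut out by \<open>bounded_ops\<close> below.\<close>

type_synonym 'i op = "'i ell2 \<Rightarrow>\<^sub>L 'i ell2"

definition bounded_ops :: "'i op set" where
  "bounded_ops = {T. \<forall>c x. blinfun_apply T (ell2_scale c x) = ell2_scale c (blinfun_apply T x)}"

lemma bounded_linear_ell2_scale: "bounded_linear (ell2_scale c)"
proof (rule bounded_linear_intro)
  fix x y :: "'i ell2" and r :: real
  show "ell2_scale c (x + y) = ell2_scale c x + ell2_scale c y"
    by transfer (simp add: algebra_simps)
  show "ell2_scale c (r *\<^sub>R x) = r *\<^sub>R ell2_scale c x"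
    unfolding scaleR_ell2_def by transfer (simp add: algebra_simps)
  show "norm (ell2_scale c x) \<le> norm x * cmod c"
    by (simp add: norm_ell2_scale mult.commute)
qed

definition op_scale :: "complex \<Rightarrow> 'i op \<Rightarrow> 'i op" where
  "op_scale c T = Blinfun (\<lambda>x. ell2_scale c (blinfun_apply T x))"

lemma op_scale_apply: "blinfun_apply (op_scale c T) x = ell2_scale c (blinfun_apply T x)"
  unfolding op_scale_def
  by (simp add: bounded_linear_Blinfun_apply bounded_linear_compose[OF bounded_linear_ell2_scale]
      blinfun.bounded_linear_right)

text \<open>For \<open>T\<close> in \<open>bounded_ops\<close> the description is proper, by Riesz representation.\<close>

definition op_adjoint :: "'i op \<Rightarrow> 'i op" where
  "op_adjoint T = (THE S. \<forall>x y. cinner (blinfun_apply S x) y = cinner x (blinfun_apply T y))"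

definition commutant :: "'i op set \<Rightarrow> 'i op set" where
  "commutant X = {T \<in> bounded_ops. \<forall>S\<in>X. T o\<^sub>L S = S o\<^sub>L T}"

text \<open>Being a commutant, such an \<open>M\<close> is automatically a unital subalgebra of \<open>bounded_ops\<close>.\<close>

definition von_neumann_algebra :: "'i op set \<Rightarrow> bool" where
  "von_neumann_algebra M \<longleftrightarrow> op_adjoint ` M \<subseteq> M \<and> commutant (commutant M) = M"

definition ultraweak_topology :: "'i op topology" where
  "ultraweak_topology = topology_generated_by
     {{T. (\<Sum>n. cinner (\<eta> n) (blinfun_apply T (\<xi> n))) \<in> V} | \<xi> \<eta> V.
        summable (\<lambda>n. (norm (\<xi> n))\<^sup>2) \<and> summable (\<lambda>n. (norm (\<eta> n))\<^sup>2) \<and> open V}"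

section \<open>Tracial von Neumann algebras\<close>

record 'a tracial_alg = "(complex, 'a) module" +
  star :: "'a \<Rightarrow> 'a"
  tr :: "'a \<Rightarrow> complex"

definition operator_alg :: "'i op set \<Rightarrow> ('i op \<Rightarrow> complex) \<Rightarrow> 'i op tracial_alg" where
  "operator_alg M \<tau> =
     \<lparr>carrier = M, mult = (o\<^sub>L), one = id_blinfun, zero = 0, add = (+), smult = op_scale,
      star = op_adjoint, tr = \<tau>\<rparr>"

text \<open>The last clause is normality of the trace: ultraweak continuity on the algebra.\<close>

definition tracial_vna :: "'i op tracial_alg \<Rightarrow> bool" where
  "tracial_vna N \<longleftrightarrow>
     N = operator_alg (carrier N) (tr N) \<and>
     von_neumann_algebra (carrier N) \<and>
     (\<forall>S\<in>carrier N. \<forall>T\<in>carrier N. tr N (S + T) = tr N S + tr N T) \<and>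
     (\<forall>c. \<forall>T\<in>carrier N. tr N (op_scale c T) = c * tr N T) \<and>
     tr N id_blinfun = 1 \<and>
     (\<forall>T\<in>carrier N. tr N (op_adjoint T o\<^sub>L T) \<in> \<real> \<and> 0 \<le> Re (tr N (op_adjoint T o\<^sub>L T))) \<and>
     (\<forall>T\<in>carrier N. tr N (op_adjoint T o\<^sub>L T) = 0 \<longrightarrow> T = 0) \<and>
     (\<forall>S\<in>carrier N. \<forall>T\<in>carrier N. tr N (S o\<^sub>L T) = tr N (T o\<^sub>L S)) \<and>
     continuous_map (subtopology ultraweak_topology (carrier N)) euclidean (tr N)"

definition norm2 :: "'a tracial_alg \<Rightarrow> 'a \<Rightarrow> real" where
  "norm2 N x = sqrt (Re (tr N (star N x \<otimes>\<^bsub>N\<^esub> x)))"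

definition separable_vna :: "'i op tracial_alg \<Rightarrow> bool" where
  "separable_vna N \<longleftrightarrow>
     (\<exists>S. countable S \<and> S \<subseteq> carrier N \<and> (\<forall>x\<in>carrier N. \<forall>e>0. \<exists>s\<in>S. norm2 N (x - s) < e))"

definition embedding :: "('a \<Rightarrow> 'b) \<Rightarrow> 'a tracial_alg \<Rightarrow> 'b tracial_alg \<Rightarrow> bool" where
  "embedding h M N \<longleftrightarrow>
     h \<in> ring_hom M N \<and>
     (\<forall>c. \<forall>x\<in>carrier M. h (c \<odot>\<^bsub>M\<^esub> x) = c \<odot>\<^bsub>N\<^esub> h x) \<and>
     (\<forall>x\<in>carrier M. h (star M x) = star N (h x)) \<and>
     (\<forall>x\<in>carrier M. tr N (h x) = tr M x)"

section \<open>The hyperfinite \<open>II\<^sub>1\<close> factor\<close>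

definition fin_dim :: "'i op set \<Rightarrow> bool" where
  "fin_dim S \<longleftrightarrow> (\<exists>F. finite F \<and> F \<subseteq> S \<and> (\<forall>T\<in>S. \<exists>c. T = (\<Sum>E\<in>F. op_scale (c E) E)))"

definition star_subalgebra :: "'i op set \<Rightarrow> 'i op set \<Rightarrow> bool" where
  "star_subalgebra Q M \<longleftrightarrow>
     Q \<subseteq> M \<and> id_blinfun \<in> Q \<and>
     (\<forall>S\<in>Q. \<forall>T\<in>Q. S + T \<in> Q \<and> S o\<^sub>L T \<in> Q) \<and>
     (\<forall>c. \<forall>T\<in>Q. op_scale c T \<in> Q) \<and> op_adjoint ` Q \<subseteq> Q"

definition II1_factor :: "'i op tracial_alg \<Rightarrow> bool" where
  "II1_factor N \<longleftrightarrow>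
     tracial_vna N \<and> \<not> fin_dim (carrier N) \<and>
     carrier N \<inter> commutant (carrier N) = range (\<lambda>c. op_scale c id_blinfun)"

text \<open>
  By Murray and von Neumann this determines the algebra up to trace-preserving \<open>*\<close>-isomorphism.
\<close>

definition hyperfinite_II1_factor :: "'i op tracial_alg \<Rightarrow> bool" where
  "hyperfinite_II1_factor N \<longleftrightarrow>
     II1_factor N \<and>
     (\<exists>Q :: nat \<Rightarrow> 'i op set.
        (\<forall>n. star_subalgebra (Q n) (carrier N) \<and> fin_dim (Q n) \<and> Q n \<subseteq> Q (Suc n)) \<and>
        commutant (commutant (\<Union>n. Q n)) = carrier N)"

section \<open>Tracial ultrapowers\<close>

text \<open>An ultrafilter on \<open>\<nat>\<close> is represented by the filter of its eventually true predicates.\<close>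

definition nonprincipal_ultrafilter :: "nat filter \<Rightarrow> bool" where
  "nonprincipal_ultrafilter \<U> \<longleftrightarrow>
     \<U> \<noteq> bot \<and>
     (\<forall>P. eventually P \<U> \<or> eventually (\<lambda>n. \<not> P n) \<U>) \<and>
     (\<forall>k. eventually (\<lambda>n. n \<noteq> k) \<U>)"

definition bounded_seqs :: "'i op tracial_alg \<Rightarrow> (nat \<Rightarrow> 'i op) set" where
  "bounded_seqs N = {x. range x \<subseteq> carrier N \<and> bounded (range x)}"

definition ultra_rel ::
    "nat filter \<Rightarrow> 'i op tracial_alg \<Rightarrow> ((nat \<Rightarrow> 'i op) \<times> (nat \<Rightarrow> 'i op)) set" where
  "ultra_rel \<U> N = {(x, y). x \<in> bounded_seqs N \<and> y \<in> bounded_seqs N \<and>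
     ((\<lambda>n. norm2 N (x n - y n)) \<longlongrightarrow> 0) \<U>}"

definition ultrapower ::
    "nat filter \<Rightarrow> 'i op tracial_alg \<Rightarrow> (nat \<Rightarrow> 'i op) set tracial_alg" where
  "ultrapower \<U> N =
     \<lparr>carrier = bounded_seqs N // ultra_rel \<U> N,
      mult = (\<lambda>X Y. \<Union>x\<in>X. \<Union>y\<in>Y. ultra_rel \<U> N `` {\<lambda>n. x n \<otimes>\<^bsub>N\<^esub> y n}),
      one = ultra_rel \<U> N `` {\<lambda>n. \<one>\<^bsub>N\<^esub>},
      zero = ultra_rel \<U> N `` {\<lambda>n. \<zero>\<^bsub>N\<^esub>},
      add = (\<lambda>X Y. \<Union>x\<in>X. \<Union>y\<in>Y. ultra_rel \<U> N `` {\<lambda>n. x n \<oplus>\<^bsub>N\<^esub> y n}),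
      smult = (\<lambda>c X. \<Union>x\<in>X. ultra_rel \<U> N `` {\<lambda>n. c \<odot>\<^bsub>N\<^esub> x n}),
      star = (\<lambda>X. \<Union>x\<in>X. ultra_rel \<U> N `` {\<lambda>n. star N (x n)}),
      tr = (\<lambda>X. THE l. \<forall>x\<in>X. ((\<lambda>n. tr N (x n)) \<longlongrightarrow> l) \<U>)\<rparr>"

definition R_embeddable :: "'r op tracial_alg \<Rightarrow> 'i op tracial_alg \<Rightarrow> bool" where
  "R_embeddable R N \<longleftrightarrow>
     tracial_vna N \<and> separable_vna N \<and>
     (\<exists>\<U> h. nonprincipal_ultrafilter \<U> \<and> embedding h N (ultrapower \<U> R))"

section \<open>Quantifier-free formulas and existential closedness\<close>

text \<open>
  \<open>*\<close>-polynomials in two families of noncommuting variables \<open>x\<^sub>0, x\<^sub>1, \<dots>\<close> and \<open>y\<^sub>0, y\<^sub>1, \<dots>\<close>.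
\<close>

datatype star_poly =
    XVar nat | YVar nat | Unit
  | Plus star_poly star_poly
  | Times star_poly star_poly
  | Scale complex star_poly
  | Star star_poly

primrec eval_poly :: "'a tracial_alg \<Rightarrow> (nat \<Rightarrow> 'a) \<Rightarrow> (nat \<Rightarrow> 'a) \<Rightarrow> star_poly \<Rightarrow> 'a" where
  "eval_poly N c a (XVar k) = c k"
| "eval_poly N c a (YVar k) = a k"
| "eval_poly N c a Unit = \<one>\<^bsub>N\<^esub>"
| "eval_poly N c a (Plus p q) = eval_poly N c a p \<oplus>\<^bsub>N\<^esub> eval_poly N c a q"
| "eval_poly N c a (Times p q) = eval_poly N c a p \<otimes>\<^bsub>N\<^esub> eval_poly N c a q"
| "eval_poly N c a (Scale z p) = z \<odot>\<^bsub>N\<^esub> eval_poly N c a p"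
| "eval_poly N c a (Star p) = star N (eval_poly N c a p)"

text \<open>
  A connective of arity \<open>m\<close> is a continuous function \<open>\<real>\<^sup>m \<rightarrow> \<real>\<close>.  It is encoded by a function on
  \<open>nat \<Rightarrow> real\<close>, continuous for the product topology, applied to the list of the \<open>m\<close> argument
  values padded with zeros; the restrictions of such functions to \<open>\<real>\<^sup>m\<close> are exactly the continuous
  functions there, since one can precompose with the projection onto the first \<open>m\<close> coordinates.
\<close>

datatype qf_formula =
    ReTr star_poly | ImTr star_poly
  | Conn "(nat \<Rightarrow> real) \<Rightarrow> real" "qf_formula list"

primrec wf_formula :: "qf_formula \<Rightarrow> bool" where
  "wf_formula (ReTr p) \<longleftrightarrow> True"
| "wf_formula (ImTr p) \<longleftrightarrow> True"
| "wf_formula (Conn u \<phi>s) \<longleftrightarrow> continuous_on UNIV u \<and> list_all id (map wf_formula \<phi>s)"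

definition pad :: "real list \<Rightarrow> nat \<Rightarrow> real" where
  "pad vs k = (if k < length vs then vs ! k else 0)"

primrec eval_formula ::
    "'a tracial_alg \<Rightarrow> (nat \<Rightarrow> 'a) \<Rightarrow> (nat \<Rightarrow> 'a) \<Rightarrow> qf_formula \<Rightarrow> real" where
  "eval_formula N c a (ReTr p) = Re (tr N (eval_poly N c a p))"
| "eval_formula N c a (ImTr p) = Im (tr N (eval_poly N c a p))"
| "eval_formula N c a (Conn u \<phi>s) = u (pad (map (eval_formula N c a) \<phi>s))"

text \<open>
  Assignments give a value to every variable, with \<open>x\<^sub>k\<close> ranging over the operator-norm ball of
  radius \<open>r k\<close>.  A formula mentions only finitely many variables, so infima over assignments are
  infima over finite tuples.
\<close>

definition assignments :: "'i op tracial_alg \<Rightarrow> (nat \<Rightarrow> real) \<Rightarrow> (nat \<Rightarrow> 'i op) set" where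
  "assignments N r = {c. \<forall>k. c k \<in> carrier N \<and> norm (c k) \<le> r k}"

text \<open>
  Extensions \<open>B \<supseteq> A\<close> are given by embeddings.  It suffices to let \<open>B\<close> act on \<open>\<ell>\<^sup>2(\<nat>)\<close>: every
  \<open>\<parallel>\<cdot>\<parallel>\<^sub>2\<close>-separable tracial von Neumann algebra is isomorphic to one acting there.
\<close>

definition existentially_closed :: "'r op tracial_alg \<Rightarrow> 'i op tracial_alg \<Rightarrow> bool" where
  "existentially_closed R A \<longleftrightarrow>
     R_embeddable R A \<and>
     (\<forall>(B :: nat op tracial_alg) \<iota> \<phi> a r.
        R_embeddable R B \<and> embedding \<iota> A B \<and> wf_formula \<phi> \<and>
        (\<forall>k. a k \<in> carrier A) \<and> (\<forall>k. 0 < r k) \<longrightarrow>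
        (INF c\<in>assignments A r. eval_formula A c a \<phi>) =
        (INF b\<in>assignments B r. eval_formula B b (\<iota> \<circ> a) \<phi>))"

end

(*
  Existential closedness says that the moments of finitely many elements of B relative to A are
  approximated by moments of tuples c(n) in A, so B embeds over A into an ultrapower of A and hence,
  through \<gamma>, into an ultrapower of C, which contains C diagonally.  There the two copies meet in A:
  if a sequence from A represents an element v of C, then v is a 2-norm limit of elements of A, and
  A is 2-norm closed in C.  The ultrapower of C is only used through moments: the tuples
  (\<gamma> c(n), C) are lifted to bounded tuples in R with almost the same moments, B and C embed into the
  corresponding ultrapower of R, and the generated algebra is realised on \<open>\<ell>\<^sup>2(\<nat>)\<close> by the GNS
  construction.

  Two steps pass from 2-norm approximation to genuine elements of bounded operator norm.  A Kaplansky
  density argument provides approximating polynomials whose norm stays bounded under every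
  substitution of bounded tuples, and norm-bounded sets are complete for the 2-norm: in ultrapowers
  by a diagonal argument, in a tracial von Neumann algebra by weak compactness and normality.
*)
theory Submission
  imports Defs "HOL-Library.Infinite_Set" "HOL-Library.Function_Algebras"
begin

section \<open>Complex Hilbert space structure of \<open>\<ell>\<^sup>2\<close>\<close>

text \<open>\<open>existentially_closed\<close> only tests extensions acting on
  \<open>\<ell>\<^sup>2(\<nat>)\<close>, so \<open>B\<close> is first copied there by GNS. For the
  GNS space to be all of \<open>\<ell>\<^sup>2(\<nat>)\<close> it must be infinite dimensional, and
  this is drawn from \<open>R\<close>.

  The intersection is decided by a single moment, that of \<open>Times (Star q) q\<close> with q =
  x_k - y_l. If f u = g v, take b_k near u and y_l near v: the sequences X_k and Y_l are then close
  in \<open>R\<close>, and the same moment read in \<open>C\<close> says that \<gamma>(c(n)_k) is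
  close to y_l, hence to v.

  The obstacle is that 2-norm estimates say nothing about operator norms, whereas a sequence defines
  an element of an ultrapower only if it is norm bounded. A cut-off made in one algebra must make
  sense in every other one. Therefore it is the function t / (1 + t^2), approximated by polynomials
  from a Neumann series whose bounds hold in all algebras at once. Square roots and preimages come
  from contraction fixed points in norm closed algebras.

  Ultrapowers are handled through bounded sequences with the degenerate limit trace; the quotient is
  left to the GNS coordinates, which send null sequences to 0.\<close>

instance ell2 :: (type) banach ..

lemma cinner_add_right: "cinner x (y + z) = cinner x y + cinner x z"
  by transfer (simp add: distrib_left infsum_add abs_summable_summable ell2_mult_abs_summable)

lemma cinner_scale_right: "cinner x (ell2_scale c y) = c * cinner x y"
  by transfer (simp add: mult.left_commute infsum_cmult_right')

lemma cinner_commute: "cinner y x = cnj (cinner x y)"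
  by transfer (simp flip: infsum_cnj add: mult.commute)

lemma cinner_add_left: "cinner (x + y) z = cinner x z + cinner y z"
  by (metis cinner_add_right cinner_commute complex_cnj_add)

lemma cinner_scale_left: "cinner (ell2_scale c x) y = cnj c * cinner x y"
  by (metis cinner_scale_right cinner_commute complex_cnj_mult)

lemma cinner_scaleR_right: "cinner x (r *\<^sub>R y) = complex_of_real r * cinner x y"
  by (simp add: scaleR_ell2_def cinner_scale_right)

lemma cinner_scaleR_left: "cinner (r *\<^sub>R x) y = complex_of_real r * cinner x y"
  by (simp add: scaleR_ell2_def cinner_scale_left)

lemma cinner_self: "cinner x x = complex_of_real ((norm x)\<^sup>2)"
proof (rule complex_eqI)
  show "Re (cinner x x) = Re (complex_of_real ((norm x)\<^sup>2))"
    by (simp add: power2_norm_eq_inner inner_ell2_def)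
  have "cinner x x = cnj (cinner x x)" by (rule cinner_commute)
  then show "Im (cinner x x) = Im (complex_of_real ((norm x)\<^sup>2))"
    by (simp add: complex_eq_iff)
qed

text \<open>Rotating \<open>y\<close> by a unit scalar makes the complex inner product real and
  nonnegative, so the Cauchy-Schwarz inequality of the real inner product applies.\<close>

lemma cmod_cinner_le: "cmod (cinner x y) \<le> norm x * norm y"
proof (cases "cinner x y = 0")
  case False
  define u where "u = cnj (cinner x y) / complex_of_real (cmod (cinner x y))"
  have u: "cmod u = 1" using False by (simp add: u_def norm_divide)
  have "u * cinner x y = complex_of_real (cmod (cinner x y))"
    using False complex_norm_square[of "cinner x y"]
    by (simp add: u_def field_simps power2_eq_square)
  then have "cmod (cinner x y) = inner x (ell2_scale u y)"
    by (simp add: inner_ell2_def cinner_scale_right)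
  also have "\<dots> \<le> norm x * norm (ell2_scale u y)" by (rule norm_cauchy_schwarz)
  finally show ?thesis by (simp add: norm_ell2_scale u)
qed simp

lemma bounded_bilinear_cinner: "bounded_bilinear cinner"
proof
  fix x x' y y' :: "'a ell2" and r :: real
  show "cinner (x + x') y = cinner x y + cinner x' y" by (rule cinner_add_left)
  show "cinner x (y + y') = cinner x y + cinner x y'" by (rule cinner_add_right)
  show "cinner (r *\<^sub>R x) y = r *\<^sub>R cinner x y"
    by (simp add: cinner_scaleR_left scaleR_conv_of_real)
  show "cinner x (r *\<^sub>R y) = r *\<^sub>R cinner x y"
    by (simp add: cinner_scaleR_right scaleR_conv_of_real)
  show "\<exists>K. \<forall>(x::'a ell2) y. norm (cinner x y) \<le> norm x * norm y * K"
    by (intro exI[of _ 1]) (simp add: cmod_cinner_le)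
qed

interpretation cinner: bounded_bilinear cinner
  by (rule bounded_bilinear_cinner)

lemma cinner_eqI: "(\<And>x. cinner x y = cinner x z) \<Longrightarrow> y = z"
proof -
  assume "\<And>x. cinner x y = cinner x z"
  then have "cinner (y - z) (y - z) = 0" by (simp add: cinner.diff_right)
  then show "y = z" by (simp add: cinner_self)
qed

lemma ell2_scale_add_right: "ell2_scale c (x + y) = ell2_scale c x + ell2_scale c y"
  by transfer (simp add: distrib_left)

lemma ell2_scale_zero_right [simp]: "ell2_scale c 0 = 0"
  by transfer simp

lemma ell2_scale_scale: "ell2_scale c (ell2_scale d x) = ell2_scale (c * d) x"
  by transfer (simp add: mult.assoc)

lemma ell2_scale_one [simp]: "ell2_scale 1 x = x"
  by transfer simp

lemma ell2_scale_zero [simp]: "ell2_scale 0 x = 0"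
  by transfer simp

lemma ell2_scale_add_left: "ell2_scale (c + d) x = ell2_scale c x + ell2_scale d x"
  by transfer (simp add: distrib_right)

lift_definition ket :: "'i \<Rightarrow> 'i ell2" is "\<lambda>i j. if j = i then 1 else 0"
proof -
  fix i :: 'i
  have "(\<lambda>j. (cmod (if j = i then 1 else 0))\<^sup>2) summable_on {i}" by simp
  then show "(\<lambda>j. (cmod (if j = i then 1 else 0))\<^sup>2) summable_on UNIV"
    by (rule summable_on_cong_neutral[THEN iffD1, rotated -1]) auto
qed

lemma coord_ket: "coord (ket i) j = (if j = i then 1 else 0)"
  by (simp add: ket.rep_eq)

lemma cinner_ket: "cinner (ket i) x = coord x i"
proof -
  have "cinner (ket i) x = (\<Sum>\<^sub>\<infinity>j. cnj (if j = i then 1 else 0) * coord x j)"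
    by (simp add: cinner.rep_eq ket.rep_eq)
  also have "\<dots> = (\<Sum>\<^sub>\<infinity>j\<in>{i}. cnj (if j = i then 1 else 0) * coord x j)"
    by (rule infsum_cong_neutral) auto
  finally show ?thesis by simp
qed

lemma coord_add: "coord (x + y) i = coord x i + coord y i" by (simp add: plus_ell2.rep_eq)
lemma coord_diff: "coord (x - y) i = coord x i - coord y i" by (simp add: minus_ell2.rep_eq)
lemma coord_scale: "coord (ell2_scale c x) i = c * coord x i" by (simp add: ell2_scale.rep_eq)
lemma coord_zero: "coord 0 i = 0" by (simp add: zero_ell2.rep_eq)
lemma coord_sum: "coord (sum f F) i = (\<Sum>x\<in>F. coord (f x) i)"
  by (induction F rule: infinite_finite_induct) (auto simp: coord_zero coord_add)

lemma ell2_eqI: "(\<And>i. coord x i = coord y i) \<Longrightarrow> x = y"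
  by (metis coord_inject ext)

lemma coord_finite_sum:
  "finite F \<Longrightarrow> coord (\<Sum>i\<in>F. ell2_scale (c i) (ket i)) j = (if j \<in> F then c j else 0)"
  by (simp add: coord_sum coord_scale coord_ket if_distrib cong: if_cong)

lemma norm_finite_sum_ket:
  assumes "finite F"
  shows "(norm (\<Sum>i\<in>F. ell2_scale (c i) (ket i)))\<^sup>2 = (\<Sum>i\<in>F. (cmod (c i))\<^sup>2)"
proof -
  have "(norm (\<Sum>i\<in>F. ell2_scale (c i) (ket i)))\<^sup>2 = (\<Sum>\<^sub>\<infinity>j. (cmod (if j \<in> F then c j else 0))\<^sup>2)"
    using assms by (simp add: norm_ell2_eq coord_finite_sum)
  also have "\<dots> = (\<Sum>\<^sub>\<infinity>j\<in>F. (cmod (c j))\<^sup>2)"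
    by (rule infsum_cong_neutral) auto
  finally show ?thesis using assms by simp
qed

text \<open>The squared distance to the partial sum over \<open>F\<close> is the squared norm minus
  the sum of the squared coordinates in \<open>F\<close>.\<close>

lemma ell2_finite_approx:
  assumes "e > 0"
  shows "\<exists>F. finite F \<and> norm (x - (\<Sum>i\<in>F. ell2_scale (coord x i) (ket i))) < e"
proof -
  have s: "(\<lambda>i. (cmod (coord x i))\<^sup>2) summable_on UNIV" using coord[of x] by simp
  then have "((\<lambda>i. (cmod (coord x i))\<^sup>2) has_sum (norm x)\<^sup>2) UNIV"
    by (simp add: norm_ell2_eq)
  then have "((\<lambda>F. \<Sum>i\<in>F. (cmod (coord x i))\<^sup>2) \<longlongrightarrow> (norm x)\<^sup>2) (finite_subsets_at_top UNIV)"
    by (simp add: has_sum_def)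
  then have "eventually (\<lambda>F. dist (\<Sum>i\<in>F. (cmod (coord x i))\<^sup>2) ((norm x)\<^sup>2) < e\<^sup>2) (finite_subsets_at_top UNIV)"
    using assms by (intro tendstoD) auto
  then obtain F where F: "finite F" "dist (\<Sum>i\<in>F. (cmod (coord x i))\<^sup>2) ((norm x)\<^sup>2) < e\<^sup>2"
    unfolding eventually_finite_subsets_at_top by blast
  define y where "y = (\<Sum>i\<in>F. ell2_scale (coord x i) (ket i))"
  have cy: "coord y j = (if j \<in> F then coord x j else 0)" for j
    using F(1) by (simp add: y_def coord_finite_sum)
  have c1: "cinner y x = complex_of_real (\<Sum>i\<in>F. (cmod (coord x i))\<^sup>2)"
    by (simp add: y_def cinner.sum_left cinner_scale_left cinner_ket complex_norm_square mult.commute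
        del: of_real_power)
  have ny: "(norm y)\<^sup>2 = (\<Sum>i\<in>F. (cmod (coord x i))\<^sup>2)"
    unfolding y_def by (rule norm_finite_sum_ket[OF F(1)])
  have "(norm (x - y))\<^sup>2 = (norm x)\<^sup>2 - 2 * inner y x + (norm y)\<^sup>2"
    by (simp add: power2_norm_eq_inner inner_diff_left inner_diff_right inner_commute)
  also have "\<dots> = (norm x)\<^sup>2 - (\<Sum>i\<in>F. (cmod (coord x i))\<^sup>2)"
    using c1 ny by (simp add: inner_ell2_def)
  also have "\<dots> < e\<^sup>2" using F(2) by (simp add: dist_real_def)
  finally have "norm (x - y) < e" using assms by (simp add: power2_less_imp_less)
  then show ?thesis using F(1) y_def by blast
qed

section \<open>Bounded complex-linear operators and adjoints\<close>

lemma bounded_ops_scale: "T \<in> bounded_ops \<Longrightarrow> blinfun_apply T (ell2_scale c x) = ell2_scale c (blinfun_apply T x)"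
  by (simp add: bounded_ops_def)

lemma bounded_ops_id [simp]: "id_blinfun \<in> bounded_ops" by (simp add: bounded_ops_def)
lemma bounded_ops_add: "S \<in> bounded_ops \<Longrightarrow> T \<in> bounded_ops \<Longrightarrow> S + T \<in> bounded_ops"
  by (simp add: bounded_ops_def blinfun.add_left ell2_scale_add_right)
lemma bounded_ops_compose: "S \<in> bounded_ops \<Longrightarrow> T \<in> bounded_ops \<Longrightarrow> S o\<^sub>L T \<in> bounded_ops"
  by (simp add: bounded_ops_def)
lemma bounded_ops_op_scale: "T \<in> bounded_ops \<Longrightarrow> op_scale c T \<in> bounded_ops"
  by (simp add: bounded_ops_def op_scale_apply ell2_scale_scale mult.commute)

lemma op_scale_add_right: "op_scale c (S + T) = op_scale c S + op_scale c T"
  by (rule blinfun_eqI) (simp add: op_scale_apply blinfun.add_left ell2_scale_add_right)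
lemma op_scale_add_left: "op_scale (c + d) T = op_scale c T + op_scale d T"
  by (rule blinfun_eqI) (simp add: op_scale_apply blinfun.add_left ell2_scale_add_left)
lemma op_scale_scale: "op_scale c (op_scale d T) = op_scale (c * d) T"
  by (rule blinfun_eqI) (simp add: op_scale_apply ell2_scale_scale)
lemma op_scale_one [simp]: "op_scale 1 T = T"
  by (rule blinfun_eqI) (simp add: op_scale_apply)
lemma op_scale_zero [simp]: "op_scale 0 T = 0"
  by (rule blinfun_eqI) (simp add: op_scale_apply)
lemma op_scale_of_real: "op_scale (complex_of_real r) T = r *\<^sub>R T"
  by (rule blinfun_eqI) (simp add: op_scale_apply blinfun.scaleR_left scaleR_ell2_def)
lemma op_scale_minus_one: "op_scale (-1) T = - T"
  using op_scale_of_real[of "-1" T] by simp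
lemma op_scale_compose_left: "op_scale c S o\<^sub>L T = op_scale c (S o\<^sub>L T)"
  by (rule blinfun_eqI) (simp add: op_scale_apply)
lemma op_scale_compose_right: "S \<in> bounded_ops \<Longrightarrow> S o\<^sub>L op_scale c T = op_scale c (S o\<^sub>L T)"
  by (rule blinfun_eqI) (simp add: op_scale_apply bounded_ops_scale)

lemma norm_op_scale: "norm (op_scale c T) \<le> cmod c * norm T"
proof (rule norm_blinfun_bound)
  fix x
  show "norm (blinfun_apply (op_scale c T) x) \<le> cmod c * norm T * norm x"
    by (simp add: op_scale_apply norm_ell2_scale mult.assoc mult_left_mono norm_blinfun)
qed simp

lemma norm_compose: "norm (S o\<^sub>L T) \<le> norm S * norm T"
  by (rule norm_blinfun_compose)

lemma closed_bounded_ops: "closed (bounded_ops :: 'i op set)"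
proof -
  have "(bounded_ops :: 'i op set) = (\<Inter>c x. {T. blinfun_apply T (ell2_scale c x) = ell2_scale c (blinfun_apply T x)})"
    by (auto simp: bounded_ops_def)
  also have "closed \<dots>"
    by (intro closed_INT ballI closed_Collect_eq continuous_intros bounded_linear.continuous_on[OF bounded_linear_ell2_scale])
  finally show ?thesis .
qed

text \<open>Riesz representation for forms: the coordinate of \<open>S y\<close> at \<open>i\<close>
  has to be \<open>B (ket i) y\<close>, and the bound on \<open>B\<close> makes these coordinates
  square summable. Adjoints and weak limits of operators both come from here.\<close>

lemma sesquilinear_form_operator:
  fixes B :: "'i ell2 \<Rightarrow> 'i ell2 \<Rightarrow> complex"
  assumes B_add_left: "\<And>x y z. B (x + y) z = B x z + B y z"
    and B_add_right: "\<And>x y z. B x (y + z) = B x y + B x z"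
    and B_scale_left: "\<And>c x y. B (ell2_scale c x) y = cnj c * B x y"
    and B_scale_right: "\<And>c x y. B x (ell2_scale c y) = c * B x y"
    and B_bound: "\<And>x y. cmod (B x y) \<le> C * norm x * norm y"
    and C: "0 \<le> C"
  shows "\<exists>S\<in>bounded_ops. norm S \<le> C \<and> (\<forall>x y. cinner x (blinfun_apply S y) = B x y)"
proof -
  define f where "f x i = B (ket i) x" for x i
  have B_zero: "B 0 x = 0" for x using B_add_left[of 0 0 x] by simp
  have B_sum: "B (sum g F) x = (\<Sum>i\<in>F. B (g i) x)" for g :: "'i \<Rightarrow> 'i ell2" and F x
    by (induction F rule: infinite_finite_induct) (auto simp: B_zero B_add_left)
  have B_diff: "B (x - y) z = B x z - B y z" for x y z using B_add_left[of "x - y" y z] by simp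
  have bd: "(\<Sum>i\<in>F. (cmod (f x i))\<^sup>2) \<le> (C * norm x)\<^sup>2" if F: "finite F" for F x
  proof -
    \<comment> \<open>Testing \<open>B\<close> against the vector built from its own coefficients
      gives \<open>(norm z)\<^sup>2 \<le> C * norm z * norm x\<close>; one factor
      \<open>norm z\<close> cancels.\<close>
    define z where "z = (\<Sum>i\<in>F. ell2_scale (f x i) (ket i))"
    have nz: "(norm z)\<^sup>2 = (\<Sum>i\<in>F. (cmod (f x i))\<^sup>2)"
      unfolding z_def by (rule norm_finite_sum_ket[OF F])
    have "B z x = (\<Sum>i\<in>F. cnj (f x i) * f x i)"
      by (simp add: z_def B_sum B_scale_left f_def)
    also have "\<dots> = complex_of_real ((norm z)\<^sup>2)"
      by (simp add: nz complex_norm_square mult.commute del: of_real_power)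
    finally have "cmod (B z x) = (norm z)\<^sup>2"
      by (metis norm_of_real abs_of_nonneg zero_le_power2)
    then have "norm z * norm z \<le> norm z * (C * norm x)"
      using B_bound[of z x] by (simp add: power2_eq_square algebra_simps)
    then have "norm z \<le> C * norm x"
      using C by (cases "norm z = 0") (auto simp: mult_le_cancel_left)
    then show ?thesis unfolding nz[symmetric] by (intro power_mono) auto
  qed
  have sm: "(\<lambda>i. (cmod (f x i))\<^sup>2) summable_on UNIV" for x
    by (rule nonneg_bdd_above_summable_on) (auto intro!: bdd_aboveI2[where M = "(C * norm x)\<^sup>2"] bd)
  define S where "S x = Abs_ell2 (f x)" for x
  have cS: "coord (S x) = f x" for x
    unfolding S_def by (rule Abs_ell2_inverse) (use sm in simp)
  have nS: "norm (S x) \<le> C * norm x" for x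
  proof -
    have "(norm (S x))\<^sup>2 \<le> (C * norm x)\<^sup>2"
      unfolding norm_ell2_eq cS by (rule infsum_le_finite_sums[OF sm bd])
    then show ?thesis using C by (simp add: power2_le_iff_abs_le)
  qed
  have "bounded_linear S"
  proof (rule bounded_linear_intro[where K = C])
    fix x y :: "'i ell2" and r :: real
    show "S (x + y) = S x + S y" by (rule ell2_eqI) (simp add: cS coord_add f_def B_add_right)
    show "S (r *\<^sub>R x) = r *\<^sub>R S x"
      by (rule ell2_eqI) (simp add: cS f_def scaleR_ell2_def coord_scale B_scale_right)
    show "norm (S x) \<le> norm x * C" using nS by (simp add: mult.commute)
  qed
  then have ap: "blinfun_apply (Blinfun S) x = S x" for x by (simp add: bounded_linear_Blinfun_apply)
  have adj: "cinner y (S x) = B y x" for x y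
  proof -
    have "cmod (cinner y (S x) - B y x) \<le> e" if e: "e > 0" for e
    proof -
      define d where "d = e / (norm (S x) + C * norm x + 1)"
      have pos: "norm (S x) + C * norm x + 1 > 0" using C by (intro add_nonneg_pos) auto
      then have d: "d > 0" using e by (simp add: d_def)
      obtain F where F: "finite F" "norm (y - (\<Sum>i\<in>F. ell2_scale (coord y i) (ket i))) < d"
        using ell2_finite_approx[OF d] by blast
      define z where "z = (\<Sum>i\<in>F. ell2_scale (coord y i) (ket i))"
      have "cinner z (S x) = B z x"
        by (simp add: z_def B_sum B_scale_left cinner.sum_left cinner_scale_left cinner_ket cS f_def)
      then have "cinner y (S x) - B y x = cinner (y - z) (S x) - B (y - z) x"
        by (simp add: cinner.diff_left B_diff)
      also have "cmod \<dots> \<le> cmod (cinner (y - z) (S x)) + cmod (B (y - z) x)"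
        by (rule norm_triangle_ineq4)
      also have "\<dots> \<le> norm (y - z) * norm (S x) + C * norm (y - z) * norm x"
        by (intro add_mono cmod_cinner_le B_bound)
      also have "\<dots> = norm (y - z) * (norm (S x) + C * norm x)" by (simp add: algebra_simps)
      also have "\<dots> \<le> d * (norm (S x) + C * norm x + 1)"
        using F(2) d C by (intro mult_mono) (auto simp: z_def)
      also have "\<dots> = e" using pos by (simp add: d_def)
      finally show ?thesis .
    qed
    then have "cmod (cinner y (S x) - B y x) \<le> 0" by (rule dense_ge)
    then show ?thesis by simp
  qed
  show ?thesis
  proof (intro bexI[of _ "Blinfun S"] allI conjI)
    show "cinner x (blinfun_apply (Blinfun S) y) = B x y" for x y
      unfolding ap using adj by simp
    show "Blinfun S \<in> bounded_ops"
      unfolding bounded_ops_def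
      by (auto simp: ap intro!: ell2_eqI simp: cS f_def coord_scale B_scale_right)
    show "norm (Blinfun S) \<le> C" by (rule norm_blinfun_bound) (use C nS ap in auto)
  qed
qed

lemma adjoint_exists:
  assumes T: "T \<in> bounded_ops"
  shows "\<exists>S\<in>bounded_ops. \<forall>x y. cinner (blinfun_apply S x) y = cinner x (blinfun_apply T y)"
proof -
  have "cmod (cinner (blinfun_apply T x) y) \<le> norm T * norm x * norm y" for x y
    by (rule order_trans[OF cmod_cinner_le]) (intro mult_right_mono norm_blinfun, simp)
  then obtain S where "S \<in> bounded_ops" "\<And>x y. cinner x (blinfun_apply S y) = cinner (blinfun_apply T x) y"
    using sesquilinear_form_operator[of "\<lambda>x y. cinner (blinfun_apply T x) y" "norm T"]
    by (auto simp: blinfun.add_right cinner_add_left cinner_add_right bounded_ops_scale[OF T]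
        cinner_scale_left cinner_scale_right)
  then show ?thesis by (metis cinner_commute)
qed

lemma op_adjoint_unique:
  assumes "\<And>x y. cinner (blinfun_apply S x) y = cinner x (blinfun_apply T y)"
  shows "op_adjoint T = S"
  unfolding op_adjoint_def
proof (rule the_equality)
  show "\<forall>x y. cinner (blinfun_apply S x) y = cinner x (blinfun_apply T y)" using assms by blast
  fix S' assume "\<forall>x y. cinner (blinfun_apply S' x) y = cinner x (blinfun_apply T y)"
  then have "cinner (blinfun_apply S' x) y = cinner (blinfun_apply S x) y" for x y
    using assms by simp
  then have "blinfun_apply S' x = blinfun_apply S x" for x
    by (intro cinner_eqI) (metis cinner_commute)
  then show "S' = S" by (rule blinfun_eqI)
qed

lemma
  assumes "T \<in> bounded_ops"
  shows op_adjoint_left: "cinner (blinfun_apply (op_adjoint T) x) y = cinner x (blinfun_apply T y)"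
    and op_adjoint_right: "cinner x (blinfun_apply (op_adjoint T) y) = cinner (blinfun_apply T x) y"
    and bounded_ops_adjoint: "op_adjoint T \<in> bounded_ops"
proof -
  obtain S where S: "S \<in> bounded_ops" "\<And>x y. cinner (blinfun_apply S x) y = cinner x (blinfun_apply T y)"
    using adjoint_exists[OF assms] by blast
  then have "op_adjoint T = S" by (intro op_adjoint_unique)
  with S show "op_adjoint T \<in> bounded_ops"
    and 1: "\<And>x y. cinner (blinfun_apply (op_adjoint T) x) y = cinner x (blinfun_apply T y)" by auto
  show "cinner x (blinfun_apply (op_adjoint T) y) = cinner (blinfun_apply T x) y"
    using 1[of y x] by (metis cinner_commute)
qed

lemma op_adjoint_add: "S \<in> bounded_ops \<Longrightarrow> T \<in> bounded_ops \<Longrightarrow> op_adjoint (S + T) = op_adjoint S + op_adjoint T"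
  by (rule op_adjoint_unique) (simp add: blinfun.add_left cinner_add_left cinner_add_right op_adjoint_left)
lemma op_adjoint_compose: "S \<in> bounded_ops \<Longrightarrow> T \<in> bounded_ops \<Longrightarrow> op_adjoint (S o\<^sub>L T) = op_adjoint T o\<^sub>L op_adjoint S"
  by (rule op_adjoint_unique) (simp add: op_adjoint_left)
lemma op_adjoint_op_scale: "T \<in> bounded_ops \<Longrightarrow> op_adjoint (op_scale c T) = op_scale (cnj c) (op_adjoint T)"
  by (rule op_adjoint_unique) (simp add: op_adjoint_left op_scale_apply cinner_scale_left cinner_scale_right)
lemma op_adjoint_adjoint: "T \<in> bounded_ops \<Longrightarrow> op_adjoint (op_adjoint T) = T"
  by (rule op_adjoint_unique) (simp add: op_adjoint_right)

lemma norm_op_adjoint_le: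
  assumes "T \<in> bounded_ops" shows "norm (op_adjoint T) \<le> norm T"
proof (rule norm_blinfun_bound)
  fix x
  let ?y = "blinfun_apply (op_adjoint T) x"
  have "complex_of_real ((norm ?y)\<^sup>2) = cinner x (blinfun_apply T ?y)"
    using op_adjoint_left[OF assms, of x ?y] by (simp add: cinner_self)
  then have "(norm ?y)\<^sup>2 = cmod (cinner x (blinfun_apply T ?y))"
    by (metis norm_of_real abs_of_nonneg zero_le_power2)
  also have "\<dots> \<le> norm x * (norm T * norm ?y)"
    by (rule order_trans[OF cmod_cinner_le]) (intro mult_left_mono norm_blinfun, auto)
  finally have "norm ?y * norm ?y \<le> norm ?y * (norm T * norm x)"
    by (simp add: power2_eq_square algebra_simps)
  then show "norm ?y \<le> norm T * norm x"
    by (cases "norm ?y = 0") (auto simp: mult_le_cancel_left)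
qed simp

lemma norm_op_adjoint: "T \<in> bounded_ops \<Longrightarrow> norm (op_adjoint T) = norm T"
  by (metis bounded_ops_adjoint norm_op_adjoint_le op_adjoint_adjoint order_antisym)

text \<open>Stated by inner products and not as \<open>op_adjoint T = T\<close>:
  \<open>op_adjoint\<close> is a description that is under control only on
  \<open>bounded_ops\<close>, while this condition is visibly closed and stable under real
  combinations.\<close>

definition self_adj :: "'i op \<Rightarrow> bool" where
  "self_adj T \<longleftrightarrow> (\<forall>x y. cinner (blinfun_apply T x) y = cinner x (blinfun_apply T y))"

lemma self_adjD: "self_adj T \<Longrightarrow> op_adjoint T = T"
  by (rule op_adjoint_unique) (simp add: self_adj_def)

lemma self_adj_iff: "T \<in> bounded_ops \<Longrightarrow> self_adj T \<longleftrightarrow> op_adjoint T = T"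
  by (metis self_adjD self_adj_def op_adjoint_left)

lemma closed_self_adj: "closed {T. self_adj (T :: 'i op)}"
proof -
  have "{T. self_adj (T :: 'i op)} = (\<Inter>x y. {T. cinner (blinfun_apply T x) y = cinner x (blinfun_apply T y)})"
    by (auto simp: self_adj_def)
  also have "closed \<dots>"
    by (intro closed_INT ballI closed_Collect_eq cinner.continuous_on continuous_intros)
  finally show ?thesis .
qed

lemma self_adj_add: "self_adj S \<Longrightarrow> self_adj T \<Longrightarrow> self_adj (S + T)"
  by (simp add: self_adj_def blinfun.add_left cinner_add_left cinner_add_right)
lemma self_adj_scaleR: "self_adj T \<Longrightarrow> self_adj (r *\<^sub>R T)"
  by (simp add: self_adj_def blinfun.scaleR_left cinner_scaleR_left cinner_scaleR_right)
lemma self_adj_id [simp]: "self_adj id_blinfun" by (simp add: self_adj_def)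
lemma self_adj_minus: "self_adj T \<Longrightarrow> self_adj (- T)"
  using self_adj_scaleR[of T "-1"] by simp
lemma self_adj_diff: "self_adj S \<Longrightarrow> self_adj T \<Longrightarrow> self_adj (S - T)"
  using self_adj_add[of S "- T"] self_adj_minus[of T] by simp
lemma self_adj_compose: "self_adj S \<Longrightarrow> self_adj T \<Longrightarrow> S o\<^sub>L T = T o\<^sub>L S \<Longrightarrow> self_adj (S o\<^sub>L T)"
  by (simp add: self_adj_def) (metis blinfun_apply_blinfun_compose)

section \<open>Fixed points and approximate inverses in closed operator algebras\<close>

text \<open>Complete real algebras of operators, the common setting in which the fixed points below
  are found. It covers von Neumann algebras and the closures \<open>poly_closure\<close>.\<close>

definition closed_alg :: "'i op set \<Rightarrow> bool" where
  "closed_alg L \<longleftrightarrow> closed L \<and> id_blinfun \<in> L \<and>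
     (\<forall>S\<in>L. \<forall>T\<in>L. S + T \<in> L \<and> S o\<^sub>L T \<in> L) \<and> (\<forall>r. \<forall>T\<in>L. r *\<^sub>R T \<in> L)"

lemma closed_algD:
  assumes "closed_alg L"
  shows "closed L" "id_blinfun \<in> L" "S \<in> L \<Longrightarrow> T \<in> L \<Longrightarrow> S + T \<in> L"
    "S \<in> L \<Longrightarrow> T \<in> L \<Longrightarrow> S o\<^sub>L T \<in> L" "T \<in> L \<Longrightarrow> r *\<^sub>R T \<in> L"
    "0 \<in> L" "S \<in> L \<Longrightarrow> T \<in> L \<Longrightarrow> S - T \<in> L"
proof -
  show *: "closed L" "id_blinfun \<in> L" "\<And>S T. S \<in> L \<Longrightarrow> T \<in> L \<Longrightarrow> S + T \<in> L"
    "S \<in> L \<Longrightarrow> T \<in> L \<Longrightarrow> S o\<^sub>L T \<in> L" "\<And>T r. T \<in> L \<Longrightarrow> r *\<^sub>R T \<in> L"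
    using assms by (auto simp: closed_alg_def)
  show "0 \<in> L" using *(5)[OF *(2), of 0] by simp
  show "S \<in> L \<Longrightarrow> T \<in> L \<Longrightarrow> S - T \<in> L" using *(3)[of S "(-1) *\<^sub>R T"] *(5)[of T "-1"] by simp
qed

lemma blinfun_compose_diff_left: "(S - S') o\<^sub>L T = (S o\<^sub>L T) - (S' o\<^sub>L T)"
  by (rule blinfun_eqI) (simp add: blinfun.diff_left)
lemma blinfun_compose_diff_right: "S o\<^sub>L (T - T') = (S o\<^sub>L T) - (S o\<^sub>L T')"
  by (rule blinfun_eqI) (simp add: blinfun.diff_left blinfun.diff_right)
lemma blinfun_compose_add_left': "(S + S') o\<^sub>L T = (S o\<^sub>L T) + (S' o\<^sub>L T)"
  by (rule blinfun_eqI) (simp add: blinfun.add_left)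
lemma blinfun_compose_add_right': "S o\<^sub>L (T + T') = (S o\<^sub>L T) + (S o\<^sub>L T')"
  by (rule blinfun_eqI) (simp add: blinfun.add_left blinfun.add_right)
lemma blinfun_compose_scaleR_left': "(r *\<^sub>R S) o\<^sub>L T = r *\<^sub>R (S o\<^sub>L T)"
  by (rule blinfun_eqI) (simp add: blinfun.scaleR_left)
lemma blinfun_compose_scaleR_right': "S o\<^sub>L (r *\<^sub>R T) = r *\<^sub>R (S o\<^sub>L T)"
  by (rule blinfun_eqI) (simp add: blinfun.scaleR_left blinfun.scaleR_right)
lemma blinfun_compose_assoc: "(S o\<^sub>L T) o\<^sub>L U = S o\<^sub>L (T o\<^sub>L U)"
  by (rule blinfun_eqI) simp
lemma blinfun_compose_id [simp]: "id_blinfun o\<^sub>L T = T" "T o\<^sub>L id_blinfun = T"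
  by (auto intro: blinfun_eqI)
lemma blinfun_compose_zero_right [simp]: "T o\<^sub>L 0 = 0"
  by (auto intro: blinfun_eqI)

lemmas blinfun_alg = blinfun_compose_diff_left blinfun_compose_diff_right blinfun_compose_add_left'
  blinfun_compose_add_right' blinfun_compose_scaleR_left' blinfun_compose_scaleR_right'
  blinfun_compose_assoc

text \<open>Since \<open>u\<close> and \<open>v\<close> need not commute, the difference of squares
  is split as u (u - v) + (u - v) v. This supplies the contraction constants below.\<close>

lemma norm_square_diff_le:
  assumes "norm u \<le> \<rho>" "norm v \<le> \<rho>"
  shows "norm ((u o\<^sub>L u) - (v o\<^sub>L v)) \<le> 2 * \<rho> * norm (u - v)"
proof -
  have "(u o\<^sub>L u) - (v o\<^sub>L v) = (u o\<^sub>L (u - v)) + ((u - v) o\<^sub>L v)" by (simp add: blinfun_alg)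
  also have "norm \<dots> \<le> norm (u o\<^sub>L (u - v)) + norm ((u - v) o\<^sub>L v)" by (rule norm_triangle_ineq)
  also have "\<dots> \<le> norm u * norm (u - v) + norm (u - v) * norm v" by (intro add_mono norm_compose)
  also have "\<dots> \<le> \<rho> * norm (u - v) + norm (u - v) * \<rho>"
    using assms by (intro add_mono mult_right_mono mult_left_mono) auto
  finally show ?thesis by (simp add: algebra_simps)
qed

text \<open>With y = 1 - u the equation becomes u = (t + u^2) / 2, and the right side is a
  contraction with constant \<open>norm t\<close> on the ball of that radius. The limit stays in
  \<open>L\<close> because \<open>L\<close> is closed.\<close>

lemma closed_alg_sqrt:
  assumes L: "closed_alg L" and t: "t \<in> L" "self_adj t" "norm t < 1"
  shows "\<exists>y\<in>L. self_adj y \<and> y o\<^sub>L y = id_blinfun - t"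
proof -
  note La = closed_algD[OF L]
  define \<rho> where "\<rho> = norm t"
  define s where "s = {u \<in> L. norm u \<le> \<rho> \<and> self_adj u}"
  define f where "f u = (1/2) *\<^sub>R (t + (u o\<^sub>L u))" for u :: "'a op"
  have \<rho>: "0 \<le> \<rho>" "\<rho> < 1" using t by (auto simp: \<rho>_def)
  have "s = L \<inter> cball 0 \<rho> \<inter> {u. self_adj u}" by (auto simp: s_def)
  then have "closed s" using La(1) by (auto intro: closed_self_adj closed_cball)
  then have comp: "complete s" by (simp add: complete_eq_closed)
  have ne: "s \<noteq> {}" using t by (auto simp: s_def \<rho>_def)
  have maps: "f u \<in> s" if u: "u \<in> s" for u
  proof -
    have "norm (f u) \<le> (1/2) * (norm t + norm u * norm u)"
      unfolding f_def norm_scaleR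
      by (auto intro!: order_trans[OF norm_triangle_ineq] add_mono norm_compose)
    also have "\<dots> \<le> (1/2) * (\<rho> + \<rho> * \<rho>)"
      using u by (auto simp: s_def \<rho>_def intro!: mult_mono)
    also have "\<dots> \<le> \<rho>" using \<rho> mult_left_mono[of \<rho> 1 \<rho>] by simp
    finally show ?thesis
      using u La t by (auto simp: s_def f_def intro!: self_adj_scaleR self_adj_add self_adj_compose)
  qed
  have contr: "dist (f u) (f v) \<le> \<rho> * dist u v" if "u \<in> s" "v \<in> s" for u v
  proof -
    have "f u - f v = (1/2) *\<^sub>R ((u o\<^sub>L u) - (v o\<^sub>L v))" by (simp add: f_def algebra_simps)
    then have "norm (f u - f v) = (1/2) * norm ((u o\<^sub>L u) - (v o\<^sub>L v))" by simp
    also have "\<dots> \<le> (1/2) * (2 * \<rho> * norm (u - v))"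
      using that by (intro mult_left_mono norm_square_diff_le) (auto simp: s_def)
    finally show ?thesis by (simp add: dist_norm)
  qed
  obtain u where u: "u \<in> s" "f u = u"
    using Banach_fix[OF comp ne \<rho>, of f] maps contr by blast
  have "t + (u o\<^sub>L u) = 2 *\<^sub>R f u" by (simp add: f_def)
  then have e: "u o\<^sub>L u = 2 *\<^sub>R u - t" using u(2) by (simp add: algebra_simps)
  have "(id_blinfun - u) o\<^sub>L (id_blinfun - u) = id_blinfun - 2 *\<^sub>R u + (u o\<^sub>L u)"
    by (simp add: blinfun_alg scaleR_2)
  also have "\<dots> = id_blinfun - t" by (simp add: e)
  finally show ?thesis using u(1) La
    by (intro bexI[of _ "id_blinfun - u"]) (auto simp: s_def intro!: self_adj_diff)
qed

text \<open>The fixed point \<open>S\<close> satisfies \<open>T = S / (1 + S\<^sup>2)\<close>.\<close>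

lemma closed_alg_resolvent_preimage:
  assumes L: "closed_alg L" and T: "T \<in> L" "self_adj T" "norm T \<le> 1/4"
  shows "\<exists>S\<in>L. self_adj S \<and> norm S \<le> 1 \<and> S o\<^sub>L T = T o\<^sub>L S \<and> S = T + (T o\<^sub>L (S o\<^sub>L S))"
proof -
  note La = closed_algD[OF L]
  \<comment> \<open>Commutation with \<open>T\<close> is part of the domain, for otherwise T S^2
    need not be self-adjoint and the map would leave it. The bound 1/4 on \<open>norm T\<close>
    gives the contraction constant 2 * 1/4.\<close>
  define s where "s = {S \<in> L. norm S \<le> 1 \<and> self_adj S \<and> S o\<^sub>L T = T o\<^sub>L S}"
  define f where "f S = T + (T o\<^sub>L (S o\<^sub>L S))" for S
  have "closed {S. S o\<^sub>L T = T o\<^sub>L S}"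
    by (intro closed_Collect_eq bounded_bilinear.continuous_on[OF bounded_bilinear_blinfun_compose] continuous_intros)
  moreover have "s = L \<inter> cball 0 1 \<inter> {S. self_adj S} \<inter> {S. S o\<^sub>L T = T o\<^sub>L S}" by (auto simp: s_def)
  ultimately have "closed s" using La(1) by (auto intro: closed_self_adj closed_cball)
  then have comp: "complete s" by (simp add: complete_eq_closed)
  have ne: "s \<noteq> {}" using T by (auto simp: s_def)
  have maps: "f S \<in> s" if S: "S \<in> s" for S
  proof -
    have c: "S o\<^sub>L T = T o\<^sub>L S" using S by (simp add: s_def)
    have "norm (f S) \<le> norm T + norm T * (norm S * norm S)"
      unfolding f_def
      by (rule order_trans[OF norm_triangle_ineq]) (auto intro!: order_trans[OF norm_compose] mult_left_mono norm_compose)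
    also have "\<dots> \<le> 1/4 + 1/4 * (1 * 1)"
      using T(3) S by (intro add_mono mult_mono) (auto simp: s_def)
    finally have n: "norm (f S) \<le> 1" by simp
    have c2: "(S o\<^sub>L S) o\<^sub>L T = T o\<^sub>L (S o\<^sub>L S)" by (metis c blinfun_compose_assoc)
    have c3: "f S o\<^sub>L T = T o\<^sub>L f S" 
      unfolding f_def blinfun_compose_add_left' blinfun_compose_add_right'
        blinfun_compose_assoc[of T "S o\<^sub>L S" T] c2 ..
    have "self_adj (f S)" using S T c2 unfolding f_def s_def
      by (intro self_adj_add self_adj_compose) auto
    then show ?thesis
      using S La T n c3 by (auto simp: s_def f_def)
  qed
  have contr: "dist (f u) (f v) \<le> (1/2) * dist u v" if "u \<in> s" "v \<in> s" for u v
  proof -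
    have "f u - f v = T o\<^sub>L ((u o\<^sub>L u) - (v o\<^sub>L v))" by (simp add: f_def blinfun_alg)
    then have "norm (f u - f v) \<le> norm T * norm ((u o\<^sub>L u) - (v o\<^sub>L v))" by (metis norm_compose)
    also have "\<dots> \<le> (1/4) * (2 * 1 * norm (u - v))"
      using that T by (intro mult_mono norm_square_diff_le) (auto simp: s_def)
    finally show ?thesis by (simp add: dist_norm)
  qed
  obtain u where u: "u \<in> s" "f u = u"
    using Banach_fix[OF comp ne, of "1/2" f] maps contr by auto
  then show ?thesis by (intro bexI[of _ u]) (auto simp: s_def f_def)
qed

text \<open>Partial sums of the Neumann series of \<open>(1 + y\<^sup>2)\<^sup>-\<^sup>1\<close> with relaxation parameter \<open>t\<close>.\<close>

primrec resolvent_sum :: "real \<Rightarrow> 'i op \<Rightarrow> nat \<Rightarrow> 'i op" where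
  "resolvent_sum t y 0 = 0"
| "resolvent_sum t y (Suc k) =
     t *\<^sub>R id_blinfun + ((id_blinfun + (- t) *\<^sub>R (id_blinfun + (y o\<^sub>L y))) o\<^sub>L resolvent_sum t y k)"

lemma resolvent_sum_commute: "resolvent_sum t y k o\<^sub>L y = y o\<^sub>L resolvent_sum t y k"
proof (induction k)
  case (Suc k)
  define A where "A = id_blinfun + (- t) *\<^sub>R (id_blinfun + (y o\<^sub>L y))"
  have "A o\<^sub>L y = y o\<^sub>L A" by (simp add: A_def blinfun_alg)
  then have "(A o\<^sub>L resolvent_sum t y k) o\<^sub>L y = y o\<^sub>L (A o\<^sub>L resolvent_sum t y k)"
    using Suc by (metis blinfun_compose_assoc)
  moreover have "resolvent_sum t y (Suc k) = t *\<^sub>R id_blinfun + (A o\<^sub>L resolvent_sum t y k)"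
    by (simp only: resolvent_sum.simps A_def)
  ultimately show ?case
    by (simp add: blinfun_compose_add_left' blinfun_compose_add_right'
      blinfun_compose_scaleR_left' blinfun_compose_scaleR_right' del: resolvent_sum.simps)
qed simp

lemma inner_self_adj: "self_adj y \<Longrightarrow> inner (blinfun_apply y v) w = inner v (blinfun_apply y w)"
  by (simp add: self_adj_def inner_ell2_def)

text \<open>The step length of the iteration for 1 + y^2 when \<open>norm y \<le> c\<close>: the
  operator then has norm at most 1 + c^2, and the parameter is the inverse square of that bound. It
  depends on \<open>c\<close> only, never on \<open>y\<close>.\<close>

definition resolvent_par :: "real \<Rightarrow> real" where
  "resolvent_par c = 1 / (1 + c\<^sup>2)\<^sup>2"

lemma resolvent_par: "0 < resolvent_par c" "resolvent_par c \<le> 1"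
proof -
  have "1 \<le> (1 + c\<^sup>2)\<^sup>2" "1 + c\<^sup>2 \<noteq> 0"
    using add_pos_nonneg[OF zero_less_one zero_le_power2[of c]] by (auto simp: one_le_power)
  then show "0 < resolvent_par c" "resolvent_par c \<le> 1"
    by (auto simp: resolvent_par_def divide_simps)
qed

context
  fixes y :: "'i op" and c t :: real and P
  assumes y: "self_adj y" "norm y \<le> c"
    and t_def: "t = resolvent_par c" and P_def: "P = id_blinfun + (y o\<^sub>L y)"
begin

lemma inner_P: "inner v (blinfun_apply P v) = (norm v)\<^sup>2 + (norm (blinfun_apply y v))\<^sup>2"
  using inner_self_adj[OF y(1), of v "blinfun_apply y v"]
  by (simp add: P_def blinfun.add_left inner_add_right power2_norm_eq_inner)

lemma norm_P: "norm (blinfun_apply P v) \<le> (1 + c\<^sup>2) * norm v"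
proof -
  have c: "0 \<le> c" using y(2) norm_ge_zero order_trans by blast
  have "norm (blinfun_apply P v) \<le> norm v + norm (blinfun_apply y (blinfun_apply y v))"
    by (simp add: P_def blinfun.add_left norm_triangle_ineq)
  also have "norm (blinfun_apply y (blinfun_apply y v)) \<le> c * (c * norm v)"
    using y(2) c by (intro order_trans[OF norm_blinfun] mult_mono) auto
  finally show ?thesis by (simp add: algebra_simps power2_eq_square)
qed

text \<open>\<open>P\<close> is at least 1, so the cross term gains 2 t on the squared norm, while
  the quadratic term costs t^2 (1 + c^2)^2, which is \<open>t\<close> by the choice of
  \<open>t\<close>.\<close>

lemma norm_relaxation: "norm (id_blinfun - t *\<^sub>R P) \<le> sqrt (1 - t)"
proof (rule norm_blinfun_bound)
  show "0 \<le> sqrt (1 - t)" using resolvent_par(2) by (simp add: t_def)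
  fix v
  have tt: "t * (1 + c\<^sup>2)\<^sup>2 = 1"
    using add_pos_nonneg[OF zero_less_one zero_le_power2[of c]] by (simp add: t_def resolvent_par_def)
  have t0: "0 \<le> t" using resolvent_par(1)[of c] by (simp add: t_def)
  have "(norm (blinfun_apply (id_blinfun - t *\<^sub>R P) v))\<^sup>2
      = (norm v)\<^sup>2 - 2 * t * inner v (blinfun_apply P v) + t\<^sup>2 * (norm (blinfun_apply P v))\<^sup>2"
    unfolding power2_norm_eq_inner
    by (simp add: blinfun.diff_left blinfun.scaleR_left inner_diff_left
        inner_diff_right inner_commute power2_eq_square algebra_simps)
  also have "\<dots> \<le> (norm v)\<^sup>2 - 2 * t * (norm v)\<^sup>2 + t\<^sup>2 * ((1 + c\<^sup>2) * norm v)\<^sup>2"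
    using t0 unfolding inner_P
    by (intro add_mono diff_mono mult_left_mono power_mono norm_P) auto
  also have "t\<^sup>2 * ((1 + c\<^sup>2) * norm v)\<^sup>2 = t * (t * (1 + c\<^sup>2)\<^sup>2) * (norm v)\<^sup>2"
    by (simp add: power_mult_distrib power2_eq_square)
  also have "(norm v)\<^sup>2 - 2 * t * (norm v)\<^sup>2 + t * (t * (1 + c\<^sup>2)\<^sup>2) * (norm v)\<^sup>2 = (1 - t) * (norm v)\<^sup>2"
    unfolding tt by (simp add: algebra_simps)
  finally have "norm (blinfun_apply (id_blinfun - t *\<^sub>R P) v) \<le> sqrt ((1 - t) * (norm v)\<^sup>2)"
    by (rule real_le_rsqrt)
  then show "norm (blinfun_apply (id_blinfun - t *\<^sub>R P) v) \<le> sqrt (1 - t) * norm v"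
    by (simp add: real_sqrt_mult)
qed

text \<open>One step of the recursion multiplies the defect 1 - P Q on the left by 1 - t P.\<close>

lemma resolvent_sum_error: "norm (id_blinfun - (P o\<^sub>L resolvent_sum t y k)) \<le> sqrt (1 - t) ^ k"
proof (induction k)
  case 0
  show ?case by (simp add: norm_blinfun_id_le)
next
  case (Suc k)
  define Q where "Q = resolvent_sum t y k"
  have "id_blinfun - (P o\<^sub>L resolvent_sum t y (Suc k)) = (id_blinfun - t *\<^sub>R P) o\<^sub>L (id_blinfun - (P o\<^sub>L Q))"
    by (simp add: blinfun_alg flip: P_def Q_def)
  then have "norm (id_blinfun - (P o\<^sub>L resolvent_sum t y (Suc k)))
      \<le> norm (id_blinfun - t *\<^sub>R P) * norm (id_blinfun - (P o\<^sub>L Q))" by (metis norm_compose)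
  also have "\<dots> \<le> sqrt (1 - t) * sqrt (1 - t) ^ k"
    using Suc norm_relaxation resolvent_par(2)[of c] by (intro mult_mono) (auto simp: Q_def t_def)
  finally show ?case by simp
qed

lemma norm_one_plus_square_resolvent_sum: "norm (blinfun_apply P (blinfun_apply (resolvent_sum t y k) w)) \<le> 2 * norm w"
proof -
  define F where "F = id_blinfun - (P o\<^sub>L resolvent_sum t y k)"
  have "norm F \<le> sqrt (1 - t) ^ k" using resolvent_sum_error by (simp add: F_def)
  also have "\<dots> \<le> 1" using resolvent_par[of c] by (intro power_le_one) (auto simp: t_def)
  finally have F: "norm F \<le> 1" .
  have "blinfun_apply P (blinfun_apply (resolvent_sum t y k) w) = w - blinfun_apply F w"
    by (simp add: F_def blinfun.diff_left)
  also have "norm \<dots> \<le> norm w + norm F * norm w"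
    by (intro order_trans[OF norm_triangle_ineq4] add_left_mono norm_blinfun)
  also have "\<dots> \<le> norm w + 1 * norm w" using F by (intro add_mono mult_right_mono) auto
  finally show ?thesis by simp
qed

text \<open>For v = Q w one has |v|^2 + |y v|^2 = <v, P v> \<le> 2 |v| |w|, which bounds both
  vectors by 2 |w|. The bound 2 does not depend on \<open>c\<close>, on \<open>k\<close> or on the
  size of \<open>y\<close>; the whole density argument rests on this.\<close>

lemma
  shows norm_resolvent_sum: "norm (resolvent_sum t y k) \<le> 2"
    and norm_mult_resolvent_sum: "norm (y o\<^sub>L resolvent_sum t y k) \<le> 2"
proof -
  have *: "norm (blinfun_apply (resolvent_sum t y k) w) \<le> 2 * norm w"
    "norm (blinfun_apply y (blinfun_apply (resolvent_sum t y k) w)) \<le> 2 * norm w" for w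
  proof -
    define v where "v = blinfun_apply (resolvent_sum t y k) w"
    have a: "(norm v)\<^sup>2 + (norm (blinfun_apply y v))\<^sup>2 \<le> norm v * (2 * norm w)"
    proof -
      have "inner v (blinfun_apply P v) \<le> norm v * norm (blinfun_apply P v)" by (rule norm_cauchy_schwarz)
      also have "\<dots> \<le> norm v * (2 * norm w)"
        unfolding v_def by (intro mult_left_mono norm_one_plus_square_resolvent_sum) auto
      finally show ?thesis by (simp add: inner_P)
    qed
    then have "norm v * norm v \<le> norm v * (2 * norm w)"
      by (smt (verit) power2_eq_square zero_le_power2)
    then have 1: "norm v \<le> 2 * norm w"
      by (cases "norm v = 0") (auto simp: mult_le_cancel_left)
    have "(norm (blinfun_apply y v))\<^sup>2 \<le> norm v * (2 * norm w)" using a by (smt (verit) zero_le_power2)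
    also have "\<dots> \<le> (2 * norm w) * (2 * norm w)" using 1 by (intro mult_right_mono) auto
    finally have "(norm (blinfun_apply y v))\<^sup>2 \<le> (2 * norm w)\<^sup>2" by (simp add: power2_eq_square)
    then have "norm (blinfun_apply y v) \<le> 2 * norm w" by (rule power2_le_imp_le) simp
    with 1 show "norm (blinfun_apply (resolvent_sum t y k) w) \<le> 2 * norm w"
      "norm (blinfun_apply y (blinfun_apply (resolvent_sum t y k) w)) \<le> 2 * norm w" by (auto simp: v_def)
  qed
  show "norm (resolvent_sum t y k) \<le> 2" by (rule norm_blinfun_bound) (auto simp: *)
  show "norm (y o\<^sub>L resolvent_sum t y k) \<le> 2" by (rule norm_blinfun_bound) (auto simp: *)
qed

end

section \<open>Von Neumann algebras\<close>

lemma commutant_bounded: "T \<in> commutant X \<Longrightarrow> T \<in> bounded_ops" by (simp add: commutant_def)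

lemma commutant_commute: "T \<in> commutant X \<Longrightarrow> S \<in> X \<Longrightarrow> T o\<^sub>L S = S o\<^sub>L T"
  by (simp add: commutant_def)

lemma closed_commutant: "closed (commutant X)"
proof -
  have "commutant X = bounded_ops \<inter> (\<Inter>S\<in>X. {T. T o\<^sub>L S = S o\<^sub>L T})" by (auto simp: commutant_def)
  also have "closed \<dots>"
    by (intro closed_Int closed_bounded_ops closed_INT ballI closed_Collect_eq
        bounded_bilinear.continuous_on[OF bounded_bilinear_blinfun_compose] continuous_intros)
  finally show ?thesis .
qed

lemma commutant_alg:
  assumes X: "X \<subseteq> bounded_ops"
  shows "id_blinfun \<in> commutant X"
    "S \<in> commutant X \<Longrightarrow> T \<in> commutant X \<Longrightarrow> S + T \<in> commutant X"
    "S \<in> commutant X \<Longrightarrow> T \<in> commutant X \<Longrightarrow> S o\<^sub>L T \<in> commutant X"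
    "T \<in> commutant X \<Longrightarrow> op_scale c T \<in> commutant X"
proof -
  show "id_blinfun \<in> commutant X" by (simp add: commutant_def)
  show "S \<in> commutant X \<Longrightarrow> T \<in> commutant X \<Longrightarrow> S + T \<in> commutant X"
    by (simp add: commutant_def blinfun_alg bounded_ops_add)
  show "S o\<^sub>L T \<in> commutant X" if "S \<in> commutant X" "T \<in> commutant X"
  proof -
    have "(S o\<^sub>L T) o\<^sub>L A = A o\<^sub>L (S o\<^sub>L T)" if "A \<in> X" for A
      unfolding blinfun_compose_assoc commutant_commute[OF \<open>T \<in> commutant X\<close> that]
      unfolding blinfun_compose_assoc[symmetric] commutant_commute[OF \<open>S \<in> commutant X\<close> that] ..
    then show ?thesis using that by (auto simp: commutant_def bounded_ops_compose)
  qed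
  show "T \<in> commutant X \<Longrightarrow> op_scale c T \<in> commutant X"
    unfolding commutant_def
    using X by (simp add: bounded_ops_op_scale op_scale_compose_left op_scale_compose_right subset_iff)
qed

lemma commutant_adjoint:
  assumes X: "X \<subseteq> bounded_ops" "op_adjoint ` X \<subseteq> X" and T: "T \<in> commutant X"
  shows "op_adjoint T \<in> commutant X"
proof -
  have "op_adjoint T o\<^sub>L S = S o\<^sub>L op_adjoint T" if S: "S \<in> X" for S
  proof -
    have b: "S \<in> bounded_ops" "op_adjoint S \<in> X" "T \<in> bounded_ops" "op_adjoint S \<in> bounded_ops"
      using S X T commutant_bounded by auto
    have "T o\<^sub>L op_adjoint S = op_adjoint S o\<^sub>L T" using commutant_commute[OF T b(2)] .
    then have "op_adjoint (T o\<^sub>L op_adjoint S) = op_adjoint (op_adjoint S o\<^sub>L T)" by simp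
    then show ?thesis using b by (simp add: op_adjoint_compose op_adjoint_adjoint)
  qed
  then show ?thesis using T by (auto simp: commutant_def bounded_ops_adjoint)
qed

lemma bicommutant_vna:
  assumes X: "X \<subseteq> bounded_ops" "op_adjoint ` X \<subseteq> X"
  shows "von_neumann_algebra (commutant (commutant X))" "X \<subseteq> commutant (commutant X)"
proof -
  have c: "commutant X \<subseteq> bounded_ops" "op_adjoint ` commutant X \<subseteq> commutant X"
    using X commutant_adjoint commutant_bounded by blast+
  show sub: "X \<subseteq> commutant (commutant X)"
    using X by (auto simp: commutant_def)
  have "commutant (commutant (commutant X)) = commutant X"
  proof
    show "commutant (commutant (commutant X)) \<subseteq> commutant X"
      using sub by (auto simp: commutant_def)
    show "commutant X \<subseteq> commutant (commutant (commutant X))"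
      by (auto simp: commutant_def)
  qed
  moreover have "op_adjoint ` commutant (commutant X) \<subseteq> commutant (commutant X)"
    using c commutant_adjoint by blast
  ultimately show "von_neumann_algebra (commutant (commutant X))"
    by (simp add: von_neumann_algebra_def)
qed

context
  fixes M :: "'i op set"
  assumes M: "von_neumann_algebra M"
begin

lemma vna_bicommutant: "commutant (commutant M) = M"
  using M by (simp add: von_neumann_algebra_def)

lemma vna_bounded: "T \<in> M \<Longrightarrow> T \<in> bounded_ops"
  using vna_bicommutant commutant_bounded by blast

lemma vna_adjoint: "T \<in> M \<Longrightarrow> op_adjoint T \<in> M"
  using M by (auto simp: von_neumann_algebra_def)

lemma commutant_sub_bounded: "commutant M \<subseteq> bounded_ops" by (auto simp: commutant_def)

lemma
  shows vna_id: "id_blinfun \<in> M"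
    and vna_add: "S \<in> M \<Longrightarrow> T \<in> M \<Longrightarrow> S + T \<in> M"
    and vna_compose: "S \<in> M \<Longrightarrow> T \<in> M \<Longrightarrow> S o\<^sub>L T \<in> M"
    and vna_scale: "T \<in> M \<Longrightarrow> op_scale c T \<in> M"
  using commutant_alg[OF commutant_sub_bounded] by (simp_all add: vna_bicommutant)

lemma vna_scaleR: "T \<in> M \<Longrightarrow> r *\<^sub>R T \<in> M"
  using vna_scale[of T "complex_of_real r"] by (simp add: op_scale_of_real)

lemma closed_alg_vna: "closed_alg M"
  unfolding closed_alg_def
  using closed_commutant[of "commutant M"]
  by (auto simp: vna_bicommutant vna_id vna_add vna_compose vna_scaleR)

end

section \<open>Traces on \<open>*\<close>-algebras\<close>

text \<open>The trace is positive but possibly degenerate, so that bounded sequences with a limit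
  trace are an instance next to the tracial von Neumann algebras. The laws are required on the
  carrier \<open>K\<close> only, because the operations on the whole type need not satisfy
  them.\<close>

locale tracial_star =
  fixes K :: "'a :: ab_group_add set"
    and mul :: "'a \<Rightarrow> 'a \<Rightarrow> 'a"  (infixl "\<cdot>" 70)
    and sc :: "complex \<Rightarrow> 'a \<Rightarrow> 'a"
    and st :: "'a \<Rightarrow> 'a"
    and un :: 'a
    and \<tau> :: "'a \<Rightarrow> complex"
  assumes add_mem: "x \<in> K \<Longrightarrow> y \<in> K \<Longrightarrow> x + y \<in> K"
    and mul_mem: "x \<in> K \<Longrightarrow> y \<in> K \<Longrightarrow> x \<cdot> y \<in> K"
    and sc_mem: "x \<in> K \<Longrightarrow> sc c x \<in> K"
    and st_mem: "x \<in> K \<Longrightarrow> st x \<in> K"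
    and un_mem: "un \<in> K"
    and mul_assoc: "x \<in> K \<Longrightarrow> y \<in> K \<Longrightarrow> z \<in> K \<Longrightarrow> (x \<cdot> y) \<cdot> z = x \<cdot> (y \<cdot> z)"
    and mul_add_left: "x \<in> K \<Longrightarrow> y \<in> K \<Longrightarrow> z \<in> K \<Longrightarrow> (x + y) \<cdot> z = x \<cdot> z + y \<cdot> z"
    and mul_add_right: "x \<in> K \<Longrightarrow> y \<in> K \<Longrightarrow> z \<in> K \<Longrightarrow> x \<cdot> (y + z) = x \<cdot> y + x \<cdot> z"
    and mul_sc_left: "x \<in> K \<Longrightarrow> y \<in> K \<Longrightarrow> sc c x \<cdot> y = sc c (x \<cdot> y)"
    and mul_sc_right: "x \<in> K \<Longrightarrow> y \<in> K \<Longrightarrow> x \<cdot> sc c y = sc c (x \<cdot> y)"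
    and un_mul: "x \<in> K \<Longrightarrow> un \<cdot> x = x"
    and mul_un: "x \<in> K \<Longrightarrow> x \<cdot> un = x"
    and st_add: "x \<in> K \<Longrightarrow> y \<in> K \<Longrightarrow> st (x + y) = st x + st y"
    and st_mul: "x \<in> K \<Longrightarrow> y \<in> K \<Longrightarrow> st (x \<cdot> y) = st y \<cdot> st x"
    and st_sc: "x \<in> K \<Longrightarrow> st (sc c x) = sc (cnj c) (st x)"
    and st_st: "x \<in> K \<Longrightarrow> st (st x) = x"
    and sc_add_right: "x \<in> K \<Longrightarrow> y \<in> K \<Longrightarrow> sc c (x + y) = sc c x + sc c y"
    and sc_add_left: "x \<in> K \<Longrightarrow> sc (c + d) x = sc c x + sc d x"
    and sc_sc: "x \<in> K \<Longrightarrow> sc c (sc d x) = sc (c * d) x"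
    and sc_one: "x \<in> K \<Longrightarrow> sc 1 x = x"
    and tr_add: "x \<in> K \<Longrightarrow> y \<in> K \<Longrightarrow> \<tau> (x + y) = \<tau> x + \<tau> y"
    and tr_sc: "x \<in> K \<Longrightarrow> \<tau> (sc c x) = c * \<tau> x"
    and tr_un: "\<tau> un = 1"
    and tr_comm: "x \<in> K \<Longrightarrow> y \<in> K \<Longrightarrow> \<tau> (x \<cdot> y) = \<tau> (y \<cdot> x)"
    and tr_pos: "x \<in> K \<Longrightarrow> \<tau> (st x \<cdot> x) \<in> \<real> \<and> 0 \<le> Re (\<tau> (st x \<cdot> x))"
begin

lemma sc_zero: "x \<in> K \<Longrightarrow> sc 0 x = 0"
  using sc_add_left[of x 0 0] by simp

lemma sc_minus_one: "x \<in> K \<Longrightarrow> sc (-1) x = - x"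
  using sc_add_left[of x 1 "-1"] sc_zero[of x] sc_one[of x] by (simp add: eq_neg_iff_add_eq_0 add.commute)

lemma zero_mem: "0 \<in> K"
  using sc_mem[OF un_mem, of 0] sc_zero[OF un_mem] by simp

lemma minus_mem: "x \<in> K \<Longrightarrow> - x \<in> K"
  using sc_mem[of x "-1"] sc_minus_one by simp

lemma diff_mem: "x \<in> K \<Longrightarrow> y \<in> K \<Longrightarrow> x - y \<in> K"
  using add_mem[of x "- y"] minus_mem by simp

lemma sum_mem: "(\<And>i. i \<in> F \<Longrightarrow> f i \<in> K) \<Longrightarrow> sum f F \<in> K"
  by (induction F rule: infinite_finite_induct) (auto simp: zero_mem add_mem)

lemma tr_minus: "x \<in> K \<Longrightarrow> \<tau> (- x) = - \<tau> x"
  using tr_sc[of x "-1"] by (simp add: sc_minus_one)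

lemma tr_diff: "x \<in> K \<Longrightarrow> y \<in> K \<Longrightarrow> \<tau> (x - y) = \<tau> x - \<tau> y"
  using tr_add[of x "- y"] by (simp add: minus_mem tr_minus)

lemma st_minus: "x \<in> K \<Longrightarrow> st (- x) = - st x"
  using st_sc[of x "-1"] by (simp add: sc_minus_one st_mem)

lemma st_diff: "x \<in> K \<Longrightarrow> y \<in> K \<Longrightarrow> st (x - y) = st x - st y"
  using st_add[of x "- y"] by (simp add: minus_mem st_minus)

lemma st_un: "st un = un"
  by (metis mul_un st_mem st_mul st_st un_mem un_mul)

lemma mul_minus_left: "x \<in> K \<Longrightarrow> y \<in> K \<Longrightarrow> (- x) \<cdot> y = - (x \<cdot> y)"
  using mul_sc_left[of x y "-1"] by (simp add: sc_minus_one mul_mem)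

lemma mul_minus_right: "x \<in> K \<Longrightarrow> y \<in> K \<Longrightarrow> x \<cdot> (- y) = - (x \<cdot> y)"
  using mul_sc_right[of x y "-1"] by (simp add: sc_minus_one mul_mem)

lemma mul_diff_left: "x \<in> K \<Longrightarrow> y \<in> K \<Longrightarrow> z \<in> K \<Longrightarrow> (x - y) \<cdot> z = x \<cdot> z - y \<cdot> z"
  using mul_add_left[of x "- y" z] by (simp add: minus_mem mul_minus_left)

lemma mul_diff_right: "x \<in> K \<Longrightarrow> y \<in> K \<Longrightarrow> z \<in> K \<Longrightarrow> x \<cdot> (y - z) = x \<cdot> y - x \<cdot> z"
  using mul_add_right[of x y "- z"] by (simp add: minus_mem mul_minus_right)

definition ip :: "'a \<Rightarrow> 'a \<Rightarrow> complex" where "ip x y = \<tau> (st x \<cdot> y)"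
definition n2 :: "'a \<Rightarrow> real" where "n2 x = sqrt (Re (ip x x))"

text \<open>Positivity at 1 + w makes the imaginary parts of the traces of w and of its adjoint
  cancel. Taking w = x gives the imaginary part of the claim, w = \<i> x the real part.\<close>

lemma tr_st:
  assumes x: "x \<in> K" shows "\<tau> (st x) = cnj (\<tau> x)"
proof -
  have r: "Im (\<tau> (st z \<cdot> z)) = 0" if "z \<in> K" for z
    using tr_pos[OF that] by (simp add: complex_is_Real_iff)
  have g: "Im (\<tau> (sc c x)) + Im (\<tau> (st (sc c x))) = 0" for c
  proof -
    let ?w = "sc c x"
    have w: "?w \<in> K" "st ?w \<in> K" using x by (auto intro: sc_mem st_mem)
    have "st (un + ?w) \<cdot> (un + ?w) = un + ?w + st ?w + st ?w \<cdot> ?w"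
      using w by (simp add: st_add st_un mul_add_left mul_add_right un_mem un_mul mul_un add_mem mul_mem add.assoc)
    then have "\<tau> (st (un + ?w) \<cdot> (un + ?w)) = 1 + \<tau> ?w + \<tau> (st ?w) + \<tau> (st ?w \<cdot> ?w)"
      using w by (simp add: tr_add add_mem un_mem mul_mem tr_un)
    then have "Im (\<tau> (st (un + ?w) \<cdot> (un + ?w))) = Im (\<tau> ?w) + Im (\<tau> (st ?w)) + Im (\<tau> (st ?w \<cdot> ?w))"
      by simp
    then show ?thesis using r[OF w(1)] r[of "un + ?w"] w by (simp add: add_mem un_mem)
  qed
  show ?thesis
  proof (rule complex_eqI)
    show "Im (\<tau> (st x)) = Im (cnj (\<tau> x))"
      using g[of 1] x by (simp add: sc_one)
    show "Re (\<tau> (st x)) = Re (cnj (\<tau> x))"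
      using g[of \<i>] x by (simp add: tr_sc st_sc st_mem)
  qed
qed

lemma ip_commute: "x \<in> K \<Longrightarrow> y \<in> K \<Longrightarrow> ip y x = cnj (ip x y)"
  unfolding ip_def using tr_st[of "st x \<cdot> y"] by (simp add: mul_mem st_mem st_mul st_st)

lemma ip_add_right: "x \<in> K \<Longrightarrow> y \<in> K \<Longrightarrow> z \<in> K \<Longrightarrow> ip x (y + z) = ip x y + ip x z"
  by (simp add: ip_def mul_add_right st_mem tr_add mul_mem)
lemma ip_add_left: "x \<in> K \<Longrightarrow> y \<in> K \<Longrightarrow> z \<in> K \<Longrightarrow> ip (x + y) z = ip x z + ip y z"
  by (simp add: ip_def mul_add_left st_add st_mem tr_add mul_mem)
lemma ip_diff_right: "x \<in> K \<Longrightarrow> y \<in> K \<Longrightarrow> z \<in> K \<Longrightarrow> ip x (y - z) = ip x y - ip x z"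
  by (simp add: ip_def mul_diff_right st_mem tr_diff mul_mem)
lemma ip_diff_left: "x \<in> K \<Longrightarrow> y \<in> K \<Longrightarrow> z \<in> K \<Longrightarrow> ip (x - y) z = ip x z - ip y z"
  by (simp add: ip_def mul_diff_left st_diff st_mem tr_diff mul_mem)
lemma ip_sc_right: "x \<in> K \<Longrightarrow> y \<in> K \<Longrightarrow> ip x (sc c y) = c * ip x y"
  by (simp add: ip_def mul_sc_right st_mem tr_sc mul_mem)
lemma ip_sc_left: "x \<in> K \<Longrightarrow> y \<in> K \<Longrightarrow> ip (sc c x) y = cnj c * ip x y"
  by (simp add: ip_def mul_sc_left st_sc st_mem tr_sc mul_mem)
lemma ip_sum_right: "x \<in> K \<Longrightarrow> (\<And>i. i \<in> F \<Longrightarrow> f i \<in> K) \<Longrightarrow> ip x (sum f F) = (\<Sum>i\<in>F. ip x (f i))"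
proof (induction F rule: infinite_finite_induct)
  case empty
  then show ?case using ip_sc_right[of x x 0] by (simp add: sc_zero)
next
  case (insert i F)
  then show ?case by (simp add: ip_add_right sum_mem)
qed (use ip_sc_right[of x x 0] in \<open>simp add: sc_zero\<close>)
lemma ip_sum_left: "x \<in> K \<Longrightarrow> (\<And>i. i \<in> F \<Longrightarrow> f i \<in> K) \<Longrightarrow> ip (sum f F) x = (\<Sum>i\<in>F. ip (f i) x)"
  using ip_sum_right[of x F f] by (simp add: ip_commute[of x] sum_mem cong: sum.cong)

lemma Re_ip_self: "x \<in> K \<Longrightarrow> 0 \<le> Re (ip x x)"
  using tr_pos by (simp add: ip_def)

lemma n2_nonneg [simp]: "x \<in> K \<Longrightarrow> 0 \<le> n2 x" by (simp add: n2_def Re_ip_self)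

lemma n2_sq: "x \<in> K \<Longrightarrow> (n2 x)\<^sup>2 = Re (ip x x)" by (simp add: n2_def Re_ip_self)

lemma ip_self: "x \<in> K \<Longrightarrow> ip x x = complex_of_real ((n2 x)\<^sup>2)"
  using tr_pos[of x] by (auto simp: n2_sq complex_is_Real_iff ip_def intro!: complex_eqI)

lemma Cauchy_Schwarz:
  assumes x: "x \<in> K" and y: "y \<in> K"
  shows "cmod (ip x y) \<le> n2 x * n2 y"
proof -
  define c where "c = ip x y"
  define C where "C = (cmod c)\<^sup>2"
  have q: "0 \<le> (n2 x)\<^sup>2 - 2 * s * C + s\<^sup>2 * C * (n2 y)\<^sup>2" for s :: real
  proof -
    \<comment> \<open>With this scalar the cross terms of
      \<open>ip (x + sc z y) (x + sc z y)\<close> add up to -2 s |c|^2, which leaves a real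
      quadratic in \<open>s\<close>.\<close>
    define z where "z = - complex_of_real s * cnj c"
    have m: "sc z y \<in> K" "x + sc z y \<in> K" using x y by (auto intro: sc_mem add_mem)
    have cc: "c * cnj c = complex_of_real C" unfolding C_def by (rule complex_norm_square[symmetric])
    have "ip (x + sc z y) (x + sc z y) = ip x x + z * c + cnj z * cnj c + cnj z * z * ip y y"
      using x y m by (simp add: ip_add_left ip_add_right ip_sc_left ip_sc_right ip_commute[of x y] c_def algebra_simps)
    also have "\<dots> = ip x x - 2 * of_real s * (c * cnj c) + of_real (s\<^sup>2) * (c * cnj c) * ip y y"
      by (simp add: z_def power2_eq_square algebra_simps)
    also have "\<dots> = complex_of_real ((n2 x)\<^sup>2 - 2 * s * C + s\<^sup>2 * C * (n2 y)\<^sup>2)"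
      unfolding cc ip_self[OF x] ip_self[OF y] by simp
    finally have "Re (ip (x + sc z y) (x + sc z y)) = (n2 x)\<^sup>2 - 2 * s * C + s\<^sup>2 * C * (n2 y)\<^sup>2" by simp
    then show ?thesis using Re_ip_self[OF m(2)] by simp
  qed
  have "C \<le> (n2 x * n2 y)\<^sup>2"
  proof (cases "n2 y = 0")
    \<comment> \<open>The trace may be degenerate: if \<open>n2 y\<close> vanishes, the quadratic is
      only linear in \<open>s\<close>, and large \<open>s\<close> forces
      \<open>C = 0\<close>.\<close>
    case True
    then have "2 * s * C \<le> (n2 x)\<^sup>2" for s using q[of s] by simp
    from this[of "((n2 x)\<^sup>2 + 1) / (2 * C)"] have "C = 0" by (cases "C = 0") auto
    then show ?thesis by simp
  next
    case False
    then have p: "(n2 y)\<^sup>2 > 0" by simp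
    have "0 \<le> (n2 x)\<^sup>2 - C / (n2 y)\<^sup>2"
      using q[of "1 / (n2 y)\<^sup>2"] p by (simp add: power2_eq_square divide_simps split: if_splits)
    then have "C \<le> (n2 x)\<^sup>2 * (n2 y)\<^sup>2" using p by (simp add: field_simps)
    then show ?thesis by (simp add: power_mult_distrib)
  qed
  then show ?thesis unfolding C_def c_def
    by (rule power2_le_imp_le) (simp add: x y)
qed

lemma n2_triangle:
  assumes x: "x \<in> K" and y: "y \<in> K" shows "n2 (x + y) \<le> n2 x + n2 y"
proof (rule power2_le_imp_le)
  have "(n2 (x + y))\<^sup>2 = (n2 x)\<^sup>2 + 2 * Re (ip x y) + (n2 y)\<^sup>2"
    using x y by (simp add: n2_sq add_mem ip_add_left ip_add_right ip_commute[of x y])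
  also have "Re (ip x y) \<le> n2 x * n2 y"
    using Cauchy_Schwarz[OF x y] complex_Re_le_cmod order_trans by blast
  finally show "(n2 (x + y))\<^sup>2 \<le> (n2 x + n2 y)\<^sup>2" by (simp add: power2_sum)
qed (simp add: x y)

lemma n2_sc: "x \<in> K \<Longrightarrow> n2 (sc c x) = cmod c * n2 x"
proof -
  assume x: "x \<in> K"
  have "ip (sc c x) (sc c x) = complex_of_real ((cmod c)\<^sup>2) * ip x x"
    unfolding complex_norm_square using x by (simp add: ip_sc_left ip_sc_right sc_mem)
  then show ?thesis by (simp add: n2_def real_sqrt_mult)
qed

lemma n2_minus: "x \<in> K \<Longrightarrow> n2 (- x) = n2 x"
  using n2_sc[of x "-1"] by (simp add: sc_minus_one)

lemma n2_commute: "x \<in> K \<Longrightarrow> y \<in> K \<Longrightarrow> n2 (x - y) = n2 (y - x)"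
  using n2_minus[of "x - y"] by (simp add: diff_mem)

lemma n2_zero [simp]: "n2 0 = 0"
  using n2_sc[OF un_mem, of 0] by (simp add: sc_zero un_mem)

lemma n2_un [simp]: "n2 un = 1"
  by (simp add: n2_def ip_def st_un un_mul un_mem tr_un)

lemma n2_st: "x \<in> K \<Longrightarrow> n2 (st x) = n2 x"
  unfolding n2_def ip_def by (simp add: st_st st_mem tr_comm)

lemma n2_diff_triangle:
  "x \<in> K \<Longrightarrow> y \<in> K \<Longrightarrow> z \<in> K \<Longrightarrow> n2 (x - z) \<le> n2 (x - y) + n2 (y - z)"
  using n2_triangle[of "x - y" "y - z"] by (simp add: diff_mem)

lemma n2_diff_le: "x \<in> K \<Longrightarrow> y \<in> K \<Longrightarrow> n2 x \<le> n2 y + n2 (x - y)"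
  using n2_triangle[of y "x - y"] by (simp add: diff_mem)

lemma n2_diff2: "x \<in> K \<Longrightarrow> y \<in> K \<Longrightarrow> x' \<in> K \<Longrightarrow> y' \<in> K \<Longrightarrow> n2 ((x + y) - (x' + y')) \<le> n2 (x - x') + n2 (y - y')"
  using n2_triangle[of "x - x'" "y - y'"] by (simp add: diff_mem algebra_simps)

lemma cmod_tr_le: "x \<in> K \<Longrightarrow> cmod (\<tau> x) \<le> n2 x"
  using Cauchy_Schwarz[of un x] by (simp add: ip_def st_un un_mul un_mem)

end

section \<open>Closures of \<open>*\<close>-subalgebras in the 2-norm\<close>

lemma tracial_star_subset:
  assumes "tracial_star K mul sc st un \<tau>" and "K0 \<subseteq> K"
    and "\<And>x y. x \<in> K0 \<Longrightarrow> y \<in> K0 \<Longrightarrow> x + y \<in> K0" and "\<And>x y. x \<in> K0 \<Longrightarrow> y \<in> K0 \<Longrightarrow> mul x y \<in> K0"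
    and "\<And>x c. x \<in> K0 \<Longrightarrow> sc c x \<in> K0" and "\<And>x. x \<in> K0 \<Longrightarrow> st x \<in> K0" and "un \<in> K0"
  shows "tracial_star K0 mul sc st un \<tau>"
proof -
  interpret tracial_star K mul sc st un \<tau> by fact
  have s: "x \<in> K" if "x \<in> K0" for x using that assms(2) by blast
  show ?thesis
    by unfold_locales
      (auto simp: assms(3-) s mul_assoc mul_add_left mul_add_right mul_sc_left mul_sc_right un_mul mul_un
        st_add st_mul st_sc st_st sc_add_right sc_add_left sc_sc sc_one tr_add tr_sc tr_un
        dest!: s intro: tr_comm tr_pos[THEN conjunct1] tr_pos[THEN conjunct2])
qed

context tracial_star
begin

definition closure2 :: "'a set \<Rightarrow> 'a set" where
  "closure2 W = {x \<in> K. \<forall>\<epsilon>>0. \<exists>w\<in>W. n2 (x - w) < \<epsilon>}"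

context
  fixes W :: "'a set"
  assumes W: "W \<subseteq> K"
    and W_add: "\<And>x y. x \<in> W \<Longrightarrow> y \<in> W \<Longrightarrow> x + y \<in> W"
    and W_mul: "\<And>x y. x \<in> W \<Longrightarrow> y \<in> W \<Longrightarrow> x \<cdot> y \<in> W"
    and W_st: "\<And>x. x \<in> W \<Longrightarrow> st x \<in> W"
    and lb: "\<And>x. x \<in> K \<Longrightarrow> \<exists>C. \<forall>y\<in>K. n2 (x \<cdot> y) \<le> C * n2 y"
begin

lemma closure2_mem: "x \<in> closure2 W \<Longrightarrow> x \<in> K" by (simp add: closure2_def)
lemma closure2_approx: "x \<in> closure2 W \<Longrightarrow> \<epsilon> > 0 \<Longrightarrow> \<exists>w\<in>W. n2 (x - w) < \<epsilon>" by (simp add: closure2_def)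

lemma subset_closure2: "w \<in> W \<Longrightarrow> w \<in> closure2 W"
  using W by (auto simp: closure2_def intro!: bexI[of _ w])

lemma closure2_add:
  assumes "x \<in> closure2 W" "y \<in> closure2 W" shows "x + y \<in> closure2 W"
  unfolding closure2_def
proof (intro CollectI conjI allI impI)
  show "x + y \<in> K" using assms by (intro add_mem closure2_mem)
  fix \<epsilon> :: real assume "\<epsilon> > 0"
  then have e: "\<epsilon> / 2 > 0" by simp
  obtain v w where v: "v \<in> W" "n2 (x - v) < \<epsilon> / 2" and w: "w \<in> W" "n2 (y - w) < \<epsilon> / 2"
    using closure2_approx[OF assms(1) e] closure2_approx[OF assms(2) e] by blast
  have "n2 ((x + y) - (v + w)) \<le> n2 (x - v) + n2 (y - w)"
    using v(1) w(1) W assms by (intro n2_diff2) (auto dest: closure2_mem)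
  then show "\<exists>w\<in>W. n2 (x + y - w) < \<epsilon>" using v w by (intro bexI[of _ "v + w"] W_add) auto
qed

lemma closure2_st:
  assumes "x \<in> closure2 W" shows "st x \<in> closure2 W"
  unfolding closure2_def
proof (intro CollectI conjI allI impI)
  show "st x \<in> K" using assms by (intro st_mem closure2_mem)
  fix \<epsilon> :: real assume "\<epsilon> > 0"
  then obtain v where v: "v \<in> W" "n2 (x - v) < \<epsilon>" using closure2_approx[OF assms] by blast
  have vK: "v \<in> K" using v W by blast
  have "n2 (st x - st v) = n2 (x - v)"
    using n2_st[OF diff_mem[OF closure2_mem[OF assms] vK]] by (simp add: st_diff closure2_mem[OF assms] vK)
  then show "\<exists>w\<in>W. n2 (st x - w) < \<epsilon>" using v by (intro bexI[of _ "st v"] W_st) auto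
qed

text \<open>Adjoints turn right multiplication into left multiplication without changing the 2-norm.
  The constant is made positive so that one can divide by it.\<close>

lemma right_bounded:
  assumes x: "x \<in> K" shows "\<exists>C>0. \<forall>y\<in>K. n2 (y \<cdot> x) \<le> C * n2 y"
proof -
  obtain C where C: "\<And>y. y \<in> K \<Longrightarrow> n2 (st x \<cdot> y) \<le> C * n2 y" using lb[OF st_mem[OF x]] by blast
  have "n2 (y \<cdot> x) \<le> (\<bar>C\<bar> + 1) * n2 y" if y: "y \<in> K" for y
  proof -
    have "n2 (y \<cdot> x) \<le> C * n2 y"
      using C[OF st_mem[OF y]] n2_st[OF mul_mem[OF y x]] n2_st[OF y] by (simp add: st_mul x y)
    also have "\<dots> \<le> (\<bar>C\<bar> + 1) * n2 y" using y by (intro mult_right_mono) auto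
    finally show ?thesis .
  qed
  then show ?thesis by (intro exI[of _ "\<bar>C\<bar> + 1"]) auto
qed

text \<open>The order of choices matters: \<open>w\<close> is fitted to \<open>y\<close> against the
  left bound of \<open>x\<close>, and only then \<open>v\<close> to \<open>x\<close>, against the
  right bound of the chosen \<open>w\<close>.\<close>

lemma closure2_mul:
  assumes x: "x \<in> closure2 W" and y: "y \<in> closure2 W" shows "x \<cdot> y \<in> closure2 W"
  unfolding closure2_def
proof (intro CollectI conjI allI impI)
  note xK = closure2_mem[OF x] and yK = closure2_mem[OF y]
  show "x \<cdot> y \<in> K" using xK yK by (rule mul_mem)
  fix \<epsilon> :: real assume \<epsilon>: "\<epsilon> > 0"
  obtain C0 where C0: "\<And>z. z \<in> K \<Longrightarrow> n2 (x \<cdot> z) \<le> C0 * n2 z" using lb[OF xK] by blast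
  define C where "C = \<bar>C0\<bar> + 1"
  have C: "C > 0" by (simp add: C_def)
  obtain w where w: "w \<in> W" "n2 (y - w) < \<epsilon> / (2 * C)"
    using closure2_approx[OF y, of "\<epsilon> / (2 * C)"] \<epsilon> C by auto
  have wK: "w \<in> K" using w W by blast
  obtain D where D: "D > 0" "\<And>z. z \<in> K \<Longrightarrow> n2 (z \<cdot> w) \<le> D * n2 z" using right_bounded[OF wK] by blast
  obtain v where v: "v \<in> W" "n2 (x - v) < \<epsilon> / (2 * D)"
    using closure2_approx[OF x, of "\<epsilon> / (2 * D)"] \<epsilon> D(1) by auto
  have vK: "v \<in> K" using v W by blast
  have eq: "x \<cdot> y - v \<cdot> w = x \<cdot> (y - w) + (x - v) \<cdot> w"
    using xK yK vK wK by (simp add: mul_diff_right mul_diff_left)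
  have "n2 (x \<cdot> y - v \<cdot> w) \<le> n2 (x \<cdot> (y - w)) + n2 ((x - v) \<cdot> w)"
    unfolding eq using xK yK vK wK by (intro n2_triangle mul_mem diff_mem)
  also have "\<dots> \<le> C * n2 (y - w) + D * n2 (x - v)"
  proof (rule add_mono)
    have "n2 (x \<cdot> (y - w)) \<le> C0 * n2 (y - w)" using yK wK by (intro C0 diff_mem)
    also have "\<dots> \<le> C * n2 (y - w)" using yK wK by (intro mult_right_mono) (auto simp: C_def diff_mem)
    finally show "n2 (x \<cdot> (y - w)) \<le> C * n2 (y - w)" .
    show "n2 ((x - v) \<cdot> w) \<le> D * n2 (x - v)" using xK vK by (intro D diff_mem)
  qed
  also have "\<dots> < \<epsilon> / 2 + \<epsilon> / 2"
    using w(2) v(2) C D(1) by (intro add_strict_mono) (simp_all add: field_simps)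
  finally show "\<exists>w\<in>W. n2 (x \<cdot> y - w) < \<epsilon>" using v w by (intro bexI[of _ "v \<cdot> w"] W_mul) auto
qed

end

end

section \<open>Tracial von Neumann algebras\<close>

lemma operator_alg_simps:
  assumes "tracial_vna N"
  shows "mult N = (o\<^sub>L)" "one N = id_blinfun" "zero N = 0" "add N = (+)" "smult N = op_scale"
    "star N = op_adjoint"
proof -
  have N: "N = operator_alg (carrier N) (tr N)" using assms by (simp add: tracial_vna_def)
  show "mult N = (o\<^sub>L)" "one N = id_blinfun" "zero N = 0" "add N = (+)" "smult N = op_scale"
    "star N = op_adjoint"
    by (subst N, simp add: operator_alg_def)+
qed

lemma tracial_vna_vna: "tracial_vna N \<Longrightarrow> von_neumann_algebra (carrier N)"
  by (simp add: tracial_vna_def)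

lemma tracial_vna_star:
  assumes N: "tracial_vna N"
  shows "tracial_star (carrier N) (o\<^sub>L) op_scale op_adjoint id_blinfun (tr N)"
proof -
  note v = tracial_vna_vna[OF N]
  note b = vna_bounded[OF v]
  show ?thesis
    apply unfold_locales
    using N
    by (auto simp: vna_add[OF v] vna_compose[OF v] vna_scale[OF v] vna_adjoint[OF v] vna_id[OF v]
      blinfun_compose_assoc blinfun_compose_add_left' blinfun_compose_add_right' op_scale_compose_left
      op_scale_compose_right b op_adjoint_add op_adjoint_compose op_adjoint_op_scale op_adjoint_adjoint
      op_scale_add_right op_scale_add_left op_scale_scale tracial_vna_def)
qed

lemma norm2_eq_n2:
  assumes N: "tracial_vna N"
  shows "norm2 N = tracial_star.n2 (o\<^sub>L) op_adjoint (tr N)"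
proof
  interpret tracial_star "carrier N" "(o\<^sub>L)" op_scale op_adjoint id_blinfun "tr N"
    by (rule tracial_vna_star[OF N])
  show "norm2 N x = tracial_star.n2 (o\<^sub>L) op_adjoint (tr N) x" for x
    by (simp add: norm2_def n2_def ip_def operator_alg_simps[OF N])
qed

context
  fixes N :: "'i op tracial_alg"
  assumes N: "tracial_vna N"
begin

interpretation N: tracial_star "carrier N" "(o\<^sub>L)" op_scale op_adjoint id_blinfun "tr N"
  rewrites "N.n2 = norm2 N"
  by (rule tracial_vna_star[OF N]) (simp add: norm2_eq_n2[OF N])

lemmas norm2_triangle = N.n2_triangle
  and norm2_nonneg = N.n2_nonneg
  and norm2_scale = N.n2_sc
  and norm2_commute = N.n2_commute
  and norm2_adjoint = N.n2_st
  and norm2_diff_triangle = N.n2_diff_triangle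
  and norm2_diff_le = N.n2_diff_le
  and norm2_diff2 = N.n2_diff2
  and norm2_zero = N.n2_zero
  and norm2_minus = N.n2_minus
  and cmod_tr_le_norm2 = N.cmod_tr_le
  and tracial_diff_mem = N.diff_mem
  and tracial_zero_mem = N.zero_mem
  and tracial_add_mem = N.add_mem
  and tracial_mul_mem = N.mul_mem
  and tracial_scale_mem = N.sc_mem
  and tracial_adjoint_mem = N.st_mem
  and tracial_id_mem = N.un_mem
  and tracial_adjoint_diff = N.st_diff
  and tracial_tr_diff = N.tr_diff
  and tracial_tr_add = N.tr_add
  and tracial_tr_scale = N.tr_sc
  and tracial_tr_adjoint = N.tr_st

lemma tracial_bounded: "T \<in> carrier N \<Longrightarrow> T \<in> bounded_ops"
  by (rule vna_bounded[OF tracial_vna_vna[OF N]])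

lemma norm2_sq: "T \<in> carrier N \<Longrightarrow> tr N (op_adjoint T o\<^sub>L T) = complex_of_real ((norm2 N T)\<^sup>2)"
  using N.ip_self[of T] by (simp add: N.ip_def)

lemma norm2_eq_0: "T \<in> carrier N \<Longrightarrow> norm2 N T = 0 \<Longrightarrow> T = 0"
  using N norm2_sq[of T] by (simp add: tracial_vna_def)

text \<open>An algebraic certificate for \<open>norm S < 1\<close>: the complement is a square in
  the same algebra. It can be multiplied, traced and transported by embeddings.\<close>

lemma contraction_square_complement:
  assumes S: "S \<in> carrier N" "norm S < 1"
  shows "\<exists>y\<in>carrier N. op_adjoint y o\<^sub>L y = id_blinfun - (op_adjoint S o\<^sub>L S)"
proof -
  note v = tracial_vna_vna[OF N]
  define t where "t = op_adjoint S o\<^sub>L S"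
  have b: "S \<in> bounded_ops" "op_adjoint S \<in> bounded_ops"
    using S tracial_bounded bounded_ops_adjoint by auto
  have "norm t \<le> norm S * norm S"
    unfolding t_def using norm_compose[of "op_adjoint S" S] norm_op_adjoint[OF b(1)] by simp
  also have "\<dots> < 1" using S(2) mult_strict_mono[of "norm S" 1 "norm S" 1] by simp
  finally have "norm t < 1" .
  moreover have "self_adj t"
    unfolding t_def using b by (subst self_adj_iff) (auto simp: bounded_ops_compose op_adjoint_compose op_adjoint_adjoint)
  ultimately obtain y where y: "y \<in> carrier N" "self_adj y" "y o\<^sub>L y = id_blinfun - t"
    using closed_alg_sqrt[OF closed_alg_vna[OF v], of t] S by (auto simp: t_def vna_compose[OF v] vna_adjoint[OF v])
  then show ?thesis by (intro bexI[of _ y]) (auto simp: self_adjD t_def)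
qed

text \<open>For \<open>norm S < 1\<close> the certificate gives |S T|^2 = |T|^2 - |y T|^2 in the
  2-norm. A general \<open>S\<close> is divided by any \<open>r\<close> above its norm, and
  \<open>r\<close> then decreases to it.\<close>

lemma norm2_mult_left:
  assumes S: "S \<in> carrier N" and T: "T \<in> carrier N"
  shows "norm2 N (S o\<^sub>L T) \<le> norm S * norm2 N T"
proof -
  have *: "norm2 N (S o\<^sub>L T) \<le> norm2 N T" if S: "S \<in> carrier N" "norm S < 1" for S
  proof -
    obtain y where y: "y \<in> carrier N" "op_adjoint y o\<^sub>L y = id_blinfun - (op_adjoint S o\<^sub>L S)"
      using contraction_square_complement[OF S] by blast
    have sq: "(norm2 N (A o\<^sub>L T))\<^sup>2 = Re (tr N (op_adjoint T o\<^sub>L (op_adjoint A o\<^sub>L A) o\<^sub>L T))" if "A \<in> carrier N" for A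
      using norm2_sq[of "A o\<^sub>L T"] that T
      by (simp add: N.mul_mem op_adjoint_compose tracial_bounded blinfun_compose_assoc)
    have "op_adjoint T o\<^sub>L (op_adjoint y o\<^sub>L y) o\<^sub>L T
        = (op_adjoint T o\<^sub>L T) - (op_adjoint T o\<^sub>L (op_adjoint S o\<^sub>L S) o\<^sub>L T)"
      by (simp add: y(2) blinfun_alg)
    then have "(norm2 N (y o\<^sub>L T))\<^sup>2 = (norm2 N T)\<^sup>2 - (norm2 N (S o\<^sub>L T))\<^sup>2"
      unfolding sq[OF y(1)] sq[OF S(1)]
      using norm2_sq[OF T] S T by (simp add: N.tr_diff N.mul_mem N.st_mem)
    then have "(norm2 N (S o\<^sub>L T))\<^sup>2 \<le> (norm2 N T)\<^sup>2"
      by (smt (verit) zero_le_power2)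
    then show ?thesis by (rule power2_le_imp_le) (simp add: T)
  qed
  have **: "norm2 N (S o\<^sub>L T) \<le> r * norm2 N T" if r: "norm S < r" for r
  proof -
    have r0: "0 < r" using r norm_ge_zero[of S] by linarith
    define S' where "S' = op_scale (complex_of_real (1 / r)) S"
    have "norm S' < 1" using r r0 by (simp add: S'_def op_scale_of_real divide_simps del: of_real_divide)
    then have "norm2 N (S' o\<^sub>L T) \<le> norm2 N T" using * S by (simp add: S'_def N.sc_mem)
    moreover have "norm2 N (S' o\<^sub>L T) = (1 / r) * norm2 N (S o\<^sub>L T)"
      unfolding S'_def op_scale_compose_left using S T r0 by (subst N.n2_sc) (auto simp: N.mul_mem norm_divide)
    ultimately show ?thesis using r0 by (simp add: field_simps)
  qed
  show ?thesis
  proof (cases "norm2 N T = 0")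
    case True
    then show ?thesis using **[of "norm S + 1"] by simp
  next
    case False
    then have p: "norm2 N T > 0" using T by (simp add: order_less_le)
    have "norm2 N (S o\<^sub>L T) / norm2 N T \<le> norm S"
      by (rule dense_ge) (use ** p in \<open>auto simp: divide_simps\<close>)
    then show ?thesis using p by (simp add: field_simps)
  qed
qed

lemma norm2_mult_right:
  assumes S: "S \<in> carrier N" and T: "T \<in> carrier N"
  shows "norm2 N (S o\<^sub>L T) \<le> norm2 N S * norm T"
proof -
  have "norm2 N (S o\<^sub>L T) = norm2 N (op_adjoint T o\<^sub>L op_adjoint S)"
    using N.n2_st[of "S o\<^sub>L T"] S T by (simp add: N.mul_mem N.st_mul)
  also have "\<dots> \<le> norm (op_adjoint T) * norm2 N (op_adjoint S)"
    using S T by (intro norm2_mult_left N.st_mem)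
  also have "\<dots> = norm2 N S * norm T"
    using S T by (simp add: norm_op_adjoint tracial_bounded N.n2_st)
  finally show ?thesis .
qed

lemma norm2_le_norm: "T \<in> carrier N \<Longrightarrow> norm2 N T \<le> norm T"
  using norm2_mult_left[of T id_blinfun] by (simp add: N.un_mem)

lemma norm2_diff_mult:
  assumes "S \<in> carrier N" "T \<in> carrier N" "S' \<in> carrier N" "T' \<in> carrier N"
  shows "norm2 N ((S o\<^sub>L T) - (S' o\<^sub>L T')) \<le> norm S * norm2 N (T - T') + norm2 N (S - S') * norm T'"
proof -
  have "(S o\<^sub>L T) - (S' o\<^sub>L T') = (S o\<^sub>L (T - T')) + ((S - S') o\<^sub>L T')" by (simp add: blinfun_alg)
  also have "norm2 N \<dots> \<le> norm2 N (S o\<^sub>L (T - T')) + norm2 N ((S - S') o\<^sub>L T')"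
    using assms by (intro N.n2_triangle N.mul_mem N.diff_mem)
  also have "\<dots> \<le> norm S * norm2 N (T - T') + norm2 N (S - S') * norm T'"
    using assms by (intro add_mono norm2_mult_left norm2_mult_right N.diff_mem)
  finally show ?thesis .
qed

end

section \<open>Embeddings\<close>

context
  fixes M :: "'i op tracial_alg" and N :: "'j op tracial_alg" and h
  assumes M: "tracial_vna M" and N: "tracial_vna N" and h: "embedding h M N"
begin

lemma
  shows embedding_mem: "x \<in> carrier M \<Longrightarrow> h x \<in> carrier N"
    and embedding_mult: "x \<in> carrier M \<Longrightarrow> y \<in> carrier M \<Longrightarrow> h (x o\<^sub>L y) = h x o\<^sub>L h y"
    and embedding_add: "x \<in> carrier M \<Longrightarrow> y \<in> carrier M \<Longrightarrow> h (x + y) = h x + h y"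
    and embedding_one: "h id_blinfun = id_blinfun"
    and embedding_scale: "x \<in> carrier M \<Longrightarrow> h (op_scale c x) = op_scale c (h x)"
    and embedding_adjoint: "x \<in> carrier M \<Longrightarrow> h (op_adjoint x) = op_adjoint (h x)"
    and embedding_tr: "x \<in> carrier M \<Longrightarrow> tr N (h x) = tr M x"
  using h by (auto simp: embedding_def ring_hom_def operator_alg_simps[OF M] operator_alg_simps[OF N])

lemma embedding_diff:
  assumes "x \<in> carrier M" "y \<in> carrier M" shows "h (x - y) = h x - h y"
proof -
  have "h (x + op_scale (-1) y) = h x + op_scale (-1) (h y)"
    using assms by (simp add: embedding_add embedding_scale tracial_scale_mem[OF M])
  then show ?thesis by (simp add: op_scale_minus_one)
qed

lemma embedding_norm2: "x \<in> carrier M \<Longrightarrow> norm2 N (h x) = norm2 M x"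
  by (simp add: norm2_def operator_alg_simps[OF M] operator_alg_simps[OF N] tracial_adjoint_mem[OF M]
      tracial_mul_mem[OF M] flip: embedding_mult embedding_adjoint embedding_tr)

text \<open>An embedding carries the identity y* y = 1 - x* x to the same identity for the images,
  and this already says that the image of \<open>x\<close> is a contraction.\<close>

lemma embedding_norm_le:
  assumes x: "x \<in> carrier M" shows "norm (h x) \<le> norm x"
proof -
  have *: "norm (h x) \<le> 1" if x: "x \<in> carrier M" "norm x < 1" for x
  proof (rule norm_blinfun_bound)
    obtain y where y: "y \<in> carrier M" "op_adjoint y o\<^sub>L y = id_blinfun - (op_adjoint x o\<^sub>L x)"
      using contraction_square_complement[OF M x] by blast
    have sq: "(norm (blinfun_apply (h z) v))\<^sup>2 = Re (cinner v (blinfun_apply (op_adjoint (h z) o\<^sub>L h z) v))"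
      if "z \<in> carrier M" for z v
      using tracial_bounded[OF N embedding_mem[OF that]]
      by (simp add: op_adjoint_right cinner_self del: of_real_power)
    fix v
    have "op_adjoint (h y) o\<^sub>L h y = id_blinfun - (op_adjoint (h x) o\<^sub>L h x)"
      using arg_cong[OF y(2), of h] x(1) y(1)
      by (simp add: embedding_diff embedding_mult embedding_adjoint embedding_one tracial_adjoint_mem[OF M]
        tracial_mul_mem[OF M] tracial_id_mem[OF M])
    then have "(norm (blinfun_apply (h y) v))\<^sup>2 = (norm v)\<^sup>2 - (norm (blinfun_apply (h x) v))\<^sup>2"
      unfolding sq[OF y(1)] sq[OF x(1)]
      by (simp add: blinfun.diff_left cinner.diff_right cinner_self del: of_real_power)
    then have "(norm (blinfun_apply (h x) v))\<^sup>2 \<le> (norm v)\<^sup>2"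
      by (smt (verit) zero_le_power2)
    then show "norm (blinfun_apply (h x) v) \<le> 1 * norm v" by (simp add: power2_le_iff_abs_le)
  qed simp
  have **: "norm (h x) \<le> r" if r: "norm x < r" for r
  proof -
    have r0: "0 < r" using r norm_ge_zero[of x] by linarith
    have "norm (op_scale (complex_of_real (1 / r)) x) < 1"
      using r r0 by (simp add: op_scale_of_real divide_simps del: of_real_divide)
    then have "norm (h (op_scale (complex_of_real (1 / r)) x)) \<le> 1"
      using * x by (simp add: tracial_scale_mem[OF M])
    then show ?thesis using r0
      unfolding embedding_scale[OF x] unfolding op_scale_of_real by (simp add: divide_simps split: if_splits)
  qed
  show ?thesis by (rule dense_ge) (rule **)
qed

end

lemma embedding_comp:
  assumes "embedding f M N" "embedding g N P"
  shows "embedding (g \<circ> f) M P"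
  using assms by (auto simp: embedding_def ring_hom_def Pi_iff)

section \<open>Evaluating \<open>*\<close>-polynomials\<close>

definition bounded_tuple ::
    "'i op tracial_alg \<Rightarrow> (nat \<Rightarrow> real) \<Rightarrow> (nat \<Rightarrow> real) \<Rightarrow> (nat \<Rightarrow> 'i op) \<Rightarrow> (nat \<Rightarrow> 'i op) \<Rightarrow> bool" where
  "bounded_tuple N r r' c a \<longleftrightarrow> c \<in> assignments N r \<and> a \<in> assignments N r'"

lemma bounded_tupleI:
  assumes "\<And>k. c k \<in> carrier N" "\<And>k. a k \<in> carrier N"
  shows "bounded_tuple N (\<lambda>k. norm (c k)) (\<lambda>k. norm (a k)) c a"
  using assms by (simp add: bounded_tuple_def assignments_def)

text \<open>Depends on the radii and on no algebra or tuple: this is what lets one polynomial,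
  chosen in one algebra, be controlled in all others.\<close>

primrec pbound :: "(nat \<Rightarrow> real) \<Rightarrow> (nat \<Rightarrow> real) \<Rightarrow> star_poly \<Rightarrow> real" where
  "pbound r r' (XVar k) = r k"
| "pbound r r' (YVar k) = r' k"
| "pbound r r' Unit = 1"
| "pbound r r' (Plus p q) = pbound r r' p + pbound r r' q"
| "pbound r r' (Times p q) = pbound r r' p * pbound r r' q"
| "pbound r r' (Scale z p) = cmod z * pbound r r' p"
| "pbound r r' (Star p) = pbound r r' p"

primrec psubst :: "(nat \<Rightarrow> star_poly) \<Rightarrow> (nat \<Rightarrow> star_poly) \<Rightarrow> star_poly \<Rightarrow> star_poly" where
  "psubst f g (XVar k) = f k"
| "psubst f g (YVar k) = g k"
| "psubst f g Unit = Unit"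
| "psubst f g (Plus p q) = Plus (psubst f g p) (psubst f g q)"
| "psubst f g (Times p q) = Times (psubst f g p) (psubst f g q)"
| "psubst f g (Scale z p) = Scale z (psubst f g p)"
| "psubst f g (Star p) = Star (psubst f g p)"

lemma eval_psubst:
  "eval_poly N c a (psubst f g p) = eval_poly N (\<lambda>k. eval_poly N c a (f k)) (\<lambda>k. eval_poly N c a (g k)) p"
  by (induction p) auto

declare eval_poly.simps(3-) [simp del]

context
  fixes N :: "'i op tracial_alg"
  assumes N: "tracial_vna N"
begin

lemma eval_poly_op:
  "eval_poly N c a Unit = id_blinfun"
  "eval_poly N c a (Plus p q) = eval_poly N c a p + eval_poly N c a q"
  "eval_poly N c a (Times p q) = eval_poly N c a p o\<^sub>L eval_poly N c a q"
  "eval_poly N c a (Scale z p) = op_scale z (eval_poly N c a p)"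
  "eval_poly N c a (Star p) = op_adjoint (eval_poly N c a p)"
  by (simp_all add: operator_alg_simps[OF N] eval_poly.simps)

lemma eval_poly_mem:
  "(\<And>k. c k \<in> carrier N) \<Longrightarrow> (\<And>k. a k \<in> carrier N) \<Longrightarrow> eval_poly N c a p \<in> carrier N"
  by (induction p) (auto simp: eval_poly_op operator_alg_simps[OF N] tracial_add_mem[OF N] tracial_mul_mem[OF N]
      tracial_scale_mem[OF N] tracial_adjoint_mem[OF N] tracial_id_mem[OF N])

lemma bounded_tuple_eval_mem: "bounded_tuple N r r' c a \<Longrightarrow> eval_poly N c a p \<in> carrier N"
  by (rule eval_poly_mem) (auto simp: bounded_tuple_def assignments_def)

lemma norm_eval_poly_le: "bounded_tuple N r r' c a \<Longrightarrow> norm (eval_poly N c a p) \<le> pbound r r' p"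
proof (induction p)
  case (Plus p q)
  then show ?case unfolding eval_poly_op pbound.simps
    by (intro order_trans[OF norm_triangle_ineq] add_mono) auto
next
  case (Times p q)
  have "0 \<le> pbound r r' p" using Times norm_ge_zero order_trans by blast
  then show ?case unfolding eval_poly_op pbound.simps
    using Times by (intro order_trans[OF norm_compose] mult_mono) auto
next
  case (Scale z p)
  then show ?case unfolding eval_poly_op pbound.simps
    by (intro order_trans[OF norm_op_scale] mult_left_mono) auto
next
  case (Star p)
  then show ?case unfolding eval_poly_op pbound.simps
    by (simp add: norm_op_adjoint tracial_bounded[OF N] bounded_tuple_eval_mem)
next
  case Unit
  show ?case unfolding eval_poly_op by (simp add: norm_blinfun_id_le)
qed (auto simp: bounded_tuple_def assignments_def)

end

lemma embedding_eval_poly: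
  assumes M: "tracial_vna M" and N: "tracial_vna N" and h: "embedding h M N"
    and c: "\<And>k. c k \<in> carrier M" "\<And>k. a k \<in> carrier M"
  shows "h (eval_poly M c a p) = eval_poly N (\<lambda>k. h (c k)) (\<lambda>k. h (a k)) p"
proof (induction p)
qed (simp_all add: eval_poly_op[OF M] eval_poly_op[OF N] eval_poly_mem[OF M c] embedding_one[OF M N h]
      embedding_add[OF M N h] embedding_mult[OF M N h] embedding_scale[OF M N h] embedding_adjoint[OF M N h])

subsection \<open>Rational coefficients\<close>

text \<open>Polynomials with coefficients in the Gaussian rationals. Being countable, they give
  dense sequences for GNS and an enumeration of the moments, of which only finitely many can be
  matched at a time.\<close>

datatype qpoly = QX nat | QY nat | QUnit | QPlus qpoly qpoly | QTimes qpoly qpoly | QScale "rat \<times> rat" qpoly | QStar qpoly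

instance qpoly :: countable by countable_datatype

definition rat_complex :: "rat \<times> rat \<Rightarrow> complex" where
  "rat_complex z = Complex (of_rat (fst z)) (of_rat (snd z))"

primrec of_qpoly :: "qpoly \<Rightarrow> star_poly" where
  "of_qpoly (QX k) = XVar k"
| "of_qpoly (QY k) = YVar k"
| "of_qpoly QUnit = Unit"
| "of_qpoly (QPlus p q) = Plus (of_qpoly p) (of_qpoly q)"
| "of_qpoly (QTimes p q) = Times (of_qpoly p) (of_qpoly q)"
| "of_qpoly (QScale z p) = Scale (rat_complex z) (of_qpoly p)"
| "of_qpoly (QStar p) = Star (of_qpoly p)"

primrec qround :: "(complex \<Rightarrow> rat \<times> rat) \<Rightarrow> star_poly \<Rightarrow> qpoly" where
  "qround \<rho> (XVar k) = QX k"
| "qround \<rho> (YVar k) = QY k"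
| "qround \<rho> Unit = QUnit"
| "qround \<rho> (Plus p q) = QPlus (qround \<rho> p) (qround \<rho> q)"
| "qround \<rho> (Times p q) = QTimes (qround \<rho> p) (qround \<rho> q)"
| "qround \<rho> (Scale z p) = QScale (\<rho> z) (qround \<rho> p)"
| "qround \<rho> (Star p) = QStar (qround \<rho> p)"

text \<open>Bounds the change in norm when every coefficient moves by at most \<eta>, over all
  tuples within the radii. In the product rule the second summand contains a bound for the already
  rounded right factor.\<close>

primrec round_err :: "(nat \<Rightarrow> real) \<Rightarrow> (nat \<Rightarrow> real) \<Rightarrow> real \<Rightarrow> star_poly \<Rightarrow> real" where
  "round_err r r' \<eta> (XVar k) = 0"
| "round_err r r' \<eta> (YVar k) = 0"
| "round_err r r' \<eta> Unit = 0"
| "round_err r r' \<eta> (Plus p q) = round_err r r' \<eta> p + round_err r r' \<eta> q"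
| "round_err r r' \<eta> (Times p q) = pbound r r' p * round_err r r' \<eta> q
     + round_err r r' \<eta> p * (pbound r r' q + round_err r r' \<eta> q)"
| "round_err r r' \<eta> (Scale z p) = cmod z * round_err r r' \<eta> p + \<eta> * (pbound r r' p + round_err r r' \<eta> p)"
| "round_err r r' \<eta> (Star p) = round_err r r' \<eta> p"

lemma round_err_tendsto: "((\<lambda>\<eta>. round_err r r' \<eta> p) \<longlongrightarrow> 0) (at_right 0)"
  by (induction p) (auto intro!: tendsto_eq_intros)

lemma rounding_exists:
  assumes "\<eta> > 0" shows "\<exists>\<rho>. \<forall>z. cmod (z - rat_complex (\<rho> z)) \<le> \<eta>"
proof -
  have "\<exists>q. cmod (z - rat_complex q) \<le> \<eta>" for z
  proof -
    obtain a where a: "Re z < of_rat a" "of_rat a < Re z + \<eta> / 2"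
      using of_rat_dense[of "Re z" "Re z + \<eta> / 2"] assms by auto
    obtain b where b: "Im z < of_rat b" "of_rat b < Im z + \<eta> / 2"
      using of_rat_dense[of "Im z" "Im z + \<eta> / 2"] assms by auto
    have "cmod (z - rat_complex (a, b)) \<le> \<bar>Re (z - rat_complex (a, b))\<bar> + \<bar>Im (z - rat_complex (a, b))\<bar>"
      by (rule cmod_le)
    also have "\<dots> \<le> \<eta>" using a b by (simp add: rat_complex_def)
    finally show ?thesis by blast
  qed
  then show ?thesis by metis
qed

lemma norm_eval_qround_le:
  assumes N: "tracial_vna N" and t: "bounded_tuple N r r' c a"
    and \<rho>: "\<And>z. cmod (z - rat_complex (\<rho> z)) \<le> \<eta>"
  shows "norm (eval_poly N c a p - eval_poly N c a (of_qpoly (qround \<rho> p))) \<le> round_err r r' \<eta> p"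
proof (induction p)
  case (Plus p q)
  let ?e = "\<lambda>p. eval_poly N c a p" and ?q = "\<lambda>p. eval_poly N c a (of_qpoly (qround \<rho> p))"
  have "?e (Plus p q) - ?q (Plus p q) = (?e p - ?q p) + (?e q - ?q q)"
    by (simp add: eval_poly_op[OF N])
  then show ?case using Plus norm_triangle_mono by (metis round_err.simps(4))
next
  case (Times p q)
  let ?e = "\<lambda>p. eval_poly N c a p" and ?q = "\<lambda>p. eval_poly N c a (of_qpoly (qround \<rho> p))"
  have nq: "norm (?q q) \<le> pbound r r' q + round_err r r' \<eta> q"
    using norm_triangle_ineq4[of "?e q" "?e q - ?q q"] norm_eval_poly_le[OF N t, of q] Times(2) by simp
  have "?e (Times p q) - ?q (Times p q) = (?e p o\<^sub>L (?e q - ?q q)) + ((?e p - ?q p) o\<^sub>L ?q q)"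
    by (simp add: eval_poly_op[OF N] blinfun_alg)
  then have "norm (?e (Times p q) - ?q (Times p q)) \<le> norm (?e p o\<^sub>L (?e q - ?q q)) + norm ((?e p - ?q p) o\<^sub>L ?q q)"
    by (metis norm_triangle_ineq)
  also have "\<dots> \<le> norm (?e p) * norm (?e q - ?q q) + norm (?e p - ?q p) * norm (?q q)"
    by (intro add_mono norm_compose)
  also have "\<dots> \<le> round_err r r' \<eta> (Times p q)"
    unfolding round_err.simps
    by (intro add_mono mult_mono[OF norm_eval_poly_le[OF N t] Times(2)] mult_mono[OF Times(1) nq] norm_ge_zero
        order_trans[OF norm_ge_zero norm_eval_poly_le[OF N t]] order_trans[OF norm_ge_zero Times(1)])
  finally show ?case .
next
  case (Scale z p)
  let ?e = "\<lambda>p. eval_poly N c a p" and ?q = "\<lambda>p. eval_poly N c a (of_qpoly (qround \<rho> p))"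
  have nq: "norm (?q p) \<le> pbound r r' p + round_err r r' \<eta> p"
    using norm_triangle_ineq4[of "?e p" "?e p - ?q p"] norm_eval_poly_le[OF N t, of p] Scale by simp
  have "?e (Scale z p) - ?q (Scale z p) = op_scale z (?e p - ?q p) + op_scale (z - rat_complex (\<rho> z)) (?q p)"
    using op_scale_add_right[of z "?e p - ?q p" "?q p"]
      op_scale_add_left[of "z - rat_complex (\<rho> z)" "rat_complex (\<rho> z)" "?q p"]
    by (simp add: eval_poly_op[OF N])
  then have "norm (?e (Scale z p) - ?q (Scale z p)) \<le> norm (op_scale z (?e p - ?q p)) + norm (op_scale (z - rat_complex (\<rho> z)) (?q p))"
    by (metis norm_triangle_ineq)
  also have "\<dots> \<le> cmod z * norm (?e p - ?q p) + cmod (z - rat_complex (\<rho> z)) * norm (?q p)"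
    by (intro add_mono norm_op_scale)
  also have "\<dots> \<le> round_err r r' \<eta> (Scale z p)"
    unfolding round_err.simps
    by (intro add_mono mult_mono[OF order_refl Scale] mult_mono[OF \<rho> nq] norm_ge_zero
        order_trans[OF norm_ge_zero \<rho>])
  finally show ?case .
next
  case (Star p)
  have q: "eval_poly N c a p \<in> bounded_ops" for p
    using bounded_tuple_eval_mem[OF N t] tracial_bounded[OF N] by blast
  have m: "eval_poly N c a p - eval_poly N c a (of_qpoly (qround \<rho> p)) \<in> bounded_ops"
    using bounded_tuple_eval_mem[OF N t] tracial_bounded[OF N] tracial_diff_mem[OF N] by blast
  then show ?case using Star norm_op_adjoint[OF m] bounded_tuple_eval_mem[OF N t]
    by (simp add: eval_poly_op[OF N] tracial_adjoint_diff[OF N] flip: tracial_adjoint_diff[OF N])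
qed (simp_all add: eval_poly_op[OF N])

section \<open>Kaplansky density for \<open>*\<close>-polynomials\<close>

definition poly_closure :: "'i op tracial_alg \<Rightarrow> (nat \<Rightarrow> 'i op) \<Rightarrow> (nat \<Rightarrow> 'i op) \<Rightarrow> 'i op set" where
  "poly_closure N c a = {u \<in> carrier N. \<forall>e>0. \<exists>p. norm2 N (u - eval_poly N c a p) < e}"

lemma self_adj_eval_poly:
  assumes N: "tracial_vna N" and b: "bounded_tuple N r r' c a"
  shows "self_adj (eval_poly N c a (Scale (complex_of_real (1/2)) (Plus p (Star p))))"
  using tracial_bounded[OF N bounded_tuple_eval_mem[OF N b]]
  by (subst self_adj_iff) (auto simp: eval_poly_op[OF N] op_adjoint_op_scale op_adjoint_add op_adjoint_adjoint
      bounded_ops_add bounded_ops_adjoint bounded_ops_op_scale add.commute)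

text \<open>The iteration behind \<open>resolvent_sum\<close> as a formal expression, so that it can
  be evaluated at tuples of an algebra other than the one in which \<open>t\<close> and
  \<open>k\<close> were chosen.\<close>

primrec resolvent_poly :: "real \<Rightarrow> star_poly \<Rightarrow> nat \<Rightarrow> star_poly" where
  "resolvent_poly t p 0 = Scale 0 Unit"
| "resolvent_poly t p (Suc k) = Plus (Scale (complex_of_real t) Unit)
     (Times (Plus Unit (Scale (complex_of_real (- t)) (Plus Unit (Times p p)))) (resolvent_poly t p k))"

lemma eval_resolvent_poly:
  assumes N: "tracial_vna N"
  shows "eval_poly N c a (resolvent_poly t p k) = resolvent_sum t (eval_poly N c a p) k"
  by (induction k) (simp_all only: resolvent_poly.simps resolvent_sum.simps eval_poly_op[OF N]
      op_scale_of_real op_scale_zero)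

context
  fixes M :: "'i op tracial_alg" and c a :: "nat \<Rightarrow> 'i op" and r r' :: "nat \<Rightarrow> real"
  assumes M: "tracial_vna M" and t: "bounded_tuple M r r' c a"
begin

lemma poly_closure_mem: "u \<in> poly_closure M c a \<Longrightarrow> u \<in> carrier M"
  by (simp add: poly_closure_def)

lemma poly_closure_approx: "u \<in> poly_closure M c a \<Longrightarrow> e > 0 \<Longrightarrow> \<exists>p. norm2 M (u - eval_poly M c a p) < e"
  by (simp add: poly_closure_def)

lemma eval_mem_poly_closure: "eval_poly M c a p \<in> poly_closure M c a"
  using bounded_tuple_eval_mem[OF M t] by (auto simp: poly_closure_def norm2_zero[OF M] intro!: exI[of _ p])

interpretation M: tracial_star "carrier M" "(o\<^sub>L)" op_scale op_adjoint id_blinfun "tr M"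
  by (rule tracial_vna_star[OF M])

lemma poly_closure_eq: "poly_closure M c a = M.closure2 (range (eval_poly M c a))"
  by (auto simp: poly_closure_def M.closure2_def norm2_eq_n2[OF M])

lemma range_eval_poly:
  "range (eval_poly M c a) \<subseteq> carrier M"
  "u \<in> range (eval_poly M c a) \<Longrightarrow> v \<in> range (eval_poly M c a) \<Longrightarrow> u + v \<in> range (eval_poly M c a)"
  "u \<in> range (eval_poly M c a) \<Longrightarrow> v \<in> range (eval_poly M c a) \<Longrightarrow> u o\<^sub>L v \<in> range (eval_poly M c a)"
  "u \<in> range (eval_poly M c a) \<Longrightarrow> op_adjoint u \<in> range (eval_poly M c a)"
  using bounded_tuple_eval_mem[OF M t] by (auto simp flip: eval_poly_op[OF M])

lemma left_mult_bounded: "u \<in> carrier M \<Longrightarrow> \<exists>C. \<forall>v\<in>carrier M. M.n2 (u o\<^sub>L v) \<le> C * M.n2 v"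
  using norm2_mult_left[OF M] unfolding norm2_eq_n2[OF M] by blast

lemma poly_closure_add: "u \<in> poly_closure M c a \<Longrightarrow> v \<in> poly_closure M c a \<Longrightarrow> u + v \<in> poly_closure M c a"
  unfolding poly_closure_eq by (rule M.closure2_add[OF range_eval_poly left_mult_bounded])

lemma poly_closure_compose: "u \<in> poly_closure M c a \<Longrightarrow> v \<in> poly_closure M c a \<Longrightarrow> u o\<^sub>L v \<in> poly_closure M c a"
  unfolding poly_closure_eq by (rule M.closure2_mul[OF range_eval_poly left_mult_bounded])

lemma poly_closure_adjoint: "u \<in> poly_closure M c a \<Longrightarrow> op_adjoint u \<in> poly_closure M c a"
  unfolding poly_closure_eq by (rule M.closure2_st[OF range_eval_poly left_mult_bounded])

lemma poly_closure_scale: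
  assumes "u \<in> poly_closure M c a" shows "op_scale z u \<in> poly_closure M c a"
proof -
  have "eval_poly M c a (Scale z Unit) o\<^sub>L u \<in> poly_closure M c a"
    by (rule poly_closure_compose[OF eval_mem_poly_closure assms])
  then show ?thesis by (simp add: eval_poly_op[OF M] op_scale_compose_left)
qed

text \<open>The 2-norm is dominated by the operator norm, so a 2-norm closure is norm closed. The
  fixed point lemmas therefore produce elements of \<open>poly_closure\<close>.\<close>

lemma closed_alg_poly_closure: "closed_alg (poly_closure M c a)"
  unfolding closed_alg_def
proof (intro conjI ballI allI)
  have "u \<in> poly_closure M c a" if A: "\<forall>e>0. \<exists>v\<in>poly_closure M c a. dist v u < e" for u
    unfolding poly_closure_def
  proof (intro CollectI conjI allI impI)
    have "closed (carrier M)"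
      using closed_alg_vna[OF tracial_vna_vna[OF M]] by (rule closed_algD)
    then show u: "u \<in> carrier M"
      using A poly_closure_mem by (metis closed_approachable)
    fix e :: real assume e: "e > 0"
    obtain v where v: "v \<in> poly_closure M c a" "dist v u < e / 2" using A half_gt_zero[OF e] by blast
    obtain p where p: "norm2 M (v - eval_poly M c a p) < e / 2"
      using poly_closure_approx[OF v(1), of "e/2"] e by auto
    note m = u poly_closure_mem[OF v(1)] bounded_tuple_eval_mem[OF M t, of p]
    have "norm2 M (u - eval_poly M c a p) \<le> norm2 M (u - v) + norm2 M (v - eval_poly M c a p)"
      using m by (intro norm2_diff_triangle[OF M])
    also have "norm2 M (u - v) \<le> norm (u - v)"
      using m by (intro norm2_le_norm[OF M] tracial_diff_mem[OF M])
    finally show "\<exists>p. norm2 M (u - eval_poly M c a p) < e"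
      using p v(2) by (intro exI[of _ p]) (simp add: dist_norm norm_minus_commute)
  qed
  then show "closed (poly_closure M c a)"
    by (metis closed_closure closure_approachable subsetI closure_subset subset_antisym)
  show "id_blinfun \<in> poly_closure M c a"
    using eval_mem_poly_closure[of Unit] by (simp add: eval_poly_op[OF M])
  show "s *\<^sub>R u \<in> poly_closure M c a" if "u \<in> poly_closure M c a" for s u
    using poly_closure_scale[OF that, of "complex_of_real s"] by (simp add: op_scale_of_real)
qed (auto intro: poly_closure_add poly_closure_compose)

text \<open>
  Write \<open>T = S / (1 + S\<^sup>2)\<close>, choose a self-adjoint polynomial \<open>y\<close> near \<open>S\<close> and use a polynomial
  approximation of \<open>y / (1 + y\<^sup>2)\<close>, whose norm is controlled however large \<open>y\<close> is.
\<close>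

lemma kaplansky_self_adj:
  assumes T: "T \<in> poly_closure M c a" "self_adj T" "norm T \<le> 1/4" and e: "e > 0"
  shows "\<exists>s. norm2 M (T - eval_poly M c a s) < e \<and>
    (\<forall>(N :: 'n op tracial_alg) c' a'. tracial_vna N \<longrightarrow> bounded_tuple N r r' c' a' \<longrightarrow>
       norm (eval_poly N c' a' s) \<le> 2)"
proof -
  obtain S where S: "S \<in> poly_closure M c a" "self_adj S" "norm S \<le> 1" "S o\<^sub>L T = T o\<^sub>L S"
    "S = T + (T o\<^sub>L (S o\<^sub>L S))"
    using closed_alg_resolvent_preimage[OF closed_alg_poly_closure T] by blast
  \<comment> \<open>The error terms below sum to 13/4 of \<open>\<delta>\<close>; an eighth of
    \<open>e\<close> leaves room.\<close>
  define \<delta> where "\<delta> = e / 8"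
  have \<delta>: "\<delta> > 0" using e by (simp add: \<delta>_def)
  obtain p where p: "norm2 M (S - eval_poly M c a p) < \<delta>" using poly_closure_approx[OF S(1) \<delta>] by blast
  \<comment> \<open>Taking the real part of \<open>p\<close> formally makes its value self-adjoint
    at every tuple of every algebra.\<close>
  define P where "P = Scale (complex_of_real (1/2)) (Plus p (Star p))"
  define y where "y = eval_poly M c a P"
  \<comment> \<open>The parameter is taken from \<open>pbound\<close> and not from the norm of
    \<open>y\<close>, so that the same iteration is valid at all tuples within the radii.\<close>
  define \<kappa> where "\<kappa> = resolvent_par (pbound r r' P)"
  obtain k where k: "sqrt (1 - \<kappa>) ^ k < \<delta>"
  proof -
    have "sqrt (1 - \<kappa>) < 1" "0 \<le> sqrt (1 - \<kappa>)"
      using resolvent_par[of "pbound r r' P"] by (auto simp: \<kappa>_def)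
    then show ?thesis using that real_arch_pow_inv[OF \<delta>] by blast
  qed
  define s where "s = Times P (resolvent_poly \<kappa> P k)"
  have bound: "norm (eval_poly N c' a' s) \<le> 2" if N: "tracial_vna N" and b: "bounded_tuple N r r' c' a'"
    for N :: "'n op tracial_alg" and c' a'
  proof -
    have "self_adj (eval_poly N c' a' P)" unfolding P_def by (rule self_adj_eval_poly[OF that])
    then show ?thesis
      unfolding s_def eval_poly_op[OF N] eval_resolvent_poly[OF N]
      using norm_mult_resolvent_sum[OF _ norm_eval_poly_le[OF that] _ refl] by (simp add: \<kappa>_def)
  qed
  define Q where "Q = resolvent_sum \<kappa> y k"
  define F where "F = id_blinfun - ((id_blinfun + (y o\<^sub>L y)) o\<^sub>L Q)"
  have ysa: "self_adj y" "norm y \<le> pbound r r' P"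
    unfolding y_def using self_adj_eval_poly[OF M t, of p] norm_eval_poly_le[OF M t, of P] by (simp_all add: P_def)
  have F: "norm F \<le> \<delta>"
    using resolvent_sum_error[OF ysa \<kappa>_def refl, of k] k by (simp add: F_def Q_def)
  have Q: "norm Q \<le> 2" "norm (y o\<^sub>L Q) \<le> 2"
    using norm_resolvent_sum[OF ysa \<kappa>_def refl] norm_mult_resolvent_sum[OF ysa \<kappa>_def refl]
    by (auto simp: Q_def)
  have Qy: "Q o\<^sub>L y = y o\<^sub>L Q" unfolding Q_def by (rule resolvent_sum_commute)
  have ym: "y \<in> carrier M" unfolding y_def by (rule bounded_tuple_eval_mem[OF M t])
  have Qm: "Q \<in> carrier M"
    unfolding Q_def y_def eval_resolvent_poly[OF M, symmetric] by (rule bounded_tuple_eval_mem[OF M t])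
  note Sm = poly_closure_mem[OF S(1)] and Tm = poly_closure_mem[OF T(1)]
  have Fm: "F \<in> carrier M" unfolding F_def using ym Qm
    by (intro tracial_diff_mem[OF M] tracial_mul_mem[OF M] tracial_add_mem[OF M] tracial_id_mem[OF M])
  have d: "norm2 M (S - y) \<le> \<delta>"
  proof -
    let ?w = "S - eval_poly M c a p"
    have w: "?w \<in> carrier M" using Sm bounded_tuple_eval_mem[OF M t] by (intro tracial_diff_mem[OF M])
    have "S - y = op_scale (complex_of_real (1/2)) (?w + op_adjoint ?w)"
      using Sm bounded_tuple_eval_mem[OF M t, of p] self_adjD[OF S(2)]
      unfolding y_def P_def eval_poly_op[OF M] op_scale_of_real
      by (simp add: tracial_adjoint_diff[OF M] algebra_simps flip: scaleR_2)
    then have "norm2 M (S - y) = (1/2) * norm2 M (?w + op_adjoint ?w)"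
      using w by (simp add: norm2_scale[OF M] tracial_add_mem[OF M] tracial_adjoint_mem[OF M] del: of_real_divide)
    also have "\<dots> \<le> (1/2) * (norm2 M ?w + norm2 M (op_adjoint ?w))"
      using w by (intro mult_left_mono norm2_triangle[OF M] tracial_adjoint_mem[OF M]) auto
    also have "\<dots> = norm2 M ?w" using w by (simp add: norm2_adjoint[OF M])
    finally show ?thesis using p by simp
  qed
  have ST: "norm (S o\<^sub>L T) \<le> 1/4"
    using norm_compose[of S T] mult_mono[OF S(3) T(3)] by simp
  have SST: "S = T + ((S o\<^sub>L S) o\<^sub>L T)"
    using S(5) unfolding blinfun_compose_assoc S(4) unfolding blinfun_compose_assoc[symmetric] S(4) .
  define D where "D = S - y"
  have Dm: "D \<in> carrier M" unfolding D_def using Sm ym by (intro tracial_diff_mem[OF M])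
  have Fy: "F = id_blinfun - (Q + (Q o\<^sub>L (y o\<^sub>L y)))"
  proof -
    have "(y o\<^sub>L y) o\<^sub>L Q = (y o\<^sub>L Q) o\<^sub>L y" unfolding blinfun_compose_assoc Qy ..
    also have "\<dots> = Q o\<^sub>L (y o\<^sub>L y)" unfolding Qy[symmetric] blinfun_compose_assoc ..
    finally show ?thesis by (simp add: F_def blinfun_compose_add_left')
  qed
  \<comment> \<open>Using S = T + S^2 T and 1 = F + Q (1 + y^2), the difference is Q (S^2 - y^2) T -
    Q D - F T, and S^2 - y^2 = y D + D S. Every summand then has one small factor, \<open>D\<close>
    in 2-norm or \<open>F\<close> in norm, among factors of controlled norm.\<close>
  have "(y o\<^sub>L Q) - T = ((Q o\<^sub>L y) o\<^sub>L (D o\<^sub>L T)) + (Q o\<^sub>L (D o\<^sub>L (S o\<^sub>L T))) - (Q o\<^sub>L D) - (F o\<^sub>L T)"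
  proof -
    have "Q o\<^sub>L S = (Q o\<^sub>L T) + (Q o\<^sub>L (S o\<^sub>L (S o\<^sub>L T)))"
      by (subst SST) (simp add: blinfun_compose_add_right' blinfun_compose_assoc)
    then show ?thesis
      unfolding Fy D_def Qy[symmetric] by (simp add: blinfun_alg)
  qed
  then have "norm2 M ((y o\<^sub>L Q) - T) \<le> norm2 M ((Q o\<^sub>L y) o\<^sub>L (D o\<^sub>L T)) + norm2 M (Q o\<^sub>L (D o\<^sub>L (S o\<^sub>L T)))
      + norm2 M (Q o\<^sub>L D) + norm2 M (F o\<^sub>L T)"
  proof -
    let ?A = "(Q o\<^sub>L y) o\<^sub>L (D o\<^sub>L T)" and ?B = "Q o\<^sub>L (D o\<^sub>L (S o\<^sub>L T))" and ?C = "Q o\<^sub>L D" and ?E = "F o\<^sub>L T"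
    have m: "?A \<in> carrier M" "?B \<in> carrier M" "?C \<in> carrier M" "?E \<in> carrier M"
      using Qm ym Dm Tm Sm Fm by (auto intro!: tracial_mul_mem[OF M])
    have "norm2 M (?A + ?B - ?C - ?E) \<le> norm2 M (?A + ?B - ?C) + norm2 M ?E"
      using norm2_triangle[OF M, of "?A + ?B - ?C" "- ?E"] m
      by (simp add: tracial_diff_mem[OF M] tracial_add_mem[OF M] norm2_minus[OF M] tracial_diff_mem[OF M tracial_zero_mem[OF M], simplified])
    moreover have "norm2 M (?A + ?B - ?C) \<le> norm2 M (?A + ?B) + norm2 M ?C"
      using norm2_triangle[OF M, of "?A + ?B" "- ?C"] m
      by (simp add: tracial_diff_mem[OF M] tracial_add_mem[OF M] norm2_minus[OF M] tracial_diff_mem[OF M tracial_zero_mem[OF M], simplified])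
    moreover have "norm2 M (?A + ?B) \<le> norm2 M ?A + norm2 M ?B" using m by (intro norm2_triangle[OF M])
    ultimately show ?thesis
      using \<open>(y o\<^sub>L Q) - T = ?A + ?B - ?C - ?E\<close> by simp
  qed
  also have "\<dots> \<le> 2 * (\<delta> * (1/4)) + 2 * (\<delta> * (1/4)) + 2 * \<delta> + \<delta> * (1/4)"
  proof -
    have Dn: "norm2 M D \<le> \<delta>" "0 \<le> norm2 M D" using d norm2_nonneg[OF M Dm] by (auto simp: D_def)
    have 1: "norm2 M (D o\<^sub>L T) \<le> \<delta> * (1/4)"
      using norm2_mult_right[OF M Dm Tm] mult_mono[OF Dn(1) T(3)] \<delta> by simp
    have 2: "norm2 M (D o\<^sub>L (S o\<^sub>L T)) \<le> \<delta> * (1/4)"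
      using norm2_mult_right[OF M Dm tracial_mul_mem[OF M Sm Tm]] mult_mono[OF Dn(1) ST] \<delta> by simp
    have nn: "0 \<le> norm2 M (D o\<^sub>L T)" "0 \<le> norm2 M (D o\<^sub>L (S o\<^sub>L T))"
      using Dm Tm Sm by (auto intro!: norm2_nonneg[OF M] tracial_mul_mem[OF M])
    have 3: "norm2 M ((Q o\<^sub>L y) o\<^sub>L (D o\<^sub>L T)) \<le> 2 * (\<delta> * (1/4))"
      using norm2_mult_left[OF M tracial_mul_mem[OF M Qm ym] tracial_mul_mem[OF M Dm Tm]]
        mult_mono[OF Q(2) 1] nn unfolding Qy by simp
    have 4: "norm2 M (Q o\<^sub>L (D o\<^sub>L (S o\<^sub>L T))) \<le> 2 * (\<delta> * (1/4))"
      using norm2_mult_left[OF M Qm tracial_mul_mem[OF M Dm tracial_mul_mem[OF M Sm Tm]]]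
        mult_mono[OF Q(1) 2] nn by simp
    have 5: "norm2 M (Q o\<^sub>L D) \<le> 2 * \<delta>"
      using norm2_mult_left[OF M Qm Dm] mult_mono[OF Q(1) Dn(1)] Dn by simp
    have 6: "norm2 M (F o\<^sub>L T) \<le> \<delta> * (1/4)"
      using norm2_mult_left[OF M Fm Tm] mult_mono[OF F order_trans[OF norm2_le_norm[OF M Tm] T(3)]] \<delta>
        norm2_nonneg[OF M Tm] by simp
    show ?thesis using 3 4 5 6 by linarith
  qed
  also have "\<dots> < e" using e by (simp add: \<delta>_def)
  finally have "norm2 M (T - (y o\<^sub>L Q)) < e"
    using norm2_commute[OF M Tm tracial_mul_mem[OF M ym Qm]] by simp
  then have "norm2 M (T - eval_poly M c a s) < e"
    by (simp add: s_def eval_poly_op[OF M] eval_resolvent_poly[OF M] y_def Q_def)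
  with bound show ?thesis by blast
qed

text \<open>Real and imaginary parts are divided by \<open>l = 4 * norm u + 1\<close>, which brings
  them below 1/4. Their approximants have norm at most 2, and recombining costs the factor
  \<open>l\<close> twice: 2 l + 2 l is the bound \<open>16 * norm u + 4\<close>. The 1 in
  \<open>l\<close> keeps it positive when \<open>u = 0\<close>.\<close>

theorem kaplansky_density:
  assumes u: "u \<in> poly_closure M c a" and e: "e > 0"
  shows "\<exists>s. norm2 M (u - eval_poly M c a s) < e \<and>
    (\<forall>(N :: 'n op tracial_alg) c' a'. tracial_vna N \<longrightarrow> bounded_tuple N r r' c' a' \<longrightarrow>
       norm (eval_poly N c' a' s) \<le> 16 * norm u + 4)"
proof -
  define l where "l = 4 * norm u + 1"
  have l: "l > 0" by (simp add: l_def add_nonneg_pos)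
  have um: "u \<in> carrier M" and ub: "u \<in> bounded_ops"
    using u poly_closure_mem tracial_bounded[OF M] by auto
  define u1 where "u1 = op_scale (complex_of_real (1 / (2 * l))) (u + op_adjoint u)"
  define u2 where "u2 = op_scale (- \<i> * complex_of_real (1 / (2 * l))) (u + op_scale (-1) (op_adjoint u))"
  have m: "u1 \<in> poly_closure M c a" "u2 \<in> poly_closure M c a"
    unfolding u1_def u2_def using u by (auto intro!: poly_closure_scale poly_closure_add poly_closure_adjoint)
  have sa: "self_adj u1" "self_adj u2"
    using ub m[THEN poly_closure_mem, THEN tracial_bounded[OF M]]
    by (auto simp: self_adj_iff u1_def u2_def op_adjoint_op_scale op_adjoint_add op_adjoint_adjoint bounded_ops_add
        bounded_ops_adjoint bounded_ops_op_scale op_scale_add_right op_scale_scale add.commute)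
  have nn: "norm (u + op_scale z (op_adjoint u)) \<le> 2 * norm u" if "cmod z = 1" for z
    using norm_triangle_ineq[of u "op_scale z (op_adjoint u)"] norm_op_scale[of z "op_adjoint u"] that
    by (simp add: norm_op_adjoint[OF ub])
  have q: "(1 / (2 * l)) * (2 * norm u) \<le> 1 / 4" using l by (simp add: l_def field_simps)
  have n: "norm u1 \<le> 1/4" "norm u2 \<le> 1/4"
  proof -
    have "norm u1 \<le> cmod (complex_of_real (1 / (2 * l))) * norm (u + op_scale 1 (op_adjoint u))"
      unfolding u1_def using norm_op_scale by simp
    also have "\<dots> \<le> (1 / (2 * l)) * (2 * norm u)"
      using nn[of 1] l by (intro mult_mono) (auto simp: norm_divide norm_mult)
    finally show "norm u1 \<le> 1/4" using q by linarith
    have "norm u2 \<le> cmod (- \<i> * complex_of_real (1 / (2 * l))) * norm (u + op_scale (-1) (op_adjoint u))"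
      unfolding u2_def by (rule norm_op_scale)
    also have "\<dots> \<le> (1 / (2 * l)) * (2 * norm u)"
      using nn[of "-1"] l by (intro mult_mono) (auto simp: norm_divide norm_mult)
    finally show "norm u2 \<le> 1/4" using q by linarith
  qed
  have dec: "u = op_scale (complex_of_real l) u1 + op_scale (\<i> * complex_of_real l) u2"
  proof -
    have "op_scale (complex_of_real l) u1 = op_scale (1/2) u + op_scale (1/2) (op_adjoint u)"
      using l by (simp add: u1_def op_scale_scale op_scale_add_right)
    moreover have "op_scale (\<i> * complex_of_real l) u2 = op_scale (1/2) u + op_scale (-1/2) (op_adjoint u)"
      using l by (simp add: u2_def op_scale_scale op_scale_add_right)
    moreover have "op_scale (1/2) u + op_scale (1/2) u = u"
      using op_scale_add_left[of "1/2" "1/2" u] by simp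
    moreover have "op_scale (1/2) (op_adjoint u) + op_scale (-1/2) (op_adjoint u) = 0"
      using op_scale_add_left[of "1/2" "-1/2" "op_adjoint u"] by simp
    ultimately show ?thesis by (simp add: algebra_simps)
  qed
  have e': "e / (2 * l) > 0" using e l by simp
  obtain s1 where s1: "norm2 M (u1 - eval_poly M c a s1) < e / (2 * l)"
    "\<And>(N :: 'n op tracial_alg) c' a'. tracial_vna N \<Longrightarrow> bounded_tuple N r r' c' a' \<Longrightarrow> norm (eval_poly N c' a' s1) \<le> 2"
    using kaplansky_self_adj[OF m(1) sa(1) n(1) e', where 'n = 'n] by blast
  obtain s2 where s2: "norm2 M (u2 - eval_poly M c a s2) < e / (2 * l)"
    "\<And>(N :: 'n op tracial_alg) c' a'. tracial_vna N \<Longrightarrow> bounded_tuple N r r' c' a' \<Longrightarrow> norm (eval_poly N c' a' s2) \<le> 2"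
    using kaplansky_self_adj[OF m(2) sa(2) n(2) e', where 'n = 'n] by blast
  define s where "s = Plus (Scale (complex_of_real l) s1) (Scale (\<i> * complex_of_real l) s2)"
  have "norm (eval_poly N c' a' s) \<le> 16 * norm u + 4" if N: "tracial_vna N" "bounded_tuple N r r' c' a'"
    for N :: "'n op tracial_alg" and c' a'
  proof -
    have "norm (eval_poly N c' a' s) \<le> cmod (complex_of_real l) * norm (eval_poly N c' a' s1)
        + cmod (\<i> * complex_of_real l) * norm (eval_poly N c' a' s2)"
      unfolding s_def eval_poly_op[OF N(1)] by (intro order_trans[OF norm_triangle_ineq] add_mono norm_op_scale)
    also have "\<dots> \<le> l * 2 + l * 2"
      using s1(2)[OF N] s2(2)[OF N] l by (intro add_mono mult_mono) (auto simp: norm_mult)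
    finally show ?thesis by (simp add: l_def)
  qed
  moreover have "norm2 M (u - eval_poly M c a s) < e"
  proof -
    let ?d1 = "u1 - eval_poly M c a s1" and ?d2 = "u2 - eval_poly M c a s2"
    have dm: "?d1 \<in> carrier M" "?d2 \<in> carrier M"
      using m bounded_tuple_eval_mem[OF M t] by (auto intro!: tracial_diff_mem[OF M] dest: poly_closure_mem)
    have sd: "op_scale z (x - y) = op_scale z x - op_scale z y" for z x y
      using op_scale_add_right[of z "x - y" y] by simp
    have "u - eval_poly M c a s = op_scale (complex_of_real l) ?d1 + op_scale (\<i> * complex_of_real l) ?d2"
      by (subst dec) (simp add: s_def eval_poly_op[OF M] sd)
    then have "norm2 M (u - eval_poly M c a s) \<le> norm2 M (op_scale (complex_of_real l) ?d1) + norm2 M (op_scale (\<i> * complex_of_real l) ?d2)"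
      using dm by (simp add: norm2_triangle[OF M] tracial_scale_mem[OF M])
    also have "\<dots> = l * norm2 M ?d1 + l * norm2 M ?d2"
      using dm l by (simp add: norm2_scale[OF M] norm_mult)
    also have "\<dots> < e" using s1(1) s2(1) l by (simp add: field_simps)
    finally show ?thesis .
  qed
  ultimately show ?thesis by blast
qed

end

section \<open>Limits along ultrafilters\<close>

lemma nonprincipal_ultrafilter_bot: "nonprincipal_ultrafilter \<U> \<Longrightarrow> \<U> \<noteq> bot"
  by (simp add: nonprincipal_ultrafilter_def)

lemma nonprincipal_ultrafilter_le_sequentially:
  assumes "nonprincipal_ultrafilter \<U>" shows "\<U> \<le> sequentially"
proof (rule filter_leI)
  fix P assume "eventually P sequentially"
  then obtain n where n: "\<And>k. k \<ge> n \<Longrightarrow> P k" by (auto simp: eventually_sequentially)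
  have "eventually (\<lambda>m. \<forall>k<n. m \<noteq> k) \<U>"
    using assms by (simp add: nonprincipal_ultrafilter_def flip: Ball_def lessThan_iff add: eventually_ball_finite_distrib)
  then show "eventually P \<U>" by (rule eventually_mono) (use n not_less in blast)
qed

text \<open>Compactness of a closed disc gives a cluster point, and an ultrafilter converges to each
  of its cluster points, as otherwise the complement of a neighbourhood would be eventual.\<close>

lemma ultrafilter_bounded_convergent:
  fixes f :: "nat \<Rightarrow> complex"
  assumes U: "nonprincipal_ultrafilter \<U>" and b: "\<And>n. cmod (f n) \<le> C"
  shows "\<exists>l. (f \<longlongrightarrow> l) \<U>"
proof -
  have "filtermap f \<U> \<noteq> bot" using nonprincipal_ultrafilter_bot[OF U] by (simp add: filtermap_bot_iff)
  moreover have "eventually (\<lambda>x. x \<in> cball 0 C) (filtermap f \<U>)" using b by (simp add: eventually_filtermap)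
  moreover have "compact (cball (0::complex) C)" by simp
  ultimately obtain l where l: "inf (nhds l) (filtermap f \<U>) \<noteq> bot"
    unfolding compact_filter by blast
  have "eventually (\<lambda>n. f n \<in> S) \<U>" if S: "open S" "l \<in> S" for S
  proof (rule ccontr)
    assume "\<not> eventually (\<lambda>n. f n \<in> S) \<U>"
    then have "eventually (\<lambda>n. f n \<notin> S) \<U>" using U by (auto simp: nonprincipal_ultrafilter_def)
    then have "eventually (\<lambda>x. x \<notin> S) (filtermap f \<U>)" by (simp add: eventually_filtermap)
    moreover have "eventually (\<lambda>x. x \<in> S) (nhds l)" using S by (auto simp: eventually_nhds)
    ultimately have "eventually (\<lambda>x. False) (inf (nhds l) (filtermap f \<U>))"
      unfolding eventually_inf by blast
    then show False using l by (simp add: trivial_limit_def)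
  qed
  then show ?thesis unfolding tendsto_def by blast
qed

text \<open>Weak compactness of the ball: the ultralimits of the matrix coefficients form a bounded
  sesquilinear form, hence come from an operator.\<close>

lemma bounded_ops_weak_limit:
  fixes T :: "nat \<Rightarrow> 'i op"
  assumes U: "nonprincipal_ultrafilter \<U>" and T: "\<And>j. T j \<in> bounded_ops" "\<And>j. norm (T j) \<le> C"
  shows "\<exists>S\<in>bounded_ops. norm S \<le> C \<and> (\<forall>x y. ((\<lambda>j. cinner x (blinfun_apply (T j) y)) \<longlongrightarrow> cinner x (blinfun_apply S y)) \<U>)"
proof -
  note ne = nonprincipal_ultrafilter_bot[OF U]
  have bd: "cmod (cinner x (blinfun_apply (T j) y)) \<le> C * norm x * norm y" for x y j
  proof -
    have "cmod (cinner x (blinfun_apply (T j) y)) \<le> norm x * (norm (T j) * norm y)"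
      by (rule order_trans[OF cmod_cinner_le]) (intro mult_left_mono norm_blinfun, simp)
    also have "\<dots> \<le> norm x * (C * norm y)" by (intro mult_left_mono mult_right_mono T(2)) auto
    finally show ?thesis by (simp add: algebra_simps)
  qed
  define B where "B x y = Lim \<U> (\<lambda>j. cinner x (blinfun_apply (T j) y))" for x y
  have B: "((\<lambda>j. cinner x (blinfun_apply (T j) y)) \<longlongrightarrow> B x y) \<U>" for x y
  proof -
    obtain l where "((\<lambda>j. cinner x (blinfun_apply (T j) y)) \<longlongrightarrow> l) \<U>"
      using ultrafilter_bounded_convergent[OF U, of "\<lambda>j. cinner x (blinfun_apply (T j) y)"] bd by blast
    then show ?thesis unfolding B_def using tendsto_Lim[OF ne] by blast
  qed
  note un = tendsto_unique[OF ne]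
  have "\<exists>S\<in>bounded_ops. norm S \<le> C \<and> (\<forall>x y. cinner x (blinfun_apply S y) = B x y)"
  proof (rule sesquilinear_form_operator)
    fix x y z :: "'i ell2" and c :: complex
    show "B (x + y) z = B x z + B y z"
      by (rule un[OF B]) (simp add: cinner_add_left tendsto_add[OF B B])
    show "B x (y + z) = B x y + B x z"
      by (rule un[OF B]) (simp add: blinfun.add_right cinner_add_right tendsto_add[OF B B])
    show "B (ell2_scale c x) y = cnj c * B x y"
      by (rule un[OF B]) (simp add: cinner_scale_left tendsto_mult_left[OF B])
    show "B x (ell2_scale c y) = c * B x y"
      by (rule un[OF B]) (simp add: bounded_ops_scale[OF T(1)] cinner_scale_right tendsto_mult_left[OF B])
    show "cmod (B x y) \<le> C * norm x * norm y"
      by (rule tendsto_upperbound[OF tendsto_norm[OF B] _ ne]) (simp add: bd)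
    show "0 \<le> C" using T(2) norm_ge_zero order_trans by blast
  qed
  then show ?thesis using B by auto
qed

section \<open>Completeness of bounded balls in the 2-norm\<close>

text \<open>Convergence may be tested on a subbasis, by induction on the generation of the open
  set.\<close>

lemma eventually_topology_generated:
  assumes "generate_topology_on \<S> G" "l \<in> G"
    and "\<And>s. s \<in> \<S> \<Longrightarrow> l \<in> s \<Longrightarrow> eventually (\<lambda>x. f x \<in> s) F"
  shows "eventually (\<lambda>x. f x \<in> G) F"
  using assms
proof (induction)
  case (Int a b)
  then show ?case by (auto intro: eventually_conj)
next
  case (UN K)
  then obtain k where "k \<in> K" "l \<in> k" by blast
  then have "eventually (\<lambda>x. f x \<in> k) F" using UN by blast
  then show ?case by (rule eventually_mono) (use \<open>k \<in> K\<close> in blast)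
qed auto

text \<open>On norm-bounded sets weak operator convergence implies ultraweak convergence, because
  the defining series is dominated by
  \<open>C * ((norm (\<eta> n))\<^sup>2 + (norm (\<xi> n))\<^sup>2)\<close> and limit and sum may be
  exchanged. Normality of the trace then applies.\<close>

lemma trace_weak_limit:
  fixes T :: "nat \<Rightarrow> 'i op"
  assumes N: "tracial_vna N" and ne: "F \<noteq> bot"
    and T: "\<And>j. T j \<in> carrier N" "\<And>j. norm (T j) \<le> C" and S: "S \<in> carrier N"
    and w: "\<And>x y. ((\<lambda>j. cinner x (blinfun_apply (T j) y)) \<longlongrightarrow> cinner x (blinfun_apply S y)) F"
  shows "((\<lambda>j. tr N (T j)) \<longlongrightarrow> tr N S) F"
  unfolding tendsto_def
proof (intro allI impI)
  fix V :: "complex set" assume V: "open V" "tr N S \<in> V"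
  have cont: "continuous_map (subtopology ultraweak_topology (carrier N)) euclidean (tr N)"
    using N by (simp add: tracial_vna_def)
  define X where "X = {{T :: 'i op. (\<Sum>n. cinner (\<eta> n) (blinfun_apply T (\<xi> n))) \<in> V} | \<xi> \<eta> V.
        summable (\<lambda>n. (norm (\<xi> n))\<^sup>2) \<and> summable (\<lambda>n. (norm (\<eta> n))\<^sup>2) \<and> open (V :: complex set)}"
  have uw: "ultraweak_topology = topology_generated_by X" by (simp add: ultraweak_topology_def X_def)
  \<comment> \<open>The generated topology lives on the union of \<open>X\<close>; the whole space
    itself belongs to \<open>X\<close>, through zero vectors and \<open>V = UNIV\<close>.\<close>
  have "UNIV \<in> X" unfolding X_def
    by (rule CollectI, rule exI[of _ "\<lambda>_. 0"], rule exI[of _ "\<lambda>_. 0"], rule exI[of _ UNIV]) auto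
  then have "\<Union> X = UNIV" by blast
  then have ts: "topspace (subtopology ultraweak_topology (carrier N)) = carrier N"
    by (simp add: uw topology_generated_by_topspace)
  have "openin (subtopology ultraweak_topology (carrier N)) {x \<in> carrier N. tr N x \<in> V}"
    using cont V unfolding continuous_map_def ts by auto
  then obtain G where G: "openin ultraweak_topology G" "{x \<in> carrier N. tr N x \<in> V} = G \<inter> carrier N"
    unfolding openin_subtopology by blast
  have "generate_topology_on X G" using G(1) by (simp add: uw openin_topology_generated_by_iff)
  moreover have "S \<in> G" using G(2) S V by blast
  ultimately have "eventually (\<lambda>j. T j \<in> G) F"
  proof (rule eventually_topology_generated)
    fix s assume "s \<in> X" "S \<in> s"
    then obtain \<xi> \<eta> W where s: "s = {T. (\<Sum>n. cinner (\<eta> n) (blinfun_apply T (\<xi> n))) \<in> W}"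
      "summable (\<lambda>n. (norm (\<xi> n))\<^sup>2)" "summable (\<lambda>n. (norm (\<eta> n))\<^sup>2)" "open W"
      "(\<Sum>n. cinner (\<eta> n) (blinfun_apply S (\<xi> n))) \<in> W"
      unfolding X_def by blast
    have C: "0 \<le> C" using T(2) norm_ge_zero order_trans by blast
    have "((\<lambda>j. \<Sum>n. cinner (\<eta> n) (blinfun_apply (T j) (\<xi> n))) \<longlongrightarrow> (\<Sum>n. cinner (\<eta> n) (blinfun_apply S (\<xi> n)))) F"
    proof (rule tannerys_theorem[THEN conjunct2, THEN conjunct2])
      show "((\<lambda>j. cinner (\<eta> n) (blinfun_apply (T j) (\<xi> n))) \<longlongrightarrow> cinner (\<eta> n) (blinfun_apply S (\<xi> n))) F" for n
        by (rule w)
      show "summable (\<lambda>n. C * ((norm (\<eta> n))\<^sup>2 + (norm (\<xi> n))\<^sup>2))"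
        using s by (intro summable_mult summable_add)
      have "cmod (cinner (\<eta> n) (blinfun_apply (T j) (\<xi> n))) \<le> C * ((norm (\<eta> n))\<^sup>2 + (norm (\<xi> n))\<^sup>2)" for n j
      proof -
        have "cmod (cinner (\<eta> n) (blinfun_apply (T j) (\<xi> n))) \<le> norm (\<eta> n) * (norm (T j) * norm (\<xi> n))"
          by (rule order_trans[OF cmod_cinner_le]) (intro mult_left_mono norm_blinfun, simp)
        also have "\<dots> \<le> norm (\<eta> n) * (C * norm (\<xi> n))" by (intro mult_left_mono mult_right_mono T(2)) auto
        also have "\<dots> = C * (norm (\<eta> n) * norm (\<xi> n))" by simp
        also have "norm (\<eta> n) * norm (\<xi> n) \<le> (norm (\<eta> n))\<^sup>2 + (norm (\<xi> n))\<^sup>2"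
          using sum_squares_bound[of "norm (\<eta> n)" "norm (\<xi> n)"] mult_nonneg_nonneg[OF norm_ge_zero norm_ge_zero, of "\<eta> n" "\<xi> n"]
          by linarith
        finally show ?thesis using C by (simp add: mult_left_mono)
      qed
      then show "eventually (\<lambda>(n, j). cmod (cinner (\<eta> n) (blinfun_apply (T j) (\<xi> n))) \<le> C * ((norm (\<eta> n))\<^sup>2 + (norm (\<xi> n))\<^sup>2)) (at_top \<times>\<^sub>F F)"
        by (simp add: case_prod_unfold)
    qed (rule ne)
    then show "eventually (\<lambda>j. T j \<in> s) F"
      using s(4,5) unfolding s(1) tendsto_def by simp
  qed
  then show "eventually (\<lambda>j. tr N (T j) \<in> V) F"
    by (rule eventually_mono) (use G(2) T(1) in blast)
qed

text \<open>The limit is found weakly, along the ultrafilter, and lies in the algebra since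
  commuting with the commutant passes to weak limits. The 2-norm is not weakly continuous, so the
  distance to \<open>T k\<close> is recovered by pairing with the fixed element \<open>D\<close>,
  where Cauchy-Schwarz gives a bound before the limit is taken.\<close>

theorem tracial_ball_complete:
  fixes T :: "nat \<Rightarrow> 'i op"
  assumes N: "tracial_vna N" and U: "nonprincipal_ultrafilter \<U>"
    and T: "\<And>j. T j \<in> carrier N" "\<And>j. norm (T j) \<le> C"
    and cauchy: "\<And>e. e > 0 \<Longrightarrow> \<exists>J. \<forall>j\<ge>J. \<forall>k\<ge>J. norm2 N (T j - T k) < e"
  shows "\<exists>S\<in>carrier N. (\<lambda>j. norm2 N (T j - S)) \<longlonglongrightarrow> 0"
proof -
  note ne = nonprincipal_ultrafilter_bot[OF U]
  note v = tracial_vna_vna[OF N]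
  obtain S where S: "S \<in> bounded_ops" "norm S \<le> C"
    and w: "\<And>x y. ((\<lambda>j. cinner x (blinfun_apply (T j) y)) \<longlongrightarrow> cinner x (blinfun_apply S y)) \<U>"
    using bounded_ops_weak_limit[of \<U> T C] U tracial_bounded[OF N T(1)] T(2) by blast
  have Sm: "S \<in> carrier N"
  proof -
    have "S o\<^sub>L A = A o\<^sub>L S" if A: "A \<in> commutant (carrier N)" for A
    proof (intro blinfun_eqI cinner_eqI)
      fix x y
      have Ab: "A \<in> bounded_ops" using A by (rule commutant_bounded)
      have c: "T j o\<^sub>L A = A o\<^sub>L T j" for j using commutant_commute[OF A T(1)[of j]] by simp
      have "blinfun_apply (T j) (blinfun_apply A y) = blinfun_apply A (blinfun_apply (T j) y)" for j
        using arg_cong[OF c[of j], of "\<lambda>X. blinfun_apply X y"] by simp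
      then have "((\<lambda>j. cinner (blinfun_apply (op_adjoint A) x) (blinfun_apply (T j) y)) \<longlongrightarrow> cinner x (blinfun_apply S (blinfun_apply A y))) \<U>"
        using w[of x "blinfun_apply A y"] by (simp add: op_adjoint_left[OF Ab])
      with w[of "blinfun_apply (op_adjoint A) x" y]
      have "cinner (blinfun_apply (op_adjoint A) x) (blinfun_apply S y) = cinner x (blinfun_apply S (blinfun_apply A y))"
        by (rule tendsto_unique[OF ne])
      then show "cinner x (blinfun_apply (S o\<^sub>L A) y) = cinner x (blinfun_apply (A o\<^sub>L S) y)"
        by (simp add: op_adjoint_left[OF Ab])
    qed
    then have "S \<in> commutant (commutant (carrier N))" using S by (simp add: commutant_def)
    then show ?thesis by (simp add: vna_bicommutant[OF v])
  qed
  have key: "norm2 N (T k - S) \<le> e" if e: "e > 0" and J: "\<And>j k. j \<ge> J \<Longrightarrow> k \<ge> J \<Longrightarrow> norm2 N (T j - T k) < e" and k: "k \<ge> J" for e J k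
  proof -
    define D where "D = S - T k"
    have Dm: "D \<in> carrier N" unfolding D_def by (intro tracial_diff_mem[OF N] Sm T)
    note Db = tracial_bounded[OF N Dm]
    \<comment> \<open>Linear in \<open>T j\<close>, so its traces converge to the trace of D* D,
      while for late \<open>j\<close> they are at most \<open>norm2 N D * e\<close>.\<close>
    define X where "X j = op_adjoint D o\<^sub>L (T j - T k)" for j
    have Xm: "X j \<in> carrier N" for j unfolding X_def
      by (intro tracial_mul_mem[OF N] tracial_adjoint_mem[OF N] tracial_diff_mem[OF N] Dm T)
    have Xn: "norm (X j) \<le> norm D * (2 * C)" for j
    proof -
      have "norm (X j) \<le> norm (op_adjoint D) * norm (T j - T k)" unfolding X_def by (rule norm_compose)
      also have "\<dots> \<le> norm D * (2 * C)"
        using norm_triangle_ineq4[of "T j" "T k"] T(2)[of j] T(2)[of k]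
        by (intro mult_mono) (auto simp: norm_op_adjoint[OF Db])
      finally show ?thesis .
    qed
    have "((\<lambda>j. tr N (X j)) \<longlongrightarrow> tr N (op_adjoint D o\<^sub>L D)) \<U>"
    proof (rule trace_weak_limit[OF N ne Xm Xn])
      show "op_adjoint D o\<^sub>L D \<in> carrier N" by (intro tracial_mul_mem[OF N] tracial_adjoint_mem[OF N] Dm)
      show "((\<lambda>j. cinner x (blinfun_apply (X j) y)) \<longlongrightarrow> cinner x (blinfun_apply (op_adjoint D o\<^sub>L D) y)) \<U>" for x y
        unfolding X_def D_def[symmetric]
        by (simp add: op_adjoint_right[OF Db]) (simp add: D_def blinfun.diff_left cinner.diff_right tendsto_diff[OF w tendsto_const])
    qed
    moreover have "eventually (\<lambda>j. cmod (tr N (X j)) \<le> norm2 N D * e) \<U>"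
    proof -
      have "cmod (tr N (X j)) \<le> norm2 N D * e" if "j \<ge> J" for j
      proof -
        interpret N: tracial_star "carrier N" "(o\<^sub>L)" op_scale op_adjoint id_blinfun "tr N"
          by (rule tracial_vna_star[OF N])
        have "cmod (tr N (X j)) \<le> norm2 N D * norm2 N (T j - T k)"
          using N.Cauchy_Schwarz[OF Dm, of "T j - T k"] T by (simp add: X_def N.ip_def norm2_eq_n2[OF N] N.diff_mem)
        also have "\<dots> \<le> norm2 N D * e"
          using J[OF that k] norm2_nonneg[OF N Dm] by (intro mult_left_mono) auto
        finally show ?thesis .
      qed
      then have "eventually (\<lambda>j. cmod (tr N (X j)) \<le> norm2 N D * e) sequentially"
        unfolding eventually_sequentially by blast
      then show ?thesis using nonprincipal_ultrafilter_le_sequentially[OF U] by (simp add: filter_leD)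
    qed
    ultimately have "cmod (tr N (op_adjoint D o\<^sub>L D)) \<le> norm2 N D * e"
      by (intro tendsto_upperbound[OF tendsto_norm _ ne])
    then have "norm2 N D * norm2 N D \<le> norm2 N D * e"
      unfolding norm2_sq[OF N Dm] norm_of_real by (simp add: power2_eq_square)
    then have "norm2 N D \<le> e"
      using norm2_nonneg[OF N Dm] e by (cases "norm2 N D = 0") (auto simp: mult_le_cancel_left)
    then show ?thesis using norm2_commute[OF N Sm T(1)[of k]] by (simp add: D_def)
  qed
  have "(\<lambda>j. norm2 N (T j - S)) \<longlonglongrightarrow> 0"
  proof (rule LIMSEQ_I)
    fix r :: real assume r: "r > 0"
    then obtain J where J: "\<And>j k. j \<ge> J \<Longrightarrow> k \<ge> J \<Longrightarrow> norm2 N (T j - T k) < r / 2"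
      using cauchy[of "r/2"] by auto
    have "norm (norm2 N (T k - S) - 0) < r" if "k \<ge> J" for k
      using key[OF _ J that] r norm2_nonneg[OF N tracial_diff_mem[OF N T(1)[of k] Sm]] by simp
    then show "\<exists>no. \<forall>n\<ge>no. norm (norm2 N (T n - S) - 0) < r" by blast
  qed
  then show ?thesis using Sm by blast
qed

section \<open>Bounded sequences and ultrapowers\<close>

lemma bounded_seqs_iff: "x \<in> bounded_seqs N \<longleftrightarrow> (\<forall>n. x n \<in> carrier N) \<and> (\<exists>C. \<forall>n. norm (x n) \<le> C)"
  by (auto simp: bounded_seqs_def bounded_iff)

lemma bounded_seqsI: "(\<And>n. x n \<in> carrier N) \<Longrightarrow> (\<And>n. norm (x n) \<le> C) \<Longrightarrow> x \<in> bounded_seqs N"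
  by (auto simp: bounded_seqs_iff)

lemma bounded_seqs_mem: "x \<in> bounded_seqs N \<Longrightarrow> x n \<in> carrier N" by (simp add: bounded_seqs_iff)

lemma tendsto_zero_squeeze:
  fixes f g :: "'x \<Rightarrow> real"
  assumes "(g \<longlongrightarrow> 0) F" "\<And>n. 0 \<le> f n" "\<And>n. f n \<le> g n"
  shows "(f \<longlongrightarrow> 0) F"
  using assms by (intro tendsto_sandwich[of "\<lambda>_. 0" f F g]) auto

context
  fixes N :: "'r op tracial_alg"
  assumes N: "tracial_vna N"
begin

lemma
  shows bseq_add: "x \<in> bounded_seqs N \<Longrightarrow> y \<in> bounded_seqs N \<Longrightarrow> (\<lambda>n. x n + y n) \<in> bounded_seqs N"
    and bseq_mul: "x \<in> bounded_seqs N \<Longrightarrow> y \<in> bounded_seqs N \<Longrightarrow> (\<lambda>n. x n o\<^sub>L y n) \<in> bounded_seqs N"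
    and bseq_scale: "x \<in> bounded_seqs N \<Longrightarrow> (\<lambda>n. op_scale c (x n)) \<in> bounded_seqs N"
    and bseq_adjoint: "x \<in> bounded_seqs N \<Longrightarrow> (\<lambda>n. op_adjoint (x n)) \<in> bounded_seqs N"
    and bseq_const: "T \<in> carrier N \<Longrightarrow> (\<lambda>n. T) \<in> bounded_seqs N"
proof -
  show "(\<lambda>n. x n + y n) \<in> bounded_seqs N" if A: "x \<in> bounded_seqs N" "y \<in> bounded_seqs N"
  proof -
    obtain C D where "\<And>n. norm (x n) \<le> C" "\<And>n. norm (y n) \<le> D" using A by (auto simp: bounded_seqs_iff)
    then show ?thesis using A
      by (intro bounded_seqsI[of _ _ "C + D"]) (auto intro: tracial_add_mem[OF N] bounded_seqs_mem norm_triangle_mono)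
  qed
  show "(\<lambda>n. x n o\<^sub>L y n) \<in> bounded_seqs N" if A: "x \<in> bounded_seqs N" "y \<in> bounded_seqs N"
  proof -
    obtain C D where *: "\<And>n. norm (x n) \<le> C" "\<And>n. norm (y n) \<le> D" using A by (auto simp: bounded_seqs_iff)
    have "0 \<le> C" using *(1) norm_ge_zero order_trans by blast
    then show ?thesis using A *
      by (intro bounded_seqsI[of _ _ "C * D"] tracial_mul_mem[OF N] order_trans[OF norm_compose] mult_mono)
        (auto simp: bounded_seqs_mem)
  qed
  show "(\<lambda>n. op_scale c (x n)) \<in> bounded_seqs N" if A: "x \<in> bounded_seqs N"
  proof -
    obtain C where *: "\<And>n. norm (x n) \<le> C" using A by (auto simp: bounded_seqs_iff)
    then show ?thesis using A
      by (intro bounded_seqsI[of _ _ "cmod c * C"] tracial_scale_mem[OF N] order_trans[OF norm_op_scale] mult_left_mono)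
        (auto simp: bounded_seqs_mem)
  qed
  show "(\<lambda>n. op_adjoint (x n)) \<in> bounded_seqs N" if A: "x \<in> bounded_seqs N"
  proof -
    obtain C where *: "\<And>n. norm (x n) \<le> C" using A by (auto simp: bounded_seqs_iff)
    then show ?thesis using A
      by (intro bounded_seqsI[of _ _ C]) (auto simp: tracial_adjoint_mem[OF N] bounded_seqs_mem norm_op_adjoint tracial_bounded[OF N])
  qed
  show "T \<in> carrier N \<Longrightarrow> (\<lambda>n. T) \<in> bounded_seqs N" by (rule bounded_seqsI[of _ _ "norm T"]) auto
qed

lemma bseq_eval_poly:
  assumes "\<And>k. (\<lambda>n. x n k) \<in> bounded_seqs N" "\<And>k. (\<lambda>n. y n k) \<in> bounded_seqs N"
  shows "(\<lambda>n. eval_poly N (x n) (y n) p) \<in> bounded_seqs N"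
  by (induction p) (simp_all add: assms eval_poly_op[OF N] bseq_add bseq_mul bseq_scale
      bseq_adjoint bseq_const tracial_id_mem[OF N])

end

context
  fixes N :: "'r op tracial_alg" and \<U> :: "nat filter"
  assumes N: "tracial_vna N" and U: "nonprincipal_ultrafilter \<U>"
begin

abbreviation null_seq :: "(nat \<Rightarrow> 'r op) \<Rightarrow> bool" where
  "null_seq x \<equiv> ((\<lambda>n. norm2 N (x n)) \<longlongrightarrow> 0) \<U>"

lemma null_add:
  assumes "\<And>n. x n \<in> carrier N" "\<And>n. y n \<in> carrier N" "null_seq x" "null_seq y"
  shows "null_seq (\<lambda>n. x n + y n)"
  by (rule tendsto_zero_squeeze[OF tendsto_add_zero[OF assms(3,4)]])
    (use assms in \<open>auto intro!: norm2_nonneg[OF N] norm2_triangle[OF N] tracial_add_mem[OF N]\<close>)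

lemma null_commute:
  assumes "\<And>n. x n \<in> carrier N" "\<And>n. y n \<in> carrier N" "null_seq (\<lambda>n. x n - y n)"
  shows "null_seq (\<lambda>n. y n - x n)"
  using assms norm2_commute[OF N] by simp

lemma null_trans:
  assumes "\<And>n. x n \<in> carrier N" "\<And>n. y n \<in> carrier N" "\<And>n. z n \<in> carrier N"
    and "null_seq (\<lambda>n. x n - y n)" "null_seq (\<lambda>n. y n - z n)"
  shows "null_seq (\<lambda>n. x n - z n)"
  using null_add[of "\<lambda>n. x n - y n" "\<lambda>n. y n - z n"] assms by (simp add: tracial_diff_mem[OF N])

lemma null_scale:
  assumes "\<And>n. x n \<in> carrier N" "null_seq x" shows "null_seq (\<lambda>n. op_scale c (x n))"
  using assms tendsto_mult_right_zero[of "\<lambda>n. norm2 N (x n)" \<U> "cmod c"] by (simp add: norm2_scale[OF N])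

lemma null_diff_mult:
  assumes "x \<in> bounded_seqs N" "y \<in> bounded_seqs N" "x' \<in> bounded_seqs N" "y' \<in> bounded_seqs N"
    and "null_seq (\<lambda>n. x n - x' n)" "null_seq (\<lambda>n. y n - y' n)"
  shows "null_seq (\<lambda>n. (x n o\<^sub>L y n) - (x' n o\<^sub>L y' n))"
proof -
  obtain C where C: "\<And>n. norm (x n) \<le> C" using assms(1) by (auto simp: bounded_seqs_iff)
  obtain D where D: "\<And>n. norm (y' n) \<le> D" using assms(4) by (auto simp: bounded_seqs_iff)
  have "((\<lambda>n. C * norm2 N (y n - y' n) + norm2 N (x n - x' n) * D) \<longlongrightarrow> 0) \<U>"
    using tendsto_add[OF tendsto_mult_right_zero[OF assms(6), of C] tendsto_mult_left_zero[OF assms(5), of D]] by simp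
  then show ?thesis
  proof (rule tendsto_zero_squeeze)
    fix n
    note m = assms(1-4)[THEN bounded_seqs_mem, of n]
    show "0 \<le> norm2 N ((x n o\<^sub>L y n) - (x' n o\<^sub>L y' n))"
      using m by (intro norm2_nonneg[OF N] tracial_diff_mem[OF N] tracial_mul_mem[OF N])
    have "norm2 N ((x n o\<^sub>L y n) - (x' n o\<^sub>L y' n)) \<le> norm (x n) * norm2 N (y n - y' n) + norm2 N (x n - x' n) * norm (y' n)"
      using m by (intro norm2_diff_mult[OF N])
    also have "\<dots> \<le> C * norm2 N (y n - y' n) + norm2 N (x n - x' n) * D"
      using m C D by (intro add_mono mult_right_mono mult_left_mono) (auto intro!: norm2_nonneg[OF N] tracial_diff_mem[OF N])
    finally show "norm2 N ((x n o\<^sub>L y n) - (x' n o\<^sub>L y' n)) \<le> C * norm2 N (y n - y' n) + norm2 N (x n - x' n) * D" .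
  qed
qed

lemma null_adjoint:
  assumes "\<And>n. x n \<in> carrier N" "null_seq x" shows "null_seq (\<lambda>n. op_adjoint (x n))"
  using assms by (simp add: norm2_adjoint[OF N])

lemma null_tr:
  assumes "\<And>n. x n \<in> carrier N" "null_seq x" shows "((\<lambda>n. tr N (x n)) \<longlongrightarrow> 0) \<U>"
  by (rule tendsto_norm_zero_cancel, rule tendsto_zero_squeeze[OF assms(2)])
    (use assms in \<open>auto intro!: cmod_tr_le_norm2[OF N]\<close>)

lemma null_tr_eq:
  assumes "\<And>n. x n \<in> carrier N" "\<And>n. y n \<in> carrier N" "null_seq (\<lambda>n. x n - y n)" "((\<lambda>n. tr N (x n)) \<longlongrightarrow> l) \<U>"
  shows "((\<lambda>n. tr N (y n)) \<longlongrightarrow> l) \<U>"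
proof -
  have "((\<lambda>n. tr N (x n) - tr N (x n - y n)) \<longlongrightarrow> l - 0) \<U>"
    using assms by (intro tendsto_diff null_tr) (auto intro!: tracial_diff_mem[OF N])
  then show ?thesis using assms by (simp add: tracial_tr_diff[OF N])
qed

lemma null_norm2_eq:
  assumes "\<And>n. x n \<in> carrier N" "\<And>n. y n \<in> carrier N" "null_seq (\<lambda>n. x n - y n)"
    "((\<lambda>n. norm2 N (x n)) \<longlongrightarrow> l) \<U>"
  shows "((\<lambda>n. norm2 N (y n)) \<longlongrightarrow> l) \<U>"
proof -
  have "((\<lambda>n. norm2 N (y n) - norm2 N (x n)) \<longlongrightarrow> 0) \<U>"
  proof (rule tendsto_norm_zero_cancel, rule tendsto_zero_squeeze[OF assms(3)])
    fix n
    show "norm (norm2 N (y n) - norm2 N (x n)) \<le> norm2 N (x n - y n)"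
      using norm2_diff_le[OF N assms(1,2), of n n] norm2_diff_le[OF N assms(2,1), of n n] norm2_commute[OF N assms(1,2), of n n]
      by (simp add: abs_le_iff)
  qed simp
  from tendsto_add[OF this assms(4)] show ?thesis by simp
qed

lemma tr_bseq_convergent:
  assumes "x \<in> bounded_seqs N" shows "\<exists>l. ((\<lambda>n. tr N (x n)) \<longlongrightarrow> l) \<U>"
proof -
  obtain C where C: "\<And>n. norm (x n) \<le> C" using assms by (auto simp: bounded_seqs_iff)
  have "cmod (tr N (x n)) \<le> C" for n
    using cmod_tr_le_norm2[OF N bounded_seqs_mem[OF assms, of n]] norm2_le_norm[OF N bounded_seqs_mem[OF assms, of n]] C[of n]
    by linarith
  then show ?thesis by (rule ultrafilter_bounded_convergent[OF U])
qed

lemma equiv_ultra_rel: "equiv (bounded_seqs N) (ultra_rel \<U> N)"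
proof (rule equivI)
  show "ultra_rel \<U> N \<subseteq> bounded_seqs N \<times> bounded_seqs N" by (auto simp: ultra_rel_def)
  show "refl_on (bounded_seqs N) (ultra_rel \<U> N)"
    by (rule refl_onI) (auto simp: ultra_rel_def norm2_zero[OF N])
  show "sym (ultra_rel \<U> N)"
    by (rule symI) (auto simp: ultra_rel_def intro!: null_commute dest: bounded_seqs_mem)
  show "trans (ultra_rel \<U> N)"
    by (rule transI) (auto simp: ultra_rel_def intro: null_trans dest: bounded_seqs_mem)
qed

definition cl :: "(nat \<Rightarrow> 'r op) \<Rightarrow> (nat \<Rightarrow> 'r op) set" where "cl x = ultra_rel \<U> N `` {x}"

lemma cl_eq_iff: "x \<in> bounded_seqs N \<Longrightarrow> y \<in> bounded_seqs N \<Longrightarrow> cl x = cl y \<longleftrightarrow> null_seq (\<lambda>n. x n - y n)"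
  unfolding cl_def using eq_equiv_class_iff[OF equiv_ultra_rel, of x y] by (auto simp: ultra_rel_def)

lemma self_mem_cl: "x \<in> bounded_seqs N \<Longrightarrow> x \<in> cl x"
  unfolding cl_def by (rule equiv_class_self[OF equiv_ultra_rel])

lemma carrier_ultrapower: "carrier (ultrapower \<U> N) = cl ` bounded_seqs N"
  by (auto simp: ultrapower_def quotient_def cl_def)

lemma one_ultrapower: "\<one>\<^bsub>ultrapower \<U> N\<^esub> = cl (\<lambda>n. id_blinfun)"
  by (simp add: ultrapower_def cl_def operator_alg_simps[OF N])

lemma mult_ultrapower:
  assumes "x \<in> bounded_seqs N" "y \<in> bounded_seqs N"
  shows "cl x \<otimes>\<^bsub>ultrapower \<U> N\<^esub> cl y = cl (\<lambda>n. x n o\<^sub>L y n)"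
proof -
  have "congruent2 (ultra_rel \<U> N) (ultra_rel \<U> N) (\<lambda>x y. cl (\<lambda>n. x n o\<^sub>L y n))"
    unfolding congruent2_def by (auto simp: ultra_rel_def cl_eq_iff bseq_mul[OF N] intro!: null_diff_mult)
  from UN_equiv_class2[OF equiv_ultra_rel equiv_ultra_rel this assms]
  show ?thesis by (simp add: ultrapower_def cl_def operator_alg_simps[OF N])
qed

lemma add_ultrapower:
  assumes "x \<in> bounded_seqs N" "y \<in> bounded_seqs N"
  shows "cl x \<oplus>\<^bsub>ultrapower \<U> N\<^esub> cl y = cl (\<lambda>n. x n + y n)"
proof -
  have "null_seq (\<lambda>n. (x n + y n) - (x' n + y' n))"
    if "x \<in> bounded_seqs N" "y \<in> bounded_seqs N" "x' \<in> bounded_seqs N" "y' \<in> bounded_seqs N"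
      "null_seq (\<lambda>n. x n - x' n)" "null_seq (\<lambda>n. y n - y' n)" for x y x' y'
    using null_add[of "\<lambda>n. x n - x' n" "\<lambda>n. y n - y' n"] that
    by (simp add: tracial_diff_mem[OF N] bounded_seqs_mem add_diff_add)
  then have "congruent2 (ultra_rel \<U> N) (ultra_rel \<U> N) (\<lambda>x y. cl (\<lambda>n. x n + y n))"
    unfolding congruent2_def by (auto simp: ultra_rel_def cl_eq_iff bseq_add[OF N])
  from UN_equiv_class2[OF equiv_ultra_rel equiv_ultra_rel this assms]
  show ?thesis by (simp add: ultrapower_def cl_def operator_alg_simps[OF N])
qed

lemma smult_ultrapower:
  assumes "x \<in> bounded_seqs N"
  shows "c \<odot>\<^bsub>ultrapower \<U> N\<^esub> cl x = cl (\<lambda>n. op_scale c (x n))"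
proof -
  have "null_seq (\<lambda>n. op_scale c (x n) - op_scale c (x' n))"
    if "x \<in> bounded_seqs N" "x' \<in> bounded_seqs N" "null_seq (\<lambda>n. x n - x' n)" for x x'
  proof -
    have "op_scale c (x n) - op_scale c (x' n) = op_scale c (x n - x' n)" for n
      using op_scale_add_right[of c "x n - x' n" "x' n"] by simp
    then show ?thesis using null_scale[of "\<lambda>n. x n - x' n" c] that
      by (simp add: tracial_diff_mem[OF N] bounded_seqs_mem)
  qed
  then have "congruent (ultra_rel \<U> N) (\<lambda>x. cl (\<lambda>n. op_scale c (x n)))"
    unfolding congruent_def by (auto simp: ultra_rel_def cl_eq_iff bseq_scale[OF N])
  from UN_equiv_class[OF equiv_ultra_rel this assms]
  show ?thesis by (simp add: ultrapower_def cl_def operator_alg_simps[OF N])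
qed

lemma star_ultrapower:
  assumes "x \<in> bounded_seqs N"
  shows "star (ultrapower \<U> N) (cl x) = cl (\<lambda>n. op_adjoint (x n))"
proof -
  have "null_seq (\<lambda>n. op_adjoint (x n) - op_adjoint (x' n))"
    if "x \<in> bounded_seqs N" "x' \<in> bounded_seqs N" "null_seq (\<lambda>n. x n - x' n)" for x x'
    using null_adjoint[of "\<lambda>n. x n - x' n"] that
    by (simp add: tracial_diff_mem[OF N] bounded_seqs_mem tracial_adjoint_diff[OF N])
  then have "congruent (ultra_rel \<U> N) (\<lambda>x. cl (\<lambda>n. op_adjoint (x n)))"
    unfolding congruent_def by (auto simp: ultra_rel_def cl_eq_iff bseq_adjoint[OF N])
  from UN_equiv_class[OF equiv_ultra_rel this assms]
  show ?thesis by (simp add: ultrapower_def cl_def operator_alg_simps[OF N])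
qed

lemma tr_ultrapower:
  assumes x: "x \<in> bounded_seqs N" and l: "((\<lambda>n. tr N (x n)) \<longlongrightarrow> l) \<U>"
  shows "tr (ultrapower \<U> N) (cl x) = l"
proof -
  have "(THE l. \<forall>y\<in>cl x. ((\<lambda>n. tr N (y n)) \<longlongrightarrow> l) \<U>) = l"
  proof (rule the_equality)
    show "\<forall>y\<in>cl x. ((\<lambda>n. tr N (y n)) \<longlongrightarrow> l) \<U>"
      using x l by (auto simp: cl_def ultra_rel_def intro: null_tr_eq bounded_seqs_mem)
    fix l' assume "\<forall>y\<in>cl x. ((\<lambda>n. tr N (y n)) \<longlongrightarrow> l') \<U>"
    then have "((\<lambda>n. tr N (x n)) \<longlongrightarrow> l') \<U>" using self_mem_cl[OF x] by blast
    then show "l' = l" using l tendsto_unique[OF nonprincipal_ultrafilter_bot[OF U]] by blast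
  qed
  then show ?thesis by (simp add: ultrapower_def)
qed

end

text \<open>An embedding into the ultrapower in terms of representing sequences, the laws holding up
  to null sequences. Choosing representatives once avoids computing with classes.\<close>

definition asymp_embedding ::
    "('i op \<Rightarrow> nat \<Rightarrow> 'r op) \<Rightarrow> nat filter \<Rightarrow> 'i op tracial_alg \<Rightarrow> 'r op tracial_alg \<Rightarrow> bool" where
  "asymp_embedding s \<U> M N \<longleftrightarrow>
     (\<forall>u\<in>carrier M. s u \<in> bounded_seqs N) \<and>
     (\<forall>u\<in>carrier M. \<forall>v\<in>carrier M. null_seq N \<U> (\<lambda>n. s (u o\<^sub>L v) n - (s u n o\<^sub>L s v n))) \<and>
     (\<forall>u\<in>carrier M. \<forall>v\<in>carrier M. null_seq N \<U> (\<lambda>n. s (u + v) n - (s u n + s v n))) \<and>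
     null_seq N \<U> (\<lambda>n. s id_blinfun n - id_blinfun) \<and>
     (\<forall>c. \<forall>u\<in>carrier M. null_seq N \<U> (\<lambda>n. s (op_scale c u) n - op_scale c (s u n))) \<and>
     (\<forall>u\<in>carrier M. null_seq N \<U> (\<lambda>n. s (op_adjoint u) n - op_adjoint (s u n))) \<and>
     (\<forall>u\<in>carrier M. ((\<lambda>n. tr N (s u n)) \<longlongrightarrow> tr M u) \<U>)"

lemma asymp_embedding_iff:
  assumes M: "tracial_vna M" and N: "tracial_vna N" and U: "nonprincipal_ultrafilter \<U>"
    and s: "\<And>u. u \<in> carrier M \<Longrightarrow> s u \<in> bounded_seqs N"
  shows "asymp_embedding s \<U> M N \<longleftrightarrow> embedding (\<lambda>u. cl N \<U> (s u)) M (ultrapower \<U> N)"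
proof
  note bs = bseq_mul[OF N] bseq_add[OF N] bseq_scale[OF N] bseq_adjoint[OF N] bseq_const[OF N tracial_id_mem[OF N]]
  note ops = mult_ultrapower[OF N U] add_ultrapower[OF N U] smult_ultrapower[OF N U] star_ultrapower[OF N U]
    one_ultrapower[OF N U]
  note mem = tracial_mul_mem[OF M] tracial_add_mem[OF M] tracial_scale_mem[OF M] tracial_adjoint_mem[OF M] tracial_id_mem[OF M]
  note eq = cl_eq_iff[OF N U]
  {
    assume h: "embedding (\<lambda>u. cl N \<U> (s u)) M (ultrapower \<U> N)"
    define h where "h u = cl N \<U> (s u)" for u
    have hh: "\<And>u v. u \<in> carrier M \<Longrightarrow> v \<in> carrier M \<Longrightarrow> h (u o\<^sub>L v) = h u \<otimes>\<^bsub>ultrapower \<U> N\<^esub> h v"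
      "\<And>u v. u \<in> carrier M \<Longrightarrow> v \<in> carrier M \<Longrightarrow> h (u + v) = h u \<oplus>\<^bsub>ultrapower \<U> N\<^esub> h v"
      "h id_blinfun = \<one>\<^bsub>ultrapower \<U> N\<^esub>"
      "\<And>c u. u \<in> carrier M \<Longrightarrow> h (op_scale c u) = c \<odot>\<^bsub>ultrapower \<U> N\<^esub> h u"
      "\<And>u. u \<in> carrier M \<Longrightarrow> h (op_adjoint u) = star (ultrapower \<U> N) (h u)"
      "\<And>u. u \<in> carrier M \<Longrightarrow> tr (ultrapower \<U> N) (h u) = tr M u"
      using h by (auto simp: embedding_def ring_hom_def operator_alg_simps[OF M] h_def)
    show "asymp_embedding s \<U> M N"
      unfolding asymp_embedding_def
    proof (intro conjI ballI allI)
      fix u v c assume u: "u \<in> carrier M"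
      show "s u \<in> bounded_seqs N" using s u by blast
      show "null_seq N \<U> (\<lambda>n. s (op_scale c u) n - op_scale c (s u n))"
        using hh(4)[OF u, of c] u by (simp add: s mem ops bs eq h_def)
      show "null_seq N \<U> (\<lambda>n. s (op_adjoint u) n - op_adjoint (s u n))"
        using hh(5)[OF u] u by (simp add: s mem ops bs eq h_def)
      obtain l where l: "((\<lambda>n. tr N (s u n)) \<longlongrightarrow> l) \<U>" using tr_bseq_convergent[OF N U s[OF u]] by blast
      then have "l = tr M u" using tr_ultrapower[OF N U s[OF u] l] hh(6)[OF u] by (simp add: h_def)
      then show "((\<lambda>n. tr N (s u n)) \<longlongrightarrow> tr M u) \<U>" using l by simp
      assume v: "v \<in> carrier M"
      show "null_seq N \<U> (\<lambda>n. s (u o\<^sub>L v) n - (s u n o\<^sub>L s v n))"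
        using hh(1)[OF u v] u v by (simp add: s mem ops bs eq h_def)
      show "null_seq N \<U> (\<lambda>n. s (u + v) n - (s u n + s v n))"
        using hh(2)[OF u v] u v by (simp add: s mem ops bs eq h_def)
    next
      show "null_seq N \<U> (\<lambda>n. s id_blinfun n - id_blinfun)"
        using hh(3) by (simp add: s mem ops bs eq h_def)
    qed
  }
  assume "asymp_embedding s \<U> M N"
  then show "embedding (\<lambda>u. cl N \<U> (s u)) M (ultrapower \<U> N)"
    unfolding embedding_def ring_hom_def
    by (auto simp: asymp_embedding_def operator_alg_simps[OF M] carrier_ultrapower[OF N U] s mem ops bs eq
        intro!: tr_ultrapower[OF N U])
qed

lemma embedding_cong:
  assumes M: "tracial_vna M" and h: "embedding h M P" and eq: "\<And>u. u \<in> carrier M \<Longrightarrow> h' u = h u"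
  shows "embedding h' M P"
  using h unfolding embedding_def ring_hom_def
  by (auto simp: eq operator_alg_simps[OF M] tracial_mul_mem[OF M] tracial_add_mem[OF M] tracial_scale_mem[OF M]
      tracial_adjoint_mem[OF M] tracial_id_mem[OF M])

lemma embedding_ultrapower_iff:
  assumes M: "tracial_vna M" and N: "tracial_vna N" and U: "nonprincipal_ultrafilter \<U>"
  shows "(\<exists>h. embedding h M (ultrapower \<U> N)) \<longleftrightarrow> (\<exists>s. asymp_embedding s \<U> M N)"
proof
  assume "\<exists>h. embedding h M (ultrapower \<U> N)"
  then obtain h where h: "embedding h M (ultrapower \<U> N)" by blast
  have "\<exists>x\<in>bounded_seqs N. h u = cl N \<U> x" if "u \<in> carrier M" for u
  proof -
    have "h u \<in> carrier (ultrapower \<U> N)" using h that by (auto simp: embedding_def ring_hom_def)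
    then show ?thesis using carrier_ultrapower[OF N U] by blast
  qed
  then obtain s where s: "\<And>u. u \<in> carrier M \<Longrightarrow> s u \<in> bounded_seqs N" "\<And>u. u \<in> carrier M \<Longrightarrow> h u = cl N \<U> (s u)"
    by metis
  have "embedding (\<lambda>u. cl N \<U> (s u)) M (ultrapower \<U> N)" by (rule embedding_cong[OF M h]) (simp add: s(2))
  then have "asymp_embedding s \<U> M N" using asymp_embedding_iff[of M N \<U> s] M N U s(1) by simp
  then show "\<exists>s. asymp_embedding s \<U> M N" by blast
next
  assume "\<exists>s. asymp_embedding s \<U> M N"
  then obtain s where s: "asymp_embedding s \<U> M N" by blast
  then have "\<And>u. u \<in> carrier M \<Longrightarrow> s u \<in> bounded_seqs N" by (simp add: asymp_embedding_def)
  then have "embedding (\<lambda>u. cl N \<U> (s u)) M (ultrapower \<U> N)"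
    using asymp_embedding_iff[of M N \<U> s] M N U s by simp
  then show "\<exists>h. embedding h M (ultrapower \<U> N)" by blast
qed

context
  fixes M :: "'i op tracial_alg" and N :: "'r op tracial_alg" and \<U> s
  assumes M: "tracial_vna M" and N: "tracial_vna N" and U: "nonprincipal_ultrafilter \<U>"
    and s: "asymp_embedding s \<U> M N"
begin

lemma
  shows ae_bseq: "u \<in> carrier M \<Longrightarrow> s u \<in> bounded_seqs N"
    and ae_mult: "u \<in> carrier M \<Longrightarrow> v \<in> carrier M \<Longrightarrow> null_seq N \<U> (\<lambda>n. s (u o\<^sub>L v) n - (s u n o\<^sub>L s v n))"
    and ae_add: "u \<in> carrier M \<Longrightarrow> v \<in> carrier M \<Longrightarrow> null_seq N \<U> (\<lambda>n. s (u + v) n - (s u n + s v n))"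
    and ae_one: "null_seq N \<U> (\<lambda>n. s id_blinfun n - id_blinfun)"
    and ae_scale: "u \<in> carrier M \<Longrightarrow> null_seq N \<U> (\<lambda>n. s (op_scale c u) n - op_scale c (s u n))"
    and ae_adjoint: "u \<in> carrier M \<Longrightarrow> null_seq N \<U> (\<lambda>n. s (op_adjoint u) n - op_adjoint (s u n))"
    and ae_tr: "u \<in> carrier M \<Longrightarrow> ((\<lambda>n. tr N (s u n)) \<longlongrightarrow> tr M u) \<U>"
  using s by (auto simp: asymp_embedding_def)

lemma ae_mem: "u \<in> carrier M \<Longrightarrow> s u n \<in> carrier N"
  using ae_bseq bounded_seqs_mem by blast

lemma ae_norm2:
  assumes u: "u \<in> carrier M" shows "((\<lambda>n. norm2 N (s u n)) \<longlongrightarrow> norm2 M u) \<U>"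
proof -
  note a = tracial_adjoint_mem[OF M u]
  have "null_seq N \<U> (\<lambda>n. s (op_adjoint u o\<^sub>L u) n - (op_adjoint (s u n) o\<^sub>L s u n))"
  proof (rule null_trans[OF N U])
    show "null_seq N \<U> (\<lambda>n. s (op_adjoint u o\<^sub>L u) n - (s (op_adjoint u) n o\<^sub>L s u n))"
      by (rule ae_mult[OF a u])
    show "null_seq N \<U> (\<lambda>n. (s (op_adjoint u) n o\<^sub>L s u n) - (op_adjoint (s u n) o\<^sub>L s u n))"
      using ae_adjoint[OF u] norm2_zero[OF N] by (intro null_diff_mult[OF N U]) (auto intro: ae_bseq u a bseq_adjoint[OF N])
  qed (auto intro!: ae_mem tracial_mul_mem[OF M] tracial_mul_mem[OF N] tracial_adjoint_mem[OF N] u a)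
  then have "((\<lambda>n. tr N (op_adjoint (s u n) o\<^sub>L s u n)) \<longlongrightarrow> tr M (op_adjoint u o\<^sub>L u)) \<U>"
    by (intro null_tr_eq[OF N U _ _ _ ae_tr]) (auto intro!: ae_mem tracial_mul_mem[OF M] tracial_mul_mem[OF N] tracial_adjoint_mem[OF N] u a)
  then have "((\<lambda>n. sqrt (Re (tr N (op_adjoint (s u n) o\<^sub>L s u n)))) \<longlongrightarrow> sqrt (Re (tr M (op_adjoint u o\<^sub>L u)))) \<U>"
    by (intro tendsto_real_sqrt tendsto_Re)
  then show ?thesis by (simp add: norm2_def operator_alg_simps[OF N] operator_alg_simps[OF M])
qed

lemma ae_diff:
  assumes u: "u \<in> carrier M" and v: "v \<in> carrier M"
  shows "null_seq N \<U> (\<lambda>n. s (u - v) n - (s u n - s v n))"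
proof -
  note m = tracial_scale_mem[OF M v, of "-1"]
  have "null_seq N \<U> (\<lambda>n. s (u + op_scale (-1) v) n - (s u n + s (op_scale (-1) v) n))" by (rule ae_add[OF u m])
  moreover have "null_seq N \<U> (\<lambda>n. (s u n + s (op_scale (-1) v) n) - (s u n + op_scale (-1) (s v n)))"
    using ae_scale[OF v, of "-1"] by simp
  ultimately have "null_seq N \<U> (\<lambda>n. s (u + op_scale (-1) v) n - (s u n + op_scale (-1) (s v n)))"
    by (rule null_trans[OF N U, rotated -2]) (auto intro!: ae_mem tracial_add_mem[OF M] tracial_add_mem[OF N] tracial_scale_mem[OF N] u v m)
  then show ?thesis by (simp add: op_scale_minus_one)
qed

lemma ae_norm2_diff:
  assumes u: "u \<in> carrier M" and v: "v \<in> carrier M"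
  shows "((\<lambda>n. norm2 N (s u n - s v n)) \<longlongrightarrow> norm2 M (u - v)) \<U>"
  by (rule null_norm2_eq[OF N U _ _ ae_diff[OF u v] ae_norm2])
    (auto intro!: ae_mem tracial_diff_mem[OF M] tracial_diff_mem[OF N] u v)

lemma ae_poly:
  assumes c: "\<And>k. c k \<in> carrier M" "\<And>k. a k \<in> carrier M"
  shows "null_seq N \<U> (\<lambda>n. s (eval_poly M c a p) n - eval_poly N (\<lambda>k. s (c k) n) (\<lambda>k. s (a k) n) p)"
proof (induction p)
  let ?e = "eval_poly M c a" and ?E = "\<lambda>p n. eval_poly N (\<lambda>k. s (c k) n) (\<lambda>k. s (a k) n) p"
  have eM: "?e p \<in> carrier M" for p by (rule eval_poly_mem[OF M c])
  have bE: "?E p \<in> bounded_seqs N" for p by (rule bseq_eval_poly[OF N]) (auto intro: ae_bseq c)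
  have EN: "?E p n \<in> carrier N" for p n using bE bounded_seqs_mem by blast
  note mem = ae_mem eM EN tracial_add_mem[OF M] tracial_add_mem[OF N] tracial_mul_mem[OF M] tracial_mul_mem[OF N]
    tracial_scale_mem[OF M] tracial_scale_mem[OF N] tracial_adjoint_mem[OF M] tracial_adjoint_mem[OF N] tracial_diff_mem[OF N]
  {
    case (XVar k) show ?case by (simp add: norm2_zero[OF N])
  next
    case (YVar k) show ?case by (simp add: norm2_zero[OF N])
  next
    case Unit show ?case using ae_one by (simp add: eval_poly_op[OF M] eval_poly_op[OF N])
  next
    case (Plus p q)
    have "null_seq N \<U> (\<lambda>n. s (?e p + ?e q) n - (s (?e p) n + s (?e q) n))" by (rule ae_add[OF eM eM])
    moreover have "null_seq N \<U> (\<lambda>n. (s (?e p) n + s (?e q) n) - (?E p n + ?E q n))"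
      using null_add[OF N U _ _ Plus] by (simp add: mem add_diff_add)
    ultimately have "null_seq N \<U> (\<lambda>n. s (?e p + ?e q) n - (?E p n + ?E q n))"
      by (rule null_trans[OF N U, rotated -2]) (auto intro!: mem)
    then show ?case by (simp add: eval_poly_op[OF M] eval_poly_op[OF N])
  next
    case (Times p q)
    have "null_seq N \<U> (\<lambda>n. s (?e p o\<^sub>L ?e q) n - (s (?e p) n o\<^sub>L s (?e q) n))" by (rule ae_mult[OF eM eM])
    moreover have "null_seq N \<U> (\<lambda>n. (s (?e p) n o\<^sub>L s (?e q) n) - (?E p n o\<^sub>L ?E q n))"
      by (rule null_diff_mult[OF N U ae_bseq[OF eM] ae_bseq[OF eM] bE bE Times])
    ultimately have "null_seq N \<U> (\<lambda>n. s (?e p o\<^sub>L ?e q) n - (?E p n o\<^sub>L ?E q n))"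
      by (rule null_trans[OF N U, rotated -2]) (auto intro!: mem)
    then show ?case by (simp add: eval_poly_op[OF M] eval_poly_op[OF N])
  next
    case (Scale z p)
    have sd: "op_scale z (x - y) = op_scale z x - op_scale z y" for x y :: "'r op"
      using op_scale_add_right[of z "x - y" y] by simp
    have "null_seq N \<U> (\<lambda>n. s (op_scale z (?e p)) n - op_scale z (s (?e p) n))" by (rule ae_scale[OF eM])
    moreover have "null_seq N \<U> (\<lambda>n. op_scale z (s (?e p) n) - op_scale z (?E p n))"
      using null_scale[OF N U _ Scale, of z] by (simp add: mem sd)
    ultimately have "null_seq N \<U> (\<lambda>n. s (op_scale z (?e p)) n - op_scale z (?E p n))"
      by (rule null_trans[OF N U, rotated -2]) (auto intro!: mem)
    then show ?case by (simp add: eval_poly_op[OF M] eval_poly_op[OF N])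
  next
    case (Star p)
    have "null_seq N \<U> (\<lambda>n. s (op_adjoint (?e p)) n - op_adjoint (s (?e p) n))" by (rule ae_adjoint[OF eM])
    moreover have "null_seq N \<U> (\<lambda>n. op_adjoint (s (?e p) n) - op_adjoint (?E p n))"
      using null_adjoint[OF N U _ Star] by (simp add: mem tracial_adjoint_diff[OF N])
    ultimately have "null_seq N \<U> (\<lambda>n. s (op_adjoint (?e p)) n - op_adjoint (?E p n))"
      by (rule null_trans[OF N U, rotated -2]) (auto intro!: mem)
    then show ?case by (simp add: eval_poly_op[OF M] eval_poly_op[OF N])
  }
qed

lemma ae_moments:
  assumes c: "\<And>k. c k \<in> carrier M" "\<And>k. a k \<in> carrier M"
  shows "((\<lambda>n. tr N (eval_poly N (\<lambda>k. s (c k) n) (\<lambda>k. s (a k) n) p)) \<longlongrightarrow> tr M (eval_poly M c a p)) \<U>"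
  by (rule null_tr_eq[OF N U _ _ ae_poly[OF c] ae_tr]) (auto intro!: ae_mem eval_poly_mem[OF M] eval_poly_mem[OF N] c)

end

text \<open>
  \<open>y i\<close> is a subsequence with rate \<open>1 / (i + 1)\<close>; the diagonal sequence takes at \<open>n\<close> the value of the
  latest \<open>y m\<close>, \<open>m \<le> n\<close>, that is still compatible at \<open>n\<close> with all earlier ones.
\<close>

lemma bounded_seqs_complete:
  fixes x :: "nat \<Rightarrow> nat \<Rightarrow> 'r op"
  assumes N: "tracial_vna N" and U: "nonprincipal_ultrafilter \<U>"
    and x: "\<And>j n. x j n \<in> carrier N" "\<And>j n. norm (x j n) \<le> C"
    and cauchy: "\<And>e. e > 0 \<Longrightarrow> \<exists>J. \<forall>j\<ge>J. \<forall>k\<ge>J. eventually (\<lambda>n. norm2 N (x j n - x k n) < e) \<U>"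
  shows "\<exists>\<xi>. (\<forall>n. \<xi> n \<in> carrier N \<and> norm (\<xi> n) \<le> C) \<and>
    (\<forall>e>0. \<exists>J. \<forall>j\<ge>J. eventually (\<lambda>n. norm2 N (\<xi> n - x j n) < e) \<U>)"
proof -
  define \<delta> where "\<delta> i = 1 / (real i + 1)" for i :: nat
  have \<delta>: "\<delta> i > 0" for i by (simp add: \<delta>_def)
  have "\<exists>J. \<forall>i. \<forall>j\<ge>J i. \<forall>k\<ge>J i. eventually (\<lambda>n. norm2 N (x j n - x k n) < \<delta> i) \<U>"
    by (rule choice) (use cauchy[OF \<delta>] in blast)
  then obtain J where J: "\<And>i j k. j \<ge> J i \<Longrightarrow> k \<ge> J i \<Longrightarrow> eventually (\<lambda>n. norm2 N (x j n - x k n) < \<delta> i) \<U>"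
    by blast
  \<comment> \<open>A sum, so that \<open>\<phi> m\<close> is at least each \<open>J i\<close> with
    \<open>i \<le> m\<close> and all earlier rates apply to \<open>y m\<close>.\<close>
  define \<phi> where "\<phi> i = (\<Sum>l\<le>i. J l)" for i
  have \<phi>: "J i \<le> \<phi> m" if "i \<le> m" for i m
    unfolding \<phi>_def using that by (intro member_le_sum) auto
  define y where "y i = x (\<phi> i)" for i
  \<comment> \<open>The clause \<open>m \<le> n\<close> makes the set of good indices finite, and 0
    is always good, so the maximum \<open>K n\<close> exists.\<close>
  define good where "good n m \<longleftrightarrow> m \<le> n \<and> (\<forall>i\<le>m. norm2 N (y i n - y m n) < \<delta> i)" for n m
  have ev: "eventually (\<lambda>n. good n m) \<U>" for m
  proof -
    have "eventually (\<lambda>n. m \<le> n) \<U>"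
      using nonprincipal_ultrafilter_le_sequentially[OF U] eventually_ge_at_top by (rule filter_leD)
    moreover have "eventually (\<lambda>n. \<forall>i\<in>{..m}. norm2 N (y i n - y m n) < \<delta> i) \<U>"
      by (rule eventually_ball_finite) (auto simp: y_def intro!: J \<phi>)
    ultimately show ?thesis by eventually_elim (auto simp: good_def)
  qed
  have g0: "good n 0" for n by (simp add: good_def norm2_zero[OF N] \<delta>)
  have fin: "finite {m. good n m}" for n by (rule finite_subset[of _ "{..n}"]) (auto simp: good_def)
  define K where "K n = Max {m. good n m}" for n
  have K: "good n (K n)" for n using Max_in[OF fin, of n] g0 unfolding K_def by blast
  define \<xi> where "\<xi> n = y (K n) n" for n
  have close: "eventually (\<lambda>n. norm2 N (\<xi> n - y i n) < \<delta> i) \<U>" for i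
    using ev[of i]
  proof eventually_elim
    case (elim n)
    then have "i \<le> K n" unfolding K_def by (intro Max_ge fin) simp
    then have "norm2 N (y i n - y (K n) n) < \<delta> i" using K[of n] by (simp add: good_def)
    then show ?case using norm2_commute[OF N] x by (simp add: \<xi>_def y_def)
  qed
  have "\<exists>J. \<forall>j\<ge>J. eventually (\<lambda>n. norm2 N (\<xi> n - x j n) < e) \<U>" if e: "e > 0" for e
  proof -
    obtain i where i: "\<delta> i < e / 2"
      using reals_Archimedean[of "e/2"] e unfolding \<delta>_def by (auto simp: inverse_eq_divide add.commute)
    have "eventually (\<lambda>n. norm2 N (\<xi> n - x j n) < e) \<U>" if "j \<ge> J i" for j
      using close[of i] J[OF \<phi>[OF order_refl] that]
    proof eventually_elim
      case (elim n)
      have "norm2 N (\<xi> n - x j n) \<le> norm2 N (\<xi> n - y i n) + norm2 N (y i n - x j n)"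
        using x by (intro norm2_diff_triangle[OF N]) (auto simp: \<xi>_def y_def)
      then show ?case using elim i by (simp add: y_def)
    qed
    then show ?thesis by blast
  qed
  moreover have "\<xi> n \<in> carrier N \<and> norm (\<xi> n) \<le> C" for n using x by (simp add: \<xi>_def y_def)
  ultimately show ?thesis by blast
qed

section \<open>Embeddings from convergence of moments\<close>

context
  fixes M :: "'i op tracial_alg" and N :: "'r op tracial_alg" and \<U> :: "nat filter"
    and c a :: "nat \<Rightarrow> 'i op" and x y :: "nat \<Rightarrow> nat \<Rightarrow> 'r op" and r r' :: "nat \<Rightarrow> real"
  assumes M: "tracial_vna M" and N: "tracial_vna N" and U: "nonprincipal_ultrafilter \<U>"
    and ca: "\<And>k. c k \<in> carrier M" "\<And>k. a k \<in> carrier M"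
    and xy: "\<And>n. bounded_tuple N r r' (x n) (y n)"
    and moments: "\<And>p. ((\<lambda>n. tr N (eval_poly N (x n) (y n) p)) \<longlongrightarrow> tr M (eval_poly M c a p)) \<U>"
begin

abbreviation "pe \<equiv> eval_poly M c a"
abbreviation "pE p n \<equiv> eval_poly N (x n) (y n) p"

text \<open>A relation in place of a map, with one and the same polynomial serving on both sides.
  All laws are checked for the relation, and a map is selected from it only at the end.\<close>

definition corr :: "'i op \<Rightarrow> (nat \<Rightarrow> 'r op) \<Rightarrow> bool" where
  "corr u \<xi> \<longleftrightarrow> u \<in> carrier M \<and> \<xi> \<in> bounded_seqs N \<and>
     (\<forall>e>0. \<exists>p. norm2 M (u - pe p) < e \<and> eventually (\<lambda>n. norm2 N (\<xi> n - pE p n) < e) \<U>)"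

lemma pe_mem: "pe p \<in> carrier M" by (rule eval_poly_mem[OF M ca])
lemma pE_mem: "pE p n \<in> carrier N" by (rule bounded_tuple_eval_mem[OF N xy])
lemma pE_bseq: "pE p \<in> bounded_seqs N"
  by (rule bounded_seqsI[OF pE_mem norm_eval_poly_le[OF N xy]])

lemma corr_mem: "corr u \<xi> \<Longrightarrow> u \<in> carrier M" "corr u \<xi> \<Longrightarrow> \<xi> \<in> bounded_seqs N" "corr u \<xi> \<Longrightarrow> \<xi> n \<in> carrier N"
  by (auto simp: corr_def bounded_seqs_mem)

lemma corr_approx: "corr u \<xi> \<Longrightarrow> e > 0 \<Longrightarrow> \<exists>p. norm2 M (u - pe p) < e \<and> eventually (\<lambda>n. norm2 N (\<xi> n - pE p n) < e) \<U>"
  by (auto simp: corr_def)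

lemma norm2_moments: "((\<lambda>n. norm2 N (pE p n - pE q n)) \<longlongrightarrow> norm2 M (pe p - pe q)) \<U>"
proof -
  define d where "d = Plus p (Scale (-1) q)"
  have "((\<lambda>n. sqrt (Re (tr N (pE (Times (Star d) d) n)))) \<longlongrightarrow> sqrt (Re (tr M (pe (Times (Star d) d))))) \<U>"
    by (intro tendsto_real_sqrt tendsto_Re moments)
  then show ?thesis
    by (simp add: norm2_def d_def eval_poly_op[OF M] eval_poly_op[OF N] operator_alg_simps[OF M]
        operator_alg_simps[OF N] op_scale_minus_one)
qed

lemma eventually_norm2_less: "norm2 M (pe p - pe q) < e \<Longrightarrow> eventually (\<lambda>n. norm2 N (pE p n - pE q n) < e) \<U>"
  using norm2_moments by (rule order_tendstoD)

lemma corr_pe: "corr (pe p) (pE p)"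
  unfolding corr_def by (auto simp: pe_mem pE_bseq norm2_zero[OF M] norm2_zero[OF N] intro!: exI[of _ p])

lemma corr_one: "corr id_blinfun (\<lambda>n. id_blinfun)"
  using corr_pe[of Unit] by (simp add: eval_poly_op[OF M] eval_poly_op[OF N])

text \<open>Polynomials \<open>p\<close> and \<open>q\<close> approximating the same
  \<open>u\<close> are close in \<open>M\<close>. Their squared distance is a moment, so they are
  eventually close in \<open>N\<close>, and so are the two sequences.\<close>

lemma corr_unique:
  assumes "corr u \<xi>" "corr u \<eta>" shows "null_seq N \<U> (\<lambda>n. \<xi> n - \<eta> n)"
proof (rule tendstoI)
  fix e :: real assume "e > 0"
  then have e: "e / 4 > 0" by simp
  obtain p where p: "norm2 M (u - pe p) < e / 4" "eventually (\<lambda>n. norm2 N (\<xi> n - pE p n) < e / 4) \<U>"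
    using corr_approx[OF assms(1) e] by blast
  obtain q where q: "norm2 M (u - pe q) < e / 4" "eventually (\<lambda>n. norm2 N (\<eta> n - pE q n) < e / 4) \<U>"
    using corr_approx[OF assms(2) e] by blast
  note um = corr_mem(1)[OF assms(1)]
  have "norm2 M (pe p - pe q) \<le> norm2 M (pe p - u) + norm2 M (u - pe q)"
    by (intro norm2_diff_triangle[OF M] pe_mem um)
  then have "norm2 M (pe p - pe q) < e / 2" using p(1) q(1) norm2_commute[OF M um pe_mem] by simp
  then have "eventually (\<lambda>n. norm2 N (pE p n - pE q n) < e / 2) \<U>" by (rule eventually_norm2_less)
  with p(2) q(2) show "eventually (\<lambda>n. dist (norm2 N (\<xi> n - \<eta> n)) 0 < e) \<U>"
  proof eventually_elim
    case (elim n)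
    note m = corr_mem(3)[OF assms(1)] corr_mem(3)[OF assms(2)] pE_mem
    have "norm2 N (\<xi> n - \<eta> n) \<le> norm2 N (\<xi> n - pE p n) + norm2 N (pE p n - \<eta> n)"
      by (intro norm2_diff_triangle[OF N] m)
    also have "norm2 N (pE p n - \<eta> n) \<le> norm2 N (pE p n - pE q n) + norm2 N (pE q n - \<eta> n)"
      by (intro norm2_diff_triangle[OF N] m)
    finally show ?case
      using elim norm2_commute[OF N m(2) m(3)] norm2_nonneg[OF N tracial_diff_mem[OF N m(1) m(2)]] by simp
  qed
qed

lemma corr_add:
  assumes "corr u \<xi>" "corr v \<eta>" shows "corr (u + v) (\<lambda>n. \<xi> n + \<eta> n)"
  unfolding corr_def
proof (intro conjI allI impI)
  show "u + v \<in> carrier M" "(\<lambda>n. \<xi> n + \<eta> n) \<in> bounded_seqs N"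
    using assms by (auto intro!: tracial_add_mem[OF M] bseq_add[OF N] dest: corr_mem(1,2))
  fix e :: real assume "e > 0"
  then have e: "e / 2 > 0" by simp
  obtain p where p: "norm2 M (u - pe p) < e / 2" "eventually (\<lambda>n. norm2 N (\<xi> n - pE p n) < e / 2) \<U>"
    using corr_approx[OF assms(1) e] by blast
  obtain q where q: "norm2 M (v - pe q) < e / 2" "eventually (\<lambda>n. norm2 N (\<eta> n - pE q n) < e / 2) \<U>"
    using corr_approx[OF assms(2) e] by blast
  show "\<exists>p. norm2 M (u + v - pe p) < e \<and> eventually (\<lambda>n. norm2 N (\<xi> n + \<eta> n - pE p n) < e) \<U>"
  proof (intro exI[of _ "Plus p q"] conjI)
    have "norm2 M (u + v - (pe p + pe q)) \<le> norm2 M (u - pe p) + norm2 M (v - pe q)"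
      by (intro norm2_diff2[OF M] pe_mem corr_mem(1)[OF assms(1)] corr_mem(1)[OF assms(2)])
    then show "norm2 M (u + v - pe (Plus p q)) < e" using p(1) q(1) by (simp add: eval_poly_op[OF M])
    from p(2) q(2) show "eventually (\<lambda>n. norm2 N (\<xi> n + \<eta> n - pE (Plus p q) n) < e) \<U>"
    proof eventually_elim
      case (elim n)
      have "norm2 N (\<xi> n + \<eta> n - (pE p n + pE q n)) \<le> norm2 N (\<xi> n - pE p n) + norm2 N (\<eta> n - pE q n)"
        by (intro norm2_diff2[OF N] pE_mem corr_mem(3)[OF assms(1)] corr_mem(3)[OF assms(2)])
      then show ?case using elim by (simp add: eval_poly_op[OF N])
    qed
  qed
qed

lemma corr_adjoint:
  assumes "corr u \<xi>" shows "corr (op_adjoint u) (\<lambda>n. op_adjoint (\<xi> n))"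
  unfolding corr_def
proof (intro conjI allI impI)
  note um = corr_mem(1)[OF assms] and xm = corr_mem(3)[OF assms]
  show "op_adjoint u \<in> carrier M" "(\<lambda>n. op_adjoint (\<xi> n)) \<in> bounded_seqs N"
    using assms by (auto intro!: tracial_adjoint_mem[OF M] bseq_adjoint[OF N] dest: corr_mem(1,2))
  fix e :: real assume e: "e > 0"
  obtain p where p: "norm2 M (u - pe p) < e" "eventually (\<lambda>n. norm2 N (\<xi> n - pE p n) < e) \<U>"
    using corr_approx[OF assms(1) e] by blast
  show "\<exists>p. norm2 M (op_adjoint u - pe p) < e \<and> eventually (\<lambda>n. norm2 N (op_adjoint (\<xi> n) - pE p n) < e) \<U>"
    using p norm2_adjoint[OF M tracial_diff_mem[OF M um pe_mem]] norm2_adjoint[OF N tracial_diff_mem[OF N xm pE_mem]]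
    by (intro exI[of _ "Star p"]) (simp add: eval_poly_op[OF M] eval_poly_op[OF N] tracial_adjoint_diff[OF M um pe_mem]
       tracial_adjoint_diff[OF N xm pE_mem])
qed

text \<open>As for closures of algebras, \<open>q\<close> is fixed before \<open>p\<close>, since
  the accuracy of \<open>p\<close> depends on the norms of the values of \<open>q\<close>, in
  \<open>M\<close> and along the sequence.\<close>

lemma corr_mult:
  assumes u: "corr u \<xi>" and v: "corr v \<eta>" shows "corr (u o\<^sub>L v) (\<lambda>n. \<xi> n o\<^sub>L \<eta> n)"
  unfolding corr_def
proof (intro conjI allI impI)
  note um = corr_mem(1)[OF u] and vm = corr_mem(1)[OF v] and xm = corr_mem(3)[OF u] and ym = corr_mem(3)[OF v]
  show "u o\<^sub>L v \<in> carrier M" "(\<lambda>n. \<xi> n o\<^sub>L \<eta> n) \<in> bounded_seqs N"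
    using assms by (auto intro!: tracial_mul_mem[OF M] bseq_mul[OF N] dest: corr_mem(1,2))
  fix e :: real assume e: "e > 0"
  obtain C0 where C0: "\<And>n. norm (\<xi> n) \<le> C0" using corr_mem(2)[OF u] by (auto simp: bounded_seqs_iff)
  define C where "C = max C0 (norm u) + 1"
  have C: "norm (\<xi> n) \<le> C" "norm u \<le> C" "C > 0" for n
    using C0[of n] norm_ge_zero[of u] by (auto simp: C_def le_max_iff_disj intro: add_nonneg_pos)
  obtain q where q: "norm2 M (v - pe q) < e / (2 * C)" "eventually (\<lambda>n. norm2 N (\<eta> n - pE q n) < e / (2 * C)) \<U>"
    using corr_approx[OF v, of "e / (2 * C)"] e C(3) by auto
  obtain D0 where D0: "\<And>n. norm (pE q n) \<le> D0" using pE_bseq[of q] unfolding bounded_seqs_iff by blast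
  define D where "D = max D0 (norm (pe q)) + 1"
  have D: "norm (pE q n) \<le> D" "norm (pe q) \<le> D" "D > 0" for n
    using D0[of n] norm_ge_zero[of "pe q"] by (auto simp: D_def le_max_iff_disj intro: add_nonneg_pos)
  obtain p where p: "norm2 M (u - pe p) < e / (2 * D)" "eventually (\<lambda>n. norm2 N (\<xi> n - pE p n) < e / (2 * D)) \<U>"
    using corr_approx[OF u, of "e / (2 * D)"] e D(3) by auto
  have fin: "A * s + t * B < e" if "A \<le> C" "0 \<le> s" "s < e / (2 * C)" "0 \<le> t" "t < e / (2 * D)" "B \<le> D" for A B s t
  proof -
    have "A * s + t * B \<le> C * s + t * D" using that by (intro add_mono mult_right_mono mult_left_mono)
    also have "\<dots> < e / 2 + e / 2" using that C(3) D(3) by (intro add_strict_mono) (simp_all add: field_simps)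
    finally show ?thesis by simp
  qed
  show "\<exists>p. norm2 M ((u o\<^sub>L v) - pe p) < e \<and> eventually (\<lambda>n. norm2 N ((\<xi> n o\<^sub>L \<eta> n) - pE p n) < e) \<U>"
  proof (intro exI[of _ "Times p q"] conjI)
    have "norm2 M ((u o\<^sub>L v) - (pe p o\<^sub>L pe q)) \<le> norm u * norm2 M (v - pe q) + norm2 M (u - pe p) * norm (pe q)"
      by (intro norm2_diff_mult[OF M] um vm pe_mem)
    also have "\<dots> < e"
      by (intro fin C D p(1) q(1) norm2_nonneg[OF M] tracial_diff_mem[OF M] um vm pe_mem)
    finally show "norm2 M ((u o\<^sub>L v) - pe (Times p q)) < e" by (simp add: eval_poly_op[OF M])
    from p(2) q(2) show "eventually (\<lambda>n. norm2 N ((\<xi> n o\<^sub>L \<eta> n) - pE (Times p q) n) < e) \<U>"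
    proof eventually_elim
      case (elim n)
      have "norm2 N ((\<xi> n o\<^sub>L \<eta> n) - (pE p n o\<^sub>L pE q n)) \<le> norm (\<xi> n) * norm2 N (\<eta> n - pE q n) + norm2 N (\<xi> n - pE p n) * norm (pE q n)"
        by (intro norm2_diff_mult[OF N] xm ym pE_mem)
      also have "\<dots> < e"
        by (intro fin C D elim norm2_nonneg[OF N] tracial_diff_mem[OF N] xm ym pE_mem)
      finally show ?case by (simp add: eval_poly_op[OF N])
    qed
  qed
qed

lemma corr_scale:
  assumes "corr u \<xi>" shows "corr (op_scale z u) (\<lambda>n. op_scale z (\<xi> n))"
proof -
  have "corr (pe (Scale z Unit) o\<^sub>L u) (\<lambda>n. pE (Scale z Unit) n o\<^sub>L \<xi> n)"
    by (rule corr_mult[OF corr_pe assms])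
  then show ?thesis by (simp add: eval_poly_op[OF M] eval_poly_op[OF N] op_scale_compose_left)
qed

lemma corr_tr:
  assumes "corr u \<xi>" shows "((\<lambda>n. tr N (\<xi> n)) \<longlongrightarrow> tr M u) \<U>"
proof (rule tendstoI)
  note um = corr_mem(1)[OF assms] and xm = corr_mem(3)[OF assms]
  fix e :: real assume "e > 0"
  then have e: "e / 3 > 0" by simp
  obtain p where p: "norm2 M (u - pe p) < e / 3" "eventually (\<lambda>n. norm2 N (\<xi> n - pE p n) < e / 3) \<U>"
    using corr_approx[OF assms(1) e] by blast
  have "eventually (\<lambda>n. dist (tr N (pE p n)) (tr M (pe p)) < e / 3) \<U>" by (rule tendstoD[OF moments e])
  with p(2) show "eventually (\<lambda>n. dist (tr N (\<xi> n)) (tr M u) < e) \<U>"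
  proof eventually_elim
    case (elim n)
    have "dist (tr N (\<xi> n)) (tr N (pE p n)) \<le> norm2 N (\<xi> n - pE p n)"
      using cmod_tr_le_norm2[OF N tracial_diff_mem[OF N xm pE_mem]]
      by (simp add: dist_norm tracial_tr_diff[OF N xm pE_mem])
    moreover have "dist (tr M u) (tr M (pe p)) \<le> norm2 M (u - pe p)"
      using cmod_tr_le_norm2[OF M tracial_diff_mem[OF M um pe_mem]]
      by (simp add: dist_norm tracial_tr_diff[OF M um pe_mem])
    ultimately show ?case
      using elim p(1) dist_triangle[of "tr N (\<xi> n)" "tr M u" "tr N (pE p n)"]
        dist_triangle2[of "tr N (pE p n)" "tr M u" "tr M (pe p)"] by linarith
  qed
qed

text \<open>Kaplansky approximants of \<open>u\<close> are Cauchy in \<open>M\<close>, hence along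
  the ultrafilter in \<open>N\<close>, and their values in \<open>N\<close> obey the same norm bound
  at every \<open>n\<close>. Diagonal completeness then gives the sequence.\<close>

lemma corr_exists:
  assumes u: "u \<in> poly_closure M c a"
  shows "\<exists>\<xi>. corr u \<xi> \<and> (\<forall>n. norm (\<xi> n) \<le> 16 * norm u + 4)"
proof -
  \<comment> \<open>The density theorem uses one pair of radii for both algebras, so these have to
    contain the tuple in \<open>M\<close> and all tuples in \<open>N\<close>.\<close>
  define R where "R k = max (norm (c k)) (r k)" for k
  define R' where "R' k = max (norm (a k)) (r' k)" for k
  have tM: "bounded_tuple M R R' c a" using ca by (simp add: bounded_tuple_def assignments_def R_def R'_def)
  have tN: "bounded_tuple N R R' (x n) (y n)" for n
    using xy[of n] by (auto simp: bounded_tuple_def assignments_def R_def R'_def le_max_iff_disj)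
  note um = poly_closure_mem[OF M tM u]
  define \<delta> where "\<delta> i = 1 / (real i + 1)" for i :: nat
  have \<delta>: "\<delta> i > 0" for i by (simp add: \<delta>_def)
  have "\<forall>j. \<exists>s. norm2 M (u - pe s) < \<delta> j \<and> (\<forall>n. norm (pE s n) \<le> 16 * norm u + 4)"
    using kaplansky_density[OF M tM u \<delta>, where 'n = 'r] N tN by blast
  then obtain s where s: "\<And>j. norm2 M (u - pe (s j)) < \<delta> j" "\<And>j n. norm (pE (s j) n) \<le> 16 * norm u + 4"
    by metis
  have small: "\<exists>J. \<forall>j\<ge>J. \<delta> j < e" if e: "e > 0" for e
  proof -
    obtain J where J: "\<delta> J < e"
      using reals_Archimedean[OF e] unfolding \<delta>_def by (auto simp: inverse_eq_divide add.commute)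
    have "\<delta> j \<le> \<delta> J" if "j \<ge> J" for j using that by (simp add: \<delta>_def frac_le)
    then show ?thesis using J le_less_trans by blast
  qed
  have "\<exists>\<xi>. (\<forall>n. \<xi> n \<in> carrier N \<and> norm (\<xi> n) \<le> 16 * norm u + 4) \<and>
    (\<forall>e>0. \<exists>J. \<forall>j\<ge>J. eventually (\<lambda>n. norm2 N (\<xi> n - pE (s j) n) < e) \<U>)"
  proof (rule bounded_seqs_complete[OF N U])
    show "pE (s j) n \<in> carrier N" for j n by (rule pE_mem)
    show "norm (pE (s j) n) \<le> 16 * norm u + 4" for j n by (rule s)
    fix e :: real assume "e > 0"
    then obtain J where J: "\<And>j. j \<ge> J \<Longrightarrow> \<delta> j < e / 2" using small[of "e/2"] by auto
    have "eventually (\<lambda>n. norm2 N (pE (s j) n - pE (s k) n) < e) \<U>" if "j \<ge> J" "k \<ge> J" for j k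
    proof (rule eventually_norm2_less)
      have "norm2 M (pe (s j) - pe (s k)) \<le> norm2 M (pe (s j) - u) + norm2 M (u - pe (s k))"
        by (intro norm2_diff_triangle[OF M] pe_mem um)
      then show "norm2 M (pe (s j) - pe (s k)) < e"
        using s(1)[of j] s(1)[of k] J[OF that(1)] J[OF that(2)] norm2_commute[OF M um pe_mem, of "s j"] by linarith
    qed
    then show "\<exists>J. \<forall>j\<ge>J. \<forall>k\<ge>J. eventually (\<lambda>n. norm2 N (pE (s j) n - pE (s k) n) < e) \<U>" by blast
  qed
  then obtain \<xi> where \<xi>: "\<And>n. \<xi> n \<in> carrier N" "\<And>n. norm (\<xi> n) \<le> 16 * norm u + 4"
    "\<And>e. e > 0 \<Longrightarrow> \<exists>J. \<forall>j\<ge>J. eventually (\<lambda>n. norm2 N (\<xi> n - pE (s j) n) < e) \<U>" by blast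
  have "corr u \<xi>"
    unfolding corr_def
  proof (intro conjI allI impI)
    show "\<xi> \<in> bounded_seqs N" using \<xi>(1,2) by (rule bounded_seqsI)
    fix e :: real assume e: "e > 0"
    obtain J where J: "\<And>j. j \<ge> J \<Longrightarrow> \<delta> j < e" using small[OF e] by auto
    obtain J' where J': "\<And>j. j \<ge> J' \<Longrightarrow> eventually (\<lambda>n. norm2 N (\<xi> n - pE (s j) n) < e) \<U>" using \<xi>(3)[OF e] by auto
    show "\<exists>p. norm2 M (u - pe p) < e \<and> eventually (\<lambda>n. norm2 N (\<xi> n - pE p n) < e) \<U>"
      using J[of "max J J'"] J'[of "max J J'"] s(1)[of "max J J'"] by (intro exI[of _ "s (max J J')"]) auto
  qed (rule um)
  then show ?thesis using \<xi>(2) by blast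
qed

text \<open>By uniqueness up to null sequences, any choice of corresponding sequences respects the
  operations. The second conclusion keeps track of where the generators go, which allows different
  embeddings to be compared later.\<close>

theorem asymp_embedding_of_moments:
  assumes dense: "carrier M \<subseteq> poly_closure M c a"
  shows "\<exists>s. asymp_embedding s \<U> M N \<and> (\<forall>p. null_seq N \<U> (\<lambda>n. s (pe p) n - pE p n))"
proof -
  define s where "s u = (SOME \<xi>. corr u \<xi>)" for u
  have s: "corr u (s u)" if "u \<in> carrier M" for u
  proof -
    have "\<exists>\<xi>. corr u \<xi>" using corr_exists[of u] dense that by auto
    then show ?thesis unfolding s_def by (rule someI_ex)
  qed
  note mem = tracial_mul_mem[OF M] tracial_add_mem[OF M] tracial_scale_mem[OF M] tracial_adjoint_mem[OF M] tracial_id_mem[OF M]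
  have "asymp_embedding s \<U> M N"
    unfolding asymp_embedding_def
  proof (intro conjI ballI allI)
    fix u v z assume u: "u \<in> carrier M"
    note su = s[OF u]
    show "s u \<in> bounded_seqs N" by (rule corr_mem(2)[OF su])
    show "null_seq N \<U> (\<lambda>n. s (op_scale z u) n - op_scale z (s u n))"
      by (rule corr_unique[OF s corr_scale[OF su]]) (rule mem u)+
    show "null_seq N \<U> (\<lambda>n. s (op_adjoint u) n - op_adjoint (s u n))"
      by (rule corr_unique[OF s corr_adjoint[OF su]]) (rule mem u)+
    show "((\<lambda>n. tr N (s u n)) \<longlongrightarrow> tr M u) \<U>" by (rule corr_tr[OF su])
    assume v: "v \<in> carrier M"
    note sv = s[OF v]
    show "null_seq N \<U> (\<lambda>n. s (u o\<^sub>L v) n - (s u n o\<^sub>L s v n))"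
      by (rule corr_unique[OF s corr_mult[OF su sv]]) (rule mem u v)+
    show "null_seq N \<U> (\<lambda>n. s (u + v) n - (s u n + s v n))"
      by (rule corr_unique[OF s corr_add[OF su sv]]) (rule mem u v)+
  next
    show "null_seq N \<U> (\<lambda>n. s id_blinfun n - id_blinfun)"
      by (rule corr_unique[OF s corr_one]) (rule mem)
  qed
  moreover have "null_seq N \<U> (\<lambda>n. s (pe p) n - pE p n)" for p by (rule corr_unique[OF s[OF pe_mem] corr_pe])
  ultimately show ?thesis by blast
qed

end

text \<open>The moments of the constant tuple with entry \<open>u\<close> are limits along its lift,
  and \<open>u\<close> is a polynomial in that tuple. So \<open>s u\<close> and the sequence from
  the density argument both correspond to \<open>u\<close>.\<close>

lemma asymp_embedding_bounded_lift:
  assumes M: "tracial_vna M" and N: "tracial_vna N" and U: "nonprincipal_ultrafilter \<U>"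
    and s: "asymp_embedding s \<U> M N" and u: "u \<in> carrier M"
  shows "\<exists>\<xi>. (\<forall>n. \<xi> n \<in> carrier N \<and> norm (\<xi> n) \<le> 16 * norm u + 4) \<and> null_seq N \<U> (\<lambda>n. \<xi> n - s u n)"
proof -
  obtain C where C: "\<And>n. norm (s u n) \<le> C" using ae_bseq[OF M N U s u] by (auto simp: bounded_seqs_iff)
  define cu where "cu k = u" for k :: nat
  define x where "x n = (\<lambda>k::nat. s u n)" for n
  have xy: "bounded_tuple N (\<lambda>k. C) (\<lambda>k. C) (x n) (x n)" for n
    using C ae_mem[OF M N U s u] by (simp add: bounded_tuple_def assignments_def x_def)
  have cm: "cu k \<in> carrier M" for k using u by (simp add: cu_def)
  have moments: "((\<lambda>n. tr N (eval_poly N (x n) (x n) p)) \<longlongrightarrow> tr M (eval_poly M cu cu p)) \<U>" for p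
    using ae_moments[OF M N U s, of cu cu p] u by (simp add: cu_def x_def)
  have ev: "eval_poly M cu cu (XVar 0) = u" "(\<lambda>n. eval_poly N (x n) (x n) (XVar 0)) = s u"
    by (simp_all add: cu_def x_def)
  have "bounded_tuple M (\<lambda>k. norm (cu k)) (\<lambda>k. norm (cu k)) cu cu" by (rule bounded_tupleI) (rule cm)+
  from eval_mem_poly_closure[OF M this, of "XVar 0"]
  have "u \<in> poly_closure M cu cu" by (simp only: ev)
  then obtain \<xi> where \<xi>: "corr M N \<U> cu cu x x u \<xi>" "\<And>n. norm (\<xi> n) \<le> 16 * norm u + 4"
    using corr_exists[OF M N U cm cm xy moments] by blast
  have "corr M N \<U> cu cu x x (eval_poly M cu cu (XVar 0)) (\<lambda>n. eval_poly N (x n) (x n) (XVar 0))"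
    by (rule corr_pe[OF M N U cm cm xy moments])
  then have "corr M N \<U> cu cu x x u (s u)" unfolding ev .
  then have "null_seq N \<U> (\<lambda>n. \<xi> n - s u n)"
    by (rule corr_unique[OF M N U cm cm xy moments \<xi>(1)])
  moreover have "\<xi> n \<in> carrier N" for n by (rule corr_mem(3)[OF M N U cm cm xy moments \<xi>(1)])
  ultimately show ?thesis using \<xi>(2) by blast
qed

text \<open>An arbitrary lift bounds each sequence by a constant of its own. A bound in terms of
  \<open>norm u\<close> alone keeps the lifts of an infinite norm-bounded family within one
  ball.\<close>

lemma bounded_asymp_embedding:
  assumes M: "tracial_vna M" and N: "tracial_vna N" and U: "nonprincipal_ultrafilter \<U>"
    and s: "asymp_embedding s \<U> M N"
  shows "\<exists>s'. asymp_embedding s' \<U> M N \<and> (\<forall>u\<in>carrier M. \<forall>n. norm (s' u n) \<le> 16 * norm u + 4)"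
proof -
  have "\<forall>u\<in>carrier M. \<exists>\<xi>. (\<forall>n. \<xi> n \<in> carrier N \<and> norm (\<xi> n) \<le> 16 * norm u + 4) \<and> null_seq N \<U> (\<lambda>n. \<xi> n - s u n)"
    using asymp_embedding_bounded_lift[OF M N U s] by blast
  from bchoice[OF this] obtain s'
    where s': "\<And>u n. u \<in> carrier M \<Longrightarrow> s' u n \<in> carrier N \<and> norm (s' u n) \<le> 16 * norm u + 4"
      "\<And>u. u \<in> carrier M \<Longrightarrow> null_seq N \<U> (\<lambda>n. s' u n - s u n)" by blast
  note sb = ae_bseq[OF M N U s]
  have sb': "s' u \<in> bounded_seqs N" if "u \<in> carrier M" for u
    using s'(1)[OF that] by (intro bounded_seqsI) auto
  have "cl N \<U> (s' u) = cl N \<U> (s u)" if "u \<in> carrier M" for u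
    using cl_eq_iff[OF N U sb'[OF that] sb[OF that]] s'(2)[OF that] by simp
  moreover have "embedding (\<lambda>u. cl N \<U> (s u)) M (ultrapower \<U> N)"
    using asymp_embedding_iff[of M N \<U> s] M N U sb s by simp
  ultimately have "embedding (\<lambda>u. cl N \<U> (s' u)) M (ultrapower \<U> N)"
    using embedding_cong[OF M, of "\<lambda>u. cl N \<U> (s u)" _ "\<lambda>u. cl N \<U> (s' u)"] by simp
  then have "asymp_embedding s' \<U> M N" using asymp_embedding_iff[of M N \<U> s'] M N U sb' by simp
  then show ?thesis using s'(1) by blast
qed

lemma ae_norm2_null:
  assumes M: "tracial_vna M" and N: "tracial_vna N" and U: "nonprincipal_ultrafilter \<U>"
    and s: "asymp_embedding s \<U> M N" and u: "u \<in> carrier M" and v: "v \<in> carrier M"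
    and z: "\<And>n. z n \<in> carrier N" and sz: "null_seq N \<U> (\<lambda>n. s v n - z n)"
  shows "((\<lambda>n. norm2 N (s u n - z n)) \<longlongrightarrow> norm2 M (u - v)) \<U>"
proof (rule null_norm2_eq[OF N U _ _ _ ae_norm2_diff[OF M N U s u v]])
  note m = ae_mem[OF M N U s u] ae_mem[OF M N U s v] z
  show "s u n - s v n \<in> carrier N" "s u n - z n \<in> carrier N" for n
    by (intro tracial_diff_mem[OF N] m)+
  have "null_seq N \<U> (\<lambda>n. z n - s v n)" by (rule null_commute[OF N U m(2,3) sz])
  then show "null_seq N \<U> (\<lambda>n. (s u n - s v n) - (s u n - z n))" by simp
qed

section \<open>Orthonormal systems for a trace\<close>

context tracial_star
begin

definition semi_ons :: "(nat \<Rightarrow> 'a) \<Rightarrow> bool" where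
  "semi_ons b \<longleftrightarrow> (\<forall>j. b j \<in> K) \<and> (\<forall>i j. i \<noteq> j \<longrightarrow> ip (b i) (b j) = 0) \<and> (\<forall>j. b j = 0 \<or> ip (b j) (b j) = 1)"

definition proj :: "(nat \<Rightarrow> 'a) \<Rightarrow> nat \<Rightarrow> 'a \<Rightarrow> 'a" where
  "proj b n x = (\<Sum>j<n. sc (ip (b j) x) (b j))"

lemma ip_zero_left: "x \<in> K \<Longrightarrow> ip 0 x = 0"
  using ip_sc_left[OF un_mem, of x 0] by (simp add: sc_zero un_mem)

lemma ip_zero_right: "x \<in> K \<Longrightarrow> ip x 0 = 0"
  using ip_sc_right[OF _ un_mem, of x 0] by (simp add: sc_zero un_mem)

lemma sc_zero_right: "sc c 0 = 0"
  using sc_add_right[OF zero_mem zero_mem, of c] by simp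

lemma sc_diff_left: "x \<in> K \<Longrightarrow> sc (c - d) x = sc c x - sc d x"
  using sc_add_left[of x "c - d" d] by (simp add: algebra_simps)

context
  fixes b assumes b: "semi_ons b"
begin

lemma semi_ons_mem: "b j \<in> K" using b by (simp add: semi_ons_def)

lemma proj_mem: "proj b n x \<in> K"
  unfolding proj_def by (intro sum_mem sc_mem semi_ons_mem)

lemma sum_delta_semi: assumes "x \<in> K" shows "ip (b i) (sc (ip (b j) x) (b j)) = (if i = j then ip (b i) x else 0)"
proof (cases "b j = 0")
  case True
  then show ?thesis
    using assms ip_zero_left[of x] ip_zero_right[OF semi_ons_mem[of i]] by (auto simp: sc_zero_right)
next
  case False
  then have "ip (b j) (b j) = 1" using b by (auto simp: semi_ons_def)
  then show ?thesis
    using b assms by (auto simp: ip_sc_right semi_ons_mem semi_ons_def)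
qed

lemma ip_proj: "x \<in> K \<Longrightarrow> i < n \<Longrightarrow> ip (b i) (proj b n x) = ip (b i) x"
  unfolding proj_def by (subst ip_sum_right) (auto intro!: semi_ons_mem sc_mem simp: sum_delta_semi)

lemma ip_residual: "x \<in> K \<Longrightarrow> i < n \<Longrightarrow> ip (b i) (x - proj b n x) = 0"
  by (simp add: ip_diff_right ip_proj semi_ons_mem proj_mem)

lemma ip_proj_left: "x \<in> K \<Longrightarrow> z \<in> K \<Longrightarrow> ip (proj b n x) z = (\<Sum>j<n. cnj (ip (b j) x) * ip (b j) z)"
  unfolding proj_def by (subst ip_sum_left) (auto intro!: semi_ons_mem sc_mem simp: ip_sc_left semi_ons_mem)

lemma residual_sq: "x \<in> K \<Longrightarrow> (n2 (x - proj b n x))\<^sup>2 = (n2 x)\<^sup>2 - (\<Sum>j<n. (cmod (ip (b j) x))\<^sup>2)"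
proof -
  assume x: "x \<in> K"
  have "ip (proj b n x) (x - proj b n x) = 0"
    using x by (subst ip_proj_left) (auto intro: diff_mem proj_mem simp: ip_residual)
  then have "ip (x - proj b n x) (x - proj b n x) = ip x (x - proj b n x)"
    using x by (simp add: ip_diff_left diff_mem proj_mem)
  also have "\<dots> = ip x x - ip x (proj b n x)" using x by (simp add: ip_diff_right proj_mem)
  also have "ip x (proj b n x) = cnj (\<Sum>j<n. cnj (ip (b j) x) * ip (b j) x)"
    using ip_commute[OF proj_mem x] ip_proj_left[OF x x] by simp
  also have "(\<Sum>j<n. cnj (ip (b j) x) * ip (b j) x) = complex_of_real (\<Sum>j<n. (cmod (ip (b j) x))\<^sup>2)"
    unfolding of_real_sum complex_norm_square by (simp add: mult.commute)
  finally have "ip (x - proj b n x) (x - proj b n x) = ip x x - complex_of_real (\<Sum>j<n. (cmod (ip (b j) x))\<^sup>2)"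
    by simp
  then show ?thesis using x by (simp add: n2_sq diff_mem proj_mem)
qed

lemma bessel: "x \<in> K \<Longrightarrow> (\<Sum>j<n. (cmod (ip (b j) x))\<^sup>2) \<le> (n2 x)\<^sup>2"
  using residual_sq[of x n] zero_le_power2[of "n2 (x - proj b n x)"] by simp

lemma residual_mono: "x \<in> K \<Longrightarrow> m \<le> n \<Longrightarrow> n2 (x - proj b n x) \<le> n2 (x - proj b m x)"
proof (rule power2_le_imp_le)
  assume x: "x \<in> K" and mn: "m \<le> n"
  have "(\<Sum>j<m. (cmod (ip (b j) x))\<^sup>2) \<le> (\<Sum>j<n. (cmod (ip (b j) x))\<^sup>2)"
    using mn by (intro sum_mono2) auto
  then show "(n2 (x - proj b n x))\<^sup>2 \<le> (n2 (x - proj b m x))\<^sup>2" using x by (simp add: residual_sq)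
qed (simp add: diff_mem proj_mem)

lemma residual_le: "x \<in> K \<Longrightarrow> n2 (x - proj b n x) \<le> n2 x"
  using residual_mono[of x 0 n] by (simp add: proj_def)

lemma proj_diff: "x \<in> K \<Longrightarrow> y \<in> K \<Longrightarrow> proj b n (x - y) = proj b n x - proj b n y"
  unfolding proj_def by (simp add: ip_diff_right sc_diff_left semi_ons_mem sum_subtractf)

end

lemma gram_schmidt:
  fixes w :: "nat \<Rightarrow> 'a"
  assumes w: "\<And>n. w n \<in> K"
  shows "\<exists>b. semi_ons b \<and> (\<forall>n. n2 (w n - proj b (Suc n) (w n)) = 0)"
proof -
  \<comment> \<open>When the residual has 2-norm 0 the scalar 1 / 0 is 0, so the new vector is 0,
    even if the trace is degenerate and the residual itself is not 0.\<close>
  define P where "P b n r \<longleftrightarrow> r = sc (1 / complex_of_real (n2 (w n - proj b n (w n)))) (w n - proj b n (w n))" for b n r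
  have "\<exists>b. \<forall>n. P b n (b n)"
  proof (rule dependent_wellorder_choice)
    fix r and f g :: "nat \<Rightarrow> 'a" and n :: nat
    assume "\<And>m. m < n \<Longrightarrow> f m = g m"
    then have "proj f n x = proj g n x" for x unfolding proj_def by (intro sum.cong) auto
    then show "P f n r = P g n r" by (simp add: P_def)
  qed (auto simp: P_def)
  then obtain b where b: "\<And>n. b n = sc (1 / complex_of_real (n2 (w n - proj b n (w n)))) (w n - proj b n (w n))"
    unfolding P_def by blast
  have mem: "b n \<in> K \<and> proj b n (w n) \<in> K" for n
  proof (induction n rule: less_induct)
    case (less n)
    then have "proj b n (w n) \<in> K" unfolding proj_def by (intro sum_mem sc_mem) auto
    then show ?case using w by (subst b) (auto intro!: sc_mem diff_mem)
  qed
  define g where "g n = w n - proj b n (w n)" for n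
  have g: "g n \<in> K" for n using mem w by (auto simp: g_def intro!: diff_mem)
  have bg: "b n = sc (1 / complex_of_real (n2 (g n))) (g n)" for n unfolding g_def by (rule b)
  have nrm: "b n = 0 \<or> ip (b n) (b n) = 1" for n
  proof (cases "n2 (g n) = 0")
    case True
    then show ?thesis using bg[of n] g by (simp add: sc_zero)
  next
    case False
    have "n2 (b n) = 1" using False g[of n] by (subst bg) (simp add: n2_sc norm_divide)
    then show ?thesis using ip_self[of "b n"] mem by simp
  qed
  have orth: "\<forall>i<n. ip (b i) (b n) = 0" for n
  proof (induction n rule: less_induct)
    case (less n)
    have o: "ip (b i) (b j) = 0" if "i < n" "j < n" "i \<noteq> j" for i j
    proof (cases "i < j")
      case True then show ?thesis using less[OF that(2)] by blast
    next
      case False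
      then have "ip (b j) (b i) = 0" using that less[OF that(1)] by auto
      then show ?thesis using ip_commute[of "b j" "b i"] mem by simp
    qed
    have "ip (b i) (g n) = 0" if i: "i < n" for i
    proof -
      have d: "ip (b i) (sc (ip (b j) (w n)) (b j)) = (if i = j then ip (b i) (w n) else 0)" if "j < n" for j
        using nrm[of i] o[OF i that] mem w ip_zero_left[OF w] by (auto simp: ip_sc_right)
      have "ip (b i) (proj b n (w n)) = (\<Sum>j<n. if i = j then ip (b i) (w n) else 0)"
        unfolding proj_def using mem by (subst ip_sum_right) (auto intro!: sc_mem sum.cong simp: d)
      then show ?thesis using i mem w by (simp add: g_def ip_diff_right)
    qed
    then show ?case using bg[of n] mem g by (auto simp: ip_sc_right)
  qed
  have "ip (b i) (b j) = 0" if "i \<noteq> j" for i j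
    using orth[of i] orth[of j] that ip_commute[of "b j" "b i"] mem by (cases "i < j") auto
  then have so: "semi_ons b" using mem nrm by (auto simp: semi_ons_def)
  have "n2 (w n - proj b (Suc n) (w n)) = 0" for n
  proof -
    define \<nu> where "\<nu> = n2 (g n)"
    have "ip (g n) (proj b n (w n)) = cnj (ip (proj b n (w n)) (g n))"
      using ip_commute[of "proj b n (w n)" "g n"] mem g by simp
    also have "ip (proj b n (w n)) (g n) = 0"
      using ip_proj_left[OF so w g] ip_residual[OF so w] by (simp add: g_def)
    finally have "ip (g n) (w n) = ip (g n) (g n)"
      using g mem w by (simp add: g_def ip_diff_right diff_mem)
    then have gw: "ip (g n) (w n) = complex_of_real (\<nu>\<^sup>2)" using ip_self[OF g] by (simp add: \<nu>_def)
    have "ip (b n) (w n) = complex_of_real \<nu>"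
      using gw g w by (subst bg) (auto simp: ip_sc_left \<nu>_def power2_eq_square)
    then have "w n - proj b (Suc n) (w n) = g n - sc (complex_of_real \<nu>) (b n)"
      by (simp add: proj_def g_def)
    also have "\<dots> = g n - sc (if \<nu> = 0 then 0 else 1) (g n)"
      using g by (subst bg) (auto simp: sc_sc \<nu>_def)
    also have "n2 \<dots> = 0" using g by (auto simp: \<nu>_def sc_zero sc_one)
    finally show ?thesis .
  qed
  then show ?thesis using so by blast
qed

definition total_ons :: "(nat \<Rightarrow> 'a) \<Rightarrow> bool" where
  "total_ons e \<longleftrightarrow> semi_ons e \<and> (\<forall>j. ip (e j) (e j) = 1) \<and> (\<forall>x\<in>K. (\<lambda>n. n2 (x - proj e n x)) \<longlonglongrightarrow> 0)"

text \<open>Gram-Schmidt on the dense sequence gives a total system with possible zeros among its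
  entries. The infinite orthonormal family \<open>f\<close> forces infinitely many nonzero ones, so
  that dropping the zeros leaves a system indexed by all of \<nat>.\<close>

lemma total_ons_exists:
  fixes w :: "nat \<Rightarrow> 'a"
  assumes w: "\<And>n. w n \<in> K" and dense: "\<And>x \<epsilon>. x \<in> K \<Longrightarrow> \<epsilon> > 0 \<Longrightarrow> \<exists>n. n2 (x - w n) < \<epsilon>"
    and f: "semi_ons f" "\<And>j. ip (f j) (f j) = 1"
  shows "\<exists>e. total_ons e"
proof -
  obtain b where b: "semi_ons b" and wb: "\<And>n. n2 (w n - proj b (Suc n) (w n)) = 0"
    using gram_schmidt[of w] w by blast
  note bm = semi_ons_mem[OF b]
  have tot: "\<exists>m. \<forall>n\<ge>m. n2 (x - proj b n x) < \<epsilon>" if x: "x \<in> K" "\<epsilon> > 0" for x \<epsilon>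
  proof -
    obtain i where i: "n2 (x - w i) < \<epsilon>" using dense[OF x] by blast
    have "n2 (x - proj b n x) < \<epsilon>" if n: "n \<ge> Suc i" for n
    proof -
      note m = proj_mem[OF b] w x(1) diff_mem
      have eq: "x - proj b n x = ((x - w i) - proj b n (x - w i)) + (w i - proj b n (w i))"
        using x w by (simp add: proj_diff[OF b])
      have "n2 (x - proj b n x) \<le> n2 ((x - w i) - proj b n (x - w i)) + n2 (w i - proj b n (w i))"
        unfolding eq by (intro n2_triangle m)
      also have "n2 (w i - proj b n (w i)) \<le> 0"
        using residual_mono[OF b w n, of i] wb[of i] by simp
      also have "n2 ((x - w i) - proj b n (x - w i)) \<le> n2 (x - w i)"
        by (rule residual_le[OF b]) (use m in blast)
      finally show ?thesis using i by simp
    qed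
    then show ?thesis by blast
  qed
  define J where "J = {j. b j \<noteq> 0}"
  have inf: "infinite J"
  proof
    assume "finite J"
    then obtain m where m: "\<And>j. j \<in> J \<Longrightarrow> j < m" using finite_nat_set_iff_bounded by auto
    have bz: "b j = 0" if "j \<ge> m" for j
      using m[of j] that by (auto simp: J_def not_le[symmetric])
    have full: "(\<Sum>j<m. (cmod (ip (b j) (f k)))\<^sup>2) = 1" for k
    proof -
      note fk = semi_ons_mem[OF f(1), of k]
      have pj: "proj b n (f k) = proj b m (f k)" if "n \<ge> m" for n
        unfolding proj_def using that by (intro sum.mono_neutral_right) (auto simp: bz sc_zero_right)
      have "n2 (f k - proj b m (f k)) \<le> \<epsilon>" if "\<epsilon> > 0" for \<epsilon>
      proof -
        obtain m' where "\<forall>n\<ge>m'. n2 (f k - proj b n (f k)) < \<epsilon>" using tot[OF fk \<open>\<epsilon> > 0\<close>] by blast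
        then have "n2 (f k - proj b (max m m') (f k)) < \<epsilon>" by simp
        then show ?thesis using pj[of "max m m'"] by simp
      qed
      then have "n2 (f k - proj b m (f k)) \<le> 0" by (rule dense_ge)
      then have "n2 (f k - proj b m (f k)) = 0"
        using n2_nonneg[OF diff_mem[OF fk proj_mem[OF b]]] by (meson order_antisym)
      then show ?thesis using residual_sq[OF b fk, of m] n2_sq[OF fk] f(2)[of k] by simp
    qed
    \<comment> \<open>Double counting: if only the \<open>b j\<close> with j < m could be nonzero,
      each of the m + 1 vectors \<open>f k\<close> would have total weight 1 on them, while by
      Bessel each \<open>b j\<close> receives weight at most 1.\<close>
    have "real (Suc m) = (\<Sum>k<Suc m. \<Sum>j<m. (cmod (ip (b j) (f k)))\<^sup>2)" by (simp only: full) simp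
    also have "\<dots> = (\<Sum>j<m. \<Sum>k<Suc m. (cmod (ip (b j) (f k)))\<^sup>2)" by (rule sum.swap)
    also have "\<dots> \<le> (\<Sum>j<m. 1)"
    proof (rule sum_mono)
      fix j
      have "(\<Sum>k<Suc m. (cmod (ip (b j) (f k)))\<^sup>2) = (\<Sum>k<Suc m. (cmod (ip (f k) (b j)))\<^sup>2)"
        using ip_commute[OF bm semi_ons_mem[OF f(1)]] by (simp only: complex_mod_cnj)
      also have "\<dots> \<le> (n2 (b j))\<^sup>2" by (rule bessel[OF f(1) bm])
      also have "\<dots> \<le> 1"
      proof (cases "b j = 0")
        case False
        then have "ip (b j) (b j) = 1" using b by (auto simp: semi_ons_def)
        then show ?thesis using n2_sq[OF bm, of j] by simp
      qed simp
      finally show "(\<Sum>k<Suc m. (cmod (ip (b j) (f k)))\<^sup>2) \<le> 1" .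
    qed
    finally show False by simp
  qed
  define e where "e i = b (enumerate J i)" for i
  have eJ: "enumerate J i \<in> J" for i by (rule enumerate_in_set[OF inf])
  have inj: "enumerate J i = enumerate J j \<longleftrightarrow> i = j" for i j
    using inj_enumerate[OF inf] by (auto simp: inj_on_def)
  have se: "semi_ons e"
    using b by (auto simp: semi_ons_def e_def inj)
  have one: "ip (e j) (e j) = 1" for j
  proof -
    have "b (enumerate J j) \<noteq> 0" using eJ[of j] by (simp add: J_def)
    then show ?thesis using b unfolding semi_ons_def e_def by blast
  qed
  \<comment> \<open>Dropping zeros only reindexes partial sums: the first \<open>n\<close> vectors
    of \<open>e\<close> are the nonzero ones among the \<open>b j\<close> with
    \<open>j < enumerate J n\<close>.\<close>
  have pe: "proj e n x = proj b (enumerate J n) x" for n x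
  proof -
    have img: "enumerate J ` {..<n} = {j \<in> J. j < enumerate J n}"
    proof
      show "enumerate J ` {..<n} \<subseteq> {j \<in> J. j < enumerate J n}"
        using eJ enumerate_mono[OF _ inf] by auto
      show "{j \<in> J. j < enumerate J n} \<subseteq> enumerate J ` {..<n}"
      proof
        fix j assume "j \<in> {j \<in> J. j < enumerate J n}"
        then obtain i where i: "j = enumerate J i" "enumerate J i < enumerate J n"
          using enumerate_Ex[OF inf, of j] by auto
        then have "i < n" using enumerate_mono_iff[OF inf] by simp
        then show "j \<in> enumerate J ` {..<n}" using i by blast
      qed
    qed
    have "proj e n x = (\<Sum>j\<in>enumerate J ` {..<n}. sc (ip (b j) x) (b j))"
      unfolding proj_def e_def by (subst sum.reindex) (auto simp: inj_on_def inj)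
    also have "\<dots> = proj b (enumerate J n) x"
      unfolding proj_def img by (intro sum.mono_neutral_left) (auto simp: J_def sc_zero_right)
    finally show ?thesis .
  qed
  have "(\<lambda>n. n2 (x - proj e n x)) \<longlonglongrightarrow> 0" if x: "x \<in> K" for x
  proof (rule LIMSEQ_I)
    fix r :: real assume "r > 0"
    then obtain m where m: "\<And>n. n \<ge> m \<Longrightarrow> n2 (x - proj b n x) < r" using tot[OF x] by blast
    have "norm (n2 (x - proj e n x) - 0) < r" if "n \<ge> m" for n
      using m[of "enumerate J n"] le_enumerate[OF inf, of n] that n2_nonneg[OF diff_mem[OF x proj_mem[OF b, of "enumerate J n" x]]]
      by (simp add: pe)
    then show "\<exists>no. \<forall>n\<ge>no. norm (n2 (x - proj e n x) - 0) < r" by blast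
  qed
  then show ?thesis using se one by (auto simp: total_ons_def)
qed

end

section \<open>The GNS representation on \<open>\<ell>\<^sup>2(\<nat>)\<close>\<close>

text \<open>The total system is indexed by \<nat>, so the Hilbert space is
  \<open>\<ell>\<^sup>2(\<nat>)\<close> itself. The second assumption stands in for a norm on the
  algebra: it makes left multiplications bounded operators.\<close>

locale gns = tracial_star +
  fixes e :: "nat \<Rightarrow> 'a"
  assumes total: "total_ons e"
    and left_bounded: "x \<in> K \<Longrightarrow> \<exists>C. \<forall>y\<in>K. n2 (x \<cdot> y) \<le> C * n2 y"
begin

lemma e_ons: "semi_ons e" using total by (simp add: total_ons_def)
lemma e_mem: "e j \<in> K" by (rule semi_ons_mem[OF e_ons])
lemma e_total: "x \<in> K \<Longrightarrow> (\<lambda>n. n2 (x - proj e n x)) \<longlonglongrightarrow> 0" using total by (simp add: total_ons_def)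
lemma ip_e: "ip (e i) (e j) = (if i = j then 1 else 0)"
  using total by (auto simp: total_ons_def semi_ons_def)

text \<open>The canonical map into the GNS space, in coordinates. It sends elements of 2-norm 0 to
  0, so no quotient has to be formed.\<close>

definition vec :: "'a \<Rightarrow> nat ell2" where "vec x = Abs_ell2 (\<lambda>j. ip (e j) x)"

lemma finite_bessel: "x \<in> K \<Longrightarrow> finite F \<Longrightarrow> (\<Sum>j\<in>F. (cmod (ip (e j) x))\<^sup>2) \<le> (n2 x)\<^sup>2"
proof -
  assume x: "x \<in> K" and F: "finite F"
  then obtain m where "F \<subseteq> {..<m}" using finite_nat_iff_bounded by blast
  then have "(\<Sum>j\<in>F. (cmod (ip (e j) x))\<^sup>2) \<le> (\<Sum>j<m. (cmod (ip (e j) x))\<^sup>2)" by (intro sum_mono2) auto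
  also have "\<dots> \<le> (n2 x)\<^sup>2" by (rule bessel[OF e_ons x])
  finally show ?thesis .
qed

lemma summable_coeff: "x \<in> K \<Longrightarrow> (\<lambda>j. (cmod (ip (e j) x))\<^sup>2) summable_on UNIV"
  by (rule nonneg_bdd_above_summable_on) (auto intro!: bdd_aboveI2[where M = "(n2 x)\<^sup>2"] finite_bessel)

lemma coord_vec: "x \<in> K \<Longrightarrow> coord (vec x) j = ip (e j) x"
  unfolding vec_def using summable_coeff by (subst Abs_ell2_inverse) auto

lemma vec_add: "x \<in> K \<Longrightarrow> y \<in> K \<Longrightarrow> vec (x + y) = vec x + vec y"
  by (rule ell2_eqI) (simp add: coord_vec coord_add add_mem ip_add_right e_mem)
lemma vec_diff: "x \<in> K \<Longrightarrow> y \<in> K \<Longrightarrow> vec (x - y) = vec x - vec y"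
  by (rule ell2_eqI) (simp add: coord_vec coord_diff diff_mem ip_diff_right e_mem)
lemma vec_sc: "x \<in> K \<Longrightarrow> vec (sc c x) = ell2_scale c (vec x)"
  by (rule ell2_eqI) (simp add: coord_vec coord_scale sc_mem ip_sc_right e_mem)

lemma norm_vec: assumes x: "x \<in> K" shows "norm (vec x) = n2 x"
proof -
  have "(norm (vec x))\<^sup>2 = (n2 x)\<^sup>2"
  proof (rule antisym)
    show "(norm (vec x))\<^sup>2 \<le> (n2 x)\<^sup>2"
      unfolding norm_ell2_eq using x summable_coeff[OF x] finite_bessel[OF x]
      by (intro infsum_le_finite_sums) (auto simp: coord_vec)
    have "(\<lambda>n. (n2 x)\<^sup>2 - (n2 (x - proj e n x))\<^sup>2) \<longlonglongrightarrow> (n2 x)\<^sup>2 - 0\<^sup>2"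
      by (intro tendsto_intros e_total x)
    moreover have "(n2 x)\<^sup>2 - (n2 (x - proj e n x))\<^sup>2 \<le> (norm (vec x))\<^sup>2" for n
      using residual_sq[OF e_ons x, of n] ell2_sum_le_norm[of "{..<n}" "vec x"] by (simp add: coord_vec x)
    ultimately show "(n2 x)\<^sup>2 \<le> (norm (vec x))\<^sup>2" by (intro LIMSEQ_le_const2) auto
  qed
  then show ?thesis using x by (simp add: power2_eq_iff_nonneg)
qed

lemma cinner_vec: assumes x: "x \<in> K" and y: "y \<in> K" shows "cinner (vec x) (vec y) = ip x y"
proof -
  have re: "Re (cinner (vec x) (vec y)) = Re (ip x y)" if x: "x \<in> K" and y: "y \<in> K" for x y
  proof -
    have "(norm (vec x + vec y))\<^sup>2 = (norm (vec x))\<^sup>2 + 2 * Re (cinner (vec x) (vec y)) + (norm (vec y))\<^sup>2"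
      by (simp add: power2_norm_eq_inner inner_add_left inner_add_right inner_commute[of "vec y" "vec x"])
        (simp add: inner_ell2_def)
    moreover have "(n2 (x + y))\<^sup>2 = (n2 x)\<^sup>2 + 2 * Re (ip x y) + (n2 y)\<^sup>2"
      using x y by (simp add: n2_sq add_mem ip_add_left ip_add_right ip_commute[of x y])
    ultimately show ?thesis using x y by (simp add: norm_vec add_mem flip: vec_add)
  qed
  \<comment> \<open>Polarisation only yields real parts; multiplying \<open>y\<close> by -\<i> turns
    the imaginary part into one.\<close>
  have "Re (cinner (vec x) (vec (sc (- \<i>) y))) = Re (ip x (sc (- \<i>) y))" using x y by (intro re sc_mem)
  then have "Im (cinner (vec x) (vec y)) = Im (ip x y)"
    using x y by (simp add: vec_sc cinner_scale_right ip_sc_right)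
  then show ?thesis using re[OF x y] by (intro complex_eqI)
qed

lemma vec_e: "vec (e j) = ket j"
  by (rule ell2_eqI) (simp add: coord_vec e_mem ip_e coord_ket)

lemma vec_zero: "vec 0 = 0"
  using vec_sc[OF un_mem, of 0] by (simp add: sc_zero un_mem)

lemma vec_sum: "(\<And>i. i \<in> F \<Longrightarrow> g i \<in> K) \<Longrightarrow> vec (sum g F) = (\<Sum>i\<in>F. vec (g i))"
  by (induction F rule: infinite_finite_induct) (auto simp: vec_zero vec_add sum_mem)

lemma vec_dense: assumes "\<epsilon> > 0" shows "\<exists>x\<in>K. norm (\<xi> - vec x) < \<epsilon>"
proof -
  obtain F where F: "finite F" "norm (\<xi> - (\<Sum>i\<in>F. ell2_scale (coord \<xi> i) (ket i))) < \<epsilon>"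
    using ell2_finite_approx[OF assms] by blast
  define x where "x = (\<Sum>i\<in>F. sc (coord \<xi> i) (e i))"
  have "x \<in> K" unfolding x_def by (intro sum_mem sc_mem e_mem)
  moreover have "vec x = (\<Sum>i\<in>F. ell2_scale (coord \<xi> i) (ket i))"
    unfolding x_def by (subst vec_sum) (auto intro!: sc_mem e_mem simp: vec_sc e_mem vec_e)
  ultimately show ?thesis using F(2) by (intro bexI[of _ x]) auto
qed

lemma op_eqI:
  assumes "\<And>x. x \<in> K \<Longrightarrow> blinfun_apply S (vec x) = blinfun_apply T (vec x)" shows "S = T"
proof (rule blinfun_eqI)
  fix \<xi>
  have "norm (blinfun_apply (S - T) \<xi>) \<le> \<epsilon>" if \<epsilon>: "\<epsilon> > 0" for \<epsilon>
  proof -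
    have p: "norm (S - T) + 1 > 0" by (simp add: add_nonneg_pos)
    obtain x where x: "x \<in> K" "norm (\<xi> - vec x) < \<epsilon> / (norm (S - T) + 1)"
      using vec_dense[of "\<epsilon> / (norm (S - T) + 1)" \<xi>] \<epsilon> p by auto
    have "blinfun_apply (S - T) \<xi> = blinfun_apply (S - T) (\<xi> - vec x)"
      using assms[OF x(1)] by (simp add: blinfun.diff_left blinfun.diff_right)
    also have "norm \<dots> \<le> norm (S - T) * norm (\<xi> - vec x)" by (rule norm_blinfun)
    also have "\<dots> \<le> (norm (S - T) + 1) * norm (\<xi> - vec x)" by (intro mult_right_mono) auto
    also have "\<dots> \<le> \<epsilon>" using x(2) p by (simp add: field_simps)
    finally show ?thesis .
  qed
  then have "norm (blinfun_apply (S - T) \<xi>) \<le> 0" by (rule dense_ge)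
  then show "blinfun_apply S \<xi> = blinfun_apply T \<xi>" by (simp add: blinfun.diff_left)
qed

lemma vec_cinner_eqI:
  assumes "\<And>x. x \<in> K \<Longrightarrow> cinner (vec x) \<xi> = cinner (vec x) \<eta>" shows "\<xi> = \<eta>"
proof -
  have "coord \<xi> j = coord \<eta> j" for j
    using assms[OF e_mem[of j]] by (simp add: vec_e cinner_ket)
  then show ?thesis by (rule ell2_eqI)
qed

definition bounded_map :: "('a \<Rightarrow> 'a) \<Rightarrow> bool" where
  "bounded_map L \<longleftrightarrow> (\<forall>x\<in>K. L x \<in> K) \<and> (\<forall>x\<in>K. \<forall>y\<in>K. L (x + y) = L x + L y) \<and>
     (\<forall>c. \<forall>x\<in>K. L (sc c x) = sc c (L x)) \<and> (\<exists>C. \<forall>x\<in>K. n2 (L x) \<le> C * n2 x)"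

definition trunc :: "nat \<Rightarrow> nat ell2 \<Rightarrow> 'a" where "trunc m \<xi> = (\<Sum>j<m. sc (coord \<xi> j) (e j))"

text \<open>The continuous extension from the dense image of \<open>K\<close>, written through
  finite truncations: these lie in that image for every vector, so the extension is an explicit
  limit.\<close>

definition op_of :: "('a \<Rightarrow> 'a) \<Rightarrow> nat op" where
  "op_of L = Blinfun (\<lambda>\<xi>. lim (\<lambda>m. vec (L (trunc m \<xi>))))"

lemma trunc_mem: "trunc m \<xi> \<in> K" unfolding trunc_def by (intro sum_mem sc_mem e_mem)

lemma trunc_add: "trunc m (\<xi> + \<eta>) = trunc m \<xi> + trunc m \<eta>"
  by (simp add: trunc_def coord_add sc_add_left e_mem sum.distrib)

lemma sc_sum: "(\<And>i. i \<in> F \<Longrightarrow> g i \<in> K) \<Longrightarrow> sc c (sum g F) = (\<Sum>i\<in>F. sc c (g i))"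
  by (induction F rule: infinite_finite_induct) (auto simp: sc_zero_right sc_add_right sum_mem)

lemma trunc_scale: "trunc m (ell2_scale c \<xi>) = sc c (trunc m \<xi>)"
  unfolding trunc_def by (subst sc_sum) (auto intro: sc_mem e_mem simp: coord_scale sc_sc e_mem)

lemma n2_partial: "k \<le> m \<Longrightarrow> (n2 (trunc m \<xi> - trunc k \<xi>))\<^sup>2 = (\<Sum>j=k..<m. (cmod (coord \<xi> j))\<^sup>2)"
proof -
  assume "k \<le> m"
  then have "trunc m \<xi> - trunc k \<xi> = (\<Sum>j=k..<m. sc (coord \<xi> j) (e j))"
    unfolding trunc_def by (simp add: sum_diff_nat_ivl[of 0 k m, simplified] lessThan_atLeast0)
  moreover have "vec (\<Sum>j=k..<m. sc (coord \<xi> j) (e j)) = (\<Sum>j=k..<m. ell2_scale (coord \<xi> j) (ket j))"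
    by (subst vec_sum) (auto intro!: sc_mem e_mem simp: vec_sc e_mem vec_e)
  ultimately show ?thesis
    using norm_vec[OF diff_mem[OF trunc_mem trunc_mem], of m \<xi> k \<xi>] norm_finite_sum_ket[of "{k..<m}" "coord \<xi>"]
    by simp
qed

lemma n2_trunc_le: "n2 (trunc m \<xi>) \<le> norm \<xi>"
proof (rule power2_le_imp_le)
  have "(n2 (trunc m \<xi>))\<^sup>2 = (\<Sum>j<m. (cmod (coord \<xi> j))\<^sup>2)"
    using n2_partial[of 0 m \<xi>] by (simp add: trunc_def lessThan_atLeast0)
  also have "\<dots> \<le> (norm \<xi>)\<^sup>2" by (rule ell2_sum_le_norm) simp
  finally show "(n2 (trunc m \<xi>))\<^sup>2 \<le> (norm \<xi>)\<^sup>2" .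
qed simp

lemma trunc_vec: "x \<in> K \<Longrightarrow> trunc m (vec x) = proj e m x"
  by (simp add: trunc_def proj_def coord_vec)

context
  fixes L assumes L: "bounded_map L"
begin

lemma bounded_map_mem: "x \<in> K \<Longrightarrow> L x \<in> K" using L by (simp add: bounded_map_def)
lemma bounded_map_add: "x \<in> K \<Longrightarrow> y \<in> K \<Longrightarrow> L (x + y) = L x + L y" using L by (simp add: bounded_map_def)
lemma bounded_map_sc: "x \<in> K \<Longrightarrow> L (sc c x) = sc c (L x)" using L by (simp add: bounded_map_def)
lemma bounded_map_diff: "x \<in> K \<Longrightarrow> y \<in> K \<Longrightarrow> L (x - y) = L x - L y"
  using bounded_map_add[of "x - y" y] by (simp add: diff_mem algebra_simps)
lemma bounded_map_bound: "\<exists>C>0. \<forall>x\<in>K. n2 (L x) \<le> C * n2 x"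
proof -
  obtain C where C: "\<And>x. x \<in> K \<Longrightarrow> n2 (L x) \<le> C * n2 x"
    using L unfolding bounded_map_def by blast
  have "n2 (L x) \<le> (\<bar>C\<bar> + 1) * n2 x" if x: "x \<in> K" for x
    by (rule order_trans[OF C[OF x]]) (intro mult_right_mono, use x in auto)
  then show ?thesis by (intro exI[of _ "\<bar>C\<bar> + 1"]) auto
qed

lemma op_of_limit: "\<exists>l. (\<lambda>m. vec (L (trunc m \<xi>))) \<longlonglongrightarrow> l"
proof -
  obtain C where C: "C > 0" "\<And>x. x \<in> K \<Longrightarrow> n2 (L x) \<le> C * n2 x" using bounded_map_bound by blast
  have "(\<lambda>j. (cmod (coord \<xi> j))\<^sup>2) summable_on UNIV" using coord[of \<xi>] by simp
  then have "summable (\<lambda>j. (cmod (coord \<xi> j))\<^sup>2)" by (rule summable_on_imp_summable)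
  then have *: "\<exists>N. \<forall>m\<ge>N. \<forall>n. norm (\<Sum>j=m..<n. (cmod (coord \<xi> j))\<^sup>2) < \<epsilon>" if "\<epsilon> > 0" for \<epsilon>
    using that unfolding summable_Cauchy by blast
  have "Cauchy (\<lambda>m. vec (L (trunc m \<xi>)))"
  proof (rule CauchyI')
    fix \<epsilon> :: real assume \<epsilon>: "\<epsilon> > 0"
    obtain N where N: "\<And>m n. m \<ge> N \<Longrightarrow> (\<Sum>j=m..<n. (cmod (coord \<xi> j))\<^sup>2) < (\<epsilon> / C)\<^sup>2"
      using *[of "(\<epsilon> / C)\<^sup>2"] \<epsilon> C(1) by (auto simp: abs_of_nonneg sum_nonneg)
    have "dist (vec (L (trunc m \<xi>))) (vec (L (trunc n \<xi>))) < \<epsilon>" if "m \<ge> N" "m < n" for m n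
    proof -
      have "(n2 (trunc n \<xi> - trunc m \<xi>))\<^sup>2 < (\<epsilon> / C)\<^sup>2" using N[OF that(1), of n] n2_partial[of m n \<xi>] that by simp
      then have s: "n2 (trunc n \<xi> - trunc m \<xi>) < \<epsilon> / C" by (rule power2_less_imp_less) (use \<epsilon> C(1) in simp)
      have "dist (vec (L (trunc m \<xi>))) (vec (L (trunc n \<xi>))) = n2 (L (trunc n \<xi> - trunc m \<xi>))"
        by (subst dist_commute) (simp add: dist_norm bounded_map_diff trunc_mem bounded_map_mem diff_mem norm_vec flip: vec_diff)
      also have "\<dots> \<le> C * n2 (trunc n \<xi> - trunc m \<xi>)" by (intro C diff_mem trunc_mem)
      also have "\<dots> < \<epsilon>" using s C(1) by (simp add: field_simps)
      finally show ?thesis .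
    qed
    then show "\<exists>M. \<forall>m\<ge>M. \<forall>n>m. dist (vec (L (trunc m \<xi>))) (vec (L (trunc n \<xi>))) < \<epsilon>" by blast
  qed
  then show ?thesis by (simp add: Cauchy_convergent_iff convergent_def)
qed

lemma op_of_lim: "(\<lambda>m. vec (L (trunc m \<xi>))) \<longlonglongrightarrow> lim (\<lambda>m. vec (L (trunc m \<xi>)))"
  using op_of_limit limI by metis

lemma bounded_linear_op_of: "bounded_linear (\<lambda>\<xi>. lim (\<lambda>m. vec (L (trunc m \<xi>))))"
proof -
  obtain C where C: "C > 0" "\<And>x. x \<in> K \<Longrightarrow> n2 (L x) \<le> C * n2 x" using bounded_map_bound by blast
  show ?thesis
  proof (rule bounded_linear_intro[where K = C])
    fix \<xi> \<eta> :: "nat ell2" and r :: real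
    show "lim (\<lambda>m. vec (L (trunc m (\<xi> + \<eta>)))) = lim (\<lambda>m. vec (L (trunc m \<xi>))) + lim (\<lambda>m. vec (L (trunc m \<eta>)))"
      using tendsto_add[OF op_of_lim op_of_lim, of \<xi> \<eta>]
      by (intro limI) (simp add: trunc_add bounded_map_add trunc_mem vec_add bounded_map_mem)
    show "lim (\<lambda>m. vec (L (trunc m (r *\<^sub>R \<xi>)))) = r *\<^sub>R lim (\<lambda>m. vec (L (trunc m \<xi>)))"
      using tendsto_scaleR[OF tendsto_const op_of_lim, of r \<xi>]
      by (intro limI) (simp add: scaleR_ell2_def trunc_scale bounded_map_sc trunc_mem vec_sc bounded_map_mem)
    have "norm (vec (L (trunc m \<xi>))) \<le> norm \<xi> * C" for m
    proof -
      have "norm (vec (L (trunc m \<xi>))) \<le> C * n2 (trunc m \<xi>)" by (simp add: norm_vec bounded_map_mem trunc_mem C)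
      also have "\<dots> \<le> C * norm \<xi>" using C(1) n2_trunc_le by (intro mult_left_mono) auto
      finally show ?thesis by (simp add: mult.commute)
    qed
    then show "norm (lim (\<lambda>m. vec (L (trunc m \<xi>)))) \<le> norm \<xi> * C"
      by (intro LIMSEQ_le_const2[OF tendsto_norm[OF op_of_lim]]) auto
  qed
qed

lemma op_of_apply: "blinfun_apply (op_of L) \<xi> = lim (\<lambda>m. vec (L (trunc m \<xi>)))"
  unfolding op_of_def by (simp add: bounded_linear_Blinfun_apply bounded_linear_op_of)

lemma op_of_bounded: "op_of L \<in> bounded_ops"
  unfolding bounded_ops_def
proof (intro CollectI allI)
  fix c \<xi>
  have "(\<lambda>m. ell2_scale c (vec (L (trunc m \<xi>)))) \<longlonglongrightarrow> ell2_scale c (lim (\<lambda>m. vec (L (trunc m \<xi>))))"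
    by (rule bounded_linear.tendsto[OF bounded_linear_ell2_scale op_of_lim])
  then show "blinfun_apply (op_of L) (ell2_scale c \<xi>) = ell2_scale c (blinfun_apply (op_of L) \<xi>)"
    unfolding op_of_apply by (intro limI) (simp add: trunc_scale bounded_map_sc trunc_mem vec_sc bounded_map_mem)
qed

lemma op_of_vec:
  assumes x: "x \<in> K" shows "blinfun_apply (op_of L) (vec x) = vec (L x)"
proof -
  obtain C where C: "C > 0" "\<And>x. x \<in> K \<Longrightarrow> n2 (L x) \<le> C * n2 x" using bounded_map_bound by blast
  have "(\<lambda>m. vec (L (trunc m (vec x))) - vec (L x)) \<longlonglongrightarrow> 0"
  proof (rule Lim_null_comparison)
    show "(\<lambda>m. C * n2 (x - proj e m x)) \<longlonglongrightarrow> 0" by (rule tendsto_mult_right_zero[OF e_total[OF x]])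
    have "norm (vec (L (trunc m (vec x))) - vec (L x)) \<le> C * n2 (x - proj e m x)" for m
    proof -
      have "norm (vec (L (trunc m (vec x))) - vec (L x)) = n2 (L (proj e m x - x))"
        using x by (simp add: trunc_vec bounded_map_diff proj_mem[OF e_ons] bounded_map_mem diff_mem norm_vec flip: vec_diff)
      also have "\<dots> \<le> C * n2 (proj e m x - x)" using x by (intro C diff_mem proj_mem[OF e_ons])
      also have "n2 (proj e m x - x) = n2 (x - proj e m x)" by (rule n2_commute[OF proj_mem[OF e_ons] x])
      finally show ?thesis .
    qed
    then show "eventually (\<lambda>m. norm (vec (L (trunc m (vec x))) - vec (L x)) \<le> C * n2 (x - proj e m x)) sequentially" by simp
  qed
  then have "(\<lambda>m. vec (L (trunc m (vec x)))) \<longlonglongrightarrow> vec (L x)" by (simp add: LIM_zero_iff)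
  then show ?thesis unfolding op_of_apply by (rule limI)
qed

end

lemma bounded_map_left: "x \<in> K \<Longrightarrow> bounded_map (\<lambda>z. x \<cdot> z)"
  using left_bounded by (auto simp: bounded_map_def mul_mem mul_add_right mul_sc_right)

lemma bounded_map_right: assumes x: "x \<in> K" shows "bounded_map (\<lambda>z. z \<cdot> x)"
proof -
  obtain C where C: "\<And>y. y \<in> K \<Longrightarrow> n2 (st x \<cdot> y) \<le> C * n2 y" using left_bounded[OF st_mem[OF x]] by blast
  have "n2 (z \<cdot> x) \<le> C * n2 z" if z: "z \<in> K" for z
    using C[OF st_mem[OF z]] n2_st[OF mul_mem[OF z x]] n2_st[OF z] by (simp add: st_mul x z)
  then show ?thesis using x by (auto simp: bounded_map_def mul_mem mul_add_left mul_sc_left)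
qed

definition lrep :: "'a \<Rightarrow> nat op" where "lrep x = op_of (\<lambda>z. x \<cdot> z)"
text \<open>Right multiplications commute with left ones, hence with all of \<open>gns_alg\<close>.
  Through them an element of the bicommutant is controlled by its value at
  \<open>\<Omega>\<close>.\<close>

definition rrep :: "'a \<Rightarrow> nat op" where "rrep x = op_of (\<lambda>z. z \<cdot> x)"

lemma lrep_vec: "x \<in> K \<Longrightarrow> z \<in> K \<Longrightarrow> blinfun_apply (lrep x) (vec z) = vec (x \<cdot> z)"
  unfolding lrep_def by (rule op_of_vec[OF bounded_map_left])
lemma rrep_vec: "x \<in> K \<Longrightarrow> z \<in> K \<Longrightarrow> blinfun_apply (rrep x) (vec z) = vec (z \<cdot> x)"
  unfolding rrep_def by (rule op_of_vec[OF bounded_map_right])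
lemma lrep_bounded: "x \<in> K \<Longrightarrow> lrep x \<in> bounded_ops"
  unfolding lrep_def by (rule op_of_bounded[OF bounded_map_left])
lemma rrep_bounded: "x \<in> K \<Longrightarrow> rrep x \<in> bounded_ops"
  unfolding rrep_def by (rule op_of_bounded[OF bounded_map_right])

lemma lrep_add: "x \<in> K \<Longrightarrow> y \<in> K \<Longrightarrow> lrep (x + y) = lrep x + lrep y"
  by (rule op_eqI) (simp add: lrep_vec add_mem mul_add_left vec_add mul_mem blinfun.add_left)
lemma lrep_mul: "x \<in> K \<Longrightarrow> y \<in> K \<Longrightarrow> lrep (x \<cdot> y) = lrep x o\<^sub>L lrep y"
  by (rule op_eqI) (simp add: lrep_vec mul_mem mul_assoc)
lemma lrep_sc: "x \<in> K \<Longrightarrow> lrep (sc c x) = op_scale c (lrep x)"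
  by (rule op_eqI) (simp add: lrep_vec sc_mem mul_sc_left vec_sc mul_mem op_scale_apply)
lemma lrep_un: "lrep un = id_blinfun"
  by (rule op_eqI) (simp add: lrep_vec un_mem un_mul)

lemma lrep_adjoint: assumes x: "x \<in> K" shows "op_adjoint (lrep x) = lrep (st x)"
proof (rule op_eqI, rule vec_cinner_eqI)
  fix z w assume z: "z \<in> K" and w: "w \<in> K"
  show "cinner (vec w) (blinfun_apply (op_adjoint (lrep x)) (vec z)) = cinner (vec w) (blinfun_apply (lrep (st x)) (vec z))"
    using x z w by (simp add: op_adjoint_right[OF lrep_bounded] lrep_vec st_mem cinner_vec mul_mem ip_def st_mul mul_assoc)
qed

lemma rrep_adjoint: assumes x: "x \<in> K" shows "op_adjoint (rrep x) = rrep (st x)"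
proof (rule op_eqI, rule vec_cinner_eqI)
  fix z w assume z: "z \<in> K" and w: "w \<in> K"
  have "\<tau> (st x \<cdot> (st w \<cdot> z)) = \<tau> ((st w \<cdot> z) \<cdot> st x)" using x z w by (intro tr_comm mul_mem st_mem)
  then show "cinner (vec w) (blinfun_apply (op_adjoint (rrep x)) (vec z)) = cinner (vec w) (blinfun_apply (rrep (st x)) (vec z))"
    using x z w by (simp add: op_adjoint_right[OF rrep_bounded] rrep_vec st_mem cinner_vec mul_mem ip_def st_mul mul_assoc)
qed

definition gns_alg :: "nat op set" where "gns_alg = commutant (commutant (lrep ` K))"
abbreviation "\<Omega> \<equiv> vec un"
definition gns_tr :: "nat op \<Rightarrow> complex" where "gns_tr T = cinner \<Omega> (blinfun_apply T \<Omega>)"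

lemma gns_alg_vna: "von_neumann_algebra gns_alg" and lrep_gns_alg: "x \<in> K \<Longrightarrow> lrep x \<in> gns_alg"
proof -
  have 1: "lrep ` K \<subseteq> bounded_ops" "op_adjoint ` lrep ` K \<subseteq> lrep ` K"
    by (auto simp: lrep_bounded lrep_adjoint st_mem)
  show "von_neumann_algebra gns_alg" unfolding gns_alg_def by (rule bicommutant_vna(1)[OF 1])
  show "x \<in> K \<Longrightarrow> lrep x \<in> gns_alg" unfolding gns_alg_def using bicommutant_vna(2)[OF 1] by blast
qed

lemma gns_alg_bounded: "T \<in> gns_alg \<Longrightarrow> T \<in> bounded_ops"
  by (rule vna_bounded[OF gns_alg_vna])

lemma rrep_commutant: "x \<in> K \<Longrightarrow> rrep x \<in> commutant (lrep ` K)"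
proof -
  assume x: "x \<in> K"
  have "rrep x o\<^sub>L lrep y = lrep y o\<^sub>L rrep x" if y: "y \<in> K" for y
    by (rule op_eqI) (simp add: x y rrep_vec lrep_vec mul_mem mul_assoc)
  then show ?thesis using rrep_bounded[OF x] by (auto simp: commutant_def)
qed

text \<open>\<open>vec y\<close> is the value at \<open>\<Omega>\<close> of a right multiplication,
  and \<open>T\<close> commutes with it. So \<open>\<Omega>\<close> is separating for
  \<open>gns_alg\<close>, which gives a faithful trace even if the original one was
  degenerate.\<close>

lemma gns_alg_vec:
  assumes T: "T \<in> gns_alg" and y: "y \<in> K"
  shows "blinfun_apply T (vec y) = blinfun_apply (rrep y) (blinfun_apply T \<Omega>)"
proof -
  have "T o\<^sub>L rrep y = rrep y o\<^sub>L T"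
    using T rrep_commutant[OF y] unfolding gns_alg_def by (rule commutant_commute)
  then have "blinfun_apply (T o\<^sub>L rrep y) \<Omega> = blinfun_apply (rrep y o\<^sub>L T) \<Omega>" by simp
  then show ?thesis using y by (simp add: rrep_vec un_mem un_mul)
qed

lemma gns_faithful: "T \<in> gns_alg \<Longrightarrow> blinfun_apply T \<Omega> = 0 \<Longrightarrow> T = 0"
  by (rule op_eqI) (simp add: gns_alg_vec)

text \<open>The adjoints of left and of right multiplication by \<open>x\<close> agree at
  \<open>\<Omega>\<close>, and the right one can be moved past \<open>T\<close>.\<close>

lemma gns_tr_lrep_commute:
  assumes T: "T \<in> gns_alg" and x: "x \<in> K"
  shows "gns_tr (lrep x o\<^sub>L T) = gns_tr (T o\<^sub>L lrep x)"
proof -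
  have "gns_tr (lrep x o\<^sub>L T) = cinner (blinfun_apply (op_adjoint (lrep x)) \<Omega>) (blinfun_apply T \<Omega>)"
    by (simp add: gns_tr_def op_adjoint_left[OF lrep_bounded[OF x]])
  also have "\<dots> = cinner (vec (st x)) (blinfun_apply T \<Omega>)"
    using x by (simp add: lrep_adjoint lrep_vec st_mem un_mem mul_un)
  also have "\<dots> = cinner (blinfun_apply (op_adjoint (rrep x)) \<Omega>) (blinfun_apply T \<Omega>)"
    using x by (simp add: rrep_adjoint rrep_vec st_mem un_mem un_mul)
  also have "\<dots> = gns_tr (T o\<^sub>L lrep x)"
    using x by (simp add: gns_tr_def op_adjoint_left[OF rrep_bounded[OF x]] lrep_vec un_mem mul_un
        flip: gns_alg_vec[OF T x])
  finally show ?thesis .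
qed

text \<open>The trace property is known so far only if one factor is a left multiplication; tested
  on the dense vectors \<open>vec w\<close> it gives this bound. Closeness of two elements at
  \<open>\<Omega>\<close> thereby implies closeness of their adjoints at
  \<open>\<Omega>\<close>.\<close>

lemma gns_norm_adjoint_le:
  assumes T: "T \<in> gns_alg" shows "norm (blinfun_apply (op_adjoint T) \<Omega>) \<le> norm (blinfun_apply T \<Omega>)"
proof -
  note Tb = gns_alg_bounded[OF T]
  define \<xi> where "\<xi> = blinfun_apply (op_adjoint T) \<Omega>"
  have key: "cmod (cinner (vec w) \<xi>) \<le> norm (vec w) * norm (blinfun_apply T \<Omega>)" if w: "w \<in> K" for w
  proof -
    have "cinner (vec w) \<xi> = cinner (blinfun_apply T (blinfun_apply (lrep w) \<Omega>)) \<Omega>"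
      using w by (simp add: \<xi>_def op_adjoint_right[OF Tb] lrep_vec un_mem mul_un)
    also have "\<dots> = cnj (gns_tr (T o\<^sub>L lrep w))"
      by (simp add: gns_tr_def) (rule cinner_commute)
    also have "\<dots> = cnj (gns_tr (lrep w o\<^sub>L T))" using gns_tr_lrep_commute[OF T w] by simp
    finally have "cmod (cinner (vec w) \<xi>) = cmod (cinner (vec (st w)) (blinfun_apply T \<Omega>))"
      using w by (simp add: gns_tr_def lrep_adjoint lrep_vec st_mem un_mem mul_un flip: op_adjoint_left[OF lrep_bounded[OF w]])
    also have "\<dots> \<le> norm (vec (st w)) * norm (blinfun_apply T \<Omega>)" by (rule cmod_cinner_le)
    finally show ?thesis using w by (simp add: norm_vec st_mem n2_st)
  qed
  have "(norm \<xi>)\<^sup>2 \<le> norm \<xi> * norm (blinfun_apply T \<Omega>) + \<epsilon>" if \<epsilon>: "\<epsilon> > 0" for \<epsilon>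
  proof -
    define d where "d = \<epsilon> / (norm \<xi> + norm (blinfun_apply T \<Omega>) + 1)"
    have p: "norm \<xi> + norm (blinfun_apply T \<Omega>) + 1 > 0" by (intro add_nonneg_pos) auto
    then have d: "d > 0" using \<epsilon> by (simp add: d_def)
    obtain w where w: "w \<in> K" "norm (\<xi> - vec w) < d" using vec_dense[OF d] by blast
    have "(norm \<xi>)\<^sup>2 = cmod (cinner \<xi> \<xi>)" by (simp add: cinner_self norm_power)
    also have "\<dots> = cmod (cinner (\<xi> - vec w) \<xi> + cinner (vec w) \<xi>)" by (simp add: cinner.diff_left)
    also have "\<dots> \<le> norm (\<xi> - vec w) * norm \<xi> + norm (vec w) * norm (blinfun_apply T \<Omega>)"
      by (intro order_trans[OF norm_triangle_ineq] add_mono cmod_cinner_le key w)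
    also have "\<dots> \<le> d * norm \<xi> + (norm \<xi> + d) * norm (blinfun_apply T \<Omega>)"
      using w(2) norm_triangle_ineq3[of \<xi> "vec w"] by (intro add_mono mult_right_mono) auto
    also have "\<dots> = norm \<xi> * norm (blinfun_apply T \<Omega>) + d * (norm \<xi> + norm (blinfun_apply T \<Omega>))"
      by (simp add: algebra_simps)
    also have "d * (norm \<xi> + norm (blinfun_apply T \<Omega>)) \<le> d * (norm \<xi> + norm (blinfun_apply T \<Omega>) + 1)"
      using d by (intro mult_left_mono) auto
    also have "d * (norm \<xi> + norm (blinfun_apply T \<Omega>) + 1) = \<epsilon>" using p by (simp add: d_def)
    finally show ?thesis by simp
  qed
  then have "(norm \<xi>)\<^sup>2 \<le> norm \<xi> * norm (blinfun_apply T \<Omega>)" by (rule field_le_epsilon)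
  then have "norm \<xi> * norm \<xi> \<le> norm \<xi> * norm (blinfun_apply T \<Omega>)" by (simp add: power2_eq_square)
  then have "norm \<xi> \<le> norm (blinfun_apply T \<Omega>)"
    by (cases "norm \<xi> = 0") (auto simp: mult_le_cancel_left)
  then show ?thesis by (simp add: \<xi>_def)
qed

text \<open>\<open>S\<close> is replaced by a left multiplication close to it at
  \<open>\<Omega>\<close>, for which the property is known. In one order the error is governed by
  the adjoint of \<open>D\<close> at \<open>\<Omega>\<close>, in the other by \<open>D\<close>
  itself.\<close>

lemma gns_tr_commute:
  assumes S: "S \<in> gns_alg" and T: "T \<in> gns_alg"
  shows "gns_tr (S o\<^sub>L T) = gns_tr (T o\<^sub>L S)"
proof -
  note v = gns_alg_vna
  have "cmod (gns_tr (S o\<^sub>L T) - gns_tr (T o\<^sub>L S)) \<le> \<epsilon>" if \<epsilon>: "\<epsilon> > 0" for \<epsilon>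
  proof -
    define c where "c = norm (blinfun_apply T \<Omega>) + norm (blinfun_apply (op_adjoint T) \<Omega>) + 1"
    have c: "c > 0" unfolding c_def by (intro add_nonneg_pos) auto
    obtain w where w: "w \<in> K" "norm (blinfun_apply S \<Omega> - vec w) < \<epsilon> / c"
      using vec_dense[of "\<epsilon> / c" "blinfun_apply S \<Omega>"] \<epsilon> c by auto
    define D where "D = S - lrep w"
    have Dm: "D \<in> gns_alg"
      unfolding D_def using closed_algD(7)[OF closed_alg_vna[OF v] S lrep_gns_alg[OF w(1)]] .
    have Dn: "norm (blinfun_apply D \<Omega>) < \<epsilon> / c"
      using w by (simp add: D_def blinfun.diff_left lrep_vec un_mem mul_un)
    have eq: "gns_tr (S o\<^sub>L T) - gns_tr (T o\<^sub>L S) = gns_tr (D o\<^sub>L T) - gns_tr (T o\<^sub>L D)"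
      using gns_tr_lrep_commute[OF T w(1)]
      by (simp add: D_def gns_tr_def blinfun.diff_left blinfun.diff_right cinner.diff_right)
    have "cmod (gns_tr (S o\<^sub>L T) - gns_tr (T o\<^sub>L S)) \<le> cmod (gns_tr (D o\<^sub>L T)) + cmod (gns_tr (T o\<^sub>L D))"
      unfolding eq by (rule norm_triangle_ineq4)
    also have "\<dots> \<le> (\<epsilon> / c) * norm (blinfun_apply T \<Omega>) + norm (blinfun_apply (op_adjoint T) \<Omega>) * (\<epsilon> / c)"
    proof (rule add_mono)
      have "cmod (gns_tr (D o\<^sub>L T)) \<le> norm (blinfun_apply (op_adjoint D) \<Omega>) * norm (blinfun_apply T \<Omega>)"
        using cmod_cinner_le by (simp add: gns_tr_def flip: op_adjoint_left[OF gns_alg_bounded[OF Dm]])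
      also have "\<dots> \<le> (\<epsilon> / c) * norm (blinfun_apply T \<Omega>)"
        using gns_norm_adjoint_le[OF Dm] Dn by (intro mult_right_mono) auto
      finally show "cmod (gns_tr (D o\<^sub>L T)) \<le> (\<epsilon> / c) * norm (blinfun_apply T \<Omega>)" .
      have "cmod (gns_tr (T o\<^sub>L D)) \<le> norm (blinfun_apply (op_adjoint T) \<Omega>) * norm (blinfun_apply D \<Omega>)"
        using cmod_cinner_le by (simp add: gns_tr_def flip: op_adjoint_left[OF gns_alg_bounded[OF T]])
      also have "\<dots> \<le> norm (blinfun_apply (op_adjoint T) \<Omega>) * (\<epsilon> / c)"
        using Dn by (intro mult_left_mono) auto
      finally show "cmod (gns_tr (T o\<^sub>L D)) \<le> norm (blinfun_apply (op_adjoint T) \<Omega>) * (\<epsilon> / c)" .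
    qed
    also have "\<dots> = (\<epsilon> / c) * (norm (blinfun_apply T \<Omega>) + norm (blinfun_apply (op_adjoint T) \<Omega>))"
      by (simp add: algebra_simps)
    also have "\<dots> \<le> (\<epsilon> / c) * c" using \<epsilon> c by (intro mult_left_mono) (auto simp: c_def)
    also have "\<dots> = \<epsilon>" using c by simp
    finally show ?thesis .
  qed
  then have "cmod (gns_tr (S o\<^sub>L T) - gns_tr (T o\<^sub>L S)) \<le> 0" by (rule dense_ge)
  then show ?thesis by simp
qed

lemma gns_tr_continuous:
  "continuous_map (subtopology ultraweak_topology gns_alg) euclidean gns_tr"
  unfolding continuous_map_def
proof (intro conjI allI impI)
  fix V :: "complex set" assume "openin euclidean V"
  then have V: "open V" by simp
  \<comment> \<open>The vector state is a series with a single nonzero term, so it is one of the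
    subbasic functionals.\<close>
  define \<xi> where "\<xi> n = (if n = 0 then \<Omega> else 0)" for n :: nat
  have s: "summable (\<lambda>n. (norm (\<xi> n))\<^sup>2)" by (rule summable_finite[of "{0}"]) (auto simp: \<xi>_def)
  have t: "gns_tr T = (\<Sum>n. cinner (\<xi> n) (blinfun_apply T (\<xi> n)))" for T
    by (subst suminf_finite[of "{0}"]) (auto simp: \<xi>_def gns_tr_def cinner.zero_left)
  define G where "G = {T :: nat op. (\<Sum>n. cinner (\<xi> n) (blinfun_apply T (\<xi> n))) \<in> V}"
  have "openin ultraweak_topology G"
    unfolding ultraweak_topology_def by (rule topology_generated_by_Basis) (use s V G_def in blast)
  moreover have "{x \<in> topspace (subtopology ultraweak_topology gns_alg). gns_tr x \<in> V}
      = topspace (subtopology ultraweak_topology gns_alg) \<inter> G"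
    by (auto simp: G_def t)
  ultimately show "openin (subtopology ultraweak_topology gns_alg)
      {x \<in> topspace (subtopology ultraweak_topology gns_alg). gns_tr x \<in> V}"
    by (auto simp: openin_subtopology topspace_subtopology intro!: openin_subtopology_Int2 dest: openin_subset)
qed auto

definition gns_obj :: "nat op tracial_alg" where "gns_obj = operator_alg gns_alg gns_tr"

lemma carrier_gns_obj [simp]: "carrier gns_obj = gns_alg" by (simp add: gns_obj_def operator_alg_def)
lemma tr_gns_obj [simp]: "tr gns_obj = gns_tr" by (simp add: gns_obj_def operator_alg_def)

lemma tracial_gns_obj: "tracial_vna gns_obj"
  unfolding tracial_vna_def
proof (intro conjI ballI allI impI)
  show "gns_obj = operator_alg (carrier gns_obj) (tr gns_obj)"
    unfolding carrier_gns_obj tr_gns_obj by (rule gns_obj_def)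
  show "von_neumann_algebra (carrier gns_obj)" by (simp add: gns_alg_vna)
  show "tr gns_obj id_blinfun = 1"
    using cinner_vec[OF un_mem un_mem] ip_self[OF un_mem] by (simp add: gns_tr_def)
  show "continuous_map (subtopology ultraweak_topology (carrier gns_obj)) euclidean (tr gns_obj)"
    by (simp add: gns_tr_continuous)
  fix S T c assume S: "S \<in> carrier gns_obj"
  then have Sb: "S \<in> bounded_ops" by (simp add: gns_alg_bounded)
  show "tr gns_obj (op_scale c S) = c * tr gns_obj S" by (simp add: gns_tr_def op_scale_apply cinner_scale_right)
  have sq: "tr gns_obj (op_adjoint S o\<^sub>L S) = complex_of_real ((norm (blinfun_apply S \<Omega>))\<^sup>2)"
    by (simp add: gns_tr_def op_adjoint_right[OF Sb] cinner_self)
  show "tr gns_obj (op_adjoint S o\<^sub>L S) \<in> \<real>" "0 \<le> Re (tr gns_obj (op_adjoint S o\<^sub>L S))"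
    unfolding sq by auto
  show "S = 0" if "tr gns_obj (op_adjoint S o\<^sub>L S) = 0"
    using that S unfolding sq by (intro gns_faithful) auto
  assume T: "T \<in> carrier gns_obj"
  show "tr gns_obj (S + T) = tr gns_obj S + tr gns_obj T" by (simp add: gns_tr_def blinfun.add_left cinner_add_right)
  show "tr gns_obj (S o\<^sub>L T) = tr gns_obj (T o\<^sub>L S)" using S T gns_tr_commute by simp
qed

lemma gns_tr_lrep: "x \<in> K \<Longrightarrow> gns_tr (lrep x) = \<tau> x"
  by (simp add: gns_tr_def lrep_vec un_mem mul_un cinner_vec ip_def st_un un_mul)

lemma lrep_dense:
  assumes T: "T \<in> gns_alg" and \<epsilon>: "\<epsilon> > 0" shows "\<exists>x\<in>K. norm2 gns_obj (T - lrep x) < \<epsilon>"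
proof -
  obtain x where x: "x \<in> K" "norm (blinfun_apply T \<Omega> - vec x) < \<epsilon>"
    using vec_dense[OF \<epsilon>] by blast
  have m: "T - lrep x \<in> gns_alg"
    using closed_algD(7)[OF closed_alg_vna[OF gns_alg_vna] T lrep_gns_alg[OF x(1)]] .
  have "norm2 gns_obj (T - lrep x) = norm (blinfun_apply (T - lrep x) \<Omega>)"
    using gns_alg_bounded[OF m]
    by (simp add: norm2_def operator_alg_simps[OF tracial_gns_obj] gns_tr_def op_adjoint_right cinner_self del: of_real_power)
  also have "\<dots> < \<epsilon>" using x by (simp add: blinfun.diff_left lrep_vec un_mem mul_un)
  finally show ?thesis using x(1) by blast
qed

end

section \<open>The tracial algebra of bounded sequences\<close>

abbreviation seq_mul :: "(nat \<Rightarrow> 'r op) \<Rightarrow> (nat \<Rightarrow> 'r op) \<Rightarrow> nat \<Rightarrow> 'r op" where "seq_mul \<xi> \<eta> \<equiv> (\<lambda>n. \<xi> n o\<^sub>L \<eta> n)"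
abbreviation seq_sc :: "complex \<Rightarrow> (nat \<Rightarrow> 'r op) \<Rightarrow> nat \<Rightarrow> 'r op" where "seq_sc z \<xi> \<equiv> (\<lambda>n. op_scale z (\<xi> n))"
abbreviation seq_st :: "(nat \<Rightarrow> 'r op) \<Rightarrow> nat \<Rightarrow> 'r op" where "seq_st \<xi> \<equiv> (\<lambda>n. op_adjoint (\<xi> n))"
abbreviation seq_one :: "nat \<Rightarrow> 'r op" where "seq_one \<equiv> (\<lambda>n. id_blinfun)"
definition seq_tr :: "nat filter \<Rightarrow> 'r op tracial_alg \<Rightarrow> (nat \<Rightarrow> 'r op) \<Rightarrow> complex" where
  "seq_tr \<U> N \<xi> = Lim \<U> (\<lambda>n. tr N (\<xi> n))"

definition seq_closure ::
    "'r op tracial_alg \<Rightarrow> nat filter \<Rightarrow> (nat \<Rightarrow> nat \<Rightarrow> 'r op) \<Rightarrow> (nat \<Rightarrow> nat \<Rightarrow> 'r op) \<Rightarrow> (nat \<Rightarrow> 'r op) set" where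
  "seq_closure N \<U> x y = {\<xi> \<in> bounded_seqs N. \<forall>e>0. \<exists>p. eventually (\<lambda>n. norm2 N (\<xi> n - eval_poly N (x n) (y n) p) < e) \<U>}"

text \<open>With a faithful trace on \<open>D\<close>, preserving the limit trace fixes the kernel:
  exactly the null sequences are lost. Such a map stands for a faithful representation of a
  subalgebra of the ultrapower.\<close>

definition seq_rep ::
    "((nat \<Rightarrow> 'r op) \<Rightarrow> 'd op) \<Rightarrow> (nat \<Rightarrow> 'r op) set \<Rightarrow> nat filter \<Rightarrow> 'r op tracial_alg \<Rightarrow> 'd op tracial_alg \<Rightarrow> bool" where
  "seq_rep \<pi> K \<U> N D \<longleftrightarrow>
     (\<forall>\<xi>\<in>K. \<pi> \<xi> \<in> carrier D) \<and> \<pi> seq_one = id_blinfun \<and>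
     (\<forall>\<xi>\<in>K. \<forall>\<eta>\<in>K. \<pi> (\<xi> + \<eta>) = \<pi> \<xi> + \<pi> \<eta> \<and> \<pi> (seq_mul \<xi> \<eta>) = \<pi> \<xi> o\<^sub>L \<pi> \<eta>) \<and>
     (\<forall>z. \<forall>\<xi>\<in>K. \<pi> (seq_sc z \<xi>) = op_scale z (\<pi> \<xi>)) \<and>
     (\<forall>\<xi>\<in>K. \<pi> (seq_st \<xi>) = op_adjoint (\<pi> \<xi>)) \<and>
     (\<forall>\<xi>\<in>K. tr D (\<pi> \<xi>) = seq_tr \<U> N \<xi>)"

lemma seq_repD:
  assumes "seq_rep \<pi> K \<U> N D"
  shows "\<xi> \<in> K \<Longrightarrow> \<pi> \<xi> \<in> carrier D" "\<pi> seq_one = id_blinfun"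
    "\<xi> \<in> K \<Longrightarrow> \<eta> \<in> K \<Longrightarrow> \<pi> (\<xi> + \<eta>) = \<pi> \<xi> + \<pi> \<eta>"
    "\<xi> \<in> K \<Longrightarrow> \<eta> \<in> K \<Longrightarrow> \<pi> (seq_mul \<xi> \<eta>) = \<pi> \<xi> o\<^sub>L \<pi> \<eta>"
    "\<xi> \<in> K \<Longrightarrow> \<pi> (seq_sc z \<xi>) = op_scale z (\<pi> \<xi>)"
    "\<xi> \<in> K \<Longrightarrow> \<pi> (seq_st \<xi>) = op_adjoint (\<pi> \<xi>)"
    "\<xi> \<in> K \<Longrightarrow> tr D (\<pi> \<xi>) = seq_tr \<U> N \<xi>"
  using assms by (simp_all add: seq_rep_def)

context
  fixes N :: "'r op tracial_alg" and \<U> :: "nat filter"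
  assumes N: "tracial_vna N" and U: "nonprincipal_ultrafilter \<U>"
begin

lemma seq_tr_tendsto: "\<xi> \<in> bounded_seqs N \<Longrightarrow> ((\<lambda>n. tr N (\<xi> n)) \<longlongrightarrow> seq_tr \<U> N \<xi>) \<U>"
  unfolding seq_tr_def
  using tr_bseq_convergent[OF N U] tendsto_Lim[OF nonprincipal_ultrafilter_bot[OF U]] by metis

lemma seq_tr_eqI: "\<xi> \<in> bounded_seqs N \<Longrightarrow> ((\<lambda>n. tr N (\<xi> n)) \<longlongrightarrow> l) \<U> \<Longrightarrow> seq_tr \<U> N \<xi> = l"
  using seq_tr_tendsto tendsto_unique[OF nonprincipal_ultrafilter_bot[OF U]] by blast

lemma seq_tracial_star:
  "tracial_star (bounded_seqs N) seq_mul seq_sc seq_st seq_one (seq_tr \<U> N)"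
proof -
  interpret M: tracial_star "carrier N" "(o\<^sub>L)" op_scale op_adjoint id_blinfun "tr N" by (rule tracial_vna_star[OF N])
  note m = bounded_seqs_mem
  note ne = nonprincipal_ultrafilter_bot[OF U]
  show ?thesis
  proof unfold_locales
    fix \<xi> \<eta> \<zeta> :: "nat \<Rightarrow> 'r op" and c d :: complex
    assume \<xi>: "\<xi> \<in> bounded_seqs N"
    have pb: "seq_mul (seq_st \<xi>) \<xi> \<in> bounded_seqs N" by (intro bseq_mul[OF N] bseq_adjoint[OF N] \<xi>)
    have pt: "tr N (op_adjoint (\<xi> n) o\<^sub>L \<xi> n) = complex_of_real ((norm2 N (\<xi> n))\<^sup>2)" for n
      by (rule norm2_sq[OF N m[OF \<xi>]])
    have "((\<lambda>n. Im (tr N (op_adjoint (\<xi> n) o\<^sub>L \<xi> n))) \<longlongrightarrow> Im (seq_tr \<U> N (seq_mul (seq_st \<xi>) \<xi>))) \<U>"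
      by (rule tendsto_Im[OF seq_tr_tendsto[OF pb]])
    then have "((\<lambda>n. 0) \<longlongrightarrow> Im (seq_tr \<U> N (seq_mul (seq_st \<xi>) \<xi>))) \<U>" unfolding pt by simp
    then have "Im (seq_tr \<U> N (seq_mul (seq_st \<xi>) \<xi>)) = 0" using tendsto_const_iff[OF ne] by metis
    moreover have "0 \<le> Re (seq_tr \<U> N (seq_mul (seq_st \<xi>) \<xi>))"
      by (rule tendsto_lowerbound[OF tendsto_Re[OF seq_tr_tendsto[OF pb]] _ ne]) (simp add: pt)
    ultimately show "seq_tr \<U> N (seq_mul (seq_st \<xi>) \<xi>) \<in> \<real> \<and> 0 \<le> Re (seq_tr \<U> N (seq_mul (seq_st \<xi>) \<xi>))"
      by (simp add: complex_is_Real_iff)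
    show "seq_sc c \<xi> \<in> bounded_seqs N" "seq_st \<xi> \<in> bounded_seqs N" using \<xi> by (auto intro: bseq_scale[OF N] bseq_adjoint[OF N])
    show "seq_mul seq_one \<xi> = \<xi>" "seq_mul \<xi> seq_one = \<xi>" by auto
    show "seq_st (seq_sc c \<xi>) = seq_sc (cnj c) (seq_st \<xi>)" using m[OF \<xi>] by (auto simp: M.st_sc)
    show "seq_st (seq_st \<xi>) = \<xi>" using m[OF \<xi>] by (auto simp: M.st_st)
    show "seq_sc (c + d) \<xi> = seq_sc c \<xi> + seq_sc d \<xi>" using m[OF \<xi>] by (auto simp: M.sc_add_left)
    show "seq_sc c (seq_sc d \<xi>) = seq_sc (c * d) \<xi>" using m[OF \<xi>] by (auto simp: M.sc_sc)
    show "seq_sc 1 \<xi> = \<xi>" by auto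
    show "seq_tr \<U> N (seq_sc c \<xi>) = c * seq_tr \<U> N \<xi>"
      using tendsto_mult_left[OF seq_tr_tendsto[OF \<xi>], of c] m[OF \<xi>]
      by (intro seq_tr_eqI bseq_scale[OF N] \<xi>) (simp add: M.tr_sc)
    assume \<eta>: "\<eta> \<in> bounded_seqs N"
    show "\<xi> + \<eta> \<in> bounded_seqs N" using bseq_add[OF N \<xi> \<eta>] by (simp add: plus_fun_def)
    show "seq_mul \<xi> \<eta> \<in> bounded_seqs N" by (rule bseq_mul[OF N \<xi> \<eta>])
    show "seq_mul (seq_sc c \<xi>) \<eta> = seq_sc c (seq_mul \<xi> \<eta>)" "seq_mul \<xi> (seq_sc c \<eta>) = seq_sc c (seq_mul \<xi> \<eta>)"
      using m[OF \<xi>] m[OF \<eta>] by (auto simp: M.mul_sc_left M.mul_sc_right)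
    show "seq_st (\<xi> + \<eta>) = seq_st \<xi> + seq_st \<eta>" using m[OF \<xi>] m[OF \<eta>] by (auto simp: M.st_add)
    show "seq_st (seq_mul \<xi> \<eta>) = seq_mul (seq_st \<eta>) (seq_st \<xi>)" using m[OF \<xi>] m[OF \<eta>] by (auto simp: M.st_mul)
    show "seq_sc c (\<xi> + \<eta>) = seq_sc c \<xi> + seq_sc c \<eta>" using m[OF \<xi>] m[OF \<eta>] by (auto simp: M.sc_add_right)
    show "seq_tr \<U> N (\<xi> + \<eta>) = seq_tr \<U> N \<xi> + seq_tr \<U> N \<eta>"
      using tendsto_add[OF seq_tr_tendsto[OF \<xi>] seq_tr_tendsto[OF \<eta>]] m[OF \<xi>] m[OF \<eta>] bseq_add[OF N \<xi> \<eta>]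
      by (intro seq_tr_eqI) (simp_all add: M.tr_add plus_fun_def)
    show "seq_tr \<U> N (seq_mul \<xi> \<eta>) = seq_tr \<U> N (seq_mul \<eta> \<xi>)"
      using seq_tr_tendsto[OF bseq_mul[OF N \<eta> \<xi>]] m[OF \<xi>] m[OF \<eta>]
      by (intro seq_tr_eqI bseq_mul[OF N] \<xi> \<eta>) (simp add: M.tr_comm[OF m[OF \<xi>] m[OF \<eta>]])
    assume \<zeta>: "\<zeta> \<in> bounded_seqs N"
    show "seq_mul (seq_mul \<xi> \<eta>) \<zeta> = seq_mul \<xi> (seq_mul \<eta> \<zeta>)"
      "seq_mul (\<xi> + \<eta>) \<zeta> = seq_mul \<xi> \<zeta> + seq_mul \<eta> \<zeta>" "seq_mul \<xi> (\<eta> + \<zeta>) = seq_mul \<xi> \<eta> + seq_mul \<xi> \<zeta>"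
      using m[OF \<xi>] m[OF \<eta>] m[OF \<zeta>] by (auto simp: M.mul_assoc M.mul_add_left M.mul_add_right)
  next
    show "seq_one \<in> bounded_seqs N" by (intro bseq_const[OF N] tracial_id_mem[OF N])
    then show "seq_tr \<U> N seq_one = 1" by (rule seq_tr_eqI) (simp add: M.tr_un)
  qed
qed

interpretation S: tracial_star "bounded_seqs N" seq_mul seq_sc seq_st seq_one "seq_tr \<U> N"
  by (rule seq_tracial_star)

lemma seq_n2_tendsto: assumes \<xi>: "\<xi> \<in> bounded_seqs N" shows "((\<lambda>n. norm2 N (\<xi> n)) \<longlongrightarrow> S.n2 \<xi>) \<U>"
proof -
  have "((\<lambda>n. sqrt (Re (tr N (op_adjoint (\<xi> n) o\<^sub>L \<xi> n)))) \<longlongrightarrow> sqrt (Re (seq_tr \<U> N (seq_mul (seq_st \<xi>) \<xi>)))) \<U>"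
    by (intro tendsto_real_sqrt tendsto_Re seq_tr_tendsto bseq_mul[OF N] bseq_adjoint[OF N] \<xi>)
  then show ?thesis by (simp add: norm2_def operator_alg_simps[OF N] S.n2_def S.ip_def)
qed

lemma seq_left_bounded:
  assumes \<xi>: "\<xi> \<in> bounded_seqs N" shows "\<exists>C. \<forall>\<eta>\<in>bounded_seqs N. S.n2 (seq_mul \<xi> \<eta>) \<le> C * S.n2 \<eta>"
proof -
  obtain C where C: "\<And>n. norm (\<xi> n) \<le> C" using \<xi> by (auto simp: bounded_seqs_iff)
  have "S.n2 (seq_mul \<xi> \<eta>) \<le> C * S.n2 \<eta>" if \<eta>: "\<eta> \<in> bounded_seqs N" for \<eta>
  proof (rule tendsto_le[OF nonprincipal_ultrafilter_bot[OF U]])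
    show "((\<lambda>n. C * norm2 N (\<eta> n)) \<longlongrightarrow> C * S.n2 \<eta>) \<U>" by (intro tendsto_mult_left seq_n2_tendsto \<eta>)
    show "((\<lambda>n. norm2 N (\<xi> n o\<^sub>L \<eta> n)) \<longlongrightarrow> S.n2 (seq_mul \<xi> \<eta>)) \<U>" by (intro seq_n2_tendsto bseq_mul[OF N] \<xi> \<eta>)
    have "norm2 N (\<xi> n o\<^sub>L \<eta> n) \<le> C * norm2 N (\<eta> n)" for n
      using \<xi> \<eta> C[of n]
      by (intro order_trans[OF norm2_mult_left[OF N]] mult_right_mono norm2_nonneg[OF N]) (auto simp: bounded_seqs_mem)
    then show "eventually (\<lambda>n. norm2 N (\<xi> n o\<^sub>L \<eta> n) \<le> C * norm2 N (\<eta> n)) \<U>" by simp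
  qed
  then show ?thesis by blast
qed

lemma seq_n2_less_iff:
  assumes "\<xi> \<in> bounded_seqs N"
  shows "S.n2 \<xi> < e \<Longrightarrow> eventually (\<lambda>n. norm2 N (\<xi> n) < e) \<U>"
    and "eventually (\<lambda>n. norm2 N (\<xi> n) < e) \<U> \<Longrightarrow> S.n2 \<xi> \<le> e"
proof -
  show "S.n2 \<xi> < e \<Longrightarrow> eventually (\<lambda>n. norm2 N (\<xi> n) < e) \<U>"
    using order_tendstoD(2)[OF seq_n2_tendsto[OF assms]] by blast
  show "eventually (\<lambda>n. norm2 N (\<xi> n) < e) \<U> \<Longrightarrow> S.n2 \<xi> \<le> e"
    by (rule tendsto_upperbound[OF seq_n2_tendsto[OF assms] _ nonprincipal_ultrafilter_bot[OF U]])
      (auto elim: eventually_mono)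
qed

context
  fixes x y :: "nat \<Rightarrow> nat \<Rightarrow> 'r op" and r r' :: "nat \<Rightarrow> real"
  assumes xy: "\<And>n. bounded_tuple N r r' (x n) (y n)"
begin

definition spoly :: "star_poly \<Rightarrow> nat \<Rightarrow> 'r op" where "spoly p = (\<lambda>n. eval_poly N (x n) (y n) p)"

lemma spoly_bseq: "spoly p \<in> bounded_seqs N"
  unfolding spoly_def by (rule bounded_seqsI[OF bounded_tuple_eval_mem[OF N xy] norm_eval_poly_le[OF N xy]])

lemma spoly_simps:
  "spoly Unit = seq_one" "spoly (Plus p q) = spoly p + spoly q" "spoly (Times p q) = seq_mul (spoly p) (spoly q)"
  "spoly (Scale z p) = seq_sc z (spoly p)" "spoly (Star p) = seq_st (spoly p)"
  by (auto simp: spoly_def eval_poly_op[OF N])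

lemma seq_closure_eq: "seq_closure N \<U> x y = S.closure2 (range spoly)"
proof
  show "seq_closure N \<U> x y \<subseteq> S.closure2 (range spoly)"
  proof
    fix \<xi> assume \<xi>: "\<xi> \<in> seq_closure N \<U> x y"
    then have b: "\<xi> \<in> bounded_seqs N" by (simp add: seq_closure_def)
    show "\<xi> \<in> S.closure2 (range spoly)"
      unfolding S.closure2_def
    proof (intro CollectI conjI allI impI b)
      fix e :: real assume e: "e > 0"
      then have "e / 2 > 0" by simp
      then obtain p where "eventually (\<lambda>n. norm2 N (\<xi> n - eval_poly N (x n) (y n) p) < e / 2) \<U>"
        using \<xi> unfolding seq_closure_def by blast
      then have "S.n2 (\<xi> - spoly p) \<le> e / 2"
        using b spoly_bseq by (intro seq_n2_less_iff(2) S.diff_mem) (simp_all add: spoly_def)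
      then show "\<exists>w\<in>range spoly. S.n2 (\<xi> - w) < e" using e by (intro bexI[of _ "spoly p"]) auto
    qed
  qed
  show "S.closure2 (range spoly) \<subseteq> seq_closure N \<U> x y"
  proof
    fix \<xi> assume \<xi>: "\<xi> \<in> S.closure2 (range spoly)"
    then have b: "\<xi> \<in> bounded_seqs N" by (simp add: S.closure2_def)
    show "\<xi> \<in> seq_closure N \<U> x y"
      unfolding seq_closure_def
    proof (intro CollectI conjI allI impI b)
      fix e :: real assume "e > 0"
      then obtain p where "S.n2 (\<xi> - spoly p) < e" using \<xi> unfolding S.closure2_def by blast
      then have "eventually (\<lambda>n. norm2 N ((\<xi> - spoly p) n) < e) \<U>"
        using b spoly_bseq by (intro seq_n2_less_iff(1) S.diff_mem)
      then show "\<exists>p. eventually (\<lambda>n. norm2 N (\<xi> n - eval_poly N (x n) (y n) p) < e) \<U>"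
        by (intro exI[of _ p]) (simp add: spoly_def)
    qed
  qed
qed

lemma range_spoly:
  "range spoly \<subseteq> bounded_seqs N"
  "\<xi> \<in> range spoly \<Longrightarrow> \<eta> \<in> range spoly \<Longrightarrow> \<xi> + \<eta> \<in> range spoly"
  "\<xi> \<in> range spoly \<Longrightarrow> \<eta> \<in> range spoly \<Longrightarrow> seq_mul \<xi> \<eta> \<in> range spoly"
  "\<xi> \<in> range spoly \<Longrightarrow> seq_st \<xi> \<in> range spoly"
  using spoly_bseq by (auto simp flip: spoly_simps)

lemma spoly_closure: "spoly p \<in> seq_closure N \<U> x y"
  unfolding seq_closure_eq by (rule S.subset_closure2[OF range_spoly seq_left_bounded]) auto

lemma seq_closure_bseq: "\<xi> \<in> seq_closure N \<U> x y \<Longrightarrow> \<xi> \<in> bounded_seqs N" by (simp add: seq_closure_def)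

lemma seq_closure_add: "\<xi> \<in> seq_closure N \<U> x y \<Longrightarrow> \<eta> \<in> seq_closure N \<U> x y \<Longrightarrow> \<xi> + \<eta> \<in> seq_closure N \<U> x y"
  unfolding seq_closure_eq by (rule S.closure2_add[OF range_spoly seq_left_bounded])
lemma seq_closure_mul: "\<xi> \<in> seq_closure N \<U> x y \<Longrightarrow> \<eta> \<in> seq_closure N \<U> x y \<Longrightarrow> seq_mul \<xi> \<eta> \<in> seq_closure N \<U> x y"
  unfolding seq_closure_eq by (rule S.closure2_mul[OF range_spoly seq_left_bounded])
lemma seq_closure_st: "\<xi> \<in> seq_closure N \<U> x y \<Longrightarrow> seq_st \<xi> \<in> seq_closure N \<U> x y"
  unfolding seq_closure_eq by (rule S.closure2_st[OF range_spoly seq_left_bounded])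
lemma seq_closure_one: "seq_one \<in> seq_closure N \<U> x y"
  using spoly_closure[of Unit] by (simp add: spoly_simps)
lemma seq_closure_sc: assumes "\<xi> \<in> seq_closure N \<U> x y" shows "seq_sc z \<xi> \<in> seq_closure N \<U> x y"
proof -
  have "seq_mul (spoly (Scale z Unit)) \<xi> \<in> seq_closure N \<U> x y" by (rule seq_closure_mul[OF spoly_closure assms])
  then show ?thesis by (simp add: spoly_simps op_scale_compose_left)
qed

lemma spoly_rational_approx:
  assumes "\<epsilon> > 0" shows "\<exists>q. S.n2 (spoly p - spoly (of_qpoly q)) \<le> \<epsilon>"
proof -
  have "eventually (\<lambda>\<eta>. round_err r r' \<eta> p < \<epsilon> \<and> \<eta> > 0) (at_right (0::real))"
    using order_tendstoD(2)[OF round_err_tendsto assms] eventually_at_right_less by (rule eventually_conj)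
  then obtain \<eta> where \<eta>: "round_err r r' \<eta> p < \<epsilon>" "\<eta> > 0"
    using eventually_happens[of _ "at_right (0::real)"] by (auto simp: trivial_limit_at_right_real)
  obtain \<rho> where \<rho>: "\<And>z. cmod (z - rat_complex (\<rho> z)) \<le> \<eta>" using rounding_exists[OF \<eta>(2)] by blast
  have "norm2 N ((spoly p - spoly (of_qpoly (qround \<rho> p))) n) \<le> \<epsilon>" for n
  proof -
    have "norm2 N ((spoly p - spoly (of_qpoly (qround \<rho> p))) n) \<le> norm ((spoly p - spoly (of_qpoly (qround \<rho> p))) n)"
      by (intro norm2_le_norm[OF N] bounded_seqs_mem S.diff_mem spoly_bseq)
    also have "\<dots> \<le> round_err r r' \<eta> p"
      using norm_eval_qround_le[OF N xy \<rho>] by (simp add: spoly_def)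
    finally show ?thesis using \<eta>(1) by simp
  qed
  then have "S.n2 (spoly p - spoly (of_qpoly (qround \<rho> p))) \<le> \<epsilon>"
    by (intro tendsto_upperbound[OF seq_n2_tendsto _ nonprincipal_ultrafilter_bot[OF U]] S.diff_mem spoly_bseq) auto
  then show ?thesis by blast
qed

lemma rational_dense:
  assumes \<xi>: "\<xi> \<in> seq_closure N \<U> x y" and \<epsilon>: "\<epsilon> > 0"
  shows "\<exists>q. S.n2 (\<xi> - spoly (of_qpoly q)) < \<epsilon>"
proof -
  obtain p where p: "S.n2 (\<xi> - spoly p) < \<epsilon> / 2"
    using \<xi> half_gt_zero[OF \<epsilon>] unfolding seq_closure_eq S.closure2_def by blast
  obtain q where q: "S.n2 (spoly p - spoly (of_qpoly q)) \<le> \<epsilon> / 2" using spoly_rational_approx half_gt_zero[OF \<epsilon>] by blast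
  have "S.n2 (\<xi> - spoly (of_qpoly q)) \<le> S.n2 (\<xi> - spoly p) + S.n2 (spoly p - spoly (of_qpoly q))"
    by (intro S.n2_diff_triangle seq_closure_bseq[OF \<xi>] spoly_bseq)
  then show ?thesis using p q by (intro exI[of _ q]) simp
qed

text \<open>GNS for the limit trace on the closure of the polynomial sequences: \<open>f\<close>
  makes the space infinite dimensional, and the rational polynomials make the result separable. The
  way back into the ultrapower uses moments, since the traces of polynomials in the represented
  generators are limits of traces in \<open>N\<close>.\<close>

theorem seq_closure_representation:
  fixes f :: "nat \<Rightarrow> nat \<Rightarrow> 'r op"
  assumes f: "\<And>j. f j \<in> seq_closure N \<U> x y"
    and fo: "\<And>i j. seq_tr \<U> N (seq_mul (seq_st (f i)) (f j)) = (if i = j then 1 else 0)"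
  shows "\<exists>(D :: nat op tracial_alg) \<pi>. tracial_vna D \<and> separable_vna D \<and>
    (\<exists>h. embedding h D (ultrapower \<U> N)) \<and> seq_rep \<pi> (seq_closure N \<U> x y) \<U> N D"
proof -
  let ?K = "seq_closure N \<U> x y"
  interpret K: tracial_star ?K seq_mul seq_sc seq_st seq_one "seq_tr \<U> N"
    by (rule tracial_star_subset[OF seq_tracial_star])
      (auto intro: seq_closure_bseq seq_closure_add seq_closure_mul seq_closure_sc seq_closure_st seq_closure_one)
  define w where "w i = spoly (of_qpoly (from_nat i))" for i :: nat
  have "\<exists>e. K.total_ons e"
  proof (rule K.total_ons_exists)
    show "w n \<in> ?K" for n unfolding w_def by (rule spoly_closure)
    show "\<exists>n. K.n2 (\<xi> - w n) < \<epsilon>" if A: "\<xi> \<in> ?K" "\<epsilon> > 0" for \<xi> \<epsilon>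
    proof -
      obtain q :: qpoly where "S.n2 (\<xi> - spoly (of_qpoly q)) < \<epsilon>" using rational_dense[OF A] by blast
      then show ?thesis by (intro exI[of _ "to_nat q"]) (simp add: w_def)
    qed
    show "K.semi_ons f" "K.ip (f j) (f j) = 1" for j
      using f fo by (auto simp: K.semi_ons_def K.ip_def)
  qed
  then obtain e where e: "K.total_ons e" by blast
  interpret G: gns ?K seq_mul seq_sc seq_st seq_one "seq_tr \<U> N" e
  proof unfold_locales
    show "K.total_ons e" by (rule e)
    show "\<exists>C. \<forall>\<eta>\<in>?K. K.n2 (seq_mul \<xi> \<eta>) \<le> C * K.n2 \<eta>" if "\<xi> \<in> ?K" for \<xi>
      using seq_left_bounded[OF seq_closure_bseq[OF that]] seq_closure_bseq by blast
  qed
  define D where "D = G.gns_obj"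
  have D: "tracial_vna D" unfolding D_def by (rule G.tracial_gns_obj)
  have rep: "seq_rep G.lrep ?K \<U> N D"
    unfolding seq_rep_def D_def
    by (auto simp: G.lrep_gns_alg G.lrep_un G.lrep_add G.lrep_mul G.lrep_sc G.lrep_adjoint G.gns_tr_lrep)
  have norm2: "norm2 D (G.lrep \<xi> - G.lrep \<eta>) = S.n2 (\<xi> - \<eta>)" if "\<xi> \<in> ?K" "\<eta> \<in> ?K" for \<xi> \<eta>
  proof -
    define \<delta> where "\<delta> = \<xi> - \<eta>"
    have d: "\<delta> \<in> ?K" unfolding \<delta>_def using that by (rule K.diff_mem)
    have *: "op_adjoint (G.lrep \<delta>) o\<^sub>L G.lrep \<delta> = G.lrep (seq_mul (seq_st \<delta>) \<delta>)"
      by (simp only: G.lrep_mul[OF K.st_mem[OF d] d] G.lrep_adjoint[OF d])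
    have "G.lrep \<xi> = G.lrep \<delta> + G.lrep \<eta>" using G.lrep_add[OF d that(2)] by (simp add: \<delta>_def)
    then have "norm2 D (G.lrep \<xi> - G.lrep \<eta>) = norm2 D (G.lrep \<delta>)" by simp
    also have "norm2 D (G.lrep \<delta>) = sqrt (Re (tr D (G.lrep (seq_mul (seq_st \<delta>) \<delta>))))"
      unfolding norm2_def operator_alg_simps[OF D] * ..
    also have "\<dots> = S.n2 \<delta>"
      unfolding S.n2_def S.ip_def D_def G.tr_gns_obj using G.gns_tr_lrep[OF K.mul_mem[OF K.st_mem[OF d] d]] by simp
    finally show ?thesis unfolding \<delta>_def .
  qed
  have dense: "\<exists>q. norm2 D (T - G.lrep (spoly (of_qpoly q))) < \<epsilon>" if T: "T \<in> carrier D" and \<epsilon>: "\<epsilon> > 0" for T \<epsilon>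
  proof -
    obtain \<xi> where \<xi>: "\<xi> \<in> ?K" "norm2 D (T - G.lrep \<xi>) < \<epsilon> / 2"
      using G.lrep_dense[of T "\<epsilon> / 2"] T \<epsilon> by (auto simp: D_def)
    obtain q where q: "S.n2 (\<xi> - spoly (of_qpoly q)) < \<epsilon> / 2" using rational_dense[OF \<xi>(1)] half_gt_zero[OF \<epsilon>] by blast
    have "norm2 D (T - G.lrep (spoly (of_qpoly q))) \<le> norm2 D (T - G.lrep \<xi>) + norm2 D (G.lrep \<xi> - G.lrep (spoly (of_qpoly q)))"
      using T \<xi>(1) spoly_closure by (intro norm2_diff_triangle[OF D]) (auto simp: D_def intro: G.lrep_gns_alg)
    then show ?thesis using \<xi>(2) q norm2[OF \<xi>(1) spoly_closure] by (intro exI[of _ q]) simp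
  qed
  have "separable_vna D"
    unfolding separable_vna_def
  proof (intro exI[of _ "range (\<lambda>q::qpoly. G.lrep (spoly (of_qpoly q)))"] conjI)
    show "countable (range (\<lambda>q::qpoly. G.lrep (spoly (of_qpoly q))))" by simp
    show "range (\<lambda>q::qpoly. G.lrep (spoly (of_qpoly q))) \<subseteq> carrier D"
      using spoly_closure by (auto simp: D_def intro: G.lrep_gns_alg)
  qed (use dense in blast)
  moreover have "\<exists>h. embedding h D (ultrapower \<U> N)"
  proof -
    define c where "c k = G.lrep (spoly (XVar k))" for k
    define a where "a k = G.lrep (spoly (YVar k))" for k
    have ca: "c k \<in> carrier D" "a k \<in> carrier D" for k
      using spoly_closure by (auto simp: c_def a_def D_def intro: G.lrep_gns_alg)
    have ev: "eval_poly D c a p = G.lrep (spoly p)" for p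
      by (induction p)
        (simp_all only: eval_poly.simps(1,2) c_def a_def eval_poly_op[OF D] spoly_simps G.lrep_un G.lrep_add[OF spoly_closure spoly_closure]
          G.lrep_mul[OF spoly_closure spoly_closure] G.lrep_sc[OF spoly_closure] G.lrep_adjoint[OF spoly_closure])
    have moments: "((\<lambda>n. tr N (eval_poly N (x n) (y n) p)) \<longlongrightarrow> tr D (eval_poly D c a p)) \<U>" for p
    proof -
      have "tr D (eval_poly D c a p) = seq_tr \<U> N (spoly p)"
        unfolding ev unfolding D_def G.tr_gns_obj by (rule G.gns_tr_lrep[OF spoly_closure])
      then show ?thesis using seq_tr_tendsto[OF spoly_bseq[of p]] by (simp add: spoly_def)
    qed
    have "carrier D \<subseteq> poly_closure D c a"
      unfolding poly_closure_def using dense by (auto simp: ev)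
    then have "\<exists>s. asymp_embedding s \<U> D N"
      using asymp_embedding_of_moments[of D N \<U> c a r r' x y] D N U ca xy moments by blast
    then show ?thesis using embedding_ultrapower_iff[OF D N U] by blast
  qed
  ultimately show ?thesis using D rep by blast
qed

end

end

text \<open>Finitely many elements do not span the algebra, so some \<open>T\<close> has a nonzero
  residual against those already chosen, and faithfulness of the trace allows normalising
  it.\<close>

lemma orthonormal_sequence_exists:
  fixes N :: "'r op tracial_alg"
  assumes N: "tracial_vna N" and inf: "\<not> fin_dim (carrier N)"
  shows "\<exists>f :: nat \<Rightarrow> 'r op. (\<forall>j. f j \<in> carrier N) \<and> (\<forall>i j. tr N (op_adjoint (f i) o\<^sub>L f j) = (if i = j then 1 else 0))"
proof -
  interpret S: tracial_star "carrier N" "(o\<^sub>L)" op_scale op_adjoint id_blinfun "tr N" by (rule tracial_vna_star[OF N])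
  define P where "P f n u \<longleftrightarrow> u \<in> carrier N \<and> S.ip u u = 1 \<and> (\<forall>j<n. S.ip (f j) u = 0)" for f :: "nat \<Rightarrow> 'r op" and n u
  have "\<exists>f. \<forall>n. P f n (f n)"
  proof (rule dependent_wellorder_choice)
    fix u and f g :: "nat \<Rightarrow> 'r op" and n :: nat
    assume "\<And>m. m < n \<Longrightarrow> f m = g m"
    then show "P f n u = P g n u" by (auto simp: P_def)
  next
    fix n :: nat and f :: "nat \<Rightarrow> 'r op"
    assume A: "\<And>m. m < n \<Longrightarrow> P f m (f m)"
    \<comment> \<open>Padding with zeros makes the finite initial segment a \<open>semi_ons\<close>,
      so that \<open>proj\<close> and its lemmas apply.\<close>
    define f' where "f' j = (if j < n then f j else 0)" for j
    have fm: "f j \<in> carrier N" "S.ip (f j) (f j) = 1" if "j < n" for j using A[OF that] by (auto simp: P_def)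
    have fo: "S.ip (f i) (f j) = 0" if "i < n" "j < n" "i \<noteq> j" for i j
    proof (cases "i < j")
      case True then show ?thesis using A[OF that(2)] by (simp add: P_def)
    next
      case False
      then have "S.ip (f j) (f i) = 0" using A[OF that(1)] that by (simp add: P_def)
      then show ?thesis using S.ip_commute[of "f j" "f i"] fm that by simp
    qed
    have so: "S.semi_ons f'"
      unfolding S.semi_ons_def f'_def using fm fo by (auto simp: S.zero_mem S.ip_zero_left S.ip_zero_right)
    have "inj_on f {..<n}"
      by (rule inj_onI) (metis fm(2) fo lessThan_iff zero_neq_one)
    have "finite (f ` {..<n})" "f ` {..<n} \<subseteq> carrier N" using fm by auto
    then obtain T where T: "T \<in> carrier N" "\<And>c. T \<noteq> (\<Sum>E\<in>f ` {..<n}. op_scale (c E) E)"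
      using inf unfolding fin_dim_def by blast
    define g where "g = T - S.proj f' n T"
    have g: "g \<in> carrier N" unfolding g_def by (intro S.diff_mem T S.proj_mem[OF so])
    have "g \<noteq> 0"
    proof
      assume "g = 0"
      then have "T = S.proj f' n T" by (simp add: g_def)
      also have "\<dots> = (\<Sum>j<n. op_scale (S.ip (f j) T) (f j))" unfolding S.proj_def f'_def by (intro sum.cong) auto
      also have "\<dots> = (\<Sum>E\<in>f ` {..<n}. op_scale (S.ip E T) E)" using \<open>inj_on f {..<n}\<close> by (simp add: sum.reindex)
      finally show False using T(2)[of "\<lambda>E. S.ip E T"] by simp
    qed
    then have "norm2 N g \<noteq> 0" using norm2_eq_0[OF N g] by blast
    then have nz: "S.n2 g \<noteq> 0" by (simp add: norm2_eq_n2[OF N])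
    define u where "u = op_scale (1 / complex_of_real (S.n2 g)) g"
    have um: "u \<in> carrier N" unfolding u_def by (intro S.sc_mem g)
    have "S.n2 u = 1" using nz g S.n2_nonneg[OF g] by (simp add: u_def S.n2_sc norm_divide)
    then have "S.ip u u = 1" using S.ip_self[OF um] by simp
    moreover have "S.ip (f j) u = 0" if "j < n" for j
      using S.ip_residual[OF so T(1) that] that fm g by (simp add: u_def S.ip_sc_right f'_def g_def)
    ultimately show "\<exists>u. P f n u" using um by (auto simp: P_def)
  qed
  then obtain f :: "nat \<Rightarrow> 'r op" where f: "\<And>n. f n \<in> carrier N" "\<And>n. S.ip (f n) (f n) = 1" "\<And>n j. j < n \<Longrightarrow> S.ip (f j) (f n) = 0"
    unfolding P_def by blast
  have "S.ip (f i) (f j) = (if i = j then 1 else 0)" for i j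
  proof (cases i j rule: linorder_cases)
    case greater
    then show ?thesis using f(3)[of j i] S.ip_commute[of "f j" "f i"] f(1) by simp
  qed (use f(2,3) in auto)
  then show ?thesis using f(1) unfolding S.ip_def by blast
qed

text \<open>
  Adjoining the constant sequences of an orthonormal system of \<open>N\<close> makes the GNS space infinite
  dimensional, so that it is all of \<open>\<ell>\<^sup>2(\<nat>)\<close>.
\<close>

theorem seq_representation:
  fixes N :: "'r op tracial_alg"
  assumes N: "tracial_vna N" and U: "nonprincipal_ultrafilter \<U>" and inf: "\<not> fin_dim (carrier N)"
    and xy: "\<And>n. bounded_tuple N r r' (x n) (y n)"
  shows "\<exists>(D :: nat op tracial_alg) \<pi>. R_embeddable N D \<and> seq_rep \<pi> (seq_closure N \<U> x y) \<U> N D"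
proof -
  obtain f :: "nat \<Rightarrow> 'r op" where f: "\<And>j. f j \<in> carrier N" "\<And>i j. tr N (op_adjoint (f i) o\<^sub>L f j) = (if i = j then 1 else 0)"
    using orthonormal_sequence_exists[OF N inf] by blast
  \<comment> \<open>The old tuple moves to the even variables and the odd ones hold the constant
    orthonormal system; \<open>psubst\<close> translates old polynomials accordingly.\<close>
  define z where "z n k = (if even k then y n (k div 2) else f (k div 2))" for n k
  define s where "s k = (if even k then r' (k div 2) else norm (f (k div 2)))" for k
  have xz: "bounded_tuple N r s (x n) (z n)" for n
    using xy[of n] f(1) by (auto simp: bounded_tuple_def assignments_def z_def s_def)
  have sub: "seq_closure N \<U> x y \<subseteq> seq_closure N \<U> x z"
  proof
    fix \<xi> assume \<xi>: "\<xi> \<in> seq_closure N \<U> x y"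
    have ev: "eval_poly N (x n) (z n) (psubst XVar (\<lambda>k. YVar (2 * k)) p) = eval_poly N (x n) (y n) p" for n p
      by (simp add: eval_psubst z_def)
    show "\<xi> \<in> seq_closure N \<U> x z"
      unfolding seq_closure_def
    proof (intro CollectI conjI allI impI)
      show "\<xi> \<in> bounded_seqs N" using \<xi> by (simp add: seq_closure_def)
      fix e :: real assume "e > 0"
      then obtain p where "eventually (\<lambda>n. norm2 N (\<xi> n - eval_poly N (x n) (y n) p) < e) \<U>"
        using \<xi> unfolding seq_closure_def by blast
      then show "\<exists>p. eventually (\<lambda>n. norm2 N (\<xi> n - eval_poly N (x n) (z n) p) < e) \<U>"
        unfolding ev[symmetric] by blast
    qed
  qed
  have "(\<lambda>n. f j) \<in> seq_closure N \<U> x z" for j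
  proof -
    have "spoly N x z (YVar (2 * j + 1)) \<in> seq_closure N \<U> x z" by (rule spoly_closure[OF N U xz])
    then show ?thesis by (simp add: z_def spoly_def[OF N U xz])
  qed
  moreover have "seq_tr \<U> N (seq_mul (seq_st (\<lambda>n. f i)) (\<lambda>n. f j)) = (if i = j then 1 else 0)" for i j
    using f by (intro seq_tr_eqI[OF N U] bseq_const[OF N] tracial_mul_mem[OF N] tracial_adjoint_mem[OF N]) auto
  ultimately obtain D :: "nat op tracial_alg" and \<pi> where D: "tracial_vna D" "separable_vna D"
    "\<exists>h. embedding h D (ultrapower \<U> N)" "seq_rep \<pi> (seq_closure N \<U> x z) \<U> N D"
    using seq_closure_representation[of N \<U> r s x z "\<lambda>j n. f j"] N U xz by blast
  have "seq_rep \<pi> (seq_closure N \<U> x y) \<U> N D" using D(4) sub unfolding seq_rep_def by blast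
  then show ?thesis using D U unfolding R_embeddable_def by blast
qed

text \<open>The trace of \<open>D\<close> at the image of d* d is the limit of the squared 2-norms
  of the differences, and faithfulness of this trace turns 0 into equality.\<close>

lemma seq_rep_eq:
  assumes N: "tracial_vna N" and U: "nonprincipal_ultrafilter \<U>" and D: "tracial_vna D"
    and xy: "\<And>n. bounded_tuple N r r' (x n) (y n)"
    and rep: "seq_rep \<pi> (seq_closure N \<U> x y) \<U> N D"
    and \<xi>: "\<xi> \<in> seq_closure N \<U> x y" and \<eta>: "\<eta> \<in> seq_closure N \<U> x y"
  shows "\<pi> \<xi> = \<pi> \<eta> \<longleftrightarrow> null_seq N \<U> (\<lambda>n. \<xi> n - \<eta> n)"
proof -
  let ?K = "seq_closure N \<U> x y"
  interpret S: tracial_star "bounded_seqs N" seq_mul seq_sc seq_st seq_one "seq_tr \<U> N"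
    by (rule seq_tracial_star[OF N U])
  note bs = seq_closure_bseq[OF N U xy]
  define d where "d = \<xi> + seq_sc (-1) \<eta>"
  have deq: "d n = \<xi> n - \<eta> n" for n by (simp add: d_def op_scale_minus_one)
  have s: "seq_sc (-1) \<eta> \<in> ?K" by (rule seq_closure_sc[OF N U xy \<eta>])
  have d: "d \<in> ?K" unfolding d_def by (rule seq_closure_add[OF N U xy \<xi> s])
  note dst = seq_closure_st[OF N U xy d]
  have "\<pi> d = \<pi> \<xi> + \<pi> (seq_sc (-1) \<eta>)"
    unfolding d_def by (rule seq_repD(3)[OF rep \<xi> s])
  moreover have "\<pi> (seq_sc (-1) \<eta>) = op_scale (-1) (\<pi> \<eta>)"
    by (rule seq_repD(5)[OF rep \<eta>])
  ultimately have pd: "\<pi> d = \<pi> \<xi> - \<pi> \<eta>" by (simp only: op_scale_minus_one) simp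
  have m: "\<pi> d \<in> carrier D" using rep d by (simp add: seq_rep_def)
  have "\<pi> (seq_mul (seq_st d) d) = \<pi> (seq_st d) o\<^sub>L \<pi> d" by (rule seq_repD(4)[OF rep dst d])
  moreover have "\<pi> (seq_st d) = op_adjoint (\<pi> d)" by (rule seq_repD(6)[OF rep d])
  moreover have "tr D (\<pi> (seq_mul (seq_st d) d)) = seq_tr \<U> N (seq_mul (seq_st d) d)"
    by (rule seq_repD(7)[OF rep seq_closure_mul[OF N U xy dst d]])
  ultimately have "tr D (op_adjoint (\<pi> d) o\<^sub>L \<pi> d) = seq_tr \<U> N (seq_mul (seq_st d) d)" by simp
  then have "norm2 D (\<pi> d) = S.n2 d"
    by (simp add: norm2_def operator_alg_simps[OF D] S.n2_def S.ip_def)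
  moreover have "((\<lambda>n. norm2 N (d n)) \<longlongrightarrow> S.n2 d) \<U>" by (rule seq_n2_tendsto[OF N U bs[OF d]])
  ultimately have lim: "((\<lambda>n. norm2 N (\<xi> n - \<eta> n)) \<longlongrightarrow> norm2 D (\<pi> d)) \<U>" by (simp add: deq)
  show ?thesis
  proof
    assume "\<pi> \<xi> = \<pi> \<eta>"
    then show "null_seq N \<U> (\<lambda>n. \<xi> n - \<eta> n)" using lim pd by (simp add: norm2_zero[OF D])
  next
    assume "null_seq N \<U> (\<lambda>n. \<xi> n - \<eta> n)"
    then have "norm2 D (\<pi> d) = 0" using lim tendsto_unique[OF nonprincipal_ultrafilter_bot[OF U]] by blast
    then show "\<pi> \<xi> = \<pi> \<eta>" using norm2_eq_0[OF D m] pd by simp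
  qed
qed

text \<open>The laws for \<open>s\<close> fail only by null sequences, and these disappear under
  \<open>\<pi>\<close>.\<close>

lemma embedding_of_seq_rep:
  assumes N: "tracial_vna N" and U: "nonprincipal_ultrafilter \<U>" and D: "tracial_vna D" and M: "tracial_vna M"
    and xy: "\<And>n. bounded_tuple N r r' (x n) (y n)"
    and rep: "seq_rep \<pi> (seq_closure N \<U> x y) \<U> N D"
    and s: "asymp_embedding s \<U> M N" and sK: "\<And>u. u \<in> carrier M \<Longrightarrow> s u \<in> seq_closure N \<U> x y"
  shows "embedding (\<lambda>u. \<pi> (s u)) M D"
proof -
  let ?K = "seq_closure N \<U> x y"
  note eqI = seq_rep_eq[OF N U D xy rep, THEN iffD2]
  note cl = seq_closure_add[OF N U xy] seq_closure_mul[OF N U xy] seq_closure_sc[OF N U xy] seq_closure_st[OF N U xy]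
    seq_closure_one[OF N U xy]
  note mem = tracial_mul_mem[OF M] tracial_add_mem[OF M] tracial_scale_mem[OF M] tracial_adjoint_mem[OF M] tracial_id_mem[OF M]
  have "\<pi> (s (u o\<^sub>L v)) = \<pi> (s u) o\<^sub>L \<pi> (s v)" if "u \<in> carrier M" "v \<in> carrier M" for u v
  proof -
    have "\<pi> (s (u o\<^sub>L v)) = \<pi> (seq_mul (s u) (s v))"
      using that ae_mult[OF M N U s] by (intro eqI sK mem cl) auto
    then show ?thesis using seq_repD[OF rep] sK that by simp
  qed
  moreover have "\<pi> (s (u + v)) = \<pi> (s u) + \<pi> (s v)" if "u \<in> carrier M" "v \<in> carrier M" for u v
  proof -
    have "\<pi> (s (u + v)) = \<pi> (s u + s v)"
      using that ae_add[OF M N U s] by (intro eqI sK mem cl) auto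
    then show ?thesis using seq_repD[OF rep] sK that by simp
  qed
  moreover have "\<pi> (s id_blinfun) = id_blinfun"
  proof -
    have "\<pi> (s id_blinfun) = \<pi> seq_one"
      using ae_one[OF M N U s] by (intro eqI sK mem cl) auto
    then show ?thesis using seq_repD(2)[OF rep] by simp
  qed
  moreover have "\<pi> (s (op_scale c u)) = op_scale c (\<pi> (s u))" if "u \<in> carrier M" for u c
  proof -
    have "\<pi> (s (op_scale c u)) = \<pi> (seq_sc c (s u))"
      using that ae_scale[OF M N U s] by (intro eqI sK mem cl) auto
    then show ?thesis using seq_repD[OF rep] sK that by simp
  qed
  moreover have "\<pi> (s (op_adjoint u)) = op_adjoint (\<pi> (s u))" if "u \<in> carrier M" for u
  proof -
    have "\<pi> (s (op_adjoint u)) = \<pi> (seq_st (s u))"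
      using that ae_adjoint[OF M N U s] by (intro eqI sK mem cl) auto
    then show ?thesis using seq_repD[OF rep] sK that by simp
  qed
  moreover have "tr D (\<pi> (s u)) = tr M u" if "u \<in> carrier M" for u
    using seq_repD(7)[OF rep sK[OF that]] seq_tr_eqI[OF N U ae_bseq[OF M N U s that] ae_tr[OF M N U s that]] by simp
  moreover have "\<pi> (s u) \<in> carrier D" if "u \<in> carrier M" for u
    by (rule seq_repD(1)[OF rep sK[OF that]])
  ultimately show ?thesis
    by (auto simp: embedding_def ring_hom_def operator_alg_simps[OF M] operator_alg_simps[OF D])
qed

section \<open>Consequences of existential closedness\<close>

lemma dense_sequence:
  assumes N: "tracial_vna N" and "separable_vna N"
  shows "\<exists>s :: nat \<Rightarrow> _. (\<forall>k. s k \<in> carrier N) \<and> (\<forall>u\<in>carrier N. \<forall>e>0. \<exists>k. norm2 N (u - s k) < e)"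
proof -
  obtain S where S: "countable S" "S \<subseteq> carrier N" "\<And>u e. u \<in> carrier N \<Longrightarrow> e > 0 \<Longrightarrow> \<exists>s\<in>S. norm2 N (u - s) < e"
    using assms(2) unfolding separable_vna_def by blast
  have "S \<noteq> {}" using S(3)[OF tracial_id_mem[OF N], of 1] by auto
  then have r: "range (from_nat_into S) = S" using S(1) by (rule range_from_nat_into)
  then have "from_nat_into S k \<in> carrier N" for k using S(2) by blast
  moreover have "\<exists>k. norm2 N (u - from_nat_into S k) < e" if ue: "u \<in> carrier N" "e > 0" for u e
    using S(3)[OF ue] r by (metis rangeE)
  ultimately show ?thesis by blast
qed

text \<open>The approximants may be unbounded in operator norm. Kaplansky polynomials in them are
  found by looking at \<open>C\<close> and evaluated in \<open>A\<close>, where their norms stay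
  below one constant. There they are Cauchy in 2-norm, because \<open>\<gamma>\<close> preserves it,
  and bounded balls of \<open>A\<close> are complete.\<close>

lemma embedding_image_closed:
  fixes A :: "'i op tracial_alg" and C :: "'k op tracial_alg"
  assumes A: "tracial_vna A" and C: "tracial_vna C" and U: "nonprincipal_ultrafilter \<U>"
    and \<gamma>: "embedding \<gamma> A C" and c: "c \<in> carrier C"
    and approx: "\<And>e. e > 0 \<Longrightarrow> \<exists>a\<in>carrier A. norm2 C (\<gamma> a - c) < e"
  shows "\<exists>a\<in>carrier A. \<gamma> a = c"
proof -
  define \<delta> where "\<delta> k = inverse (real (Suc k))" for k
  have \<delta>: "\<delta> k > 0" for k by (simp add: \<delta>_def)
  have \<delta>0: "\<delta> \<longlonglongrightarrow> 0" unfolding \<delta>_def by (rule LIMSEQ_inverse_real_of_nat)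
  have "\<forall>k. \<exists>a. a \<in> carrier A \<and> norm2 C (\<gamma> a - c) < \<delta> k" using approx[OF \<delta>] by blast
  from choice[OF this] obtain a where a: "\<And>k. a k \<in> carrier A" "\<And>k. norm2 C (\<gamma> (a k) - c) < \<delta> k" by blast
  note \<gamma>m = embedding_mem[OF A C \<gamma>]
  define r where "r k = norm (a k)" for k
  have tA: "bounded_tuple A r r a a" using a(1) by (simp add: bounded_tuple_def assignments_def r_def)
  have tC: "bounded_tuple C r r (\<lambda>k. \<gamma> (a k)) (\<lambda>k. \<gamma> (a k))"
    using a(1) \<gamma>m embedding_norm_le[OF A C \<gamma>] by (simp add: bounded_tuple_def assignments_def r_def)
  have "c \<in> poly_closure C (\<lambda>k. \<gamma> (a k)) (\<lambda>k. \<gamma> (a k))"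
    unfolding poly_closure_def
  proof (intro CollectI conjI allI impI c)
    fix e :: real assume "e > 0"
    then obtain k where "\<delta> k < e" using order_tendstoD(2)[OF \<delta>0] by (auto simp: eventually_sequentially)
    then have "norm2 C (c - \<gamma> (a k)) < e" using a(2)[of k] norm2_commute[OF C c \<gamma>m[OF a(1)], of k] by simp
    then show "\<exists>p. norm2 C (c - eval_poly C (\<lambda>k. \<gamma> (a k)) (\<lambda>k. \<gamma> (a k)) p) < e"
      by (intro exI[of _ "XVar k"]) simp
  qed
  then have "\<forall>j. \<exists>s. norm2 C (c - eval_poly C (\<lambda>k. \<gamma> (a k)) (\<lambda>k. \<gamma> (a k)) s) < \<delta> j \<and> norm (eval_poly A a a s) \<le> 16 * norm c + 4"
    using kaplansky_density[OF C tC _ \<delta>, where 'n = 'i] A tA by blast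
  from choice[OF this] obtain s where s: "\<And>j. norm2 C (c - eval_poly C (\<lambda>k. \<gamma> (a k)) (\<lambda>k. \<gamma> (a k)) (s j)) < \<delta> j"
    "\<And>j. norm (eval_poly A a a (s j)) \<le> 16 * norm c + 4" by blast
  define T where "T j = eval_poly A a a (s j)" for j
  have Tm: "T j \<in> carrier A" for j unfolding T_def by (rule bounded_tuple_eval_mem[OF A tA])
  have "\<gamma> (T j) = eval_poly C (\<lambda>k. \<gamma> (a k)) (\<lambda>k. \<gamma> (a k)) (s j)" for j
    unfolding T_def by (rule embedding_eval_poly[OF A C \<gamma>]) (rule a)+
  then have Tc: "norm2 C (c - \<gamma> (T j)) < \<delta> j" for j using s(1) by simp
  have cauchy: "\<exists>J. \<forall>j\<ge>J. \<forall>k\<ge>J. norm2 A (T j - T k) < e" if e: "e > 0" for e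
  proof -
    obtain J where J: "\<And>j. j \<ge> J \<Longrightarrow> \<delta> j < e / 2"
      using order_tendstoD(2)[OF \<delta>0, of "e / 2"] e by (auto simp: eventually_sequentially)
    have "norm2 A (T j - T k) < e" if "j \<ge> J" "k \<ge> J" for j k
    proof -
      have "norm2 A (T j - T k) = norm2 C (\<gamma> (T j) - \<gamma> (T k))"
        using embedding_norm2[OF A C \<gamma> tracial_diff_mem[OF A Tm Tm]] embedding_diff[OF A C \<gamma> Tm Tm] by simp
      also have "\<dots> \<le> norm2 C (\<gamma> (T j) - c) + norm2 C (c - \<gamma> (T k))"
        by (intro norm2_diff_triangle[OF C] \<gamma>m Tm c)
      also have "norm2 C (\<gamma> (T j) - c) = norm2 C (c - \<gamma> (T j))" by (rule norm2_commute[OF C \<gamma>m[OF Tm] c])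
      finally show ?thesis using Tc[of j] Tc[of k] J[OF that(1)] J[OF that(2)] by linarith
    qed
    then show ?thesis by blast
  qed
  obtain S where S: "S \<in> carrier A" "(\<lambda>j. norm2 A (T j - S)) \<longlonglongrightarrow> 0"
    using tracial_ball_complete[of A \<U> T "16 * norm c + 4"] A U Tm s(2) cauchy by (auto simp: T_def)
  have le: "norm2 C (c - \<gamma> S) \<le> \<delta> j + norm2 A (T j - S)" for j
  proof -
    have "norm2 C (c - \<gamma> S) \<le> norm2 C (c - \<gamma> (T j)) + norm2 C (\<gamma> (T j) - \<gamma> S)"
      by (intro norm2_diff_triangle[OF C] \<gamma>m Tm c S)
    also have "norm2 C (\<gamma> (T j) - \<gamma> S) = norm2 A (T j - S)"
      using embedding_norm2[OF A C \<gamma> tracial_diff_mem[OF A Tm S(1)]] embedding_diff[OF A C \<gamma> Tm S(1)] by simp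
    finally show ?thesis using Tc[of j] by simp
  qed
  note m = tracial_diff_mem[OF C c \<gamma>m[OF S(1)]]
  have "norm2 C (c - \<gamma> S) \<le> 0 + 0"
    by (rule LIMSEQ_le_const[OF tendsto_add[OF \<delta>0 S(2)]]) (use le in blast)
  then have "norm2 C (c - \<gamma> S) = 0" using norm2_nonneg[OF C m] by simp
  then have "c - \<gamma> S = 0" by (rule norm2_eq_0[OF C m])
  then show ?thesis using S(1) by auto
qed

lemma assignments_zero: "tracial_vna N \<Longrightarrow> (\<And>k. 0 < r k) \<Longrightarrow> (\<lambda>_. 0) \<in> assignments N r"
  by (simp add: assignments_def tracial_zero_mem less_imp_le)

text \<open>
  The formula is the sum of the distances of the real and imaginary parts of the moments to their
  values at \<open>b\<close>; its infimum over \<open>B\<close> is \<open>0\<close>, so it is \<open>0\<close> over \<open>A\<close>.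
\<close>

lemma existentially_closed_moments:
  fixes R :: "'r op tracial_alg" and A :: "'i op tracial_alg" and B :: "nat op tracial_alg"
  assumes ec: "existentially_closed R A" and A: "tracial_vna A" and B: "R_embeddable R B" and \<iota>: "embedding \<iota> A B"
    and b: "\<And>k. b k \<in> carrier B" and a: "\<And>k. a k \<in> carrier A" and e: "e > 0"
  shows "\<exists>c. (\<forall>k. c k \<in> carrier A \<and> norm (c k) \<le> norm (b k) + 1) \<and>
    (\<forall>p\<in>set ps. cmod (tr A (eval_poly A c a p) - tr B (eval_poly B b (\<iota> \<circ> a) p)) < e)"
proof -
  have Bt: "tracial_vna B" using B by (simp add: R_embeddable_def)
  \<comment> \<open>Adding 1 makes the radius positive, as the sorts require, also when
    \<open>b k\<close> is 0.\<close>
  define r where "r k = norm (b k) + 1" for k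
  have r: "0 < r k" for k by (simp add: r_def add_nonneg_pos)
  define m where "m = length ps"
  define \<phi>s where "\<phi>s = map ReTr ps @ map ImTr ps"
  define t where "t = pad (map (eval_formula B b (\<iota> \<circ> a)) \<phi>s)"
  \<comment> \<open>Only the first \<open>2 * m\<close> coordinates, real parts followed by
    imaginary parts, are read; hence continuity in the product topology.\<close>
  define u where "u v = (\<Sum>i<2 * m. \<bar>v i - t i\<bar>)" for v :: "nat \<Rightarrow> real"
  define \<phi> where "\<phi> = Conn u \<phi>s"
  have "continuous_on UNIV u" unfolding u_def
    by (intro continuous_intros continuous_on_product_coordinates)
  then have wf: "wf_formula \<phi>"
    by (auto simp: \<phi>_def \<phi>s_def list_all_iff)
  have nnA: "0 \<le> eval_formula A c d \<phi>" for c d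
    unfolding \<phi>_def by (simp add: u_def sum_nonneg)
  have nnB: "0 \<le> eval_formula B c d \<phi>" for c d
    unfolding \<phi>_def by (simp add: u_def sum_nonneg)
  have zero: "eval_formula B b (\<iota> \<circ> a) \<phi> = 0"
    unfolding \<phi>_def by (simp add: u_def t_def)
  have bm: "b \<in> assignments B r" using b by (simp add: assignments_def r_def)
  have "(INF c\<in>assignments A r. eval_formula A c a \<phi>) = (INF d\<in>assignments B r. eval_formula B d (\<iota> \<circ> a) \<phi>)"
    using ec B \<iota> wf a r unfolding existentially_closed_def by blast
  also have "\<dots> \<le> eval_formula B b (\<iota> \<circ> a) \<phi>"
    by (rule cINF_lower[OF _ bm]) (auto intro!: bdd_belowI2[where m = 0] nnB)
  finally have "(INF c\<in>assignments A r. eval_formula A c a \<phi>) < e" using zero e by simp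
  then obtain c where c: "c \<in> assignments A r" "eval_formula A c a \<phi> < e"
    using assignments_zero[of A r] A r by (subst (asm) cINF_less_iff) (auto intro!: bdd_belowI2[where m = 0] nnA)
  have "cmod (tr A (eval_poly A c a p) - tr B (eval_poly B b (\<iota> \<circ> a) p)) < e" if p: "p \<in> set ps" for p
  proof -
    obtain i where i: "i < m" "p = ps ! i" using p by (auto simp: in_set_conv_nth m_def)
    define v where "v = pad (map (eval_formula A c a) \<phi>s)"
    have v: "v i = Re (tr A (eval_poly A c a p))" "v (m + i) = Im (tr A (eval_poly A c a p))"
      using i by (auto simp: v_def pad_def \<phi>s_def m_def nth_append)
    have t: "t i = Re (tr B (eval_poly B b (\<iota> \<circ> a) p))" "t (m + i) = Im (tr B (eval_poly B b (\<iota> \<circ> a) p))"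
      using i by (auto simp: t_def pad_def \<phi>s_def m_def nth_append)
    have "cmod (tr A (eval_poly A c a p) - tr B (eval_poly B b (\<iota> \<circ> a) p)) \<le> \<bar>v i - t i\<bar> + \<bar>v (m + i) - t (m + i)\<bar>"
      unfolding v t using cmod_le[of "tr A (eval_poly A c a p) - tr B (eval_poly B b (\<iota> \<circ> a) p)"] by simp
    also have "\<dots> = (\<Sum>k\<in>{i, m + i}. \<bar>v k - t k\<bar>)" using i by simp
    also have "\<dots> \<le> u v" unfolding u_def using i by (intro sum_mono2) auto
    also have "u v = eval_formula A c a \<phi>" by (simp add: \<phi>_def v_def)
    finally show ?thesis using c(2) by simp
  qed
  then show ?thesis using c(1) by (intro exI[of _ c]) (auto simp: assignments_def r_def)
qed

lemma trace_qround_le: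
  assumes N: "tracial_vna N" and t: "bounded_tuple N r r' c a"
    and \<rho>: "\<And>z. cmod (z - rat_complex (\<rho> z)) \<le> \<eta>"
  shows "cmod (tr N (eval_poly N c a p) - tr N (eval_poly N c a (of_qpoly (qround \<rho> p)))) \<le> round_err r r' \<eta> p"
proof -
  let ?q = "of_qpoly (qround \<rho> p)"
  note m = bounded_tuple_eval_mem[OF N t]
  have "cmod (tr N (eval_poly N c a p) - tr N (eval_poly N c a ?q)) \<le> norm2 N (eval_poly N c a p - eval_poly N c a ?q)"
    using cmod_tr_le_norm2[OF N tracial_diff_mem[OF N m m], of p ?q] by (simp add: tracial_tr_diff[OF N m m])
  also have "\<dots> \<le> norm (eval_poly N c a p - eval_poly N c a ?q)"
    by (rule norm2_le_norm[OF N tracial_diff_mem[OF N m m]])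
  also have "\<dots> \<le> round_err r r' \<eta> p" by (rule norm_eval_qround_le[OF N t \<rho>])
  finally show ?thesis .
qed

text \<open>The rounding error depends on the radii but not on \<open>n\<close>, so matching the
  countably many rational moments suffices for all of them.\<close>

lemma moments_from_rational:
  assumes N1: "tracial_vna N1" and N2: "tracial_vna N2"
    and t1: "\<And>n. bounded_tuple N1 r r' (c1 n) (a1 n)" and t2: "\<And>n. bounded_tuple N2 r r' (c2 n) (a2 n)"
    and lim: "\<And>q. ((\<lambda>n. tr N1 (eval_poly N1 (c1 n) (a1 n) (of_qpoly q)) - tr N2 (eval_poly N2 (c2 n) (a2 n) (of_qpoly q))) \<longlongrightarrow> 0) F"
  shows "((\<lambda>n. tr N1 (eval_poly N1 (c1 n) (a1 n) p) - tr N2 (eval_poly N2 (c2 n) (a2 n) p)) \<longlongrightarrow> 0) F"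
proof (rule tendstoI)
  fix e :: real assume "e > 0"
  then have e: "e / 3 > 0" by simp
  have "eventually (\<lambda>\<eta>. round_err r r' \<eta> p < e / 3 \<and> \<eta> > 0) (at_right (0::real))"
    using order_tendstoD(2)[OF round_err_tendsto e] eventually_at_right_less by (rule eventually_conj)
  then obtain \<eta> where \<eta>: "round_err r r' \<eta> p < e / 3" "\<eta> > 0"
    using eventually_happens[of _ "at_right (0::real)"] by (auto simp: trivial_limit_at_right_real)
  obtain \<rho> where \<rho>: "\<And>z. cmod (z - rat_complex (\<rho> z)) \<le> \<eta>" using rounding_exists[OF \<eta>(2)] by blast
  define q where "q = qround \<rho> p"
  have diff: "cmod (tr N1 (eval_poly N1 (c1 n) (a1 n) p) - tr N1 (eval_poly N1 (c1 n) (a1 n) (of_qpoly q))) < e / 3"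
    "cmod (tr N2 (eval_poly N2 (c2 n) (a2 n) p) - tr N2 (eval_poly N2 (c2 n) (a2 n) (of_qpoly q))) < e / 3" for n
    using trace_qround_le[OF N1 t1[of n] \<rho>, of p] trace_qround_le[OF N2 t2[of n] \<rho>, of p] \<eta>(1) by (simp_all add: q_def)
  from tendstoD[OF lim[of q] e]
  show "eventually (\<lambda>n. dist (tr N1 (eval_poly N1 (c1 n) (a1 n) p) - tr N2 (eval_poly N2 (c2 n) (a2 n) p)) 0 < e) F"
  proof eventually_elim
    case (elim n)
    define P1 P2 Q1 Q2 where defs: "P1 = tr N1 (eval_poly N1 (c1 n) (a1 n) p)" "P2 = tr N2 (eval_poly N2 (c2 n) (a2 n) p)"
      "Q1 = tr N1 (eval_poly N1 (c1 n) (a1 n) (of_qpoly q))" "Q2 = tr N2 (eval_poly N2 (c2 n) (a2 n) (of_qpoly q))"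
    have d: "cmod (P1 - Q1) < e / 3" "cmod (P2 - Q2) < e / 3" "cmod (Q1 - Q2) < e / 3"
      using diff[of n] elim by (auto simp: defs)
    have "P1 - P2 = (P1 - Q1) + (Q1 - Q2) - (P2 - Q2)" by simp
    then have "cmod (P1 - P2) \<le> cmod (P1 - Q1) + cmod (Q1 - Q2) + cmod (P2 - Q2)"
      by (metis norm_triangle_ineq4 norm_triangle_ineq order_trans add_right_mono)
    then show ?case using d by (simp add: defs)
  qed
qed

theorem corollary3p1:
  fixes R :: "'r op tracial_alg"
    and A :: "'i op tracial_alg"
    and B :: "'j op tracial_alg"
    and C :: "'k op tracial_alg"
    and \<beta> :: "'i op \<Rightarrow> 'j op"
    and \<gamma> :: "'i op \<Rightarrow> 'k op"
  assumes "hyperfinite_II1_factor R"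
    and "existentially_closed R A"
    and "R_embeddable R B" and "R_embeddable R C"
    and "embedding \<beta> A B" and "embedding \<gamma> A C"
  shows "\<exists>(D :: nat op tracial_alg) (f :: 'j op \<Rightarrow> nat op) (g :: 'k op \<Rightarrow> nat op).
    R_embeddable R D \<and> embedding f B D \<and> embedding g C D \<and>
    (\<forall>a\<in>carrier A. f (\<beta> a) = g (\<gamma> a)) \<and>
    f ` carrier B \<inter> g ` carrier C = f ` (\<beta> ` carrier A)"
proof -

  \<comment> \<open>Bounded lifts into ultrapowers of \<open>R\<close>, and dense sequences\<close>
  note \<beta> = assms(5) and \<gamma> = assms(6)
  have R: "tracial_vna R" "\<not> fin_dim (carrier R)"
    using assms(1) by (simp_all add: hyperfinite_II1_factor_def II1_factor_def)
  have A: "tracial_vna A" "separable_vna A"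
    using assms(2) by (simp_all add: existentially_closed_def R_embeddable_def)
  have B: "tracial_vna B" "separable_vna B" and C: "tracial_vna C" "separable_vna C"
    using assms(3,4) by (simp_all add: R_embeddable_def)
  obtain \<V> where V: "nonprincipal_ultrafilter \<V>" "\<exists>h. embedding h B (ultrapower \<V> R)"
    using assms(3) unfolding R_embeddable_def by blast
  obtain \<U> where U: "nonprincipal_ultrafilter \<U>" "\<exists>h. embedding h C (ultrapower \<U> R)"
    using assms(4) unfolding R_embeddable_def by blast
  note ne = nonprincipal_ultrafilter_bot[OF U(1)]
  obtain sB where sB: "asymp_embedding sB \<V> B R" "\<And>u n. u \<in> carrier B \<Longrightarrow> norm (sB u n) \<le> 16 * norm u + 4"
    using V embedding_ultrapower_iff[OF B(1) R(1) V(1)] bounded_asymp_embedding[OF B(1) R(1) V(1)] by blast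
  obtain sC where sC: "asymp_embedding sC \<U> C R" "\<And>u n. u \<in> carrier C \<Longrightarrow> norm (sC u n) \<le> 16 * norm u + 4"
    using U embedding_ultrapower_iff[OF C(1) R(1) U(1)] bounded_asymp_embedding[OF C(1) R(1) U(1)] by blast
  obtain a :: "nat \<Rightarrow> 'i op" where a: "\<And>k. a k \<in> carrier A" "\<And>u e. u \<in> carrier A \<Longrightarrow> e > 0 \<Longrightarrow> \<exists>k. norm2 A (u - a k) < e"
    using dense_sequence[OF A] by blast
  obtain b :: "nat \<Rightarrow> 'j op" where b: "\<And>k. b k \<in> carrier B" "\<And>u e. u \<in> carrier B \<Longrightarrow> e > 0 \<Longrightarrow> \<exists>k. norm2 B (u - b k) < e"
    using dense_sequence[OF B] by blast
  obtain d :: "nat \<Rightarrow> 'k op" where d: "\<And>k. d k \<in> carrier C" "\<And>u e. u \<in> carrier C \<Longrightarrow> e > 0 \<Longrightarrow> \<exists>k. norm2 C (u - d k) < e"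
    using dense_sequence[OF C] by blast
  note \<beta>m = embedding_mem[OF A(1) B(1) \<beta>] and \<gamma>m = embedding_mem[OF A(1) C(1) \<gamma>]
  \<comment> \<open>Even positions carry a dense sequence of the image of \<open>A\<close>, odd
    positions one of \<open>C\<close>. The common tuple later ties the embedding of
    \<open>B\<close>, which sees the even part, to that of \<open>C\<close>.\<close>
  define y where "y k = (if even k then \<gamma> (a (k div 2)) else d (k div 2))" for k
  have y: "y k \<in> carrier C" for k using d(1) \<gamma>m[OF a(1)] by (simp add: y_def)
  have y_even: "y (2 * k) = \<gamma> (a k)" and y_odd: "y (2 * k + 1) = d k" for k by (simp_all add: y_def)

  \<comment> \<open>A copy of \<open>B\<close> acting on
    \<open>\<ell>\<^sup>2(\<nat>)\<close>\<close>
  obtain B' :: "nat op tracial_alg" and j where B': "R_embeddable R B'" and j: "embedding j B B'"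
  proof -
    define x where "x n k = sB (b k) n" for n k
    have xx: "bounded_tuple R (\<lambda>k. 16 * norm (b k) + 4) (\<lambda>k. 16 * norm (b k) + 4) (x n) (x n)" for n
      using sB(2)[OF b(1)] ae_mem[OF B(1) R(1) V(1) sB(1) b(1)] by (simp add: bounded_tuple_def assignments_def x_def)
    obtain D :: "nat op tracial_alg" and \<pi> where D: "R_embeddable R D" "seq_rep \<pi> (seq_closure R \<V> x x) \<V> R D"
      using seq_representation[of R \<V> _ _ x x] R V(1) xx by blast
    have "sB u \<in> seq_closure R \<V> x x" if u: "u \<in> carrier B" for u
      unfolding seq_closure_def
    proof (intro CollectI conjI allI impI)
      show "sB u \<in> bounded_seqs R" by (rule ae_bseq[OF B(1) R(1) V(1) sB(1) u])
      fix e :: real assume "e > 0"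
      then obtain k where k: "norm2 B (u - b k) < e" using b(2)[OF u] by blast
      have "eventually (\<lambda>n. norm2 R (sB u n - sB (b k) n) < e) \<V>"
        by (rule order_tendstoD(2)[OF ae_norm2_diff[OF B(1) R(1) V(1) sB(1) u b(1)] k])
      then show "\<exists>p. eventually (\<lambda>n. norm2 R (sB u n - eval_poly R (x n) (x n) p) < e) \<V>"
        by (intro exI[of _ "XVar k"]) (simp add: x_def)
    qed
    then have "embedding (\<lambda>u. \<pi> (sB u)) B D"
      using embedding_of_seq_rep[OF R(1) V(1) _ B(1) xx D(2) sB(1)] D(1) by (auto simp: R_embeddable_def)
    then show ?thesis using that D(1) by blast
  qed
  have B't: "tracial_vna B'" using B' by (simp add: R_embeddable_def)
  define b' where "b' k = j (b k)" for k
  define \<iota> where "\<iota> = j \<circ> \<beta>"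
  have \<iota>: "embedding \<iota> A B'" unfolding \<iota>_def by (rule embedding_comp[OF \<beta> j])
  have b': "b' k \<in> carrier B'" for k unfolding b'_def by (rule embedding_mem[OF B(1) B't j b(1)])
  have \<iota>m: "(\<iota> \<circ> a) k \<in> carrier B'" for k using embedding_mem[OF A(1) B't \<iota> a(1)] by simp

  \<comment> \<open>Moments of \<open>B\<close> over \<open>A\<close>, approximated in
    \<open>A\<close>\<close>
  define ps where "ps n = map (\<lambda>i. of_qpoly (from_nat i)) [0..<n]" for n :: nat
  \<comment> \<open>Every rational polynomial is in the list from some \<open>n\<close> on, so
    errors below \<open>\<delta> n\<close> on the list give convergence of each moment.\<close>
  have ps: "of_qpoly q \<in> set (ps n)" if "n > to_nat q" for q n
    unfolding ps_def set_map by (rule image_eqI[of _ _ "to_nat q"]) (use that in auto)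
  define \<delta> where "\<delta> n = inverse (real (Suc n))" for n
  have \<delta>: "\<delta> n > 0" for n by (simp add: \<delta>_def)
  have \<delta>0: "(\<delta> \<longlongrightarrow> 0) \<U>"
    unfolding \<delta>_def
    by (rule tendsto_mono[OF nonprincipal_ultrafilter_le_sequentially[OF U(1)] LIMSEQ_inverse_real_of_nat])
  have ev_large: "eventually (\<lambda>n. n > m) \<U>" for m
    using nonprincipal_ultrafilter_le_sequentially[OF U(1)] eventually_gt_at_top by (rule filter_leD)

  have "\<forall>n. \<exists>c. (\<forall>k. c k \<in> carrier A \<and> norm (c k) \<le> norm (b' k) + 1) \<and>
    (\<forall>p\<in>set (ps n). cmod (tr A (eval_poly A c a p) - tr B' (eval_poly B' b' (\<iota> \<circ> a) p)) < \<delta> n)"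
    using existentially_closed_moments[of R A B' \<iota> b' a] assms(2) A(1) B' \<iota> b' a(1) \<delta> by blast
  from choice[OF this] obtain c where c: "\<And>n k. c n k \<in> carrier A" "\<And>n k. norm (c n k) \<le> norm (b' k) + 1"
    "\<And>n p. p \<in> set (ps n) \<Longrightarrow> cmod (tr A (eval_poly A (c n) a p) - tr B' (eval_poly B' b' (\<iota> \<circ> a) p)) < \<delta> n"
    by blast
  define c' where "c' n k = \<gamma> (c n k)" for n k
  have c': "c' n k \<in> carrier C" for n k unfolding c'_def by (rule \<gamma>m[OF c(1)])
  have nc': "norm (c' n k) \<le> norm (b' k) + 1" for n k
    unfolding c'_def by (rule order_trans[OF embedding_norm_le[OF A(1) C(1) \<gamma> c(1)] c(2)])

  \<comment> \<open>Lifting the tuples over \<open>C\<close> to tuples in \<open>R\<close>\<close>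
  have "\<forall>n. \<exists>m. \<forall>q\<in>set (ps n). cmod (tr R (eval_poly R (\<lambda>k. sC (c' n k) m) (\<lambda>k. sC (y k) m) q) - tr C (eval_poly C (c' n) y q)) < \<delta> n"
  proof
    fix n
    \<comment> \<open>A separate index \<open>m\<close> for each \<open>n\<close>: this diagonal
      choice replaces an ultrapower of \<open>C\<close>, with \<open>C\<close> inside an ultrapower
      of \<open>R\<close>, by one sequence of tuples in \<open>R\<close>.\<close>
    have "eventually (\<lambda>m. \<forall>q\<in>set (ps n). dist (tr R (eval_poly R (\<lambda>k. sC (c' n k) m) (\<lambda>k. sC (y k) m) q)) (tr C (eval_poly C (c' n) y q)) < \<delta> n) \<U>"
      by (intro eventually_ball_finite ballI tendstoD[OF ae_moments[OF C(1) R(1) U(1) sC(1)] \<delta>] c' y) simp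
    then show "\<exists>m. \<forall>q\<in>set (ps n). cmod (tr R (eval_poly R (\<lambda>k. sC (c' n k) m) (\<lambda>k. sC (y k) m) q) - tr C (eval_poly C (c' n) y q)) < \<delta> n"
      using eventually_happens'[OF ne] by (fastforce simp: dist_norm)
  qed
  from choice[OF this] obtain m where m: "\<And>n q. q \<in> set (ps n) \<Longrightarrow>
      cmod (tr R (eval_poly R (\<lambda>k. sC (c' n k) (m n)) (\<lambda>k. sC (y k) (m n)) q) - tr C (eval_poly C (c' n) y q)) < \<delta> n"
    by blast
  define X where "X n k = sC (c' n k) (m n)" for n k
  define Y where "Y n k = sC (y k) (m n)" for n k
  \<comment> \<open>The bound 16 t + 4 of the lifts, at the radius t of all \<open>c' n k\<close>;
    it does not involve \<open>n\<close>.\<close>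
  define r where "r k = 16 * (norm (b' k) + 1) + 4" for k
  define r' where "r' k = 16 * norm (y k) + 4" for k
  have "X n = (\<lambda>k. sC (c' n k) (m n))" "Y n = (\<lambda>k. sC (y k) (m n))" for n
    by (simp_all add: X_def Y_def fun_eq_iff)
  then have mXY: "cmod (tr R (eval_poly R (X n) (Y n) q) - tr C (eval_poly C (c' n) y q)) < \<delta> n" if "q \<in> set (ps n)" for n q
    using m[OF that] by simp
  have Xr: "norm (X n k) \<le> r k" for n k
    using sC(2)[OF c'[of n k], of "m n"] nc'[of n k] by (simp add: X_def r_def)
  have Yr: "norm (Y n k) \<le> r' k" for n k
    using sC(2)[OF y[of k], of "m n"] by (simp add: Y_def r'_def)
  have XY: "bounded_tuple R r r' (X n) (Y n)" for n
    using Xr Yr ae_mem[OF C(1) R(1) U(1) sC(1) c'] ae_mem[OF C(1) R(1) U(1) sC(1) y]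
    by (auto simp: bounded_tuple_def assignments_def X_def Y_def)
  have c'r: "norm (c' n k) \<le> r k" for n k
  proof -
    have "s \<le> 16 * (t + 1) + 4" if "s \<le> t + 1" "0 \<le> t" for s t :: real using that by simp
    from this[OF nc' norm_ge_zero] show ?thesis by (simp only: r_def)
  qed
  have yr: "norm (y k) \<le> r' k" for k
  proof -
    have "t \<le> 16 * t + 4" if "0 \<le> t" for t :: real using that by simp
    from this[OF norm_ge_zero] show ?thesis by (simp only: r'_def)
  qed
  have c'y: "bounded_tuple C r r' (c' n) y" for n
    using c' y c'r yr by (simp add: bounded_tuple_def assignments_def)
  have XYlim: "((\<lambda>n. tr R (eval_poly R (X n) (Y n) q) - tr C (eval_poly C (c' n) y q)) \<longlongrightarrow> 0) \<U>" for q
  proof (rule moments_from_rational[OF R(1) C(1) XY c'y])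
    fix q
    show "((\<lambda>n. tr R (eval_poly R (X n) (Y n) (of_qpoly q)) - tr C (eval_poly C (c' n) y (of_qpoly q))) \<longlongrightarrow> 0) \<U>"
    proof (rule Lim_null_comparison[OF _ \<delta>0])
      show "eventually (\<lambda>n. norm (tr R (eval_poly R (X n) (Y n) (of_qpoly q)) - tr C (eval_poly C (c' n) y (of_qpoly q))) \<le> \<delta> n) \<U>"
        using ev_large[of "to_nat q"]
        by eventually_elim (use mXY[OF ps] in \<open>auto intro: less_imp_le\<close>)
    qed
  qed
  \<comment> \<open>The limit is stated in \<open>B\<close> itself: \<open>j\<close> preserves
    polynomials and traces, so \<open>B'\<close> is no longer needed afterwards.\<close>
  have Alim: "((\<lambda>n. tr A (eval_poly A (c n) a p)) \<longlongrightarrow> tr B (eval_poly B b (\<lambda>k. \<beta> (a k)) p)) \<U>" for p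
  proof -
    define s where "s k = norm (b' k) + 1" for k
    define s' where "s' k = norm (a k)" for k
    have tA: "bounded_tuple A s s' (c n) a" for n using c(1,2) a(1) by (simp add: bounded_tuple_def assignments_def s_def s'_def)
    have tB: "bounded_tuple B' s s' b' (\<iota> \<circ> a)"
      using b' \<iota>m embedding_norm_le[OF A(1) B't \<iota> a(1)] by (simp add: bounded_tuple_def assignments_def s_def s'_def)
    have "((\<lambda>n. tr A (eval_poly A (c n) a p) - tr B' (eval_poly B' b' (\<iota> \<circ> a) p)) \<longlongrightarrow> 0) \<U>"
    proof (rule moments_from_rational[OF A(1) B't tA tB])
      fix q
      show "((\<lambda>n. tr A (eval_poly A (c n) a (of_qpoly q)) - tr B' (eval_poly B' b' (\<iota> \<circ> a) (of_qpoly q))) \<longlongrightarrow> 0) \<U>"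
      proof (rule Lim_null_comparison[OF _ \<delta>0])
        show "eventually (\<lambda>n. norm (tr A (eval_poly A (c n) a (of_qpoly q)) - tr B' (eval_poly B' b' (\<iota> \<circ> a) (of_qpoly q))) \<le> \<delta> n) \<U>"
          using ev_large[of "to_nat q"]
          by eventually_elim (use c(3)[OF ps] in \<open>auto intro: less_imp_le\<close>)
      qed
    qed
    moreover have "tr B' (eval_poly B' b' (\<iota> \<circ> a) p) = tr B (eval_poly B b (\<lambda>k. \<beta> (a k)) p)"
    proof -
      have "j (eval_poly B b (\<lambda>k. \<beta> (a k)) p) = eval_poly B' (\<lambda>k. j (b k)) (\<lambda>k. j (\<beta> (a k))) p"
        by (rule embedding_eval_poly[OF B(1) B't j b(1) \<beta>m[OF a(1)]])
      also have "(\<lambda>k. j (b k)) = b'" by (simp add: b'_def fun_eq_iff)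
      also have "(\<lambda>k. j (\<beta> (a k))) = \<iota> \<circ> a" by (simp add: \<iota>_def fun_eq_iff)
      finally have 1: "j (eval_poly B b (\<lambda>k. \<beta> (a k)) p) = eval_poly B' b' (\<iota> \<circ> a) p" .
      have "eval_poly B b (\<lambda>k. \<beta> (a k)) p \<in> carrier B"
        by (rule eval_poly_mem[OF B(1) b(1) \<beta>m[OF a(1)]])
      from embedding_tr[OF B(1) B't j this] show ?thesis by (simp only: 1)
    qed
    ultimately show ?thesis by (simp add: LIM_zero_iff)
  qed

  \<comment> \<open>Embeddings of \<open>B\<close> and \<open>C\<close> into one ultrapower of
    \<open>R\<close>\<close>
  obtain SB where SB: "asymp_embedding SB \<U> B R"
    and SBe: "\<And>p. null_seq R \<U> (\<lambda>n. SB (eval_poly B b (\<lambda>k. \<beta> (a k)) p) n - eval_poly R (X n) (\<lambda>k. Y n (2 * k)) p)"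
  proof -
    have XY2: "bounded_tuple R r (\<lambda>k. r' (2 * k)) (X n) (\<lambda>k. Y n (2 * k))" for n
      using XY[of n] by (simp add: bounded_tuple_def assignments_def)
    have "((\<lambda>n. tr R (eval_poly R (X n) (\<lambda>k. Y n (2 * k)) p)) \<longlongrightarrow> tr B (eval_poly B b (\<lambda>k. \<beta> (a k)) p)) \<U>" for p
    proof -
      \<comment> \<open>Restricted to the even variables the whole tuple is the image of one in
        \<open>A\<close>, so its moments are those already compared with \<open>B\<close>.\<close>
      have "tr C (eval_poly C (c' n) (\<lambda>k. \<gamma> (a k)) p) = tr A (eval_poly A (c n) a p)" for n
      proof -
        have "\<gamma> (eval_poly A (c n) a p) = eval_poly C (c' n) (\<lambda>k. \<gamma> (a k)) p"
          using embedding_eval_poly[OF A(1) C(1) \<gamma>, of "c n" a p] c(1) a(1) by (simp add: c'_def[abs_def])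
        moreover have "eval_poly A (c n) a p \<in> carrier A" by (rule eval_poly_mem[OF A(1) c(1) a(1)])
        ultimately show ?thesis using embedding_tr[OF A(1) C(1) \<gamma>, of "eval_poly A (c n) a p"] by simp
      qed
      then have "((\<lambda>n. tr R (eval_poly R (X n) (\<lambda>k. Y n (2 * k)) p) - tr A (eval_poly A (c n) a p)) \<longlongrightarrow> 0) \<U>"
        using XYlim[of "psubst XVar (\<lambda>k. YVar (2 * k)) p"] by (simp add: eval_psubst y_even)
      from tendsto_add[OF this Alim[of p]] show ?thesis by simp
    qed
    moreover have "carrier B \<subseteq> poly_closure B b (\<lambda>k. \<beta> (a k))"
    proof
      fix u assume u: "u \<in> carrier B"
      show "u \<in> poly_closure B b (\<lambda>k. \<beta> (a k))"
        unfolding poly_closure_def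
      proof (intro CollectI conjI allI impI u)
        fix e :: real assume "e > 0"
        then obtain k where "norm2 B (u - b k) < e" using b(2)[OF u] by blast
        then show "\<exists>p. norm2 B (u - eval_poly B b (\<lambda>k. \<beta> (a k)) p) < e" by (intro exI[of _ "XVar k"]) simp
      qed
    qed
    ultimately show ?thesis
      using that asymp_embedding_of_moments[of B R \<U> b "\<lambda>k. \<beta> (a k)" r "\<lambda>k. r' (2 * k)" X "\<lambda>n k. Y n (2 * k)"]
        B(1) R(1) U(1) b(1) \<beta>m[OF a(1)] XY2 by blast
  qed
  obtain SC where SC: "asymp_embedding SC \<U> C R"
    and SCe: "\<And>p. null_seq R \<U> (\<lambda>n. SC (eval_poly C y y p) n - eval_poly R (Y n) (Y n) p)"
  proof -
    have YY: "bounded_tuple R r' r' (Y n) (Y n)" for n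
      using XY[of n] by (simp add: bounded_tuple_def)
    have "((\<lambda>n. tr R (eval_poly R (Y n) (Y n) p)) \<longlongrightarrow> tr C (eval_poly C y y p)) \<U>" for p
    proof -
      have "((\<lambda>n. tr R (eval_poly R (Y n) (Y n) p) - tr C (eval_poly C y y p)) \<longlongrightarrow> 0) \<U>"
        using XYlim[of "psubst YVar YVar p"] by (simp add: eval_psubst)
      then show ?thesis by (simp add: LIM_zero_iff)
    qed
    moreover have "carrier C \<subseteq> poly_closure C y y"
    proof
      fix u assume u: "u \<in> carrier C"
      show "u \<in> poly_closure C y y"
        unfolding poly_closure_def
      proof (intro CollectI conjI allI impI u)
        fix e :: real assume "e > 0"
        then obtain k where "norm2 C (u - d k) < e" using d(2)[OF u] by blast
        then show "\<exists>p. norm2 C (u - eval_poly C y y p) < e" by (intro exI[of _ "XVar (2 * k + 1)"]) (simp only: eval_poly.simps(1) y_odd)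
      qed
    qed
    ultimately show ?thesis
      using that asymp_embedding_of_moments[of C R \<U> y y r' r' Y Y] C(1) R(1) U(1) y YY by blast
  qed
  have Xm: "X n k \<in> carrier R" and Ym: "Y n k \<in> carrier R" for n k
    using XY[of n] by (auto simp: bounded_tuple_def assignments_def)
  have BX: "((\<lambda>n. norm2 R (SB u n - X n k)) \<longlongrightarrow> norm2 B (u - b k)) \<U>" if u: "u \<in> carrier B" for u k
    using SBe[of "XVar k"] by (intro ae_norm2_null[OF B(1) R(1) U(1) SB u b(1) Xm]) simp
  have BY: "((\<lambda>n. norm2 R (SB u n - Y n (2 * k))) \<longlongrightarrow> norm2 B (u - \<beta> (a k))) \<U>" if u: "u \<in> carrier B" for u k
    using SBe[of "YVar k"] by (intro ae_norm2_null[OF B(1) R(1) U(1) SB u \<beta>m[OF a(1)] Ym]) simp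
  have CY: "((\<lambda>n. norm2 R (SC v n - Y n k)) \<longlongrightarrow> norm2 C (v - y k)) \<U>" if v: "v \<in> carrier C" for v k
    using SCe[of "XVar k"] by (intro ae_norm2_null[OF C(1) R(1) U(1) SC v y Ym]) simp
  note SBm = ae_mem[OF B(1) R(1) U(1) SB] and SCm = ae_mem[OF C(1) R(1) U(1) SC]

  \<comment> \<open>The amalgam and its two embeddings\<close>
  obtain D :: "nat op tracial_alg" and \<pi> where D: "R_embeddable R D" and rep: "seq_rep \<pi> (seq_closure R \<U> X Y) \<U> R D"
    using seq_representation[of R \<U> r r' X Y] R U(1) XY by blast
  have Dt: "tracial_vna D" using D by (simp add: R_embeddable_def)
  have SBK: "SB u \<in> seq_closure R \<U> X Y" if u: "u \<in> carrier B" for u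
    unfolding seq_closure_def
  proof (intro CollectI conjI allI impI)
    show "SB u \<in> bounded_seqs R" by (rule ae_bseq[OF B(1) R(1) U(1) SB u])
    fix e :: real assume "e > 0"
    then obtain k where "norm2 B (u - b k) < e" using b(2)[OF u] by blast
    from order_tendstoD(2)[OF BX[OF u] this]
    show "\<exists>p. eventually (\<lambda>n. norm2 R (SB u n - eval_poly R (X n) (Y n) p) < e) \<U>"
      by (intro exI[of _ "XVar k"]) simp
  qed
  have SCK: "SC v \<in> seq_closure R \<U> X Y" if v: "v \<in> carrier C" for v
    unfolding seq_closure_def
  proof (intro CollectI conjI allI impI)
    show "SC v \<in> bounded_seqs R" by (rule ae_bseq[OF C(1) R(1) U(1) SC v])
    fix e :: real assume "e > 0"
    then obtain k where "norm2 C (v - d k) < e" using d(2)[OF v] by blast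
    then have "norm2 C (v - y (2 * k + 1)) < e" by (simp only: y_odd)
    from order_tendstoD(2)[OF CY[OF v] this]
    show "\<exists>p. eventually (\<lambda>n. norm2 R (SC v n - eval_poly R (X n) (Y n) p) < e) \<U>"
      by (intro exI[of _ "YVar (2 * k + 1)"]) simp
  qed
  define f where "f u = \<pi> (SB u)" for u
  define g where "g v = \<pi> (SC v)" for v
  have f: "embedding f B D" unfolding f_def by (rule embedding_of_seq_rep[OF R(1) U(1) Dt B(1) XY rep SB SBK])
  have g: "embedding g C D" unfolding g_def by (rule embedding_of_seq_rep[OF R(1) U(1) Dt C(1) XY rep SC SCK])
  have fg: "f u = g v \<longleftrightarrow> null_seq R \<U> (\<lambda>n. SB u n - SC v n)" if "u \<in> carrier B" "v \<in> carrier C" for u v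
    unfolding f_def g_def using that by (intro seq_rep_eq[OF R(1) U(1) Dt XY rep] SBK SCK)

  \<comment> \<open>Agreement on \<open>A\<close>\<close>
  have agree: "f (\<beta> x) = g (\<gamma> x)" if x: "x \<in> carrier A" for x
  proof -
    note bm = \<beta>m[OF x] and gm = \<gamma>m[OF x]
    have "null_seq R \<U> (\<lambda>n. SB (\<beta> x) n - SC (\<gamma> x) n)"
    proof (rule tendstoI)
      fix e :: real assume "e > 0"
      \<comment> \<open>The entry \<open>Y n (2 * k)\<close> stands for \<open>\<beta> (a k)\<close>
        in one embedding and for \<open>\<gamma> (a k)\<close> in the other.\<close>
      then obtain k where k: "norm2 A (x - a k) < e / 2" using a(2)[OF x, of "e / 2"] by auto
      have xa: "x - a k \<in> carrier A" by (intro tracial_diff_mem[OF A(1)] x a)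
      have "norm2 B (\<beta> x - \<beta> (a k)) < e / 2"
        using k embedding_norm2[OF A(1) B(1) \<beta> xa] by (simp add: embedding_diff[OF A(1) B(1) \<beta> x a(1)])
      note 1 = order_tendstoD(2)[OF BY[OF bm] this]
      have "norm2 C (\<gamma> x - y (2 * k)) < e / 2"
        using k embedding_norm2[OF A(1) C(1) \<gamma> xa] by (simp add: embedding_diff[OF A(1) C(1) \<gamma> x a(1)] y_even)
      note 2 = order_tendstoD(2)[OF CY[OF gm] this]
      from 1 2 show "eventually (\<lambda>n. dist (norm2 R (SB (\<beta> x) n - SC (\<gamma> x) n)) 0 < e) \<U>"
      proof eventually_elim
        case (elim n)
        note m = SBm[OF bm, of n] SCm[OF gm, of n] Ym[of n "2 * k"]
        have "norm2 R (SB (\<beta> x) n - SC (\<gamma> x) n) \<le> norm2 R (SB (\<beta> x) n - Y n (2 * k)) + norm2 R (Y n (2 * k) - SC (\<gamma> x) n)"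
          by (intro norm2_diff_triangle[OF R(1)] m)
        then show ?case
          using elim norm2_commute[OF R(1) m(2,3)] norm2_nonneg[OF R(1) tracial_diff_mem[OF R(1) m(1,2)]] by simp
      qed
    qed
    then show ?thesis using fg[OF bm gm] by blast
  qed

  \<comment> \<open>The intersection of the images\<close>
  have inter: "\<exists>x\<in>carrier A. \<gamma> x = v" if u: "u \<in> carrier B" and v: "v \<in> carrier C" and eq: "f u = g v" for u v
  proof (rule embedding_image_closed[OF A(1) C(1) U(1) \<gamma> v])
    fix e0 :: real assume "e0 > 0"
    \<comment> \<open>At most four parts are spent between \<open>c' n k\<close> and
      \<open>y l\<close>, and one between \<open>y l\<close> and \<open>v\<close>.\<close>
    define e where "e = e0 / 5"
    have e: "e > 0" using \<open>e0 > 0\<close> by (simp add: e_def)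
    obtain k where k: "norm2 B (u - b k) < e" using b(2)[OF u e] by blast
    obtain l0 where l0: "norm2 C (v - d l0) < e" using d(2)[OF v e] by blast
    define l where "l = 2 * l0 + 1"
    have l: "norm2 C (v - y l) < e" using l0 by (simp only: l_def y_odd)
    \<comment> \<open>The trace at q* q is the squared 2-norm distance of the two variables, so one
      moment compares this distance in \<open>R\<close> with the one in \<open>C\<close>.\<close>
    define q where "q = Plus (XVar k) (Scale (-1) (YVar l))"
    have qR: "tr R (eval_poly R (X n) (Y n) (Times (Star q) q)) = complex_of_real ((norm2 R (X n k - Y n l))\<^sup>2)" for n
      using norm2_sq[OF R(1) tracial_diff_mem[OF R(1) Xm[of n k] Ym[of n l]]]
      by (simp add: q_def eval_poly_op[OF R(1)] op_scale_minus_one)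
    have qC: "tr C (eval_poly C (c' n) y (Times (Star q) q)) = complex_of_real ((norm2 C (c' n k - y l))\<^sup>2)" for n
      using norm2_sq[OF C(1) tracial_diff_mem[OF C(1) c'[of n k] y[of l]]]
      by (simp add: q_def eval_poly_op[OF C(1)] op_scale_minus_one)
    \<comment> \<open>Three triangle steps give a distance of at most 3 e in \<open>R\<close>; since
      9 + 7 = 16, a moment error below 7 e^2 leaves a distance below 4 e in
      \<open>C\<close>.\<close>
    have "7 * e\<^sup>2 > 0" using e by simp
    from tendstoD[OF XYlim[of "Times (Star q) q"] this]
    have 1: "eventually (\<lambda>n. dist (tr R (eval_poly R (X n) (Y n) (Times (Star q) q)) - tr C (eval_poly C (c' n) y (Times (Star q) q))) 0 < 7 * e\<^sup>2) \<U>" .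
    have "null_seq R \<U> (\<lambda>n. SB u n - SC v n)" using fg[OF u v] eq by blast
    from order_tendstoD(2)[OF this e] have 2: "eventually (\<lambda>n. norm2 R (SB u n - SC v n) < e) \<U>" .
    note 3 = order_tendstoD(2)[OF BX[OF u] k]
    note 4 = order_tendstoD(2)[OF CY[OF v] l]
    from 1 2 3 4 have "eventually (\<lambda>n. norm2 C (c' n k - y l) < 4 * e) \<U>"
    proof eventually_elim
      case (elim n)
      note m = SBm[OF u, of n] SCm[OF v, of n] Xm[of n k] Ym[of n l]
      have "norm2 R (X n k - Y n l) \<le> norm2 R (X n k - SB u n) + norm2 R (SB u n - Y n l)"
        by (intro norm2_diff_triangle[OF R(1)] m)
      also have "norm2 R (SB u n - Y n l) \<le> norm2 R (SB u n - SC v n) + norm2 R (SC v n - Y n l)"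
        by (intro norm2_diff_triangle[OF R(1)] m)
      also have "norm2 R (X n k - SB u n) = norm2 R (SB u n - X n k)" by (rule norm2_commute[OF R(1) m(3,1)])
      finally have "norm2 R (X n k - Y n l) \<le> 3 * e" using elim by simp
      then have "(norm2 R (X n k - Y n l))\<^sup>2 \<le> (3 * e)\<^sup>2"
        using norm2_nonneg[OF R(1) tracial_diff_mem[OF R(1) m(3,4)]] by (intro power_mono)
      moreover have "\<bar>(norm2 R (X n k - Y n l))\<^sup>2 - (norm2 C (c' n k - y l))\<^sup>2\<bar> < 7 * e\<^sup>2"
      proof -
        have "cmod (complex_of_real ((norm2 R (X n k - Y n l))\<^sup>2 - (norm2 C (c' n k - y l))\<^sup>2)) < 7 * e\<^sup>2"
          using elim(1) unfolding qR qC dist_norm by simp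
        then show ?thesis unfolding norm_of_real .
      qed
      ultimately have "(norm2 C (c' n k - y l))\<^sup>2 < (4 * e)\<^sup>2" by (simp add: power_mult_distrib abs_less_iff)
      then show ?case by (rule power2_less_imp_less) (use e in simp)
    qed
    then obtain n where n: "norm2 C (c' n k - y l) < 4 * e" using eventually_happens'[OF ne] by blast
    have "norm2 C (c' n k - v) \<le> norm2 C (c' n k - y l) + norm2 C (y l - v)"
      by (intro norm2_diff_triangle[OF C(1)] c' y v)
    also have "norm2 C (y l - v) = norm2 C (v - y l)" by (rule norm2_commute[OF C(1) y v])
    finally have "norm2 C (\<gamma> (c n k) - v) < e0" using n l by (simp add: e_def c'_def)
    then show "\<exists>x\<in>carrier A. norm2 C (\<gamma> x - v) < e0" using c(1) by blast
  qed
  have "f ` carrier B \<inter> g ` carrier C = f ` (\<beta> ` carrier A)"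
  proof
    show "f ` carrier B \<inter> g ` carrier C \<subseteq> f ` (\<beta> ` carrier A)"
    proof
      fix z assume "z \<in> f ` carrier B \<inter> g ` carrier C"
      then obtain u v where uv: "u \<in> carrier B" "v \<in> carrier C" "z = f u" "f u = g v" by auto
      then obtain x where x: "x \<in> carrier A" "\<gamma> x = v" using inter by blast
      then have "z = f (\<beta> x)" using agree uv by simp
      then show "z \<in> f ` (\<beta> ` carrier A)" using x(1) by blast
    qed
    show "f ` (\<beta> ` carrier A) \<subseteq> f ` carrier B \<inter> g ` carrier C"
      using agree \<beta>m \<gamma>m by force
  qed
  then show ?thesis using D f g agree by blast
qed

end
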